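(* Let $(X,\mathcal P)$ be as in the context and let $\mathcal B$ be an $\mathcal O_{X/\mathcal P}$-Lie algebroid which is locally free of finite rank over $\mathcal O_{X/\mathcal P}$. The morphism of Picard stacks $$\underline{\mathrm{Pic}}_{\mathcal B}\longrightarrow(\mathcal O^\times_{X/\mathcal P}\xrightarrow{d_{\mathcal B}\log}\Omega^{1,cl}_{\mathcal B})[1],\qquad \mathcal L\mapsto(\mathcal L^\times,\nabla),$$ where $\nabla$ is the trivialization of $d_{\mathcal B}\log(\mathcal L^\times)$ corresponding to the $\mathcal B$-module structure on $\mathcal L$, is an equivalence.
   Context: Setting. $X$ is a $C^\infty$ manifold, $\mathcal T_X$ its sheaf of complex vector fields, $\Omega^\bullet_X$ its complex-valued forms; $\mathcal P\subset\mathcal T_X$ is an integrable complex distribution, i.e. a sub-bundle whose annihilator $\mathcal P^\perp\subset\Omega^1_X$ locally has a frame of exact forms $df_i$ ($f_i$ complex-valued). It is assumed that $\Omega^\bullet_X/(\mathcal P^\perp\wedge\Omega^{\bullet-1}_X)$ with the differential induced by $d$ has zero cohomology sheaves in positive degrees. $\mathcal O_{X/\mathcal P}$ is the sheaf of complex functions killed by $\mathcal P$; $\mathcal T_{X/\mathcal P}$ is the sheaf of sections of $\mathcal T_X/\mathcal P$ invariant under the adjoint action of $\mathcal P$, a sheaf of Lie algebras acting on $\mathcal O_{X/\mathcal P}$ by derivations. Lie algebroids. An $\mathcal O_{X/\mathcal P}$-Lie algebroid is an $\mathcal O_{X/\mathcal P}$-module $\mathcal B$ with a $\mathbb C$-Lie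 bracket and an $\mathcal O_{X/\mathcal P}$-linear anchor $\sigma\colon\mathcal B\to\mathcal T_{X/\mathcal P}$ with $[b_1,fb_2]=\sigma(b_1)(f)b_2+f[b_1,b_2]$. $(\Omega^\bullet_{\mathcal B},d_{\mathcal B})$ is its de Rham (Chevalley–Eilenberg) complex: $\Omega^i_{\mathcal B}=\bigwedge^i\mathcal B^\vee$, $d_{\mathcal B}f(b)=\sigma(b)(f)$; $\Omega^{1,cl}_{\mathcal B}=\ker(d_{\mathcal B}|_{\Omega^1_{\mathcal B}})$; $d_{\mathcal B}\log\colon\mathcal O^\times_{X/\mathcal P}\to\Omega^{1,cl}_{\mathcal B}$, $f\mapsto d_{\mathcal B}f/f$. A $\mathcal B$-module structure on an $\mathcal O_{X/\mathcal P}$-module $\mathcal M$ is an $\mathcal O_{X/\mathcal P}$-linear morphism of Lie algebras $\mathcal B\to\underline{\mathrm{End}}_{\mathbb C}(\mathcal M)$, $b\mapsto(m\mapsto b.m)$, with $b.(fm)=\sigma(b)(f)m+f\,b.m$. $\underline{\mathrm{Pic}}_{\mathcal B}$ is the Picard stack (under $\otimes_{\mathcal O_{X/\mathcal P}}$ with $b.(m\otimes n)=b.m\otimes n+m\otimes b.n$) of locally free rank one $\mathcal O_{X/\mathcal P}$-modules with a $\mathcal B$-module structure, morphisms being isomorphisms of $\mathcal B$-modules. Torsors. For a complex $A^0\xrightarrow{d}A^1$ of sheaves of abelian groups, an $(A^0\to A^1)$-torsor is a pair $(T,\tau)$, $T$ an $A^0$-torsor, $\tau$ a global section (trivialization) of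 the induced $A^1$-torsor $d(T)=T\times_{A^0}A^1$; morphisms are morphisms of $A^0$-torsors respecting trivializations; $(A^0\to A^1)[1]$ is the Picard stack of such, under the sum $(S,\sigma)+(T,\tau)=(S+T,\sigma+\tau)$. The functor. For a line bundle $\mathcal L$, $\mathcal L^\times$ is the $\mathcal O^\times_{X/\mathcal P}$-torsor of nowhere vanishing sections and $d_{\mathcal B}\log(\mathcal L^\times)=\mathcal L^\times\times_{\mathcal O^\times_{X/\mathcal P}}\Omega^{1,cl}_{\mathcal B}$. Let $\mathrm{Conn}^\flat_{\mathcal B}(\mathcal L)$ be the sheaf of locally defined $\mathcal B$-module structures on $\mathcal L$. It is an $\Omega^{1,cl}_{\mathcal B}$-torsor for the action in which $\omega$ sends the structure $b.m$ to $b.m-\omega(b)m$. For $s\in\mathcal L^\times$ let $d_{\mathcal B}\log(s)\in\mathrm{Conn}^\flat_{\mathcal B}(\mathcal L)$ be the structure transported from the canonical one on $\mathcal O_{X/\mathcal P}$ by $f\mapsto fs$, i.e. the one with $b.s=0$. The map $s\mapsto d_{\mathcal B}\log(s)$ is compatible with $d_{\mathcal B}\log\colon\mathcal O^\times_{X/\mathcal P}\to\Omega^{1,cl}_{\mathcal B}$ and induces an isomorphism of torsors $d_{\mathcal B}\log(\mathcal L^\times)\cong\mathrm{Conn}^\flat_{\mathcal B}(\mathcal L)$; thus a $\mathcal B$-module structure on $\mathcal L$ is the same as a trivialization of $d_{\mathcal B}\log(\mathcal L^\times)$. *)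

theory Defs
  imports "HOL-Analysis.Analysis" "HOL-Algebra.Module"
begin

section \<open>Sheaves on open subsets of a topological space\<close>

text \<open>
  Presheaf data are given by a family of section sets and a family of restriction maps, indexed by
  open sets.  An object over an open set \<open>U\<close> is such data, of which only the values at the members of
  \<open>opens X U\<close> are constrained and used; restricting an object to a smaller open set then needs no
  change of the data.
\<close>

definition opens :: "'x topology \<Rightarrow> 'x set \<Rightarrow> 'x set set" where
  "opens X U = {V. openin X V \<and> V \<subseteq> U}"

definition sheaf_on ::
  "'x topology \<Rightarrow> 'x set \<Rightarrow> ('x set \<Rightarrow> 'a set) \<Rightarrow> ('x set \<Rightarrow> 'x set \<Rightarrow> 'a \<Rightarrow> 'a) \<Rightarrow> bool" where
  "sheaf_on X U S r \<longleftrightarrow>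
     (\<forall>V\<in>opens X U. \<forall>s\<in>S V. r V V s = s) \<and>
     (\<forall>V\<in>opens X U. \<forall>W\<in>opens X V. \<forall>s\<in>S V. r V W s \<in> S W) \<and>
     (\<forall>V\<in>opens X U. \<forall>W\<in>opens X V. \<forall>Z\<in>opens X W. \<forall>s\<in>S V. r W Z (r V W s) = r V Z s) \<and>
     (\<forall>C t. C \<subseteq> opens X U \<longrightarrow> (\<forall>V\<in>C. t V \<in> S V) \<longrightarrow>
        (\<forall>V\<in>C. \<forall>W\<in>C. r V (V \<inter> W) (t V) = r W (V \<inter> W) (t W)) \<longrightarrow>
        (\<exists>!s. s \<in> S (\<Union>C) \<and> (\<forall>V\<in>C. r (\<Union>C) V s = t V)))"

text \<open>
  Quotient sheaves.  If \<open>E\<close> is an equivalence relation on the sheaf \<open>S\<close> (itself a subsheaf of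
  \<open>S \<times> S\<close>), a section over \<open>U\<close> of the sheaf \<open>S/E\<close> is encoded by its sheaf of lifts: \<open>c V\<close> is the set
  of those sections of \<open>S\<close> over \<open>V\<close> which represent the restriction to \<open>V\<close> of the given section.
  Lifts exist locally, any two are equivalent, and \<open>c\<close> contains every section locally equivalent to
  one of its members.  \<open>quot_close\<close> is the section determined by a family of representatives.
\<close>

definition quot_close ::
  "'x topology \<Rightarrow> ('x set \<Rightarrow> 'a set) \<Rightarrow> ('x set \<Rightarrow> 'x set \<Rightarrow> 'a \<Rightarrow> 'a) \<Rightarrow> ('x set \<Rightarrow> ('a \<times> 'a) set)
     \<Rightarrow> 'x set \<Rightarrow> ('x set \<Rightarrow> 'a set) \<Rightarrow> ('x set \<Rightarrow> 'a set)" where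
  "quot_close X S r E U c = (\<lambda>V. if V \<in> opens X U
     then {s \<in> S V. \<forall>x\<in>V. \<exists>W\<in>opens X V. x \<in> W \<and> (\<exists>t\<in>c W. (r V W s, t) \<in> E W)} else {})"

definition quot_sections ::
  "'x topology \<Rightarrow> ('x set \<Rightarrow> 'a set) \<Rightarrow> ('x set \<Rightarrow> 'x set \<Rightarrow> 'a \<Rightarrow> 'a) \<Rightarrow> ('x set \<Rightarrow> ('a \<times> 'a) set)
     \<Rightarrow> 'x set \<Rightarrow> ('x set \<Rightarrow> 'a set) set" where
  "quot_sections X S r E U = {c. quot_close X S r E U c = c \<and>
     (\<forall>V\<in>opens X U. \<forall>W\<in>opens X V. \<forall>s\<in>c V. r V W s \<in> c W) \<and>
     (\<forall>V\<in>opens X U. c V \<times> c V \<subseteq> E V) \<and>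
     (\<forall>x\<in>U. \<exists>V\<in>opens X U. x \<in> V \<and> c V \<noteq> {})}"

section \<open>Sheaves of modules over a sheaf of complex functions\<close>

text \<open>Functions on \<open>U\<close> are extensional, and the restriction maps of a sheaf of functions are \<open>restrict\<close>.\<close>

type_synonym 'x cfun = "'x \<Rightarrow> complex"

definition fun_ring :: "'x set \<Rightarrow> 'x cfun set \<Rightarrow> 'x cfun ring" where
  "fun_ring U F = \<lparr>carrier = F, mult = (\<lambda>f g. \<lambda>x\<in>U. f x * g x), one = (\<lambda>x\<in>U. 1),
     zero = (\<lambda>x\<in>U. 0), add = (\<lambda>f g. \<lambda>x\<in>U. f x + g x)\<rparr>"

text \<open>
  The record \<open>module\<close> of the algebra library also has fields \<open>mult\<close> and \<open>one\<close>, which the locale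
  \<open>module\<close> ignores; they are left undefined below.
\<close>

record ('x, 'a) mod_sheaf =
  Mod :: "'x set \<Rightarrow> ('x cfun, 'a) module"
  mres :: "'x set \<Rightarrow> 'x set \<Rightarrow> 'a \<Rightarrow> 'a"

definition module_sheaf ::
  "'x topology \<Rightarrow> 'x set \<Rightarrow> ('x set \<Rightarrow> 'x cfun ring) \<Rightarrow> ('x, 'a, 'z) mod_sheaf_scheme \<Rightarrow> bool" where
  "module_sheaf X U R M \<longleftrightarrow>
     (\<forall>V\<in>opens X U. module (R V) (Mod M V)) \<and>
     sheaf_on X U (\<lambda>V. carrier (Mod M V)) (mres M) \<and>
     (\<forall>V\<in>opens X U. \<forall>W\<in>opens X V. \<forall>m\<in>carrier (Mod M V). \<forall>m'\<in>carrier (Mod M V).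
        mres M V W (m \<oplus>\<^bsub>Mod M V\<^esub> m') = mres M V W m \<oplus>\<^bsub>Mod M W\<^esub> mres M V W m') \<and>
     (\<forall>V\<in>opens X U. \<forall>W\<in>opens X V. \<forall>f\<in>carrier (R V). \<forall>m\<in>carrier (Mod M V).
        mres M V W (f \<odot>\<^bsub>Mod M V\<^esub> m) = restrict f W \<odot>\<^bsub>Mod M W\<^esub> mres M V W m)"

definition sheaf_hom ::
  "'x topology \<Rightarrow> 'x set \<Rightarrow> ('x set \<Rightarrow> 'x cfun ring) \<Rightarrow> ('x, 'a, 'y) mod_sheaf_scheme
     \<Rightarrow> ('x, 'b, 'z) mod_sheaf_scheme \<Rightarrow> ('x set \<Rightarrow> 'a \<Rightarrow> 'b) \<Rightarrow> bool" where
  "sheaf_hom X U R M N \<phi> \<longleftrightarrow> (\<forall>V\<in>opens X U.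
     \<phi> V \<in> carrier (Mod M V) \<rightarrow> carrier (Mod N V) \<and>
     (\<forall>m\<in>carrier (Mod M V). \<forall>m'\<in>carrier (Mod M V).
        \<phi> V (m \<oplus>\<^bsub>Mod M V\<^esub> m') = \<phi> V m \<oplus>\<^bsub>Mod N V\<^esub> \<phi> V m') \<and>
     (\<forall>f\<in>carrier (R V). \<forall>m\<in>carrier (Mod M V).
        \<phi> V (f \<odot>\<^bsub>Mod M V\<^esub> m) = f \<odot>\<^bsub>Mod N V\<^esub> \<phi> V m) \<and>
     (\<forall>W\<in>opens X V. \<forall>m\<in>carrier (Mod M V). \<phi> W (mres M V W m) = mres N V W (\<phi> V m)))"

text \<open>Families of maps are made extensional so that equality of morphisms is equality in HOL.\<close>

definition ext_family ::
  "'x topology \<Rightarrow> 'x set \<Rightarrow> ('x set \<Rightarrow> 'a set) \<Rightarrow> ('x set \<Rightarrow> 'a \<Rightarrow> 'b) set" where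
  "ext_family X U S = {\<phi> \<in> extensional (opens X U). \<forall>V\<in>opens X U. \<phi> V \<in> extensional (S V)}"

definition frame ::
  "'x topology \<Rightarrow> ('x set \<Rightarrow> 'x cfun ring) \<Rightarrow> ('x, 'a, 'z) mod_sheaf_scheme \<Rightarrow> 'x set \<Rightarrow> nat
     \<Rightarrow> (nat \<Rightarrow> 'a) \<Rightarrow> bool" where
  "frame X R M U r e \<longleftrightarrow> (\<forall>i<r. e i \<in> carrier (Mod M U)) \<and>
     (\<forall>V\<in>opens X U. \<forall>m\<in>carrier (Mod M V). \<exists>!c. c \<in> {..<r} \<rightarrow>\<^sub>E carrier (R V) \<and>
        m = (\<Oplus>\<^bsub>Mod M V\<^esub>i\<in>{..<r}. c i \<odot>\<^bsub>Mod M V\<^esub> mres M U V (e i)))"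

definition locally_free_finite ::
  "'x topology \<Rightarrow> 'x set \<Rightarrow> ('x set \<Rightarrow> 'x cfun ring) \<Rightarrow> ('x, 'a, 'z) mod_sheaf_scheme \<Rightarrow> bool" where
  "locally_free_finite X U R M \<longleftrightarrow> (\<forall>x\<in>U. \<exists>V\<in>opens X U. x \<in> V \<and> (\<exists>r e. frame X R M V r e))"

definition locally_free_rank ::
  "'x topology \<Rightarrow> 'x set \<Rightarrow> ('x set \<Rightarrow> 'x cfun ring) \<Rightarrow> ('x, 'a, 'z) mod_sheaf_scheme \<Rightarrow> nat \<Rightarrow> bool" where
  "locally_free_rank X U R M r \<longleftrightarrow> (\<forall>x\<in>U. \<exists>V\<in>opens X U. x \<in> V \<and> (\<exists>e. frame X R M V r e))"

section \<open>Alternating forms and the Chevalley--Eilenberg differential\<close>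

text \<open>
  A \<open>k\<close>-form over \<open>U\<close> on a sheaf of modules \<open>M\<close> is a section over \<open>U\<close> of the sheaf of alternating
  \<open>R\<close>-multilinear maps from \<open>M\<^sup>k\<close> to \<open>R\<close>, i.e. a family of such maps over the open subsets of \<open>U\<close>
  compatible with restriction.  The arguments are passed as a list of length \<open>k\<close>.
\<close>

type_synonym ('x, 'b) form = "'x set \<Rightarrow> 'b list \<Rightarrow> 'x cfun"

definition form_args :: "('x, 'b, 'z) mod_sheaf_scheme \<Rightarrow> nat \<Rightarrow> 'x set \<Rightarrow> 'b list set" where
  "form_args M k V = {bs. length bs = k \<and> set bs \<subseteq> carrier (Mod M V)}"

definition forms ::
  "'x topology \<Rightarrow> ('x set \<Rightarrow> 'x cfun ring) \<Rightarrow> ('x, 'b, 'z) mod_sheaf_scheme \<Rightarrow> nat \<Rightarrow> 'x set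
     \<Rightarrow> ('x, 'b) form set" where
  "forms X R M k U = {\<omega> \<in> ext_family X U (form_args M k). \<forall>V\<in>opens X U. \<forall>bs\<in>form_args M k V.
     \<omega> V bs \<in> carrier (R V) \<and>
     (\<forall>W\<in>opens X V. \<omega> W (map (mres M V W) bs) = restrict (\<omega> V bs) W) \<and>
     (\<forall>i<k. \<forall>b\<in>carrier (Mod M V). \<omega> V (bs[i := bs ! i \<oplus>\<^bsub>Mod M V\<^esub> b])
        = \<omega> V bs \<oplus>\<^bsub>R V\<^esub> \<omega> V (bs[i := b])) \<and>
     (\<forall>i<k. \<forall>f\<in>carrier (R V). \<omega> V (bs[i := f \<odot>\<^bsub>Mod M V\<^esub> bs ! i]) = f \<otimes>\<^bsub>R V\<^esub> \<omega> V bs) \<and>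
     (\<forall>i j. i < j \<longrightarrow> j < k \<longrightarrow> bs ! i = bs ! j \<longrightarrow> \<omega> V bs = \<zero>\<^bsub>R V\<^esub>)}"

definition mk_form ::
  "'x topology \<Rightarrow> ('x, 'b, 'z) mod_sheaf_scheme \<Rightarrow> nat \<Rightarrow> 'x set \<Rightarrow> ('x set \<Rightarrow> 'b list \<Rightarrow> 'x cfun)
     \<Rightarrow> ('x, 'b) form" where
  "mk_form X M k U h = (\<lambda>V\<in>opens X U. \<lambda>bs\<in>form_args M k V. restrict (h V bs) V)"

definition form_sheaf ::
  "'x topology \<Rightarrow> ('x set \<Rightarrow> 'x cfun ring) \<Rightarrow> ('x, 'b, 'z) mod_sheaf_scheme \<Rightarrow> nat
     \<Rightarrow> ('x, ('x, 'b) form) mod_sheaf" where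
  "form_sheaf X R M k = \<lparr>
     Mod = (\<lambda>U. \<lparr>carrier = forms X R M k U, mult = undefined, one = undefined,
       zero = mk_form X M k U (\<lambda>V bs x. 0),
       add = (\<lambda>\<omega> \<eta>. mk_form X M k U (\<lambda>V bs x. \<omega> V bs x + \<eta> V bs x)),
       smult = (\<lambda>f \<omega>. mk_form X M k U (\<lambda>V bs x. f x * \<omega> V bs x))\<rparr>),
     mres = (\<lambda>U V \<omega>. restrict \<omega> (opens X V))\<rparr>"

definition drop_nth :: "nat \<Rightarrow> 'b list \<Rightarrow> 'b list" where
  "drop_nth i bs = take i bs @ drop (Suc i) bs"

definition form0 :: "'x topology \<Rightarrow> ('x, 'b, 'z) mod_sheaf_scheme \<Rightarrow> 'x set \<Rightarrow> 'x cfun \<Rightarrow> ('x, 'b) form" where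
  "form0 X M U f = mk_form X M 0 U (\<lambda>V bs. f)"

text \<open>\<open>br\<close> is the bracket on \<open>M\<close> and \<open>ac\<close> the action of \<open>M\<close> on functions.\<close>

definition ce_diff ::
  "'x topology \<Rightarrow> ('x, 'b, 'z) mod_sheaf_scheme \<Rightarrow> ('x set \<Rightarrow> 'b \<Rightarrow> 'b \<Rightarrow> 'b)
     \<Rightarrow> ('x set \<Rightarrow> 'b \<Rightarrow> 'x cfun \<Rightarrow> 'x cfun) \<Rightarrow> nat \<Rightarrow> 'x set \<Rightarrow> ('x, 'b) form \<Rightarrow> ('x, 'b) form" where
  "ce_diff X M br ac k U \<omega> = mk_form X M (Suc k) U (\<lambda>V bs x.
     (\<Sum>i\<le>k. (-1) ^ i * ac V (bs ! i) (\<omega> V (drop_nth i bs)) x) +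
     (\<Sum>j\<le>k. \<Sum>i<j. (-1) ^ (i + j) * \<omega> V (br V (bs ! i) (bs ! j) # drop_nth i (drop_nth j bs)) x))"

text \<open>Wedge product of a \<open>1\<close>-form with a \<open>(k-1)\<close>-form.\<close>

definition wedge1 ::
  "'x topology \<Rightarrow> ('x, 'b, 'z) mod_sheaf_scheme \<Rightarrow> nat \<Rightarrow> 'x set \<Rightarrow> ('x, 'b) form \<Rightarrow> ('x, 'b) form
     \<Rightarrow> ('x, 'b) form" where
  "wedge1 X M k U \<alpha> \<eta> = mk_form X M k U (\<lambda>V bs x.
     \<Sum>i<k. (-1) ^ i * \<alpha> V [bs ! i] x * \<eta> V (drop_nth i bs) x)"

section \<open>Smooth manifolds\<close>

text \<open>
  \<open>C\<^sup>k\<close> functions on an open subset \<open>S\<close> of \<open>\<real>\<^sup>n\<close>, the latter being \<open>Euclidean_space n\<close>: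
  the iterated partial derivatives up to order \<open>k\<close> exist and are continuous.
\<close>

primrec Ck_on :: "nat \<Rightarrow> (nat \<Rightarrow> real) set \<Rightarrow> nat \<Rightarrow> ((nat \<Rightarrow> real) \<Rightarrow> complex) \<Rightarrow> bool" where
  "Ck_on n S 0 f \<longleftrightarrow> continuous_map (subtopology (Euclidean_space n) S) euclidean f"
| "Ck_on n S (Suc k) f \<longleftrightarrow> continuous_map (subtopology (Euclidean_space n) S) euclidean f \<and>
     (\<forall>i<n. \<exists>g. (\<forall>y\<in>S. ((\<lambda>t. f (y(i := t))) has_vector_derivative g y) (at (y i))) \<and> Ck_on n S k g)"

definition smooth_on :: "nat \<Rightarrow> (nat \<Rightarrow> real) set \<Rightarrow> ((nat \<Rightarrow> real) \<Rightarrow> complex) \<Rightarrow> bool" where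
  "smooth_on n S f \<longleftrightarrow> (\<forall>k. Ck_on n S k f)"

text \<open>
  A chart \<open>(n, W, \<phi>)\<close> is a homeomorphism \<open>\<phi>\<close> from the open set \<open>W\<close> onto an open subset of \<open>\<real>\<^sup>n\<close>.
  The dimension may vary between connected components.
\<close>

type_synonym 'x atlas = "(nat \<times> 'x set \<times> ('x \<Rightarrow> nat \<Rightarrow> real)) set"

definition smooth_manifold :: "'x topology \<Rightarrow> 'x atlas \<Rightarrow> bool" where
  "smooth_manifold X A \<longleftrightarrow> Hausdorff_space X \<and> second_countable X \<and>
     (\<Union>(n, W, \<phi>)\<in>A. W) = topspace X \<and>
     (\<forall>(n, W, \<phi>)\<in>A. openin X W \<and> (\<exists>S. openin (Euclidean_space n) S \<and>
        homeomorphic_map (subtopology X W) (subtopology (Euclidean_space n) S) \<phi>)) \<and>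
     (\<forall>(n, W, \<phi>)\<in>A. \<forall>(m, Z, \<psi>)\<in>A. \<forall>i<m.
        smooth_on n (\<phi> ` (W \<inter> Z)) (\<lambda>y. complex_of_real (\<psi> (inv_into W \<phi> y) i)))"

definition Cinf :: "'x topology \<Rightarrow> 'x atlas \<Rightarrow> 'x set \<Rightarrow> 'x cfun ring" where
  "Cinf X A U = fun_ring U {f \<in> extensional U.
     \<forall>(n, W, \<phi>)\<in>A. smooth_on n (\<phi> ` (U \<inter> W)) (\<lambda>y. f (inv_into W \<phi> y))}"

text \<open>Complex vector fields over \<open>U\<close> are the derivations of the sheaf of algebras \<open>Cinf\<close> on \<open>U\<close>.\<close>

type_synonym 'x vfield = "'x set \<Rightarrow> 'x cfun \<Rightarrow> 'x cfun"

definition vfields :: "'x topology \<Rightarrow> 'x atlas \<Rightarrow> 'x set \<Rightarrow> 'x vfield set" where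
  "vfields X A U = {v \<in> ext_family X U (\<lambda>V. carrier (Cinf X A V)). \<forall>V\<in>opens X U.
     v V \<in> carrier (Cinf X A V) \<rightarrow> carrier (Cinf X A V) \<and>
     (\<forall>f\<in>carrier (Cinf X A V). \<forall>g\<in>carrier (Cinf X A V). \<forall>x\<in>V.
        v V (f \<oplus>\<^bsub>Cinf X A V\<^esub> g) x = v V f x + v V g x \<and>
        v V (f \<otimes>\<^bsub>Cinf X A V\<^esub> g) x = v V f x * g x + f x * v V g x) \<and>
     (\<forall>c. \<forall>f\<in>carrier (Cinf X A V). \<forall>x\<in>V. v V (\<lambda>y\<in>V. c * f y) x = c * v V f x) \<and>
     (\<forall>W\<in>opens X V. \<forall>f\<in>carrier (Cinf X A V). v W (restrict f W) = restrict (v V f) W)}"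

definition mk_vfield ::
  "'x topology \<Rightarrow> 'x atlas \<Rightarrow> 'x set \<Rightarrow> ('x set \<Rightarrow> 'x cfun \<Rightarrow> 'x cfun) \<Rightarrow> 'x vfield" where
  "mk_vfield X A U h = (\<lambda>V\<in>opens X U. \<lambda>f\<in>carrier (Cinf X A V). restrict (h V f) V)"

definition TX :: "'x topology \<Rightarrow> 'x atlas \<Rightarrow> ('x, 'x vfield) mod_sheaf" where
  "TX X A = \<lparr>
     Mod = (\<lambda>U. \<lparr>carrier = vfields X A U, mult = undefined, one = undefined,
       zero = mk_vfield X A U (\<lambda>V f x. 0),
       add = (\<lambda>v w. mk_vfield X A U (\<lambda>V f x. v V f x + w V f x)),
       smult = (\<lambda>g v. mk_vfield X A U (\<lambda>V f x. g x * v V f x))\<rparr>),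
     mres = (\<lambda>U V v. restrict v (opens X V))\<rparr>"

definition vf_bracket :: "'x topology \<Rightarrow> 'x atlas \<Rightarrow> 'x set \<Rightarrow> 'x vfield \<Rightarrow> 'x vfield \<Rightarrow> 'x vfield" where
  "vf_bracket X A U v w = mk_vfield X A U (\<lambda>V f x. v V (w V f) x - w V (v V f) x)"

abbreviation vf_act :: "'x set \<Rightarrow> 'x vfield \<Rightarrow> 'x cfun \<Rightarrow> 'x cfun" where
  "vf_act V v f \<equiv> v V f"

abbreviation \<Omega>X :: "'x topology \<Rightarrow> 'x atlas \<Rightarrow> nat \<Rightarrow> ('x, ('x, 'x vfield) form) mod_sheaf" where
  "\<Omega>X X A k \<equiv> form_sheaf X (Cinf X A) (TX X A) k"

abbreviation dX ::
  "'x topology \<Rightarrow> 'x atlas \<Rightarrow> nat \<Rightarrow> 'x set \<Rightarrow> ('x, 'x vfield) form \<Rightarrow> ('x, 'x vfield) form" where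
  "dX X A k U \<omega> \<equiv> ce_diff X (TX X A) (vf_bracket X A) vf_act k U \<omega>"

section \<open>Integrable distributions\<close>

definition sub_sheaf ::
  "('x, 'a, 'z) mod_sheaf_scheme \<Rightarrow> ('x set \<Rightarrow> 'a set) \<Rightarrow> ('x, 'a, 'z) mod_sheaf_scheme" where
  "sub_sheaf M S = M\<lparr>Mod := (\<lambda>V. (Mod M V)\<lparr>carrier := S V\<rparr>)\<rparr>"

definition Pperp ::
  "'x topology \<Rightarrow> 'x atlas \<Rightarrow> ('x set \<Rightarrow> 'x vfield set) \<Rightarrow> 'x set \<Rightarrow> ('x, 'x vfield) form set" where
  "Pperp X A P U = {\<alpha> \<in> carrier (Mod (\<Omega>X X A 1) U). \<forall>V\<in>opens X U. \<forall>p\<in>P V. \<alpha> V [p] = \<zero>\<^bsub>Cinf X A V\<^esub>}"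

definition integrable_distribution ::
  "'x topology \<Rightarrow> 'x atlas \<Rightarrow> ('x set \<Rightarrow> 'x vfield set) \<Rightarrow> bool" where
  "integrable_distribution X A P \<longleftrightarrow>
     (\<forall>U. openin X U \<longrightarrow> P U \<subseteq> vfields X A U) \<and>
     module_sheaf X (topspace X) (Cinf X A) (sub_sheaf (TX X A) P) \<and>
     (\<forall>x\<in>topspace X. \<exists>U. openin X U \<and> x \<in> U \<and> (\<exists>n k e. k \<le> n \<and>
        frame X (Cinf X A) (TX X A) U n e \<and>
        frame X (Cinf X A) (sub_sheaf (TX X A) P) U k e)) \<and>
     (\<forall>x\<in>topspace X. \<exists>U. openin X U \<and> x \<in> U \<and> (\<exists>r f. (\<forall>i<r. f i \<in> carrier (Cinf X A U)) \<and>
        frame X (Cinf X A) (sub_sheaf (\<Omega>X X A 1) (Pperp X A P)) U r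
          (\<lambda>i. dX X A 0 U (form0 X (TX X A) U (f i)))))"

text \<open>The subsheaf \<open>\<P>\<^sup>\<bottom> \<and> \<Omega>\<^sup>k\<^sup>-\<^sup>1\<close> of \<open>\<Omega>\<^sup>k\<close>.\<close>

definition Pideal ::
  "'x topology \<Rightarrow> 'x atlas \<Rightarrow> ('x set \<Rightarrow> 'x vfield set) \<Rightarrow> nat \<Rightarrow> 'x set \<Rightarrow> ('x, 'x vfield) form set" where
  "Pideal X A P k U = {\<omega> \<in> carrier (Mod (\<Omega>X X A k) U).
     if k = 0 then \<omega> = \<zero>\<^bsub>Mod (\<Omega>X X A 0) U\<^esub> else
     \<forall>x\<in>U. \<exists>V\<in>opens X U. x \<in> V \<and> (\<exists>(m::nat) \<alpha> \<eta>.
       (\<forall>j<m. \<alpha> j \<in> Pperp X A P V \<and> \<eta> j \<in> carrier (Mod (\<Omega>X X A (k - 1)) V)) \<and>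
       mres (\<Omega>X X A k) U V \<omega> = (\<Oplus>\<^bsub>Mod (\<Omega>X X A k) V\<^esub>j\<in>{..<m}. wedge1 X (TX X A) k V (\<alpha> j) (\<eta> j)))}"

text \<open>
  Vanishing of the cohomology sheaves in positive degrees of \<open>\<Omega>\<^sup>\<bullet>/(\<P>\<^sup>\<bottom> \<and> \<Omega>\<^sup>\<bullet>\<^sup>-\<^sup>1)\<close>, spelled out on
  local representatives: a form closed modulo the ideal is locally exact modulo the ideal.
\<close>

definition relative_deRham_acyclic ::
  "'x topology \<Rightarrow> 'x atlas \<Rightarrow> ('x set \<Rightarrow> 'x vfield set) \<Rightarrow> bool" where
  "relative_deRham_acyclic X A P \<longleftrightarrow> (\<forall>k>0. \<forall>U. openin X U \<longrightarrow> (\<forall>\<omega>\<in>carrier (Mod (\<Omega>X X A k) U).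
     dX X A k U \<omega> \<in> Pideal X A P (k + 1) U \<longrightarrow>
     (\<forall>x\<in>U. \<exists>V\<in>opens X U. x \<in> V \<and> (\<exists>\<eta>\<in>carrier (Mod (\<Omega>X X A (k - 1)) V).
        mres (\<Omega>X X A k) U V \<omega> \<ominus>\<^bsub>Mod (\<Omega>X X A k) V\<^esub> dX X A (k - 1) V \<eta> \<in> Pideal X A P k V))))"

definition OXP :: "'x topology \<Rightarrow> 'x atlas \<Rightarrow> ('x set \<Rightarrow> 'x vfield set) \<Rightarrow> 'x set \<Rightarrow> 'x cfun ring" where
  "OXP X A P U = fun_ring U {f \<in> carrier (Cinf X A U).
     \<forall>V\<in>opens X U. \<forall>p\<in>P V. p V (restrict f V) = \<zero>\<^bsub>Cinf X A V\<^esub>}"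

text \<open>Sections of \<open>\<T>\<^sub>X/\<P>\<close>, of the form of \<open>quot_sections\<close>; the operations are those on representatives.\<close>

type_synonym 'x vclass = "'x set \<Rightarrow> 'x vfield set"

definition vf_rel :: "'x topology \<Rightarrow> 'x atlas \<Rightarrow> ('x set \<Rightarrow> 'x vfield set) \<Rightarrow> 'x set
     \<Rightarrow> ('x vfield \<times> 'x vfield) set" where
  "vf_rel X A P V = {(v, w). v \<in> vfields X A V \<and> w \<in> vfields X A V \<and> v \<ominus>\<^bsub>Mod (TX X A) V\<^esub> w \<in> P V}"

definition vf_class :: "'x topology \<Rightarrow> 'x atlas \<Rightarrow> ('x set \<Rightarrow> 'x vfield set) \<Rightarrow> 'x set
     \<Rightarrow> ('x set \<Rightarrow> 'x vfield set) \<Rightarrow> 'x vclass" where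
  "vf_class X A P U c = quot_close X (vfields X A) (mres (TX X A)) (vf_rel X A P) U c"

definition TXP :: "'x topology \<Rightarrow> 'x atlas \<Rightarrow> ('x set \<Rightarrow> 'x vfield set) \<Rightarrow> ('x, 'x vclass) mod_sheaf" where
  "TXP X A P = \<lparr>
     Mod = (\<lambda>U. \<lparr>
       carrier = {c \<in> quot_sections X (vfields X A) (mres (TX X A)) (vf_rel X A P) U.
         \<forall>V\<in>opens X U. \<forall>p\<in>P V. \<forall>v\<in>c V. vf_bracket X A V p v \<in> P V},
       mult = undefined, one = undefined,
       zero = vf_class X A P U (\<lambda>V. {\<zero>\<^bsub>Mod (TX X A) V\<^esub>}),
       add = (\<lambda>c c'. vf_class X A P U (\<lambda>V. {v \<oplus>\<^bsub>Mod (TX X A) V\<^esub> w | v w. v \<in> c V \<and> w \<in> c' V})),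
       smult = (\<lambda>f c. vf_class X A P U (\<lambda>V. {restrict f V \<odot>\<^bsub>Mod (TX X A) V\<^esub> v | v. v \<in> c V}))\<rparr>),
     mres = (\<lambda>U V c. \<lambda>W. if W \<in> opens X V then c W else {})\<rparr>"

text \<open>The value at \<open>x\<close> of \<open>c(f)\<close>, computed with any local vector field representing \<open>c\<close>.\<close>

definition class_act :: "'x topology \<Rightarrow> 'x set \<Rightarrow> 'x vclass \<Rightarrow> 'x cfun \<Rightarrow> 'x cfun" where
  "class_act X U c f = (\<lambda>x\<in>U. THE z. \<exists>V\<in>opens X U. x \<in> V \<and> (\<exists>v\<in>c V. v V (restrict f V) x = z))"

section \<open>Lie algebroids and their modules\<close>

record ('x, 'b) lie_algd = "('x, 'b) mod_sheaf" +
  lbr :: "'x set \<Rightarrow> 'b \<Rightarrow> 'b \<Rightarrow> 'b"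
  anchor :: "'x set \<Rightarrow> 'b \<Rightarrow> 'x vclass"

definition alg_act :: "'x topology \<Rightarrow> ('x, 'b) lie_algd \<Rightarrow> 'x set \<Rightarrow> 'b \<Rightarrow> 'x cfun \<Rightarrow> 'x cfun" where
  "alg_act X B V b f = class_act X V (anchor B V b) f"

text \<open>Complex scalars act through the constant functions, which belong to \<open>OXP\<close>.\<close>

definition lie_algebroid ::
  "'x topology \<Rightarrow> 'x atlas \<Rightarrow> ('x set \<Rightarrow> 'x vfield set) \<Rightarrow> ('x, 'b) lie_algd \<Rightarrow> bool" where
  "lie_algebroid X A P B \<longleftrightarrow>
     module_sheaf X (topspace X) (OXP X A P) B \<and>
     sheaf_hom X (topspace X) (OXP X A P) B (TXP X A P) (anchor B) \<and>
     (\<forall>V. openin X V \<longrightarrow> (\<forall>a\<in>carrier (Mod B V). \<forall>b\<in>carrier (Mod B V).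
        lbr B V a b \<in> carrier (Mod B V) \<and>
        lbr B V a a = \<zero>\<^bsub>Mod B V\<^esub> \<and>
        (\<forall>W\<in>opens X V. mres B V W (lbr B V a b) = lbr B W (mres B V W a) (mres B V W b)) \<and>
        (\<forall>z. lbr B V ((\<lambda>x\<in>V. z) \<odot>\<^bsub>Mod B V\<^esub> a) b = (\<lambda>x\<in>V. z) \<odot>\<^bsub>Mod B V\<^esub> lbr B V a b \<and>
             lbr B V a ((\<lambda>x\<in>V. z) \<odot>\<^bsub>Mod B V\<^esub> b) = (\<lambda>x\<in>V. z) \<odot>\<^bsub>Mod B V\<^esub> lbr B V a b) \<and>
        (\<forall>c\<in>carrier (Mod B V).
           lbr B V (a \<oplus>\<^bsub>Mod B V\<^esub> b) c = lbr B V a c \<oplus>\<^bsub>Mod B V\<^esub> lbr B V b c \<and>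
           lbr B V a (b \<oplus>\<^bsub>Mod B V\<^esub> c) = lbr B V a b \<oplus>\<^bsub>Mod B V\<^esub> lbr B V a c \<and>
           lbr B V a (lbr B V b c) \<oplus>\<^bsub>Mod B V\<^esub> lbr B V b (lbr B V c a) \<oplus>\<^bsub>Mod B V\<^esub>
             lbr B V c (lbr B V a b) = \<zero>\<^bsub>Mod B V\<^esub>) \<and>
        (\<forall>f\<in>carrier (OXP X A P V). lbr B V a (f \<odot>\<^bsub>Mod B V\<^esub> b) =
           alg_act X B V a f \<odot>\<^bsub>Mod B V\<^esub> b \<oplus>\<^bsub>Mod B V\<^esub> f \<odot>\<^bsub>Mod B V\<^esub> lbr B V a b)))"

definition B_module_structure ::
  "'x topology \<Rightarrow> 'x atlas \<Rightarrow> ('x set \<Rightarrow> 'x vfield set) \<Rightarrow> ('x, 'b) lie_algd \<Rightarrow> 'x set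
     \<Rightarrow> ('x, 'm, 'z) mod_sheaf_scheme \<Rightarrow> ('x set \<Rightarrow> 'b \<Rightarrow> 'm \<Rightarrow> 'm) \<Rightarrow> bool" where
  "B_module_structure X A P B U M D \<longleftrightarrow>
     (\<forall>V\<in>opens X U. \<forall>b\<in>carrier (Mod B V). \<forall>m\<in>carrier (Mod M V).
        D V b m \<in> carrier (Mod M V) \<and>
        (\<forall>W\<in>opens X V. mres M V W (D V b m) = D W (mres B V W b) (mres M V W m)) \<and>
        (\<forall>m'\<in>carrier (Mod M V). D V b (m \<oplus>\<^bsub>Mod M V\<^esub> m') = D V b m \<oplus>\<^bsub>Mod M V\<^esub> D V b m') \<and>
        (\<forall>z. D V b ((\<lambda>x\<in>V. z) \<odot>\<^bsub>Mod M V\<^esub> m) = (\<lambda>x\<in>V. z) \<odot>\<^bsub>Mod M V\<^esub> D V b m) \<and>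
        (\<forall>b'\<in>carrier (Mod B V).
           D V (b \<oplus>\<^bsub>Mod B V\<^esub> b') m = D V b m \<oplus>\<^bsub>Mod M V\<^esub> D V b' m \<and>
           D V (lbr B V b b') m = D V b (D V b' m) \<ominus>\<^bsub>Mod M V\<^esub> D V b' (D V b m)) \<and>
        (\<forall>f\<in>carrier (OXP X A P V).
           D V (f \<odot>\<^bsub>Mod B V\<^esub> b) m = f \<odot>\<^bsub>Mod M V\<^esub> D V b m \<and>
           D V b (f \<odot>\<^bsub>Mod M V\<^esub> m) =
             alg_act X B V b f \<odot>\<^bsub>Mod M V\<^esub> m \<oplus>\<^bsub>Mod M V\<^esub> f \<odot>\<^bsub>Mod M V\<^esub> D V b m))"

section \<open>Picard stacks\<close>

text \<open>
  A stack of groupoids over the open subsets of a space, with restriction functors and with a sum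
  functor on every fibre, together with the constraints of the sum.  \<open>Cmp \<S> U a g f\<close> is \<open>g \<circ> f\<close> for
  \<open>f\<close> with source \<open>a\<close>; \<open>ResO \<S> V\<close>, \<open>ResM \<S> V\<close> restrict to \<open>V\<close>; \<open>SumM \<S> U a a' b b' f g\<close> is the sum of
  \<open>f: a \<rightarrow> a'\<close> and \<open>g: b \<rightarrow> b'\<close>; \<open>Asc\<close>, \<open>Brd\<close> are the associativity and commutativity constraints
  \<open>(a + b) + c \<rightarrow> a + (b + c)\<close>, \<open>a + b \<rightarrow> b + a\<close>; \<open>ResSum \<S> U V a b\<close> is the isomorphism from the
  restriction to \<open>V\<close> of \<open>a + b\<close> to the sum of the restrictions.
\<close>

record ('x, 'o, 'm) picard =
  Ob :: "'x set \<Rightarrow> 'o set"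
  Mor :: "'x set \<Rightarrow> 'o \<Rightarrow> 'o \<Rightarrow> 'm set"
  Idm :: "'x set \<Rightarrow> 'o \<Rightarrow> 'm"
  Cmp :: "'x set \<Rightarrow> 'o \<Rightarrow> 'm \<Rightarrow> 'm \<Rightarrow> 'm"
  ResO :: "'x set \<Rightarrow> 'o \<Rightarrow> 'o"
  ResM :: "'x set \<Rightarrow> 'm \<Rightarrow> 'm"
  SumO :: "'x set \<Rightarrow> 'o \<Rightarrow> 'o \<Rightarrow> 'o"
  SumM :: "'x set \<Rightarrow> 'o \<Rightarrow> 'o \<Rightarrow> 'o \<Rightarrow> 'o \<Rightarrow> 'm \<Rightarrow> 'm \<Rightarrow> 'm"
  Asc :: "'x set \<Rightarrow> 'o \<Rightarrow> 'o \<Rightarrow> 'o \<Rightarrow> 'm"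
  Brd :: "'x set \<Rightarrow> 'o \<Rightarrow> 'o \<Rightarrow> 'm"
  ResSum :: "'x set \<Rightarrow> 'x set \<Rightarrow> 'o \<Rightarrow> 'o \<Rightarrow> 'm"

definition is_iso :: "('x, 'o, 'm) picard \<Rightarrow> 'x set \<Rightarrow> 'o \<Rightarrow> 'o \<Rightarrow> 'm \<Rightarrow> bool" where
  "is_iso \<S> U a b f \<longleftrightarrow> f \<in> Mor \<S> U a b \<and>
     (\<exists>g\<in>Mor \<S> U b a. Cmp \<S> U a g f = Idm \<S> U a \<and> Cmp \<S> U b f g = Idm \<S> U b)"

definition stack_functor ::
  "'x topology \<Rightarrow> ('x, 'o, 'm) picard \<Rightarrow> ('x, 'p, 'n) picard \<Rightarrow> ('x set \<Rightarrow> 'o \<Rightarrow> 'p)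
     \<Rightarrow> ('x set \<Rightarrow> 'o \<Rightarrow> 'o \<Rightarrow> 'm \<Rightarrow> 'n) \<Rightarrow> bool" where
  "stack_functor X \<S> \<T> FO FM \<longleftrightarrow> (\<forall>U. openin X U \<longrightarrow> (\<forall>a\<in>Ob \<S> U.
     FO U a \<in> Ob \<T> U \<and>
     FM U a a (Idm \<S> U a) = Idm \<T> U (FO U a) \<and>
     (\<forall>V\<in>opens X U. FO V (ResO \<S> V a) = ResO \<T> V (FO U a)) \<and>
     (\<forall>b\<in>Ob \<S> U. \<forall>f\<in>Mor \<S> U a b.
        FM U a b f \<in> Mor \<T> U (FO U a) (FO U b) \<and>
        (\<forall>V\<in>opens X U. FM V (ResO \<S> V a) (ResO \<S> V b) (ResM \<S> V f) = ResM \<T> V (FM U a b f)) \<and>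
        (\<forall>c\<in>Ob \<S> U. \<forall>g\<in>Mor \<S> U b c.
           FM U a c (Cmp \<S> U a g f) = Cmp \<T> U (FO U a) (FM U b c g) (FM U a b f)))))"

text \<open>Compatibility with the sums, through natural isomorphisms \<open>\<mu> U a b\<close> from \<open>F a + F b\<close> to \<open>F (a + b)\<close>.\<close>

definition additive_structure ::
  "'x topology \<Rightarrow> ('x, 'o, 'm) picard \<Rightarrow> ('x, 'p, 'n) picard \<Rightarrow> ('x set \<Rightarrow> 'o \<Rightarrow> 'p)
     \<Rightarrow> ('x set \<Rightarrow> 'o \<Rightarrow> 'o \<Rightarrow> 'm \<Rightarrow> 'n) \<Rightarrow> ('x set \<Rightarrow> 'o \<Rightarrow> 'o \<Rightarrow> 'n) \<Rightarrow> bool" where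
  "additive_structure X \<S> \<T> FO FM \<mu> \<longleftrightarrow> (\<forall>U. openin X U \<longrightarrow> (\<forall>a\<in>Ob \<S> U. \<forall>b\<in>Ob \<S> U.
     SumO \<S> U a b \<in> Ob \<S> U \<and> SumO \<T> U (FO U a) (FO U b) \<in> Ob \<T> U \<and>
     is_iso \<T> U (SumO \<T> U (FO U a) (FO U b)) (FO U (SumO \<S> U a b)) (\<mu> U a b) \<and>
     (\<forall>a'\<in>Ob \<S> U. \<forall>b'\<in>Ob \<S> U. \<forall>f\<in>Mor \<S> U a a'. \<forall>g\<in>Mor \<S> U b b'.
        Cmp \<T> U (SumO \<T> U (FO U a) (FO U b))
          (FM U (SumO \<S> U a b) (SumO \<S> U a' b') (SumM \<S> U a a' b b' f g)) (\<mu> U a b)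
        = Cmp \<T> U (SumO \<T> U (FO U a) (FO U b)) (\<mu> U a' b')
          (SumM \<T> U (FO U a) (FO U a') (FO U b) (FO U b') (FM U a a' f) (FM U b b' g))) \<and>
     Cmp \<T> U (SumO \<T> U (FO U a) (FO U b))
       (FM U (SumO \<S> U a b) (SumO \<S> U b a) (Brd \<S> U a b)) (\<mu> U a b)
     = Cmp \<T> U (SumO \<T> U (FO U a) (FO U b)) (\<mu> U b a) (Brd \<T> U (FO U a) (FO U b)) \<and>
     (\<forall>c\<in>Ob \<S> U. let s = SumO \<T> U (SumO \<T> U (FO U a) (FO U b)) (FO U c) in
        Cmp \<T> U s
          (FM U (SumO \<S> U (SumO \<S> U a b) c) (SumO \<S> U a (SumO \<S> U b c)) (Asc \<S> U a b c))
          (Cmp \<T> U s (\<mu> U (SumO \<S> U a b) c)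
            (SumM \<T> U (SumO \<T> U (FO U a) (FO U b)) (FO U (SumO \<S> U a b)) (FO U c) (FO U c)
              (\<mu> U a b) (Idm \<T> U (FO U c))))
        = Cmp \<T> U s (\<mu> U a (SumO \<S> U b c))
          (Cmp \<T> U s
            (SumM \<T> U (FO U a) (FO U a) (SumO \<T> U (FO U b) (FO U c)) (FO U (SumO \<S> U b c))
              (Idm \<T> U (FO U a)) (\<mu> U b c))
            (Asc \<T> U (FO U a) (FO U b) (FO U c)))) \<and>
     (\<forall>V\<in>opens X U. let s = ResO \<T> V (SumO \<T> U (FO U a) (FO U b)) in
        Cmp \<T> V s
          (FM V (ResO \<S> V (SumO \<S> U a b)) (SumO \<S> V (ResO \<S> V a) (ResO \<S> V b)) (ResSum \<S> U V a b))
          (ResM \<T> V (\<mu> U a b))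
        = Cmp \<T> V s (\<mu> V (ResO \<S> V a) (ResO \<S> V b)) (ResSum \<T> U V (FO U a) (FO U b)))))"

definition picard_stack_equivalence ::
  "'x topology \<Rightarrow> ('x, 'o, 'm) picard \<Rightarrow> ('x, 'p, 'n) picard \<Rightarrow> ('x set \<Rightarrow> 'o \<Rightarrow> 'p)
     \<Rightarrow> ('x set \<Rightarrow> 'o \<Rightarrow> 'o \<Rightarrow> 'm \<Rightarrow> 'n) \<Rightarrow> ('x set \<Rightarrow> 'o \<Rightarrow> 'o \<Rightarrow> 'n) \<Rightarrow> bool" where
  "picard_stack_equivalence X \<S> \<T> FO FM \<mu> \<longleftrightarrow>
     stack_functor X \<S> \<T> FO FM \<and> additive_structure X \<S> \<T> FO FM \<mu> \<and>
     (\<forall>U. openin X U \<longrightarrow>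
        (\<forall>a\<in>Ob \<S> U. \<forall>b\<in>Ob \<S> U. bij_betw (FM U a b) (Mor \<S> U a b) (Mor \<T> U (FO U a) (FO U b))) \<and>
        (\<forall>y\<in>Ob \<T> U. \<exists>a\<in>Ob \<S> U. \<exists>f. is_iso \<T> U (FO U a) y f))"

text \<open>
  All objects below have their sections in a fixed type \<open>'u\<close>, which plays the role of a universe; it
  must be large enough to contain copies of the sheaves constructed from the given ones.

  In both stacks below the objects are sheaves with additional structure, the morphisms are families
  of maps of section sets, and a sum of \<open>a\<close> and \<open>b\<close> is an object \<open>p\<close> with a universal map \<open>\<beta>\<close> from
  \<open>a \<times> b\<close> to \<open>p\<close>, defined up to unique isomorphism.  \<open>the_sum\<close> makes a choice, and the constraints are
  the isomorphisms that are prescribed by their values on the images of the universal maps.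
  Here \<open>sc a V\<close> is the set of sections of \<open>a\<close> over \<open>V\<close>.
\<close>

type_synonym ('x, 'u) smap = "'x set \<Rightarrow> 'u \<Rightarrow> 'u"
type_synonym ('x, 'u) sbimap = "'x set \<Rightarrow> 'u \<Rightarrow> 'u \<Rightarrow> 'u"

definition the_sum :: "('x set \<Rightarrow> 'o set) \<Rightarrow> ('x set \<Rightarrow> 'o \<Rightarrow> 'o \<Rightarrow> 'o \<Rightarrow> ('x, 'u) sbimap \<Rightarrow> bool)
     \<Rightarrow> 'x set \<Rightarrow> 'o \<Rightarrow> 'o \<Rightarrow> 'o \<times> ('x, 'u) sbimap" where
  "the_sum ob isum U a b = (SOME (p, \<beta>). p \<in> ob U \<and> isum U a b p \<beta>)"

definition mk_picard ::
  "'x topology \<Rightarrow> ('x set \<Rightarrow> 'o set) \<Rightarrow> ('x set \<Rightarrow> 'o \<Rightarrow> 'o \<Rightarrow> ('x, 'u) smap set)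
     \<Rightarrow> ('o \<Rightarrow> 'x set \<Rightarrow> 'u set) \<Rightarrow> ('x set \<Rightarrow> 'o \<Rightarrow> 'o)
     \<Rightarrow> ('x set \<Rightarrow> 'o \<Rightarrow> 'o \<Rightarrow> 'o \<Rightarrow> ('x, 'u) sbimap \<Rightarrow> bool) \<Rightarrow> ('x, 'o, ('x, 'u) smap) picard" where
  "mk_picard X ob mo sc ro isum = (let
     sm = (\<lambda>U a b. fst (the_sum ob isum U a b));
     bt = (\<lambda>U a b. snd (the_sum ob isum U a b))
   in \<lparr>
     Ob = ob,
     Mor = mo,
     Idm = (\<lambda>U a. \<lambda>V\<in>opens X U. \<lambda>s\<in>sc a V. s),
     Cmp = (\<lambda>U a g f. \<lambda>V\<in>opens X U. \<lambda>s\<in>sc a V. g V (f V s)),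
     ResO = ro,
     ResM = (\<lambda>V f. restrict f (opens X V)),
     SumO = sm,
     SumM = (\<lambda>U a a' b b' f g. THE h. h \<in> mo U (sm U a b) (sm U a' b') \<and>
       (\<forall>V\<in>opens X U. \<forall>s\<in>sc a V. \<forall>t\<in>sc b V. h V (bt U a b V s t) = bt U a' b' V (f V s) (g V t))),
     Asc = (\<lambda>U a b c. THE h. h \<in> mo U (sm U (sm U a b) c) (sm U a (sm U b c)) \<and>
       (\<forall>V\<in>opens X U. \<forall>s\<in>sc a V. \<forall>t\<in>sc b V. \<forall>u\<in>sc c V.
          h V (bt U (sm U a b) c V (bt U a b V s t) u) = bt U a (sm U b c) V s (bt U b c V t u))),
     Brd = (\<lambda>U a b. THE h. h \<in> mo U (sm U a b) (sm U b a) \<and>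
       (\<forall>V\<in>opens X U. \<forall>s\<in>sc a V. \<forall>t\<in>sc b V. h V (bt U a b V s t) = bt U b a V t s)),
     ResSum = (\<lambda>U V a b. THE h. h \<in> mo V (ro V (sm U a b)) (sm V (ro V a) (ro V b)) \<and>
       (\<forall>W\<in>opens X V. \<forall>s\<in>sc a W. \<forall>t\<in>sc b W.
          h W (bt U a b W s t) = bt V (ro V a) (ro V b) W s t))\<rparr>)"

section \<open>The Picard stack of line bundles with a B-module structure\<close>

record ('x, 'u, 'b) bmod = "('x, 'u) mod_sheaf" +
  bact :: "'x set \<Rightarrow> 'b \<Rightarrow> 'u \<Rightarrow> 'u"

definition PicB_Ob ::
  "'x topology \<Rightarrow> 'x atlas \<Rightarrow> ('x set \<Rightarrow> 'x vfield set) \<Rightarrow> ('x, 'b) lie_algd \<Rightarrow> 'x set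
     \<Rightarrow> ('x, 'u, 'b) bmod set" where
  "PicB_Ob X A P B U = {L. module_sheaf X U (OXP X A P) L \<and> locally_free_rank X U (OXP X A P) L 1 \<and>
     B_module_structure X A P B U L (bact L)}"

definition PicB_Mor ::
  "'x topology \<Rightarrow> 'x atlas \<Rightarrow> ('x set \<Rightarrow> 'x vfield set) \<Rightarrow> ('x, 'b) lie_algd \<Rightarrow> 'x set
     \<Rightarrow> ('x, 'u, 'b) bmod \<Rightarrow> ('x, 'u, 'b) bmod \<Rightarrow> ('x, 'u) smap set" where
  "PicB_Mor X A P B U L M = {\<phi> \<in> ext_family X U (\<lambda>V. carrier (Mod L V)).
     sheaf_hom X U (OXP X A P) L M \<phi> \<and>
     (\<forall>V\<in>opens X U. bij_betw (\<phi> V) (carrier (Mod L V)) (carrier (Mod M V)) \<and>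
        (\<forall>b\<in>carrier (Mod B V). \<forall>m\<in>carrier (Mod L V). \<phi> V (bact L V b m) = bact M V b (\<phi> V m)))}"

definition bilinear_map ::
  "'x topology \<Rightarrow> 'x set \<Rightarrow> ('x set \<Rightarrow> 'x cfun ring) \<Rightarrow> ('x, 'u, 'y) mod_sheaf_scheme
     \<Rightarrow> ('x, 'u, 'y) mod_sheaf_scheme \<Rightarrow> ('x, 'u, 'z) mod_sheaf_scheme \<Rightarrow> ('x, 'u) sbimap \<Rightarrow> bool" where
  "bilinear_map X U R L M N \<beta> \<longleftrightarrow>
     (\<forall>V\<in>opens X U. \<forall>l\<in>carrier (Mod L V). \<forall>m\<in>carrier (Mod M V).
        \<beta> V l m \<in> carrier (Mod N V) \<and>
        (\<forall>W\<in>opens X V. mres N V W (\<beta> V l m) = \<beta> W (mres L V W l) (mres M V W m)) \<and>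
        (\<forall>l'\<in>carrier (Mod L V). \<beta> V (l \<oplus>\<^bsub>Mod L V\<^esub> l') m = \<beta> V l m \<oplus>\<^bsub>Mod N V\<^esub> \<beta> V l' m) \<and>
        (\<forall>m'\<in>carrier (Mod M V). \<beta> V l (m \<oplus>\<^bsub>Mod M V\<^esub> m') = \<beta> V l m \<oplus>\<^bsub>Mod N V\<^esub> \<beta> V l m') \<and>
        (\<forall>f\<in>carrier (R V). \<beta> V (f \<odot>\<^bsub>Mod L V\<^esub> l) m = f \<odot>\<^bsub>Mod N V\<^esub> \<beta> V l m \<and>
           \<beta> V l (f \<odot>\<^bsub>Mod M V\<^esub> m) = f \<odot>\<^bsub>Mod N V\<^esub> \<beta> V l m))"

definition PicB_tensor ::
  "'x topology \<Rightarrow> 'x atlas \<Rightarrow> ('x set \<Rightarrow> 'x vfield set) \<Rightarrow> ('x, 'b) lie_algd \<Rightarrow> 'x set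
     \<Rightarrow> ('x, 'u, 'b) bmod \<Rightarrow> ('x, 'u, 'b) bmod \<Rightarrow> ('x, 'u, 'b) bmod \<Rightarrow> ('x, 'u) sbimap \<Rightarrow> bool" where
  "PicB_tensor X A P B U L M T \<beta> \<longleftrightarrow>
     bilinear_map X U (OXP X A P) L M T \<beta> \<and>
     (\<forall>(N :: ('x, 'u) mod_sheaf) \<gamma>.
        module_sheaf X U (OXP X A P) N \<longrightarrow> bilinear_map X U (OXP X A P) L M N \<gamma> \<longrightarrow>
        (\<exists>!\<phi>. \<phi> \<in> ext_family X U (\<lambda>V. carrier (Mod T V)) \<and> sheaf_hom X U (OXP X A P) T N \<phi> \<and>
           (\<forall>V\<in>opens X U. \<forall>l\<in>carrier (Mod L V). \<forall>m\<in>carrier (Mod M V). \<phi> V (\<beta> V l m) = \<gamma> V l m))) \<and>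
     (\<forall>V\<in>opens X U. \<forall>b\<in>carrier (Mod B V). \<forall>l\<in>carrier (Mod L V). \<forall>m\<in>carrier (Mod M V).
        bact T V b (\<beta> V l m) = \<beta> V (bact L V b l) m \<oplus>\<^bsub>Mod T V\<^esub> \<beta> V l (bact M V b m))"

definition PicB ::
  "'x topology \<Rightarrow> 'x atlas \<Rightarrow> ('x set \<Rightarrow> 'x vfield set) \<Rightarrow> ('x, 'b) lie_algd
     \<Rightarrow> ('x, ('x, 'u, 'b) bmod, ('x, 'u) smap) picard" where
  "PicB X A P B = mk_picard X (PicB_Ob X A P B) (PicB_Mor X A P B) (\<lambda>L V. carrier (Mod L V))
     (\<lambda>V L. L) (PicB_tensor X A P B)"

section \<open>Torsors under a two-term complex of sheaves of abelian groups\<close>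

record ('x, 'g) group_sheaf =
  Grp :: "'x set \<Rightarrow> 'g monoid"
  gres :: "'x set \<Rightarrow> 'x set \<Rightarrow> 'g \<Rightarrow> 'g"

record ('x, 'g, 'h, 'u) ttorsor =
  tsec :: "'x set \<Rightarrow> 'u set"
  tres :: "'x set \<Rightarrow> 'x set \<Rightarrow> 'u \<Rightarrow> 'u"
  tact :: "'x set \<Rightarrow> 'g \<Rightarrow> 'u \<Rightarrow> 'u"
  triv :: "'x set \<Rightarrow> ('u \<times> 'h) set"

definition is_torsor ::
  "'x topology \<Rightarrow> ('x, 'g) group_sheaf \<Rightarrow> 'x set \<Rightarrow> ('x, 'g, 'h, 'u) ttorsor \<Rightarrow> bool" where
  "is_torsor X G U T \<longleftrightarrow> sheaf_on X U (tsec T) (tres T) \<and>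
     (\<forall>V\<in>opens X U. \<forall>t\<in>tsec T V.
        tact T V \<one>\<^bsub>Grp G V\<^esub> t = t \<and>
        (\<forall>g\<in>carrier (Grp G V). tact T V g t \<in> tsec T V \<and>
           (\<forall>h\<in>carrier (Grp G V). tact T V (g \<otimes>\<^bsub>Grp G V\<^esub> h) t = tact T V g (tact T V h t)) \<and>
           (\<forall>W\<in>opens X V. tres T V W (tact T V g t) = tact T W (gres G V W g) (tres T V W t))) \<and>
        (\<forall>t'\<in>tsec T V. \<exists>!g. g \<in> carrier (Grp G V) \<and> tact T V g t = t')) \<and>
     (\<forall>x\<in>U. \<exists>V\<in>opens X U. x \<in> V \<and> tsec T V \<noteq> {})"

text \<open>
  The induced torsor \<open>d(T) = T \<times>\<^bsub>G\<^esub> H\<close> is the quotient sheaf of \<open>T \<times> H\<close> by the identification of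
  \<open>(g t, a)\<close> with \<open>(t, d(g) a)\<close>.
\<close>

definition ind_sec :: "('x, 'h) group_sheaf \<Rightarrow> ('x, 'g, 'h, 'u) ttorsor \<Rightarrow> 'x set \<Rightarrow> ('u \<times> 'h) set" where
  "ind_sec H T V = tsec T V \<times> carrier (Grp H V)"

definition ind_res :: "('x, 'h) group_sheaf \<Rightarrow> ('x, 'g, 'h, 'u) ttorsor \<Rightarrow> 'x set \<Rightarrow> 'x set
     \<Rightarrow> 'u \<times> 'h \<Rightarrow> 'u \<times> 'h" where
  "ind_res H T V W = map_prod (tres T V W) (gres H V W)"

definition ind_rel :: "('x, 'g) group_sheaf \<Rightarrow> ('x, 'h) group_sheaf \<Rightarrow> ('x set \<Rightarrow> 'g \<Rightarrow> 'h)
     \<Rightarrow> ('x, 'g, 'h, 'u) ttorsor \<Rightarrow> 'x set \<Rightarrow> (('u \<times> 'h) \<times> ('u \<times> 'h)) set" where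
  "ind_rel G H d T V = {((tact T V g t, a), (t, d V g \<otimes>\<^bsub>Grp H V\<^esub> a)) | g t a.
     g \<in> carrier (Grp G V) \<and> t \<in> tsec T V \<and> a \<in> carrier (Grp H V)}"

definition ind_class :: "'x topology \<Rightarrow> ('x, 'g) group_sheaf \<Rightarrow> ('x, 'h) group_sheaf
     \<Rightarrow> ('x set \<Rightarrow> 'g \<Rightarrow> 'h) \<Rightarrow> ('x, 'g, 'h, 'u) ttorsor \<Rightarrow> 'x set \<Rightarrow> ('x set \<Rightarrow> ('u \<times> 'h) set)
     \<Rightarrow> ('x set \<Rightarrow> ('u \<times> 'h) set)" where
  "ind_class X G H d T U c = quot_close X (ind_sec H T) (ind_res H T) (ind_rel G H d T) U c"

definition Tors_Ob ::
  "'x topology \<Rightarrow> ('x, 'g) group_sheaf \<Rightarrow> ('x, 'h) group_sheaf \<Rightarrow> ('x set \<Rightarrow> 'g \<Rightarrow> 'h) \<Rightarrow> 'x set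
     \<Rightarrow> ('x, 'g, 'h, 'u) ttorsor set" where
  "Tors_Ob X G H d U = {T. is_torsor X G U T \<and>
     triv T \<in> quot_sections X (ind_sec H T) (ind_res H T) (ind_rel G H d T) U}"

definition Tors_Mor ::
  "'x topology \<Rightarrow> ('x, 'g) group_sheaf \<Rightarrow> ('x, 'h) group_sheaf \<Rightarrow> ('x set \<Rightarrow> 'g \<Rightarrow> 'h) \<Rightarrow> 'x set
     \<Rightarrow> ('x, 'g, 'h, 'u) ttorsor \<Rightarrow> ('x, 'g, 'h, 'u) ttorsor \<Rightarrow> ('x, 'u) smap set" where
  "Tors_Mor X G H d U S T = {\<phi> \<in> ext_family X U (tsec S).
     (\<forall>V\<in>opens X U. \<forall>s\<in>tsec S V. \<phi> V s \<in> tsec T V \<and>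
        (\<forall>g\<in>carrier (Grp G V). \<phi> V (tact S V g s) = tact T V g (\<phi> V s)) \<and>
        (\<forall>W\<in>opens X V. \<phi> W (tres S V W s) = tres T V W (\<phi> V s))) \<and>
     ind_class X G H d T U (\<lambda>V. {(\<phi> V s, a) | s a. (s, a) \<in> triv S V}) = triv T}"

text \<open>
  The sum \<open>S + T\<close> is the contracted product of \<open>S\<close> and \<open>T\<close>: a torsor \<open>Q\<close> with a biequivariant map
  \<open>\<beta>: S \<times> T \<rightarrow> Q\<close>, which then identifies \<open>Q\<close> with the quotient sheaf \<open>(S \<times> T)/G\<close>.  The trivialization
  of \<open>Q\<close> is the sum of those of \<open>S\<close> and \<open>T\<close>.
\<close>

definition Tors_sum ::
  "'x topology \<Rightarrow> ('x, 'g) group_sheaf \<Rightarrow> ('x, 'h) group_sheaf \<Rightarrow> ('x set \<Rightarrow> 'g \<Rightarrow> 'h) \<Rightarrow> 'x set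
     \<Rightarrow> ('x, 'g, 'h, 'u) ttorsor \<Rightarrow> ('x, 'g, 'h, 'u) ttorsor \<Rightarrow> ('x, 'g, 'h, 'u) ttorsor
     \<Rightarrow> ('x, 'u) sbimap \<Rightarrow> bool" where
  "Tors_sum X G H d U S T Q \<beta> \<longleftrightarrow>
     (\<forall>V\<in>opens X U. \<forall>s\<in>tsec S V. \<forall>t\<in>tsec T V. \<beta> V s t \<in> tsec Q V \<and>
        (\<forall>W\<in>opens X V. tres Q V W (\<beta> V s t) = \<beta> W (tres S V W s) (tres T V W t)) \<and>
        (\<forall>g\<in>carrier (Grp G V). \<beta> V (tact S V g s) t = tact Q V g (\<beta> V s t) \<and>
           \<beta> V s (tact T V g t) = tact Q V g (\<beta> V s t))) \<and>
     triv Q = ind_class X G H d Q U (\<lambda>V. {(\<beta> V s t, a \<otimes>\<^bsub>Grp H V\<^esub> b) | s t a b.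
        (s, a) \<in> triv S V \<and> (t, b) \<in> triv T V})"

definition Tors ::
  "'x topology \<Rightarrow> ('x, 'g) group_sheaf \<Rightarrow> ('x, 'h) group_sheaf \<Rightarrow> ('x set \<Rightarrow> 'g \<Rightarrow> 'h)
     \<Rightarrow> ('x, ('x, 'g, 'h, 'u) ttorsor, ('x, 'u) smap) picard" where
  "Tors X G H d = mk_picard X (Tors_Ob X G H d) (Tors_Mor X G H d) tsec
     (\<lambda>V T. T\<lparr>triv := \<lambda>W. if W \<in> opens X V then triv T W else {}\<rparr>) (Tors_sum X G H d)"

section \<open>The complex of invertible functions and closed 1-forms\<close>

definition Ounits :: "'x topology \<Rightarrow> 'x atlas \<Rightarrow> ('x set \<Rightarrow> 'x vfield set) \<Rightarrow> ('x, 'x cfun) group_sheaf" where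
  "Ounits X A P = \<lparr>Grp = (\<lambda>U. units_of (OXP X A P U)), gres = (\<lambda>U V f. restrict f V)\<rparr>"

abbreviation \<Omega>B :: "'x topology \<Rightarrow> 'x atlas \<Rightarrow> ('x set \<Rightarrow> 'x vfield set) \<Rightarrow> ('x, 'b) lie_algd \<Rightarrow> nat
     \<Rightarrow> ('x, ('x, 'b) form) mod_sheaf" where
  "\<Omega>B X A P B k \<equiv> form_sheaf X (OXP X A P) B k"

abbreviation dB :: "'x topology \<Rightarrow> ('x, 'b) lie_algd \<Rightarrow> nat \<Rightarrow> 'x set \<Rightarrow> ('x, 'b) form \<Rightarrow> ('x, 'b) form" where
  "dB X B k U \<omega> \<equiv> ce_diff X B (lbr B) (alg_act X B) k U \<omega>"

definition Omega1cl :: "'x topology \<Rightarrow> 'x atlas \<Rightarrow> ('x set \<Rightarrow> 'x vfield set) \<Rightarrow> ('x, 'b) lie_algd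
     \<Rightarrow> ('x, ('x, 'b) form) group_sheaf" where
  "Omega1cl X A P B = \<lparr>
     Grp = (\<lambda>U. \<lparr>
       carrier = {\<omega> \<in> carrier (Mod (\<Omega>B X A P B 1) U). dB X B 1 U \<omega> = \<zero>\<^bsub>Mod (\<Omega>B X A P B 2) U\<^esub>},
       mult = add (Mod (\<Omega>B X A P B 1) U), one = \<zero>\<^bsub>Mod (\<Omega>B X A P B 1) U\<^esub>\<rparr>),
     gres = mres (\<Omega>B X A P B 1)\<rparr>"

definition dlog :: "'x topology \<Rightarrow> ('x, 'b) lie_algd \<Rightarrow> 'x set \<Rightarrow> 'x cfun \<Rightarrow> ('x, 'b) form" where
  "dlog X B U f = mk_form X B 1 U (\<lambda>V bs x. dB X B 0 U (form0 X B U f) V bs x / f x)"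

section \<open>The functor\<close>

text \<open>A section vanishes at \<open>x\<close> if its image in the fibre of \<open>L\<close> at \<open>x\<close> is zero (\<open>L\<close> of rank one).\<close>

definition vanishes_at :: "'x topology \<Rightarrow> ('x set \<Rightarrow> 'x cfun ring) \<Rightarrow> ('x, 'u, 'z) mod_sheaf_scheme
     \<Rightarrow> 'x set \<Rightarrow> 'u \<Rightarrow> 'x \<Rightarrow> bool" where
  "vanishes_at X R L V s x \<longleftrightarrow> (\<exists>W\<in>opens X V. x \<in> W \<and>
     (\<exists>f\<in>carrier (R W). \<exists>t\<in>carrier (Mod L W). f x = 0 \<and> mres L V W s = f \<odot>\<^bsub>Mod L W\<^esub> t))"

definition nonvanishing :: "'x topology \<Rightarrow> ('x set \<Rightarrow> 'x cfun ring) \<Rightarrow> ('x, 'u, 'z) mod_sheaf_scheme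
     \<Rightarrow> 'x set \<Rightarrow> 'u set" where
  "nonvanishing X R L V = {s \<in> carrier (Mod L V). \<forall>x\<in>V. \<not> vanishes_at X R L V s x}"

definition ext_structure ::
  "'x topology \<Rightarrow> ('x, 'b) lie_algd \<Rightarrow> ('x, 'u, 'z) mod_sheaf_scheme \<Rightarrow> 'x set
     \<Rightarrow> ('x set \<Rightarrow> 'b \<Rightarrow> 'u \<Rightarrow> 'u) \<Rightarrow> ('x set \<Rightarrow> 'b \<Rightarrow> 'u \<Rightarrow> 'u)" where
  "ext_structure X B L V D =
     (\<lambda>W\<in>opens X V. \<lambda>b\<in>carrier (Mod B W). \<lambda>m\<in>carrier (Mod L W). D W b m)"

text \<open>The action of a closed \<open>1\<close>-form on the sheaf of \<open>B\<close>-module structures on \<open>L\<close>.\<close>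

definition conn_act ::
  "'x topology \<Rightarrow> ('x, 'b) lie_algd \<Rightarrow> ('x, 'u, 'z) mod_sheaf_scheme \<Rightarrow> 'x set
     \<Rightarrow> ('x, 'b) form \<Rightarrow> ('x set \<Rightarrow> 'b \<Rightarrow> 'u \<Rightarrow> 'u) \<Rightarrow> ('x set \<Rightarrow> 'b \<Rightarrow> 'u \<Rightarrow> 'u)" where
  "conn_act X B L V \<omega> D = ext_structure X B L V
     (\<lambda>W b m. D W b m \<ominus>\<^bsub>Mod L W\<^esub> \<omega> W [b] \<odot>\<^bsub>Mod L W\<^esub> m)"

text \<open>The structure on \<open>L\<close> transported from the canonical one on \<open>OXP\<close> along \<open>f \<mapsto> f s\<close>.\<close>

definition dlog_section ::
  "'x topology \<Rightarrow> ('x set \<Rightarrow> 'x cfun ring) \<Rightarrow> ('x, 'b) lie_algd \<Rightarrow> ('x, 'u, 'z) mod_sheaf_scheme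
     \<Rightarrow> 'x set \<Rightarrow> 'u \<Rightarrow> ('x set \<Rightarrow> 'b \<Rightarrow> 'u \<Rightarrow> 'u)" where
  "dlog_section X R B L V s = ext_structure X B L V
     (\<lambda>W b m. alg_act X B W b (THE f. f \<in> carrier (R W) \<and> m = f \<odot>\<^bsub>Mod L W\<^esub> mres L V W s)
        \<odot>\<^bsub>Mod L W\<^esub> mres L V W s)"

text \<open>
  The isomorphism of \<open>dlog(L\<^sup>\<times>)\<close> with the sheaf of structures sends the class of \<open>(s, \<omega>)\<close> to the
  translate of \<open>dlog_section s\<close> by \<open>\<omega>\<close>.  The trivialization attached to \<open>L\<close> is the inverse image of
  the given structure, encoded as in \<open>quot_sections\<close> by its lifts.
\<close>

definition nabla ::
  "'x topology \<Rightarrow> 'x atlas \<Rightarrow> ('x set \<Rightarrow> 'x vfield set) \<Rightarrow> ('x, 'b) lie_algd \<Rightarrow> 'x set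
     \<Rightarrow> ('x, 'u, 'b) bmod \<Rightarrow> 'x set \<Rightarrow> ('u \<times> ('x, 'b) form) set" where
  "nabla X A P B U L V = (if V \<in> opens X U then
     {(s, \<omega>). s \<in> nonvanishing X (OXP X A P) L V \<and> \<omega> \<in> carrier (Grp (Omega1cl X A P B) V) \<and>
        conn_act X B L V \<omega> (dlog_section X (OXP X A P) B L V s) = ext_structure X B L V (bact L)}
     else {})"

definition F_Ob ::
  "'x topology \<Rightarrow> 'x atlas \<Rightarrow> ('x set \<Rightarrow> 'x vfield set) \<Rightarrow> ('x, 'b) lie_algd \<Rightarrow> 'x set
     \<Rightarrow> ('x, 'u, 'b) bmod \<Rightarrow> ('x, 'x cfun, ('x, 'b) form, 'u) ttorsor" where
  "F_Ob X A P B U L = \<lparr>tsec = nonvanishing X (OXP X A P) L, tres = mres L,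
     tact = (\<lambda>V f s. f \<odot>\<^bsub>Mod L V\<^esub> s), triv = nabla X A P B U L\<rparr>"

definition F_Mor ::
  "'x topology \<Rightarrow> 'x atlas \<Rightarrow> ('x set \<Rightarrow> 'x vfield set) \<Rightarrow> 'x set
     \<Rightarrow> ('x, 'u, 'b) bmod \<Rightarrow> ('x, 'u, 'b) bmod \<Rightarrow> ('x, 'u) smap \<Rightarrow> ('x, 'u) smap" where
  "F_Mor X A P U L M \<phi> = (\<lambda>V\<in>opens X U. \<lambda>s\<in>nonvanishing X (OXP X A P) L V. \<phi> V s)"

abbreviation dlog_torsors ::
  "'x topology \<Rightarrow> 'x atlas \<Rightarrow> ('x set \<Rightarrow> 'x vfield set) \<Rightarrow> ('x, 'b) lie_algd
     \<Rightarrow> ('x, ('x, 'x cfun, ('x, 'b) form, 'u) ttorsor, ('x, 'u) smap) picard" where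
  "dlog_torsors X A P B \<equiv> Tors X (Ounits X A P) (Omega1cl X A P B) (dlog X B)"

text \<open>The isomorphism from \<open>L\<^sup>\<times> + M\<^sup>\<times>\<close> to \<open>(L \<otimes> M)\<^sup>\<times>\<close> sending \<open>s + t\<close> to \<open>s \<otimes> t\<close>.\<close>

definition F_add ::
  "'x topology \<Rightarrow> 'x atlas \<Rightarrow> ('x set \<Rightarrow> 'x vfield set) \<Rightarrow> ('x, 'b) lie_algd \<Rightarrow> 'x set
     \<Rightarrow> ('x, 'u, 'b) bmod \<Rightarrow> ('x, 'u, 'b) bmod \<Rightarrow> ('x, 'u) smap" where
  "F_add X A P B U L M = (let G = Ounits X A P; H = Omega1cl X A P B; d = dlog X B;
       SL = F_Ob X A P B U L; SM = F_Ob X A P B U M;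
       (Q, \<beta>) = the_sum (Tors_Ob X G H d) (Tors_sum X G H d) U SL SM;
       (T, \<tau>) = the_sum (PicB_Ob X A P B) (PicB_tensor X A P B) U L M
     in THE h. h \<in> Tors_Mor X G H d U Q (F_Ob X A P B U T) \<and>
       (\<forall>V\<in>opens X U. \<forall>s\<in>tsec SL V. \<forall>t\<in>tsec SM V. h V (\<beta> V s t) = \<tau> V s t))"

end

theory Submission
  imports Defs
begin

text \<open>
  Locally, a line bundle has a frame \<open>s\<close>, and a module structure over the algebroid is the closed form
  \<open>\<omega>\<close> with \<open>b.s = - \<omega>(b) s\<close>; the pairs \<open>(s, \<omega>)\<close> so obtained are the representatives of the
  trivialization \<open>\<nabla>\<close>.  Conversely, choose functions for the sections of a torsor compatibly with the
  action of units.  The functions that are locally multiples of these form a line bundle, and the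
  representatives \<open>(v, \<omega>)\<close> of the trivialization make \<open>b.(h v) = (b(h) - \<omega>(b) h) v\<close> well defined, since
  replacing \<open>v\<close> by \<open>g v\<close> changes \<open>\<omega>\<close> by \<open>- dlog g\<close>, and flat, since \<open>\<omega>\<close> is closed.  This gives
  essential surjectivity, and applied to products of frames it gives tensor products and sums.  A
  morphism of torsors extends linearly from nonvanishing sections to all sections, whence full
  faithfulness.  The compatibilities with the sums are equalities of maps out of a sum, which hold
  because both sides agree on the image of the universal map.
\<close>

text \<open>The obstacle is that a torsor has no common trivialization in which its sections could
  be compared with functions. Value maps avoid gluing data: for every point \<open>x\<close> a
  generator near \<open>x\<close> is chosen, and the value of a section at \<open>x\<close> is the
  value there of its coefficient. As functions of \<open>x\<close> these values have no regularity,
  but their ratios, with nonvanishing denominator, are sections of \<open>OXP\<close>, and only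
  ratios matter. Line bundles, tensor products and sums thus live among functions, so an injection
  of functions into \<open>'u\<close> is all that the universe must provide, and a contracted
  product becomes a pointwise product.

  The sign in b.s = - \<omega>(b) s comes from \<open>conn_act\<close>, which subtracts the form.
  For \<open>dlog\<close> to have closed values the anchor must respect brackets; this is derived
  from the Jacobi identity with the help of local frames of \<open>B\<close>.

  Modules and torsors are treated together as sheaves over a multiplicative system of functions,
  locally generated by one section. Sums of torsors are realized as torsors of line bundles, so that
  one product construction serves both stacks.\<close>

abbreviation mod_smult ("_ \<odot>[_,_] _" [70, 0, 0, 71] 70) where "f \<odot>[M,V] m \<equiv> f \<odot>\<^bsub>Mod M V\<^esub> m"
abbreviation mod_add ("_ \<oplus>[_,_] _" [65, 0, 0, 66] 65) where "m \<oplus>[M,V] m' \<equiv> m \<oplus>\<^bsub>Mod M V\<^esub> m'"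
abbreviation grp_mult ("_ \<otimes>[_,_] _" [70, 0, 0, 71] 70) where "g \<otimes>[G,V] h \<equiv> g \<otimes>\<^bsub>Grp G V\<^esub> h"

section \<open>Smooth functions\<close>

text \<open>The derivatives in \<open>Ck_on\<close> run along ambient lines, so comparing functions
  known only on \<open>S\<close> requires such a line to stay in \<open>S\<close> near
  \<open>y\<close>. As \<open>i < n\<close>, moving the \<open>i\<close>-th coordinate does not
  leave the subspace where the coordinates from \<open>n\<close> on vanish, and the line is
  continuous for the product topology.\<close>

lemma Euclidean_line_open:
  assumes "openin (Euclidean_space n) S" "y \<in> S" "i < n"
  shows "\<exists>T. open T \<and> y i \<in> T \<and> (\<forall>t\<in>T. y(i := t) \<in> S)"
proof -
  obtain T' where T': "open T'" "S = T' \<inter> {x. \<forall>i\<ge>n. x i = 0}"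
    using assms(1) by (auto simp: Euclidean_space_def openin_subtopology euclidean_product_topology)
  have c: "continuous_on UNIV (\<lambda>t::real. y(i := t))"
  proof (rule continuous_on_coordinatewise_then_product)
    show "continuous_on UNIV (\<lambda>t. (y(i := t)) j)" for j
      by (cases "j = i") (simp_all add: continuous_on_id)
  qed
  have "open ((\<lambda>t. y(i := t)) -` T')"
    using c T'(1) by (simp add: continuous_on_open_vimage)
  moreover have "y i \<in> (\<lambda>t. y(i := t)) -` T'" using assms(2) T' by simp
  moreover have "y(i := t) \<in> S" if "t \<in> (\<lambda>t. y(i := t)) -` T'" for t
    using that assms T' by auto
  ultimately show ?thesis by blast
qed

lemma Ck_on_continuous: "Ck_on n S k f \<Longrightarrow> continuous_map (subtopology (Euclidean_space n) S) euclidean f"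
  by (cases k) auto

lemma Ck_on_Suc_imp: "Ck_on n S (Suc k) f \<Longrightarrow> Ck_on n S k f"
proof (induction k arbitrary: f)
  case (Suc k)
  then show ?case by (metis Ck_on.simps(2))
qed simp

lemma Ck_on_subset: "Ck_on n S k f \<Longrightarrow> S' \<subseteq> S \<Longrightarrow> Ck_on n S' k f"
proof (induction k arbitrary: f)
  case 0
  then show ?case by (auto intro: continuous_map_from_subtopology_mono)
next
  case (Suc k)
  then show ?case by (auto intro: continuous_map_from_subtopology_mono) blast
qed

text \<open>Openness of \<open>S\<close> is essential: values off \<open>S\<close> enter the ambient
  derivatives, but near a point of \<open>S\<close> the coordinate lines stay inside. The partial
  derivatives of \<open>f\<close> then serve for \<open>g\<close> too.\<close>

lemma Ck_on_cong:
  assumes "openin (Euclidean_space n) S"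
  shows "Ck_on n S k f \<Longrightarrow> (\<And>y. y \<in> S \<Longrightarrow> f y = g y) \<Longrightarrow> Ck_on n S k g"
proof (induction k arbitrary: f g)
  case 0
  then show ?case by (auto elim: continuous_map_eq)
next
  case (Suc k)
  have "\<exists>h. (\<forall>y\<in>S. ((\<lambda>t. g (y(i := t))) has_vector_derivative h y) (at (y i))) \<and> Ck_on n S k h"
    if i: "i < n" for i
  proof -
    obtain h where h: "\<forall>y\<in>S. ((\<lambda>t. f (y(i := t))) has_vector_derivative h y) (at (y i))" "Ck_on n S k h"
      using Suc.prems(1) i by (simp only: Ck_on.simps) blast
    have "((\<lambda>t. g (y(i := t))) has_vector_derivative h y) (at (y i))" if y: "y \<in> S" for y
    proof -
      obtain T where T: "open T" "y i \<in> T" "\<And>t. t \<in> T \<Longrightarrow> y(i := t) \<in> S"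
        using Euclidean_line_open[OF assms y i] by blast
      show ?thesis
      proof (rule has_vector_derivative_transform_within_open[OF _ T(1,2)])
        show "((\<lambda>t. f (y(i := t))) has_vector_derivative h y) (at (y i))" using h(1) y by blast
      qed (use T(3) Suc.prems(2) in blast)
    qed
    then show ?thesis using h by blast
  qed
  then show ?case using Suc.prems by (auto elim: continuous_map_eq)
qed

lemma continuous_map_local:
  assumes "\<And>x. x \<in> S \<Longrightarrow> \<exists>S'. openin X S' \<and> x \<in> S' \<and> S' \<subseteq> S \<and> continuous_map (subtopology X S') Y f"
  shows "continuous_map (subtopology X S) Y f"
  unfolding continuous_map_def
proof (intro conjI allI impI)
  show "f \<in> topspace (subtopology X S) \<rightarrow> topspace Y"
    using assms by (fastforce simp: continuous_map_def)
  fix U assume U: "openin Y U"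
  show "openin (subtopology X S) {x \<in> topspace (subtopology X S). f x \<in> U}"
  proof (subst openin_subopen, intro ballI)
    fix x assume x: "x \<in> {x \<in> topspace (subtopology X S). f x \<in> U}"
    then obtain S' where S': "openin X S'" "x \<in> S'" "S' \<subseteq> S" "continuous_map (subtopology X S') Y f"
      using assms by auto
    define T where "T = {x \<in> topspace (subtopology X S'). f x \<in> U}"
    have "openin (subtopology X S') T" using S'(4) U by (simp add: T_def continuous_map_def)
    then have "openin X T" using S'(1) openin_trans_full by blast
    moreover have "T \<subseteq> S" using S' by (auto simp: T_def)
    ultimately have "openin (subtopology X S) T" by (metis openin_subset_topspace_eq openin_subtopology inf.absorb_iff1)
    then show "\<exists>T. openin (subtopology X S) T \<and> x \<in> T \<and> T \<subseteq> {x \<in> topspace (subtopology X S). f x \<in> U}"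
      using x S' by (intro exI[of _ T]) (auto simp: T_def)
  qed
qed

text \<open>The partial derivatives found on different neighbourhoods have to form one function on
  \<open>S\<close>; \<open>vector_derivative\<close>, being determined by \<open>f\<close>, provides
  it.\<close>

lemma Ck_on_local:
  assumes "\<And>y. y \<in> S \<Longrightarrow> \<exists>S'. openin (Euclidean_space n) S' \<and> y \<in> S' \<and> S' \<subseteq> S \<and> Ck_on n S' k f"
  shows "Ck_on n S k f"
  using assms
proof (induction k arbitrary: f)
  case 0
  then show ?case by (auto intro: continuous_map_local)
next
  case (Suc k)
  have "\<exists>h. (\<forall>y\<in>S. ((\<lambda>t. f (y(i := t))) has_vector_derivative h y) (at (y i))) \<and> Ck_on n S k h"
    if i: "i < n" for i
  proof (intro exI conjI ballI)
    define h where "h y = vector_derivative (\<lambda>t. f (y(i := t))) (at (y i))" for y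
    fix y assume "y \<in> S"
    then obtain S' where "y \<in> S'" "Ck_on n S' (Suc k) f"
      using Suc.prems by blast
    then obtain h' where h': "\<forall>y\<in>S'. ((\<lambda>t. f (y(i := t))) has_vector_derivative h' y) (at (y i))"
      using i by (simp only: Ck_on.simps) blast
    have "((\<lambda>t. f (y(i := t))) has_vector_derivative h' y) (at (y i))" using h' \<open>y \<in> S'\<close> by blast
    then show "((\<lambda>t. f (y(i := t))) has_vector_derivative h y) (at (y i))"
      unfolding h_def by (simp only: vector_derivative_at)
  next
    define h where "h y = vector_derivative (\<lambda>t. f (y(i := t))) (at (y i))" for y
    show "Ck_on n S k h"
    proof (rule Suc.IH)
      fix y assume "y \<in> S"
      then obtain S' where S': "openin (Euclidean_space n) S'" "y \<in> S'" "S' \<subseteq> S" "Ck_on n S' (Suc k) f"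
        using Suc.prems by blast
      then obtain h' where h': "\<forall>y\<in>S'. ((\<lambda>t. f (y(i := t))) has_vector_derivative h' y) (at (y i))"
         "Ck_on n S' k h'"
        using i by auto
      have "Ck_on n S' k h"
      proof (rule Ck_on_cong[OF S'(1) h'(2)])
        fix z assume "z \<in> S'"
        then have "((\<lambda>t. f (z(i := t))) has_vector_derivative h' z) (at (z i))" using h' by blast
        then show "h' z = h z" unfolding h_def by (rule vector_derivative_at[symmetric])
      qed
      then show "\<exists>S'. openin (Euclidean_space n) S' \<and> y \<in> S' \<and> S' \<subseteq> S \<and> Ck_on n S' k h"
        using S' by blast
    qed
  qed
  moreover have "continuous_map (subtopology (Euclidean_space n) S) euclidean f"
  proof (rule continuous_map_local)
    fix y assume "y \<in> S"
    then obtain S' where "openin (Euclidean_space n) S'" "y \<in> S'" "S' \<subseteq> S" "Ck_on n S' (Suc k) f"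
      using Suc.prems by blast
    then show "\<exists>S'. openin (Euclidean_space n) S' \<and> y \<in> S' \<and> S' \<subseteq> S \<and>
        continuous_map (subtopology (Euclidean_space n) S') euclidean f"
      using Ck_on_continuous[of n S' "Suc k" f] by (intro exI[of _ S'] conjI)
  qed
  ultimately show ?case by simp
qed

text \<open>\<open>Euclidean_space n\<close> is a subspace of a product, so its continuity becomes
  \<open>continuous_on\<close>, for which the rules for sums, products and inverses are
  available.\<close>

lemma continuous_map_Euclidean_subspace:
  "continuous_map (subtopology (Euclidean_space n) S) euclidean f \<longleftrightarrow>
     continuous_on ({x. \<forall>i\<ge>n. x i = 0} \<inter> S) f"
  unfolding Euclidean_space_def subtopology_subtopology euclidean_product_topology
    continuous_map_iff_continuous ..

lemma Ck_on_add: "Ck_on n S k f \<Longrightarrow> Ck_on n S k g \<Longrightarrow> Ck_on n S k (\<lambda>y. f y + g y)"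
proof (induction k arbitrary: f g)
  case 0
  then show ?case
    unfolding Ck_on.simps continuous_map_Euclidean_subspace by (rule continuous_on_add)
next
  case (Suc k)
  have "\<exists>h. (\<forall>y\<in>S. ((\<lambda>t. f (y(i := t)) + g (y(i := t))) has_vector_derivative h y) (at (y i))) \<and> Ck_on n S k h"
    if i: "i < n" for i
  proof -
    obtain f' where f': "\<forall>y\<in>S. ((\<lambda>t. f (y(i := t))) has_vector_derivative f' y) (at (y i))" "Ck_on n S k f'"
      using Suc.prems(1) i unfolding Ck_on.simps by blast
    obtain g' where g': "\<forall>y\<in>S. ((\<lambda>t. g (y(i := t))) has_vector_derivative g' y) (at (y i))" "Ck_on n S k g'"
      using Suc.prems(2) i unfolding Ck_on.simps by blast
    define h where "h y = f' y + g' y" for y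
    have "\<forall>y\<in>S. ((\<lambda>t. f (y(i := t)) + g (y(i := t))) has_vector_derivative h y) (at (y i))"
    proof
      fix y assume y: "y \<in> S"
      show "((\<lambda>t. f (y(i := t)) + g (y(i := t))) has_vector_derivative h y) (at (y i))"
        using has_vector_derivative_add[OF bspec[OF f'(1) y] bspec[OF g'(1) y]]
        unfolding h_def fun_upd_triv .
    qed
    moreover have "Ck_on n S k h"
      unfolding h_def
      by (rule Suc.IH[OF f'(2) g'(2)])
    ultimately show ?thesis by blast
  qed
  moreover have "continuous_map (subtopology (Euclidean_space n) S) euclidean (\<lambda>y. f y + g y)"
    using Suc.prems[THEN Ck_on_continuous]
    unfolding continuous_map_Euclidean_subspace by (rule continuous_on_add)
  ultimately show ?case unfolding Ck_on.simps by blast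
qed

lemma Ck_on_mult: "Ck_on n S k f \<Longrightarrow> Ck_on n S k g \<Longrightarrow> Ck_on n S k (\<lambda>y. f y * g y)"
proof (induction k arbitrary: f g)
  case 0
  then show ?case
    unfolding Ck_on.simps continuous_map_Euclidean_subspace by (rule continuous_on_mult)
next
  case (Suc k)
  have "\<exists>h. (\<forall>y\<in>S. ((\<lambda>t. f (y(i := t)) * g (y(i := t))) has_vector_derivative h y) (at (y i))) \<and> Ck_on n S k h"
    if i: "i < n" for i
  proof -
    obtain f' where f': "\<forall>y\<in>S. ((\<lambda>t. f (y(i := t))) has_vector_derivative f' y) (at (y i))" "Ck_on n S k f'"
      using Suc.prems(1) i unfolding Ck_on.simps by blast
    obtain g' where g': "\<forall>y\<in>S. ((\<lambda>t. g (y(i := t))) has_vector_derivative g' y) (at (y i))" "Ck_on n S k g'"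
      using Suc.prems(2) i unfolding Ck_on.simps by blast
    define h where "h y = f y * g' y + f' y * g y" for y
    have "\<forall>y\<in>S. ((\<lambda>t. f (y(i := t)) * g (y(i := t))) has_vector_derivative h y) (at (y i))"
    proof
      fix y assume y: "y \<in> S"
      show "((\<lambda>t. f (y(i := t)) * g (y(i := t))) has_vector_derivative h y) (at (y i))"
        using has_vector_derivative_mult[OF bspec[OF f'(1) y] bspec[OF g'(1) y]]
        unfolding h_def fun_upd_triv .
    qed
    moreover have "Ck_on n S k h"
      unfolding h_def
      by (rule Ck_on_add[OF Suc.IH[OF Ck_on_Suc_imp[OF Suc.prems(1)] g'(2)]
            Suc.IH[OF f'(2) Ck_on_Suc_imp[OF Suc.prems(2)]]])
    ultimately show ?thesis by blast
  qed
  moreover have "continuous_map (subtopology (Euclidean_space n) S) euclidean (\<lambda>y. f y * g y)"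
    using Suc.prems[THEN Ck_on_continuous]
    unfolding continuous_map_Euclidean_subspace by (rule continuous_on_mult)
  ultimately show ?case unfolding Ck_on.simps by blast
qed

lemma Ck_on_const: "Ck_on n S k (\<lambda>y. c)"
proof (induction k arbitrary: c)
  case (Suc k)
  have "\<forall>y\<in>S. ((\<lambda>t. c) has_vector_derivative 0) (at (y i))" for i :: nat
    by simp
  then show ?case unfolding Ck_on.simps using Suc[of 0] by fastforce
qed simp

text \<open>The derivative is - f' / f^2. Its factors \<open>1 / f\<close> have the lower order of
  differentiability by the induction hypothesis for \<open>f\<close> itself, and products are
  handled by \<open>Ck_on_mult\<close>.\<close>

lemma Ck_on_inverse:
  "Ck_on n S k f \<Longrightarrow> (\<And>y. y \<in> S \<Longrightarrow> f y \<noteq> 0) \<Longrightarrow> Ck_on n S k (\<lambda>y. inverse (f y))"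
proof (induction k arbitrary: f)
  case 0
  then show ?case
    unfolding Ck_on.simps continuous_map_Euclidean_subspace by (intro continuous_on_inverse) auto
next
  case (Suc k)
  have IH: "Ck_on n S k (\<lambda>y. inverse (f y))"
    by (rule Suc.IH[OF Ck_on_Suc_imp[OF Suc.prems(1)] Suc.prems(2)])
  have "\<exists>h. (\<forall>y\<in>S. ((\<lambda>t. inverse (f (y(i := t)))) has_vector_derivative h y) (at (y i))) \<and> Ck_on n S k h"
    if i: "i < n" for i
  proof -
    obtain f' where f': "\<forall>y\<in>S. ((\<lambda>t. f (y(i := t))) has_vector_derivative f' y) (at (y i))" "Ck_on n S k f'"
      using Suc.prems(1) i unfolding Ck_on.simps by blast
    define h where "h y = (-1) * f' y * (inverse (f y) * inverse (f y))" for y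
    have "\<forall>y\<in>S. ((\<lambda>t. inverse (f (y(i := t)))) has_vector_derivative h y) (at (y i))"
    proof
      fix y assume y: "y \<in> S"
      have D: "(inverse has_field_derivative - (inverse (f y) ^ Suc (Suc 0))) (at (f (y(i := y i))))"
        unfolding fun_upd_triv by (rule DERIV_inverse[OF Suc.prems(2)[OF y]])
      have "h y = f' y * - (inverse (f y) ^ Suc (Suc 0))" by (simp add: h_def)
      with field_vector_diff_chain_at[OF bspec[OF f'(1) y] D]
      show "((\<lambda>t. inverse (f (y(i := t)))) has_vector_derivative h y) (at (y i))"
        unfolding o_def by simp
    qed
    moreover have "Ck_on n S k h"
      unfolding h_def
      by (rule Ck_on_mult[OF Ck_on_mult[OF Ck_on_const f'(2)] Ck_on_mult[OF IH IH]])
    ultimately show ?thesis by blast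
  qed
  moreover have "continuous_map (subtopology (Euclidean_space n) S) euclidean (\<lambda>y. inverse (f y))"
    using Ck_on_continuous[OF IH] .
  ultimately show ?case unfolding Ck_on.simps by blast
qed

section \<open>Open sets, charts and smooth functions on the manifold\<close>

lemma opens_self: "openin X U \<Longrightarrow> U \<in> opens X U"
  and opens_openin: "V \<in> opens X U \<Longrightarrow> openin X V"
  and opens_subset: "V \<in> opens X U \<Longrightarrow> V \<subseteq> U"
  and opens_trans: "V \<in> opens X U \<Longrightarrow> W \<in> opens X V \<Longrightarrow> W \<in> opens X U"
  and opens_Int: "V \<in> opens X U \<Longrightarrow> openin X W \<Longrightarrow> V \<inter> W \<in> opens X V"
  and opens_Int': "V \<in> opens X U \<Longrightarrow> openin X W \<Longrightarrow> W \<inter> V \<in> opens X V"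
  and opens_mono: "U \<subseteq> U' \<Longrightarrow> V \<in> opens X U \<Longrightarrow> V \<in> opens X U'"
  and opens_topspace: "openin X V \<Longrightarrow> V \<in> opens X (topspace X)"
  and opensI: "openin X V \<Longrightarrow> V \<subseteq> U \<Longrightarrow> V \<in> opens X U"
  by (auto simp: opens_def openin_subset)

text \<open>\<open>Ck_on_cong\<close> and \<open>Ck_on_local\<close> need open domains. A chart is a
  homeomorphism onto an open set, so it maps open pieces to open sets, and injectivity makes
  \<open>inv_into\<close> a true inverse there.\<close>

lemma chart_image_open:
  assumes "smooth_manifold X A" "(n, W, \<phi>) \<in> A" "openin X V"
  shows "openin (Euclidean_space n) (\<phi> ` (V \<inter> W))" "inj_on \<phi> W" "openin X W"
proof -
  obtain S where S: "openin (Euclidean_space n) S" "openin X W"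
    "homeomorphic_map (subtopology X W) (subtopology (Euclidean_space n) S) \<phi>"
    using assms by (fastforce simp: smooth_manifold_def)
  have "topspace (subtopology X W) = W" using S(2) openin_subset by fastforce
  then show "inj_on \<phi> W" "openin X W"
    using S homeomorphic_imp_injective_map by fastforce+
  have "openin (subtopology X W) (V \<inter> W)" using assms(3) by (auto simp: openin_subtopology)
  then have "openin (subtopology (Euclidean_space n) S) (\<phi> ` (V \<inter> W))"
    using S(3) homeomorphic_imp_open_map open_map_def by blast
  then show "openin (Euclidean_space n) (\<phi> ` (V \<inter> W))"
    using S(1) openin_trans_full by blast
qed

lemma carrier_Cinf:
  "f \<in> carrier (Cinf X A U) \<longleftrightarrow> f \<in> extensional U \<and>
     (\<forall>(n, W, \<phi>)\<in>A. smooth_on n (\<phi> ` (U \<inter> W)) (\<lambda>y. f (inv_into W \<phi> y)))"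
  by (simp add: Cinf_def fun_ring_def)

lemma Cinf_simps:
  "f \<oplus>\<^bsub>Cinf X A U\<^esub> g = (\<lambda>x\<in>U. f x + g x)" "f \<otimes>\<^bsub>Cinf X A U\<^esub> g = (\<lambda>x\<in>U. f x * g x)"
  "\<zero>\<^bsub>Cinf X A U\<^esub> = (\<lambda>x\<in>U. 0)" "\<one>\<^bsub>Cinf X A U\<^esub> = (\<lambda>x\<in>U. 1)"
  by (simp_all add: Cinf_def fun_ring_def)

context
  fixes X :: "'x topology" and A :: "'x atlas"
  assumes mf: "smooth_manifold X A"
begin

lemma Cinf_restrict:
  assumes f: "f \<in> carrier (Cinf X A U)" and V: "V \<in> opens X U"
  shows "restrict f V \<in> carrier (Cinf X A V)"
  unfolding carrier_Cinf smooth_on_def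
proof safe
  fix n W \<phi> k assume c: "(n, W, \<phi>) \<in> A"
  note ch = chart_image_open[OF mf c opens_openin[OF V]]
  have "Ck_on n (\<phi> ` (U \<inter> W)) k (\<lambda>y. f (inv_into W \<phi> y))"
    using f c by (auto simp: carrier_Cinf smooth_on_def)
  then have "Ck_on n (\<phi> ` (V \<inter> W)) k (\<lambda>y. f (inv_into W \<phi> y))"
    by (rule Ck_on_subset) (use V in \<open>auto simp: opens_def\<close>)
  then show "Ck_on n (\<phi> ` (V \<inter> W)) k (\<lambda>y. restrict f V (inv_into W \<phi> y))"
    by (rule Ck_on_cong[OF ch(1)]) (use ch(2) in auto)
qed auto

lemma Cinf_local:
  assumes f: "f \<in> extensional U" and U: "openin X U"
    and loc: "\<And>x. x \<in> U \<Longrightarrow> \<exists>V\<in>opens X U. x \<in> V \<and> restrict f V \<in> carrier (Cinf X A V)"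
  shows "f \<in> carrier (Cinf X A U)"
  unfolding carrier_Cinf smooth_on_def
proof safe
  fix n W \<phi> k assume c: "(n, W, \<phi>) \<in> A"
  note ch = chart_image_open[OF mf c U]
  show "Ck_on n (\<phi> ` (U \<inter> W)) k (\<lambda>y. f (inv_into W \<phi> y))"
  proof (rule Ck_on_local)
    fix y assume "y \<in> \<phi> ` (U \<inter> W)"
    then obtain x where x: "x \<in> U" "x \<in> W" "y = \<phi> x" by blast
    obtain V where V: "V \<in> opens X U" "x \<in> V" "restrict f V \<in> carrier (Cinf X A V)"
      using loc[OF x(1)] by blast
    note chV = chart_image_open[OF mf c opens_openin[OF V(1)]]
    have "Ck_on n (\<phi> ` (V \<inter> W)) k (\<lambda>y. restrict f V (inv_into W \<phi> y))"
      using V(3) c by (auto simp: carrier_Cinf smooth_on_def)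
    then have "Ck_on n (\<phi> ` (V \<inter> W)) k (\<lambda>y. f (inv_into W \<phi> y))"
      by (rule Ck_on_cong[OF chV(1)]) (use ch(2) in auto)
    then show "\<exists>S'. openin (Euclidean_space n) S' \<and> y \<in> S' \<and> S' \<subseteq> \<phi> ` (U \<inter> W) \<and>
        Ck_on n S' k (\<lambda>y. f (inv_into W \<phi> y))"
      using chV(1) x V opens_subset[OF V(1)] by (intro exI[of _ "\<phi> ` (V \<inter> W)"]) auto
  qed
qed (use f in auto)

lemma Cinf_const: "openin X U \<Longrightarrow> (\<lambda>x\<in>U. c) \<in> carrier (Cinf X A U)"
  unfolding carrier_Cinf smooth_on_def
proof safe
  fix n W \<phi> k assume U: "openin X U" and c: "(n, W, \<phi>) \<in> A"
  note ch = chart_image_open[OF mf c U]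
  show "Ck_on n (\<phi> ` (U \<inter> W)) k (\<lambda>y. (\<lambda>x\<in>U. c) (inv_into W \<phi> y))"
    by (rule Ck_on_cong[OF ch(1) Ck_on_const[of _ _ _ c]]) (use ch(2) in auto)
qed auto

lemma Cinf_inverse:
  assumes U: "openin X U" and f: "f \<in> carrier (Cinf X A U)" and nz: "\<And>x. x \<in> U \<Longrightarrow> f x \<noteq> 0"
  shows "(\<lambda>x\<in>U. inverse (f x)) \<in> carrier (Cinf X A U)"
  unfolding carrier_Cinf smooth_on_def
proof safe
  fix n W \<phi> k assume c: "(n, W, \<phi>) \<in> A"
  note ch = chart_image_open[OF mf c U]
  have "Ck_on n (\<phi> ` (U \<inter> W)) k (\<lambda>y. f (inv_into W \<phi> y))"
    using f c by (auto simp: carrier_Cinf smooth_on_def)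
  then have "Ck_on n (\<phi> ` (U \<inter> W)) k (\<lambda>y. inverse (f (inv_into W \<phi> y)))"
    by (rule Ck_on_inverse) (use ch(2) nz in auto)
  then show "Ck_on n (\<phi> ` (U \<inter> W)) k (\<lambda>y. (\<lambda>x\<in>U. inverse (f x)) (inv_into W \<phi> y))"
    by (rule Ck_on_cong[OF ch(1)]) (use ch(2) in auto)
qed auto

end

section \<open>Vector fields and classes modulo a distribution\<close>

lemma vfieldsD:
  assumes "v \<in> vfields X A U" "V \<in> opens X U" "f \<in> carrier (Cinf X A V)"
  shows "v V f \<in> carrier (Cinf X A V)"
    and "g \<in> carrier (Cinf X A V) \<Longrightarrow> x \<in> V \<Longrightarrow> v V (\<lambda>x\<in>V. f x + g x) x = v V f x + v V g x"
    and "g \<in> carrier (Cinf X A V) \<Longrightarrow> x \<in> V \<Longrightarrow> v V (\<lambda>x\<in>V. f x * g x) x = v V f x * g x + f x * v V g x"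
    and "x \<in> V \<Longrightarrow> v V (\<lambda>y\<in>V. c * f y) x = c * v V f x"
    and "W \<in> opens X V \<Longrightarrow> v W (restrict f W) = restrict (v V f) W"
  using assms unfolding vfields_def Cinf_simps by blast+

lemma vfields_ext: "v \<in> vfields X A U \<Longrightarrow> v \<in> ext_family X U (\<lambda>V. carrier (Cinf X A V))"
  by (simp add: vfields_def)

lemma ext_familyD:
  "v \<in> ext_family X U S \<Longrightarrow> v \<in> extensional (opens X U)"
  "v \<in> ext_family X U S \<Longrightarrow> V \<in> opens X U \<Longrightarrow> v V \<in> extensional (S V)"
  by (auto simp: ext_family_def)

lemma ext_family_eqI:
  assumes "v \<in> ext_family X U S" "w \<in> ext_family X U S"
    and "\<And>V s. V \<in> opens X U \<Longrightarrow> s \<in> S V \<Longrightarrow> v V s = w V s"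
  shows "v = w"
proof (rule extensionalityI[OF ext_familyD(1)[OF assms(1)] ext_familyD(1)[OF assms(2)]])
  fix V assume "V \<in> opens X U"
  then show "v V = w V"
    using assms by (intro extensionalityI[of _ "S V"] ext_familyD(2))
qed

lemma mk_vfield_apply:
  "V \<in> opens X U \<Longrightarrow> f \<in> carrier (Cinf X A V) \<Longrightarrow> mk_vfield X A U h V f = restrict (h V f) V"
  by (simp add: mk_vfield_def)

lemma carrier_OXP:
  "f \<in> carrier (OXP X A P U) \<longleftrightarrow> f \<in> carrier (Cinf X A U) \<and>
     (\<forall>V\<in>opens X U. \<forall>p\<in>P V. p V (restrict f V) = (\<lambda>x\<in>V. 0))"
  by (simp add: OXP_def fun_ring_def Cinf_simps)

lemma OXP_simps:
  "f \<oplus>\<^bsub>OXP X A P U\<^esub> g = (\<lambda>x\<in>U. f x + g x)" "f \<otimes>\<^bsub>OXP X A P U\<^esub> g = (\<lambda>x\<in>U. f x * g x)"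
  "\<zero>\<^bsub>OXP X A P U\<^esub> = (\<lambda>x\<in>U. 0)" "\<one>\<^bsub>OXP X A P U\<^esub> = (\<lambda>x\<in>U. 1)"
  by (simp_all add: OXP_def fun_ring_def)

lemma TX_simps:
  "carrier (Mod (TX X A) U) = vfields X A U"
  "\<zero>\<^bsub>Mod (TX X A) U\<^esub> = mk_vfield X A U (\<lambda>V f x. 0)"
  "v \<oplus>\<^bsub>Mod (TX X A) U\<^esub> w = mk_vfield X A U (\<lambda>V f x. v V f x + w V f x)"
  "g \<odot>\<^bsub>Mod (TX X A) U\<^esub> v = mk_vfield X A U (\<lambda>V f x. g x * v V f x)"
  "mres (TX X A) U V v = restrict v (opens X V)"
  by (simp_all add: TX_def)

lemma quot_sectionsD:
  assumes "c \<in> quot_sections X S r E U"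
  shows "V \<in> opens X U \<Longrightarrow> W \<in> opens X V \<Longrightarrow> s \<in> c V \<Longrightarrow> r V W s \<in> c W"
    and "V \<in> opens X U \<Longrightarrow> s \<in> c V \<Longrightarrow> t \<in> c V \<Longrightarrow> (s, t) \<in> E V"
    and "x \<in> U \<Longrightarrow> \<exists>V\<in>opens X U. x \<in> V \<and> (\<exists>s. s \<in> c V)"
    and "V \<in> opens X U \<Longrightarrow> s \<in> c V \<Longrightarrow> s \<in> S V"
    and "V \<in> opens X U \<Longrightarrow> s \<in> S V \<Longrightarrow>
      (\<And>x. x \<in> V \<Longrightarrow> \<exists>W\<in>opens X V. x \<in> W \<and> (\<exists>t\<in>c W. (r V W s, t) \<in> E W)) \<Longrightarrow> s \<in> c V"
    and "V \<notin> opens X U \<Longrightarrow> c V = {}"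
proof -
  have c: "quot_close X S r E U c = c"
    "\<forall>V\<in>opens X U. \<forall>W\<in>opens X V. \<forall>s\<in>c V. r V W s \<in> c W"
    "\<forall>V\<in>opens X U. c V \<times> c V \<subseteq> E V" "\<forall>x\<in>U. \<exists>V\<in>opens X U. x \<in> V \<and> c V \<noteq> {}"
    using assms by (auto simp: quot_sections_def)
  show "V \<in> opens X U \<Longrightarrow> W \<in> opens X V \<Longrightarrow> s \<in> c V \<Longrightarrow> r V W s \<in> c W"
    "V \<in> opens X U \<Longrightarrow> s \<in> c V \<Longrightarrow> t \<in> c V \<Longrightarrow> (s, t) \<in> E V"
    "x \<in> U \<Longrightarrow> \<exists>V\<in>opens X U. x \<in> V \<and> (\<exists>s. s \<in> c V)"
    using c(2) apply blast
    using c(3) apply blast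
    using c(4) by blast
  have cV: "c V = (if V \<in> opens X U
     then {s \<in> S V. \<forall>x\<in>V. \<exists>W\<in>opens X V. x \<in> W \<and> (\<exists>t\<in>c W. (r V W s, t) \<in> E W)} else {})"
    by (subst c(1)[symmetric]) (simp add: quot_close_def)
  show "V \<in> opens X U \<Longrightarrow> s \<in> c V \<Longrightarrow> s \<in> S V" "V \<notin> opens X U \<Longrightarrow> c V = {}"
    using cV by auto
  assume "V \<in> opens X U" "s \<in> S V"
    "\<And>x. x \<in> V \<Longrightarrow> \<exists>W\<in>opens X V. x \<in> W \<and> (\<exists>t\<in>c W. (r V W s, t) \<in> E W)"
  then show "s \<in> c V" by (subst cV) simp
qed

section \<open>Derivations and the functions killed by the distribution\<close>

context
  fixes X :: "'x topology" and A :: "'x atlas" and P :: "'x set \<Rightarrow> 'x vfield set"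
  assumes mf: "smooth_manifold X A" and ID: "integrable_distribution X A P"
begin

lemma P_vfields: "openin X U \<Longrightarrow> p \<in> P U \<Longrightarrow> p \<in> vfields X A U"
  using ID by (auto simp: integrable_distribution_def)

lemma P_restrict:
  assumes "openin X U" "p \<in> P U" "V \<in> opens X U"
  shows "restrict p (opens X V) \<in> P V"
proof -
  have "sheaf_on X (topspace X) (\<lambda>V. carrier (Mod (sub_sheaf (TX X A) P) V)) (mres (sub_sheaf (TX X A) P))"
    using ID unfolding integrable_distribution_def module_sheaf_def by blast
  then have "\<forall>V\<in>opens X (topspace X). \<forall>W\<in>opens X V. \<forall>s\<in>P V. mres (TX X A) V W s \<in> P W"
    by (simp add: sheaf_on_def sub_sheaf_def)
  then show ?thesis using assms opens_topspace by (metis TX_simps(5))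
qed

text \<open>The ring axioms come with the hypothesis on the distribution:
  \<open>module_sheaf\<close> asks for \<open>module\<close> over \<open>Cinf\<close>, and that
  locale includes \<open>cring\<close> of the base.\<close>

lemma Cinf_cring: "openin X U \<Longrightarrow> cring (Cinf X A U)"
proof -
  assume "openin X U"
  then have "module (Cinf X A U) (Mod (sub_sheaf (TX X A) P) U)"
    using ID opens_topspace unfolding integrable_distribution_def module_sheaf_def by blast
  then show ?thesis by (simp add: module_def)
qed

lemma Cinf_add: "openin X U \<Longrightarrow> f \<in> carrier (Cinf X A U) \<Longrightarrow> g \<in> carrier (Cinf X A U) \<Longrightarrow>
    (\<lambda>x\<in>U. f x + g x) \<in> carrier (Cinf X A U)"
  using cring.cring_simprules(1)[OF Cinf_cring, of U f g] by (simp add: Cinf_simps)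

lemma Cinf_cmult:
  assumes "openin X U" "f \<in> carrier (Cinf X A U)"
  shows "(\<lambda>x\<in>U. c * f x) \<in> carrier (Cinf X A U)"
proof -
  have "(\<lambda>x\<in>U. (\<lambda>x\<in>U. c) x * f x) \<in> carrier (Cinf X A U)"
    using cring.cring_simprules(5)[OF Cinf_cring[OF assms(1)] Cinf_const[OF mf assms(1)] assms(2)]
    by (simp add: Cinf_simps)
  then show ?thesis by (simp cong: restrict_cong)
qed

text \<open>From 1 * 1 = 1 the Leibniz rule gives v(1) = 2 v(1), so v(1) = 0; linearity over the
  complex numbers extends this to all constants.\<close>

lemma vfield_const:
  assumes v: "v \<in> vfields X A U" and V: "V \<in> opens X U" and x: "x \<in> V"
  shows "v V (\<lambda>x\<in>V. c) x = 0"
proof -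
  have o: "openin X V" using V opens_openin by blast
  have one: "(\<lambda>x\<in>V. 1) \<in> carrier (Cinf X A V)" by (rule Cinf_const[OF mf o])
  have *: "(\<lambda>x\<in>V. (\<lambda>x\<in>V. 1::complex) x * (\<lambda>x\<in>V. 1) x) = (\<lambda>x\<in>V. 1)" by auto
  have "v V (\<lambda>x\<in>V. 1) x = v V (\<lambda>x\<in>V. 1) x + v V (\<lambda>x\<in>V. 1) x"
    using vfieldsD(3)[OF v V one one x] x unfolding * by simp
  then have "v V (\<lambda>x\<in>V. 1) x = 0" by simp
  moreover have "(\<lambda>x\<in>V. c) = (\<lambda>x\<in>V. c * (\<lambda>x\<in>V. 1) x)" by auto
  ultimately show ?thesis using vfieldsD(4)[OF v V one x, of c] by simp
qed

text \<open>Leibniz rule for the product of \<open>f\<close> with its inverse, whose derivative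
  vanishes by \<open>vfield_const\<close>.\<close>

lemma vfield_inverse:
  assumes v: "v \<in> vfields X A U" and V: "V \<in> opens X U" and x: "x \<in> V"
    and f: "f \<in> carrier (Cinf X A V)" and nz: "\<And>x. x \<in> V \<Longrightarrow> f x \<noteq> 0"
  shows "v V (\<lambda>x\<in>V. inverse (f x)) x = - v V f x / (f x)^2"
proof -
  have o: "openin X V" using V opens_openin by blast
  have i: "(\<lambda>x\<in>V. inverse (f x)) \<in> carrier (Cinf X A V)" by (rule Cinf_inverse[OF mf o f nz])
  have "(\<lambda>x\<in>V. f x * (\<lambda>x\<in>V. inverse (f x)) x) = (\<lambda>x\<in>V. 1)" using nz by (auto intro!: restrict_ext)
  then have "v V f x * inverse (f x) + f x * v V (\<lambda>x\<in>V. inverse (f x)) x = 0"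
    using vfieldsD(3)[OF v V f i x] vfield_const[OF v V x, of 1] x by simp
  then show ?thesis using nz[OF x] by (simp add: field_simps power2_eq_square add_eq_0_iff)
qed

text \<open>\<open>vf_rel\<close> uses the subtraction of the record \<open>TX\<close>, which goes
  back to a definite description of the additive inverse. It is evaluated directly, without group
  axioms for \<open>TX\<close>: the pointwise negative is a vector field, and every additive inverse
  agrees with it.\<close>

lemma TX_minus:
  assumes U: "openin X U" and v: "v \<in> vfields X A U" and w: "w \<in> vfields X A U"
    and V: "V \<in> opens X U" and f: "f \<in> carrier (Cinf X A V)" and x: "x \<in> V"
  shows "(v \<ominus>\<^bsub>Mod (TX X A) U\<^esub> w) V f x = v V f x - w V f x"
proof -
  let ?M = "Mod (TX X A) U"
  define n where "n = mk_vfield X A U (\<lambda>V f x. - w V f x)"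
  have nap: "n V f = (\<lambda>x\<in>V. (-1) * w V f x)" if "V \<in> opens X U" "f \<in> carrier (Cinf X A V)" for V f
    using that by (simp add: n_def mk_vfield_apply)
  have next1: "n \<in> ext_family X U (\<lambda>V. carrier (Cinf X A V))"
    by (simp add: n_def mk_vfield_def ext_family_def)
  have nvf: "n \<in> vfields X A U"
  proof -
    have "n V f \<in> carrier (Cinf X A V)" if "V \<in> opens X U" "f \<in> carrier (Cinf X A V)" for V f
      unfolding nap[OF that] by (rule Cinf_cmult[OF opens_openin[OF that(1)] vfieldsD(1)[OF w that]])
    moreover have "n V (\<lambda>x\<in>V. f x + g x) x = n V f x + n V g x"
      "n V (\<lambda>x\<in>V. f x * g x) x = n V f x * g x + f x * n V g x"
      if H: "V \<in> opens X U" "f \<in> carrier (Cinf X A V)" "g \<in> carrier (Cinf X A V)" "x \<in> V" for V f g x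
    proof -
      have o: "openin X V" using H opens_openin by blast
      have m: "(\<lambda>x\<in>V. f x * g x) \<in> carrier (Cinf X A V)"
        using cring.cring_simprules(5)[OF Cinf_cring[OF o] H(2,3)] by (simp add: Cinf_simps)
      show "n V (\<lambda>x\<in>V. f x + g x) x = n V f x + n V g x"
        unfolding nap[OF H(1) Cinf_add[OF o H(2,3)]] nap[OF H(1,2)] nap[OF H(1,3)]
        using H(4) vfieldsD(2)[OF w H] by simp
      show "n V (\<lambda>x\<in>V. f x * g x) x = n V f x * g x + f x * n V g x"
        unfolding nap[OF H(1) m] nap[OF H(1,2)] nap[OF H(1,3)]
        using H(4) vfieldsD(3)[OF w H] by (simp add: algebra_simps)
    qed
    moreover have "n V (\<lambda>y\<in>V. c * f y) x = c * n V f x"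
      if H: "V \<in> opens X U" "f \<in> carrier (Cinf X A V)" "x \<in> V" for V f c x
      unfolding nap[OF H(1) Cinf_cmult[OF opens_openin[OF H(1)] H(2)]] nap[OF H(1,2)]
      using H(3) vfieldsD(4)[OF w H] by simp
    moreover have "n W (restrict f W) = restrict (n V f) W"
      if H: "V \<in> opens X U" "f \<in> carrier (Cinf X A V)" "W \<in> opens X V" for V f W
      unfolding nap[OF opens_trans[OF H(1,3)] Cinf_restrict[OF mf H(2,3)]] nap[OF H(1,2)]
        vfieldsD(5)[OF w H] using opens_subset[OF H(3)] by (auto simp: restrict_def fun_eq_iff)
    ultimately show ?thesis
      unfolding vfields_def Cinf_simps using next1 by blast
  qed
  have addap: "(a \<oplus>\<^bsub>?M\<^esub> b) V f x = a V f x + b V f x"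
    if "V \<in> opens X U" "f \<in> carrier (Cinf X A V)" "x \<in> V" for a b V f x
    using that by (simp add: TX_simps mk_vfield_apply)
  have wn: "w \<oplus>\<^bsub>?M\<^esub> n = \<zero>\<^bsub>?M\<^esub>" "n \<oplus>\<^bsub>?M\<^esub> w = \<zero>\<^bsub>?M\<^esub>"
    unfolding TX_simps mk_vfield_def by (auto intro!: restrict_ext simp: nap)
  have "\<ominus>\<^bsub>?M\<^esub> w = n"
    unfolding a_inv_def m_inv_def
  proof (rule the_equality)
    show "n \<in> carrier (add_monoid ?M) \<and> w \<otimes>\<^bsub>add_monoid ?M\<^esub> n = \<one>\<^bsub>add_monoid ?M\<^esub> \<and>
        n \<otimes>\<^bsub>add_monoid ?M\<^esub> w = \<one>\<^bsub>add_monoid ?M\<^esub>"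
      using wn nvf by (simp add: TX_simps(1))
  next
    fix y assume "y \<in> carrier (add_monoid ?M) \<and> w \<otimes>\<^bsub>add_monoid ?M\<^esub> y = \<one>\<^bsub>add_monoid ?M\<^esub> \<and>
        y \<otimes>\<^bsub>add_monoid ?M\<^esub> w = \<one>\<^bsub>add_monoid ?M\<^esub>"
    then have y: "y \<in> vfields X A U" "w \<oplus>\<^bsub>?M\<^esub> y = \<zero>\<^bsub>?M\<^esub>" by (auto simp: TX_simps(1))
    show "y = n"
    proof (rule ext_family_eqI[OF vfields_ext[OF y(1)] next1])
      fix V f assume H: "V \<in> opens X U" "f \<in> carrier (Cinf X A V)"
      show "y V f = n V f"
      proof (rule extensionalityI[of _ V])
        show "y V f \<in> extensional V" "n V f \<in> extensional V"
          using vfieldsD(1)[OF y(1) H] vfieldsD(1)[OF nvf H] by (auto simp: carrier_Cinf)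
        fix x assume x: "x \<in> V"
        have "w V f x + y V f x = 0"
          using addap[OF H x, of w y] y(2) H x by (simp add: TX_simps(2) mk_vfield_apply)
        then show "y V f x = n V f x" using nap[OF H] x by (simp add: add_eq_0_iff)
      qed
    qed
  qed
  then show ?thesis
    unfolding a_minus_def using addap[OF V f x, of v n] nap[OF V f] x by simp
qed

text \<open>The difference of the two fields lies in \<open>P\<close>, which annihilates
  \<open>OXP\<close>. This is what lets a class act on such functions.\<close>

lemma vf_rel_apply:
  assumes U: "openin X U" and r: "(v, w) \<in> vf_rel X A P U" and f: "f \<in> carrier (OXP X A P U)"
    and x: "x \<in> U"
  shows "v U f x = w U f x"
proof -
  have vw: "v \<in> vfields X A U" "w \<in> vfields X A U" "v \<ominus>\<^bsub>Mod (TX X A) U\<^esub> w \<in> P U"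
    using r by (auto simp: vf_rel_def)
  have fC: "f \<in> carrier (Cinf X A U)" "restrict f U = f"
    using f by (auto simp: carrier_OXP carrier_Cinf extensional_restrict)
  have "(v \<ominus>\<^bsub>Mod (TX X A) U\<^esub> w) U f = (\<lambda>x\<in>U. 0)"
    using f vw(3) opens_self[OF U] fC(2) by (metis carrier_OXP)
  then show ?thesis using TX_minus[OF U vw(1,2) opens_self[OF U] fC(1) x] x by simp
qed

lemma OXP_ext: "f \<in> carrier (OXP X A P U) \<Longrightarrow> f \<in> extensional U"
  by (simp add: carrier_OXP carrier_Cinf)

lemma OXP_restrict:
  assumes "f \<in> carrier (OXP X A P U)" "V \<in> opens X U"
  shows "restrict f V \<in> carrier (OXP X A P V)"
proof -
  have "restrict (restrict f V) W = restrict f W" if "W \<in> opens X V" for W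
    using opens_subset[OF that] by (simp add: Int_absorb1)
  then show ?thesis
    using assms(1) Cinf_restrict[OF mf _ assms(2)] opens_trans[OF assms(2)] unfolding carrier_OXP by metis
qed

text \<open>Annihilation by \<open>P\<close> is a pointwise equation, and a section of
  \<open>P\<close> commutes with restriction and restricts to a section of \<open>P\<close> again,
  so it can be tested near each point.\<close>

lemma OXP_local:
  assumes U: "openin X U" and f: "f \<in> extensional U"
    and loc: "\<And>x. x \<in> U \<Longrightarrow> \<exists>V\<in>opens X U. x \<in> V \<and> restrict f V \<in> carrier (OXP X A P V)"
  shows "f \<in> carrier (OXP X A P U)"
  unfolding carrier_OXP
proof (intro conjI ballI)
  show fC: "f \<in> carrier (Cinf X A U)"
    by (rule Cinf_local[OF mf f U]) (meson loc carrier_OXP)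
  fix W p assume W: "W \<in> opens X U" and p: "p \<in> P W"
  have oW: "openin X W" using W opens_openin by blast
  note pv = P_vfields[OF oW p]
  have fW: "restrict f W \<in> carrier (Cinf X A W)" by (rule Cinf_restrict[OF mf fC W])
  note pf = vfieldsD(1)[OF pv opens_self[OF oW] fW]
  show "p W (restrict f W) = (\<lambda>x\<in>W. 0)"
  proof (rule extensionalityI[of _ W])
    show "p W (restrict f W) \<in> extensional W" using pf by (simp add: carrier_Cinf)
    fix x assume x: "x \<in> W"
    then obtain V where V: "V \<in> opens X U" "x \<in> V" "restrict f V \<in> carrier (OXP X A P V)"
      using loc opens_subset[OF W] by blast
    let ?Z = "V \<inter> W"
    have Z: "?Z \<in> opens X V" "?Z \<in> opens X W"
      using opens_Int[OF V(1) oW] opens_Int'[OF W opens_openin[OF V(1)]] by auto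
    have "p ?Z (restrict (restrict f V) ?Z) = (\<lambda>x\<in>?Z. 0)"
      using V(3) Z(1) P_restrict[OF oW p Z(2)] opens_self[OF opens_openin[OF Z(1)]]
      unfolding carrier_OXP by fastforce
    moreover have "restrict (restrict f V) ?Z = restrict (restrict f W) ?Z" by auto
    ultimately have "restrict (p W (restrict f W)) ?Z = (\<lambda>x\<in>?Z. 0)"
      using vfieldsD(5)[OF pv opens_self[OF oW] fW Z(2)] by simp
    then have "restrict (p W (restrict f W)) ?Z x = 0" using x V(2) by simp
    then show "p W (restrict f W) x = (\<lambda>x\<in>W. 0) x" using x V(2) by simp
  qed simp
qed

lemma OXP_const:
  assumes "openin X U" shows "(\<lambda>x\<in>U. c) \<in> carrier (OXP X A P U)"
  unfolding carrier_OXP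
proof (intro conjI ballI)
  fix W p assume W: "W \<in> opens X U" and p: "p \<in> P W"
  have oW: "openin X W" using W opens_openin by blast
  note pv = P_vfields[OF oW p]
  have r: "restrict (\<lambda>x\<in>U. c) W = (\<lambda>x\<in>W. c)" using opens_subset[OF W] by (simp add: Int_absorb1)
  show "p W (restrict (\<lambda>x\<in>U. c) W) = (\<lambda>x\<in>W. 0)"
    unfolding r
    by (rule extensionalityI[of _ W])
       (use vfieldsD(1)[OF pv opens_self[OF oW] Cinf_const[OF mf oW]] vfield_const[OF pv opens_self[OF oW]]
        in \<open>auto simp: carrier_Cinf\<close>)
qed (rule Cinf_const[OF mf assms])

lemma OXP_inverse:
  assumes U: "openin X U" and f: "f \<in> carrier (OXP X A P U)" and nz: "\<And>x. x \<in> U \<Longrightarrow> f x \<noteq> 0"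
  shows "(\<lambda>x\<in>U. inverse (f x)) \<in> carrier (OXP X A P U)"
  unfolding carrier_OXP
proof (intro conjI ballI)
  have fC: "f \<in> carrier (Cinf X A U)" using f by (simp add: carrier_OXP)
  show "(\<lambda>x\<in>U. inverse (f x)) \<in> carrier (Cinf X A U)" by (rule Cinf_inverse[OF mf U fC nz])
  fix W p assume W: "W \<in> opens X U" and p: "p \<in> P W"
  have oW: "openin X W" using W opens_openin by blast
  note pv = P_vfields[OF oW p]
  note fW = Cinf_restrict[OF mf fC W]
  have nzW: "restrict f W x \<noteq> 0" if "x \<in> W" for x using nz that opens_subset[OF W] by auto
  have r: "restrict (\<lambda>x\<in>U. inverse (f x)) W = (\<lambda>x\<in>W. inverse (restrict f W x))"
    using opens_subset[OF W] by (auto simp: restrict_def fun_eq_iff)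
  have 0: "p W (restrict f W) = (\<lambda>x\<in>W. 0)" using f W p unfolding carrier_OXP by blast
  show "p W (restrict (\<lambda>x\<in>U. inverse (f x)) W) = (\<lambda>x\<in>W. 0)"
    unfolding r
  proof (rule extensionalityI[of _ W])
    show "p W (\<lambda>x\<in>W. inverse (restrict f W x)) \<in> extensional W"
      using vfieldsD(1)[OF pv opens_self[OF oW] Cinf_inverse[OF mf oW fW nzW]] by (simp add: carrier_Cinf)
    fix x assume x: "x \<in> W"
    show "p W (\<lambda>x\<in>W. inverse (restrict f W x)) x = (\<lambda>x\<in>W. 0) x"
      using vfield_inverse[OF pv opens_self[OF oW] x fW nzW] x unfolding 0 by simp
  qed simp
qed

section \<open>Invariant classes of vector fields acting on functions\<close>

lemma carrier_TXP:
  "c \<in> carrier (Mod (TXP X A P) U) \<longleftrightarrow>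
     c \<in> quot_sections X (vfields X A) (mres (TX X A)) (vf_rel X A P) U \<and>
     (\<forall>V\<in>opens X U. \<forall>p\<in>P V. \<forall>v\<in>c V. vf_bracket X A V p v \<in> P V)"
  by (simp add: TXP_def)

context
  fixes U c
  assumes U: "openin X U" and c: "c \<in> carrier (Mod (TXP X A P) U)"
begin

lemma class_restrict: "V \<in> opens X U \<Longrightarrow> W \<in> opens X V \<Longrightarrow> v \<in> c V \<Longrightarrow> restrict v (opens X W) \<in> c W"
  using quot_sectionsD(1)[of c X "vfields X A" "mres (TX X A)"] c
  unfolding carrier_TXP TX_simps by blast

lemma class_vfield: "V \<in> opens X U \<Longrightarrow> v \<in> c V \<Longrightarrow> v \<in> vfields X A V"
  using quot_sectionsD(4)[of c X "vfields X A" "mres (TX X A)"] c unfolding carrier_TXP by blast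

lemma class_exists: "x \<in> U \<Longrightarrow> \<exists>V\<in>opens X U. x \<in> V \<and> (\<exists>v. v \<in> c V)"
  using quot_sectionsD(3)[of c X "vfields X A" "mres (TX X A)"] c unfolding carrier_TXP by blast

text \<open>Over the intersection of their domains two representatives are equivalent, so the
  description in \<open>class_act\<close> has a single solution.\<close>

lemma class_unique:
  assumes V: "V \<in> opens X U" "v \<in> c V" "x \<in> V" and W: "W \<in> opens X U" "w \<in> c W" "x \<in> W"
    and f: "f \<in> carrier (OXP X A P U)"
  shows "v V (restrict f V) x = w W (restrict f W) x"
proof -
  let ?Z = "V \<inter> W"
  have Z: "?Z \<in> opens X V" "?Z \<in> opens X W" "?Z \<in> opens X U"
    using opens_Int[OF V(1) opens_openin[OF W(1)]] opens_Int'[OF W(1) opens_openin[OF V(1)]]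
      opens_trans[OF V(1)] by auto
  have oZ: "openin X ?Z" using Z opens_openin by blast
  have fC: "f \<in> carrier (Cinf X A U)" using f by (simp add: carrier_OXP)
  have "(restrict v (opens X ?Z), restrict w (opens X ?Z)) \<in> vf_rel X A P ?Z"
    using quot_sectionsD(2)[of c X "vfields X A" "mres (TX X A)", OF _ Z(3)] c
      class_restrict[OF V(1) Z(1) V(2)] class_restrict[OF W(1) Z(2) W(2)]
    unfolding carrier_TXP by blast
  from vf_rel_apply[OF oZ this OXP_restrict[OF f Z(3)], of x]
  have "v ?Z (restrict f ?Z) x = w ?Z (restrict f ?Z) x"
    using V(3) W(3) opens_self[OF oZ] by simp
  moreover have "restrict (restrict f V) ?Z = restrict f ?Z" "restrict (restrict f W) ?Z = restrict f ?Z"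
    by auto
  ultimately show ?thesis
    using vfieldsD(5)[OF class_vfield[OF V(1,2)] opens_self[OF opens_openin[OF V(1)]] Cinf_restrict[OF mf fC V(1)] Z(1)]
      vfieldsD(5)[OF class_vfield[OF W(1,2)] opens_self[OF opens_openin[OF W(1)]] Cinf_restrict[OF mf fC W(1)] Z(2)]
      V(3) W(3) by (metis IntI restrict_apply')
qed

lemma class_act_eq:
  assumes V: "V \<in> opens X U" "v \<in> c V" "x \<in> V" and f: "f \<in> carrier (OXP X A P U)"
  shows "class_act X U c f x = v V (restrict f V) x"
proof -
  have "(THE z. \<exists>V\<in>opens X U. x \<in> V \<and> (\<exists>v\<in>c V. v V (restrict f V) x = z)) = v V (restrict f V) x"
  proof (rule the_equality)
    fix z assume "\<exists>W\<in>opens X U. x \<in> W \<and> (\<exists>w\<in>c W. w W (restrict f W) x = z)"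
    then show "z = v V (restrict f V) x" using class_unique[OF V _ _ _ f] by metis
  qed (use V in blast)
  then show ?thesis using V opens_subset[OF V(1)] by (auto simp: class_act_def)
qed

text \<open>Invariance of the class enters here: p(v f) = [p, v] f + v(p f), where the bracket lies
  in \<open>P\<close> by the definition of \<open>TXP\<close> and p f = 0. Membership in
  \<open>OXP\<close> is local, so one representative near each point is enough.\<close>

lemma class_act_closed:
  assumes f: "f \<in> carrier (OXP X A P U)"
  shows "class_act X U c f \<in> carrier (OXP X A P U)"
proof (rule OXP_local[OF U])
  show "class_act X U c f \<in> extensional U" by (simp add: class_act_def)
  fix x assume "x \<in> U"
  then obtain V v where V: "V \<in> opens X U" "x \<in> V" "v \<in> c V" using class_exists by blast
  have oV: "openin X V" using V opens_openin by blast
  note vV = class_vfield[OF V(1,3)]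
  have fC: "restrict f V \<in> carrier (Cinf X A V)" "restrict f V \<in> carrier (OXP X A P V)"
    using OXP_restrict[OF f V(1)] by (auto simp: carrier_OXP)
  note vf = vfieldsD(1)[OF vV opens_self[OF oV] fC(1)]
  have eq: "restrict (class_act X U c f) V = v V (restrict f V)"
    using vf class_act_eq[OF V(1,3) _ f]
    by (intro extensionalityI[of _ V]) (auto simp: carrier_Cinf)
  have "v V (restrict f V) \<in> carrier (OXP X A P V)"
    unfolding carrier_OXP
  proof (intro conjI ballI vf)
    fix W p assume W: "W \<in> opens X V" and p: "p \<in> P W"
    have oW: "openin X W" using W opens_openin by blast
    have ff: "restrict (restrict f V) W = restrict f W" using opens_subset[OF W] by (simp add: Int_absorb1)
    have fW: "restrict f W \<in> carrier (OXP X A P W)" using OXP_restrict[OF fC(2) W] ff by simp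
    then have fWC: "restrict f W \<in> carrier (Cinf X A W)" by (simp add: carrier_OXP)
    have vW: "v W (restrict f W) = restrict (v V (restrict f V)) W"
      using vfieldsD(5)[OF vV opens_self[OF oV] fC(1) W] ff by simp
    let ?v = "restrict v (opens X W)"
    have vcW: "?v \<in> c W" by (rule class_restrict[OF V(1) W V(3)])
    have br: "vf_bracket X A W p ?v \<in> P W"
      using c vcW p opens_trans[OF V(1) W] unfolding carrier_TXP by blast
    have rr: "restrict (restrict f W) W = restrict f W" by simp
    have pf0: "p W (restrict f W) = (\<lambda>x\<in>W. 0)" "vf_bracket X A W p ?v W (restrict f W) = (\<lambda>x\<in>W. 0)"
      using fW p br opens_self[OF oW] rr unfolding carrier_OXP by metis+
    have vfW: "v W (restrict f W) \<in> carrier (Cinf X A W)"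
      unfolding vW by (rule Cinf_restrict[OF mf vf W])
    note pv = P_vfields[OF oW p]
    show "p W (restrict (v V (restrict f V)) W) = (\<lambda>x\<in>W. 0)"
      unfolding vW[symmetric]
    proof (rule extensionalityI[of _ W])
      show "p W (v W (restrict f W)) \<in> extensional W"
        using vfieldsD(1)[OF pv opens_self[OF oW] vfW] by (simp add: carrier_Cinf)
      fix x assume x: "x \<in> W"
      have "vf_bracket X A W p ?v W (restrict f W) x = p W (v W (restrict f W)) x - v W (p W (restrict f W)) x"
        using opens_self[OF oW] fWC x by (simp add: vf_bracket_def mk_vfield_apply)
      moreover have "v W (\<lambda>x\<in>W. 0) x = 0"
        using vfield_const[OF class_vfield[OF opens_trans[OF V(1) W] vcW] opens_self[OF oW] x, of 0]
          opens_self[OF oW] by simp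
      ultimately show "p W (v W (restrict f W)) x = (\<lambda>x\<in>W. 0) x" using pf0 x by simp
    qed simp
  qed
  then show "\<exists>V\<in>opens X U. x \<in> V \<and> restrict (class_act X U c f) V \<in> carrier (OXP X A P V)"
    using V eq by auto
qed

lemma class_act_const:
  assumes "x \<in> U" shows "class_act X U c (\<lambda>x\<in>U. z) x = 0"
proof -
  obtain V v where V: "V \<in> opens X U" "x \<in> V" "v \<in> c V" using class_exists assms by blast
  have "restrict (\<lambda>x\<in>U. z) V = (\<lambda>x\<in>V. z)" using opens_subset[OF V(1)] by (simp add: Int_absorb1)
  then show ?thesis
    using class_act_eq[OF V(1,3,2) OXP_const[OF U]]
      vfield_const[OF class_vfield[OF V(1,3)] opens_self[OF opens_openin[OF V(1)]] V(2)] by simp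
qed

lemma class_act_add_mult:
  assumes x: "x \<in> U" and f: "f \<in> carrier (OXP X A P U)" and g: "g \<in> carrier (OXP X A P U)"
    and fg: "(\<lambda>x\<in>U. f x + g x) \<in> carrier (OXP X A P U)" "(\<lambda>x\<in>U. f x * g x) \<in> carrier (OXP X A P U)"
  shows "class_act X U c (\<lambda>x\<in>U. f x + g x) x = class_act X U c f x + class_act X U c g x"
    and "class_act X U c (\<lambda>x\<in>U. f x * g x) x = class_act X U c f x * g x + f x * class_act X U c g x"
proof -
  obtain V v where V: "V \<in> opens X U" "x \<in> V" "v \<in> c V" using class_exists x by blast
  have r: "restrict (\<lambda>x\<in>U. f x + g x) V = (\<lambda>x\<in>V. restrict f V x + restrict g V x)"
    "restrict (\<lambda>x\<in>U. f x * g x) V = (\<lambda>x\<in>V. restrict f V x * restrict g V x)"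
    using opens_subset[OF V(1)] by (auto simp: restrict_def fun_eq_iff)
  have C: "restrict f V \<in> carrier (Cinf X A V)" "restrict g V \<in> carrier (Cinf X A V)"
    using OXP_restrict[OF f V(1)] OXP_restrict[OF g V(1)] by (auto simp: carrier_OXP)
  note v = class_vfield[OF V(1,3)] opens_self[OF opens_openin[OF V(1)]]
  show "class_act X U c (\<lambda>x\<in>U. f x + g x) x = class_act X U c f x + class_act X U c g x"
    unfolding class_act_eq[OF V(1,3,2) f] class_act_eq[OF V(1,3,2) g] class_act_eq[OF V(1,3,2) fg(1)] r
    by (rule vfieldsD(2)[OF v C V(2)])
  show "class_act X U c (\<lambda>x\<in>U. f x * g x) x = class_act X U c f x * g x + f x * class_act X U c g x"
    unfolding class_act_eq[OF V(1,3,2) f] class_act_eq[OF V(1,3,2) g] class_act_eq[OF V(1,3,2) fg(2)] r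
    using vfieldsD(3)[OF v C V(2)] V(2) by simp
qed

text \<open>For the restricted class the definite description ranges over smaller open sets only; by
  \<open>class_unique\<close> it still picks the same value.\<close>

lemma class_act_res:
  assumes W: "W \<in> opens X U" and f: "f \<in> carrier (OXP X A P U)"
    and c': "mres (TXP X A P) U W c \<in> carrier (Mod (TXP X A P) W)"
  shows "class_act X W (mres (TXP X A P) U W c) (restrict f W) = restrict (class_act X U c f) W"
proof -
  let ?c = "mres (TXP X A P) U W c"
  have oW: "openin X W" using W opens_openin by blast
  have eq: "class_act X W ?c (restrict f W) x = class_act X U c f x" if x: "x \<in> W" for x
  proof -
    obtain V v where V: "V \<in> opens X U" "x \<in> V" "v \<in> c V"
      using class_exists x opens_subset[OF W] by blast
    let ?Z = "V \<inter> W"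
    have Z: "?Z \<in> opens X V" "?Z \<in> opens X W" "?Z \<in> opens X U"
      using opens_Int[OF V(1) oW] opens_Int'[OF W opens_openin[OF V(1)]] opens_trans[OF V(1)] by auto
    let ?v = "restrict v (opens X ?Z)"
    have v: "?v \<in> c ?Z" by (rule class_restrict[OF V(1) Z(1) V(3)])
    then have v': "?v \<in> ?c ?Z" using Z(2) by (simp add: TXP_def)
    have "restrict (restrict f W) ?Z = restrict f ?Z" by auto
    moreover have "(THE z. \<exists>V\<in>opens X W. x \<in> V \<and> (\<exists>v\<in>?c V. v V (restrict (restrict f W) V) x = z))
        = ?v ?Z (restrict f ?Z) x"
    proof (rule the_equality)
      show "\<exists>V\<in>opens X W. x \<in> V \<and> (\<exists>v\<in>?c V. v V (restrict (restrict f W) V) x = ?v ?Z (restrict f ?Z) x)"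
        using Z(2) v' x V(2) calculation by (intro bexI[of _ ?Z] conjI bexI[of _ ?v]) auto
      fix z assume "\<exists>V\<in>opens X W. x \<in> V \<and> (\<exists>v\<in>?c V. v V (restrict (restrict f W) V) x = z)"
      then obtain V' v' where V': "V' \<in> opens X W" "x \<in> V'" "v' \<in> ?c V'" "v' V' (restrict (restrict f W) V') x = z"
        by blast
      have "v' \<in> c V'" using V' by (simp add: TXP_def)
      moreover have "restrict (restrict f W) V' = restrict f V'"
        using opens_subset[OF V'(1)] by (simp add: Int_absorb1)
      ultimately show "z = ?v ?Z (restrict f ?Z) x"
        using class_unique[OF opens_trans[OF W V'(1)] _ V'(2) Z(3) v _ f] V'(4) x V(2) by auto
    qed
    ultimately show ?thesis
      using class_act_eq[OF Z(3) v _ f] x V(2) by (simp add: class_act_def)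
  qed
  show ?thesis
    by (rule extensionalityI[of _ W]) (use eq in \<open>auto simp: class_act_def\<close>)
qed

end

text \<open>A section of the sum class is a sum only locally and up to \<open>vf_rel\<close>. The
  evaluation therefore moves to a smaller \<open>W\<close> around \<open>x\<close>, where equivalent
  fields act equally.\<close>

lemma class_act_plus:
  assumes U: "openin X U" and c: "c \<in> carrier (Mod (TXP X A P) U)" and c': "c' \<in> carrier (Mod (TXP X A P) U)"
    and s: "c \<oplus>\<^bsub>Mod (TXP X A P) U\<^esub> c' \<in> carrier (Mod (TXP X A P) U)"
    and f: "f \<in> carrier (OXP X A P U)" and x: "x \<in> U"
  shows "class_act X U (c \<oplus>\<^bsub>Mod (TXP X A P) U\<^esub> c') f x = class_act X U c f x + class_act X U c' f x"
proof -
  let ?s = "c \<oplus>\<^bsub>Mod (TXP X A P) U\<^esub> c'"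
  obtain V s where V: "V \<in> opens X U" "x \<in> V" "s \<in> ?s V" using class_exists[OF U \<open>?s \<in> _\<close> x] by blast
  then have "\<exists>W\<in>opens X V. x \<in> W \<and> (\<exists>t\<in>{v \<oplus>\<^bsub>Mod (TX X A) W\<^esub> w | v w. v \<in> c W \<and> w \<in> c' W}.
      (restrict s (opens X W), t) \<in> vf_rel X A P W)"
    by (simp add: TXP_def vf_class_def quot_close_def TX_simps(5))
  then obtain W v w where W: "W \<in> opens X V" "x \<in> W" "v \<in> c W" "w \<in> c' W"
    "(restrict s (opens X W), v \<oplus>\<^bsub>Mod (TX X A) W\<^esub> w) \<in> vf_rel X A P W" by blast
  have WU: "W \<in> opens X U" using opens_trans[OF V(1) W(1)] .
  have oW: "openin X W" using W opens_openin by blast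
  have fW: "restrict f W \<in> carrier (OXP X A P W)" by (rule OXP_restrict[OF f WU])
  then have fC: "restrict f W \<in> carrier (Cinf X A W)" by (simp add: carrier_OXP)
  have "s W (restrict f W) x = (v \<oplus>\<^bsub>Mod (TX X A) W\<^esub> w) W (restrict f W) x"
    using vf_rel_apply[OF oW W(5) fW W(2)] opens_self[OF oW] by simp
  also have "\<dots> = v W (restrict f W) x + w W (restrict f W) x"
    using opens_self[OF oW] fC W(2) by (simp add: TX_simps mk_vfield_apply)
  finally show ?thesis
    using class_act_eq[OF U c WU W(3,2) f] class_act_eq[OF U c' WU W(4,2) f]
      class_act_eq[OF U \<open>?s \<in> _\<close> WU class_restrict[OF U \<open>?s \<in> _\<close> V(1) W(1) V(3)] W(2) f] opens_self[OF oW]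
    by simp
qed

lemma class_act_smult:
  assumes U: "openin X U" and c: "c \<in> carrier (Mod (TXP X A P) U)"
    and s: "g \<odot>\<^bsub>Mod (TXP X A P) U\<^esub> c \<in> carrier (Mod (TXP X A P) U)"
    and f: "f \<in> carrier (OXP X A P U)" and x: "x \<in> U"
  shows "class_act X U (g \<odot>\<^bsub>Mod (TXP X A P) U\<^esub> c) f x = g x * class_act X U c f x"
proof -
  let ?s = "g \<odot>\<^bsub>Mod (TXP X A P) U\<^esub> c"
  obtain V s where V: "V \<in> opens X U" "x \<in> V" "s \<in> ?s V" using class_exists[OF U \<open>?s \<in> _\<close> x] by blast
  then have "\<exists>W\<in>opens X V. x \<in> W \<and> (\<exists>t\<in>{restrict g W \<odot>\<^bsub>Mod (TX X A) W\<^esub> v | v. v \<in> c W}.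
      (restrict s (opens X W), t) \<in> vf_rel X A P W)"
    by (simp add: TXP_def vf_class_def quot_close_def TX_simps(5))
  then obtain W v where W: "W \<in> opens X V" "x \<in> W" "v \<in> c W"
    "(restrict s (opens X W), restrict g W \<odot>\<^bsub>Mod (TX X A) W\<^esub> v) \<in> vf_rel X A P W" by blast
  have WU: "W \<in> opens X U" using opens_trans[OF V(1) W(1)] .
  have oW: "openin X W" using W opens_openin by blast
  have fW: "restrict f W \<in> carrier (OXP X A P W)" by (rule OXP_restrict[OF f WU])
  then have fC: "restrict f W \<in> carrier (Cinf X A W)" by (simp add: carrier_OXP)
  have "s W (restrict f W) x = (restrict g W \<odot>\<^bsub>Mod (TX X A) W\<^esub> v) W (restrict f W) x"
    using vf_rel_apply[OF oW W(4) fW W(2)] opens_self[OF oW] by simp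
  also have "\<dots> = g x * v W (restrict f W) x"
    using opens_self[OF oW] fC W(2) by (simp add: TX_simps mk_vfield_apply)
  finally show ?thesis
    using class_act_eq[OF U c WU W(3,2) f]
      class_act_eq[OF U \<open>?s \<in> _\<close> WU class_restrict[OF U \<open>?s \<in> _\<close> V(1) W(1) V(3)] W(2) f] opens_self[OF oW]
    by simp
qed

end

section \<open>Sheaves and modules\<close>

lemma ex1_eqI: "\<exists>!x. Q x \<Longrightarrow> Q a \<Longrightarrow> Q b \<Longrightarrow> a = b"
  by blast

lemma sheaf_onD:
  assumes "sheaf_on X U S r" "V \<in> opens X U" "s \<in> S V"
  shows "r V V s = s" and "W \<in> opens X V \<Longrightarrow> r V W s \<in> S W"
    and "W \<in> opens X V \<Longrightarrow> Z \<in> opens X W \<Longrightarrow> r W Z (r V W s) = r V Z s"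
proof -
  have 1: "\<forall>V\<in>opens X U. \<forall>s\<in>S V. r V V s = s"
    and 2: "\<forall>V\<in>opens X U. \<forall>W\<in>opens X V. \<forall>s\<in>S V. r V W s \<in> S W"
    and 3: "\<forall>V\<in>opens X U. \<forall>W\<in>opens X V. \<forall>Z\<in>opens X W. \<forall>s\<in>S V. r W Z (r V W s) = r V Z s"
    using assms(1) unfolding sheaf_on_def by - (elim conjE, assumption)+
  show "r V V s = s" and "W \<in> opens X V \<Longrightarrow> r V W s \<in> S W"
    and "W \<in> opens X V \<Longrightarrow> Z \<in> opens X W \<Longrightarrow> r W Z (r V W s) = r V Z s"
    using 1 2 3 assms(2,3) by auto
qed

lemma sheaf_on_restrict:
  assumes S: "sheaf_on X U S r" and V: "V \<in> opens X U" shows "sheaf_on X V S r"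
proof -
  have O: "opens X V \<subseteq> opens X U" using opens_trans[OF V] by blast
  show ?thesis
    unfolding sheaf_on_def
  proof (intro conjI ballI allI impI)
    fix C t assume "C \<subseteq> opens X V" "\<forall>V\<in>C. t V \<in> S V"
      "\<forall>V\<in>C. \<forall>W\<in>C. r V (V \<inter> W) (t V) = r W (V \<inter> W) (t W)"
    then show "\<exists>!s. s \<in> S (\<Union>C) \<and> (\<forall>V\<in>C. r (\<Union>C) V s = t V)"
      using S O unfolding sheaf_on_def by (elim conjE allE[of _ C] allE[of _ t]) blast
  qed (use sheaf_onD[OF S] O in auto)
qed

text \<open>Uniqueness of gluing, applied to the cover by all open sets on which the two sections
  agree.\<close>

lemma sheaf_sep:
  assumes S: "sheaf_on X U S r" and V: "V \<in> opens X U" and st: "s \<in> S V" "t \<in> S V"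
    and loc: "\<And>x. x \<in> V \<Longrightarrow> \<exists>W\<in>opens X V. x \<in> W \<and> r V W s = r V W t"
  shows "s = t"
proof -
  define C where "C = {W \<in> opens X V. r V W s = r V W t}"
  have CV: "\<Union>C = V" using loc by (fastforce simp: C_def opens_def)
  have CU: "C \<subseteq> opens X U" using opens_trans[OF V] by (auto simp: C_def)
  have CS: "\<forall>W\<in>C. r V W s \<in> S W"
    using sheaf_onD(2)[OF S V st(1)] unfolding C_def by blast
  have CC: "\<forall>W\<in>C. \<forall>Z\<in>C. r W (W \<inter> Z) (r V W s) = r Z (W \<inter> Z) (r V Z s)"
  proof (intro ballI)
    fix W Z assume "W \<in> C" "Z \<in> C"
    then have WZ: "W \<in> opens X V" "Z \<in> opens X V" by (auto simp: C_def)
    show "r W (W \<inter> Z) (r V W s) = r Z (W \<inter> Z) (r V Z s)"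
      using sheaf_onD(3)[OF S V st(1) WZ(1) opens_Int[OF WZ(1) opens_openin[OF WZ(2)]]]
        sheaf_onD(3)[OF S V st(1) WZ(2) opens_Int'[OF WZ(2) opens_openin[OF WZ(1)]]] by simp
  qed
  have "\<exists>!s'. s' \<in> S (\<Union>C) \<and> (\<forall>W\<in>C. r (\<Union>C) W s' = r V W s)"
    using S CU CS CC unfolding sheaf_on_def
    by (elim conjE allE[of _ C] allE[of _ "\<lambda>W. r V W s"]) blast
  then have "\<exists>!s'. s' \<in> S V \<and> (\<forall>W\<in>C. r V W s' = r V W s)" unfolding CV .
  moreover have "\<forall>W\<in>C. r V W t = r V W s" by (auto simp: C_def)
  ultimately show ?thesis using st by (metis (no_types, lifting))
qed

text \<open>Local data are described by a predicate \<open>Q\<close> instead of an indexed family.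
  The condition \<open>agree\<close> with \<open>Z = W\<close> makes the section on each
  \<open>W\<close> unique, so the choice made in \<open>t\<close> is immaterial.\<close>

lemma sheaf_glue:
  assumes S: "sheaf_on X U S r" and V: "V \<in> opens X U"
    and Q: "\<And>W s. W \<in> opens X V \<Longrightarrow> Q W s \<Longrightarrow> s \<in> S W"
    and agree: "\<And>W s Z t. W \<in> opens X V \<Longrightarrow> Z \<in> opens X V \<Longrightarrow> Q W s \<Longrightarrow> Q Z t \<Longrightarrow>
      r W (W \<inter> Z) s = r Z (W \<inter> Z) t"
    and loc: "\<And>x. x \<in> V \<Longrightarrow> \<exists>W\<in>opens X V. x \<in> W \<and> (\<exists>s. Q W s)"
  shows "\<exists>s\<in>S V. \<forall>W\<in>opens X V. \<forall>t. Q W t \<longrightarrow> r V W s = t"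
proof -
  define C where "C = {W \<in> opens X V. \<exists>s. Q W s}"
  define t where "t W = (SOME s. Q W s)" for W
  have tQ: "Q W (t W)" if "W \<in> C" for W using that unfolding C_def t_def by (auto intro: someI)
  have CV: "\<Union>C = V" using loc by (fastforce simp: C_def opens_def)
  have CU: "C \<subseteq> opens X U" using opens_trans[OF V] by (auto simp: C_def)
  have CO: "W \<in> opens X V" if "W \<in> C" for W using that by (auto simp: C_def)
  have "\<exists>!s. s \<in> S (\<Union>C) \<and> (\<forall>W\<in>C. r (\<Union>C) W s = t W)"
  proof -
    have "\<forall>W\<in>C. t W \<in> S W" using Q CO tQ by blast
    moreover have "\<forall>W\<in>C. \<forall>Z\<in>C. r W (W \<inter> Z) (t W) = r Z (W \<inter> Z) (t Z)"
      using agree CO tQ by blast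
    ultimately show ?thesis
      using S CU unfolding sheaf_on_def by (elim conjE allE[of _ C] allE[of _ t]) blast
  qed
  then obtain s where s: "s \<in> S V" "\<forall>W\<in>C. r V W s = t W" unfolding CV by blast
  have "r V W s = u" if W: "W \<in> opens X V" and u: "Q W u" for W u
  proof -
    have WC: "W \<in> C" using W u by (auto simp: C_def)
    have "r W (W \<inter> W) (t W) = r W (W \<inter> W) u" by (rule agree[OF W W tQ[OF WC] u])
    then show ?thesis
      using sheaf_onD(1)[OF S opens_trans[OF V W] Q[OF W tQ[OF WC]]]
        sheaf_onD(1)[OF S opens_trans[OF V W] Q[OF W u]] s(2) WC by simp
  qed
  then show ?thesis using s(1) by blast
qed

text \<open>A morphism arises from a functional relation that need only be defined locally: images
  are glued by \<open>sheaf_glue\<close>, and \<open>sheaf_sep\<close> reduces compatibility with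
  restriction to small sets where the relation is defined.\<close>

lemma sheaf_map_ext:
  assumes S: "sheaf_on X U S r" and S': "sheaf_on X U S' r'"
    and dom: "\<And>V m m'. Rel V m m' \<Longrightarrow> V \<in> opens X U \<and> m \<in> S V \<and> m' \<in> S' V"
    and res: "\<And>V W m m'. Rel V m m' \<Longrightarrow> W \<in> opens X V \<Longrightarrow> Rel W (r V W m) (r' V W m')"
    and "fun": "\<And>V m m' m''. Rel V m m' \<Longrightarrow> Rel V m m'' \<Longrightarrow> m' = m''"
    and loc: "\<And>V m x. V \<in> opens X U \<Longrightarrow> m \<in> S V \<Longrightarrow> x \<in> V \<Longrightarrow>
      \<exists>W\<in>opens X V. x \<in> W \<and> (\<exists>m'. Rel W (r V W m) m')"
  shows "\<exists>h\<in>ext_family X U S. (\<forall>V\<in>opens X U. \<forall>m\<in>S V. h V m \<in> S' V \<and>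
      (\<forall>W\<in>opens X V. h W (r V W m) = r' V W (h V m))) \<and> (\<forall>V m m'. Rel V m m' \<longrightarrow> h V m = m')"
proof -
  have ex: "\<exists>s\<in>S' V. \<forall>W\<in>opens X V. \<forall>t. Rel W (r V W m) t \<longrightarrow> r' V W s = t"
    if V: "V \<in> opens X U" and m: "m \<in> S V" for V m
  proof (rule sheaf_glue[OF S' V])
    show "s \<in> S' W" if "Rel W (r V W m) s" for W s using dom[OF that] by blast
    show "\<exists>W\<in>opens X V. x \<in> W \<and> (\<exists>s. Rel W (r V W m) s)" if "x \<in> V" for x
      using loc[OF V m that] .
    fix W s Z t assume WZ: "W \<in> opens X V" "Z \<in> opens X V" and st: "Rel W (r V W m) s" "Rel Z (r V Z m) t"
    have o: "W \<inter> Z \<in> opens X W" "W \<inter> Z \<in> opens X Z"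
      using opens_Int[OF WZ(1) opens_openin[OF WZ(2)]] opens_Int'[OF WZ(2) opens_openin[OF WZ(1)]] .
    show "r' W (W \<inter> Z) s = r' Z (W \<inter> Z) t"
      using res[OF st(1) o(1)] res[OF st(2) o(2)] sheaf_onD(3)[OF S V m WZ(1) o(1)]
        sheaf_onD(3)[OF S V m WZ(2) o(2)] "fun" by metis
  qed
  define h where "h = (\<lambda>V\<in>opens X U. \<lambda>m\<in>S V. SOME s. s \<in> S' V \<and>
    (\<forall>W\<in>opens X V. \<forall>t. Rel W (r V W m) t \<longrightarrow> r' V W s = t))"
  have h: "h V m \<in> S' V \<and> (\<forall>W\<in>opens X V. \<forall>t. Rel W (r V W m) t \<longrightarrow> r' V W (h V m) = t)"
    if "V \<in> opens X U" "m \<in> S V" for V m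
  proof -
    have "h V m = (SOME s. s \<in> S' V \<and> (\<forall>W\<in>opens X V. \<forall>t. Rel W (r V W m) t \<longrightarrow> r' V W s = t))"
      using that by (simp add: h_def)
    then show ?thesis using someI_ex[OF ex[OF that, unfolded Bex_def]] by simp
  qed
  show ?thesis
  proof (intro bexI[of _ h] conjI ballI allI impI)
    show "h \<in> ext_family X U S" by (simp add: h_def ext_family_def)
    show "h V m \<in> S' V" if "V \<in> opens X U" "m \<in> S V" for V m using h[OF that] by blast
    show "h V m = m'" if R: "Rel V m m'" for V m m'
    proof -
      have V: "V \<in> opens X U" "m \<in> S V" using dom[OF R] by auto
      have "Rel V (r V V m) m'" using R sheaf_onD(1)[OF S V] by simp
      then have "r' V V (h V m) = m'" using h[OF V] opens_self[OF opens_openin[OF V(1)]] by blast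
      then show ?thesis using sheaf_onD(1)[OF S' V(1)] h[OF V] by auto
    qed
    fix V m W assume V: "V \<in> opens X U" and m: "m \<in> S V" and W: "W \<in> opens X V"
    have WU: "W \<in> opens X U" by (rule opens_trans[OF V W])
    have mW: "r V W m \<in> S W" by (rule sheaf_onD(2)[OF S V m W])
    have hV: "h V m \<in> S' V" using h[OF V m] by blast
    show "h W (r V W m) = r' V W (h V m)"
    proof (rule sheaf_sep[OF S' WU])
      show "h W (r V W m) \<in> S' W" using h[OF WU mW] by blast
      show "r' V W (h V m) \<in> S' W" by (rule sheaf_onD(2)[OF S' V hV W])
      fix x assume "x \<in> W"
      then obtain Z m' where Z: "Z \<in> opens X W" "x \<in> Z" "Rel Z (r W Z (r V W m)) m'"
        using loc[OF WU mW] by blast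
      have "Rel Z (r V Z m) m'" using Z(3) sheaf_onD(3)[OF S V m W Z(1)] by simp
      then have "r' V Z (h V m) = m'" using h[OF V m] opens_trans[OF W Z(1)] by blast
      moreover have "r' W Z (h W (r V W m)) = m'" using h[OF WU mW] Z(1,3) by blast
      ultimately show "\<exists>Z\<in>opens X W. x \<in> Z \<and> r' W Z (h W (r V W m)) = r' W Z (r' V W (h V m))"
        using Z sheaf_onD(3)[OF S' V hV W Z(1)] by auto
    qed
  qed
qed

section \<open>Sheaves of modules\<close>

lemma module_sheafD:
  assumes "module_sheaf X U R M" "V \<in> opens X U"
  shows "module (R V) (Mod M V)"
    and "W \<in> opens X V \<Longrightarrow> m \<in> carrier (Mod M V) \<Longrightarrow> mres M V W m \<in> carrier (Mod M W)"
    and "W \<in> opens X V \<Longrightarrow> m \<in> carrier (Mod M V) \<Longrightarrow> m' \<in> carrier (Mod M V) \<Longrightarrow>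
      mres M V W (m \<oplus>[M,V] m') = mres M V W m \<oplus>[M,W] mres M V W m'"
    and "W \<in> opens X V \<Longrightarrow> f \<in> carrier (R V) \<Longrightarrow> m \<in> carrier (Mod M V) \<Longrightarrow>
      mres M V W (f \<odot>[M,V] m) = restrict f W \<odot>[M,W] mres M V W m"
proof -
  have s: "sheaf_on X U (\<lambda>V. carrier (Mod M V)) (mres M)"
    using assms unfolding module_sheaf_def by blast
  show "W \<in> opens X V \<Longrightarrow> m \<in> carrier (Mod M V) \<Longrightarrow> mres M V W m \<in> carrier (Mod M W)"
    using sheaf_onD(2)[OF s assms(2)] by blast
qed (use assms in \<open>unfold module_sheaf_def, blast+\<close>)

lemma module_sheaf_sheaf: "module_sheaf X U R M \<Longrightarrow> sheaf_on X U (\<lambda>V. carrier (Mod M V)) (mres M)"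
  unfolding module_sheaf_def by blast

lemma module_sheaf_restrict: "module_sheaf X U R M \<Longrightarrow> V \<in> opens X U \<Longrightarrow> module_sheaf X V R M"
  unfolding module_sheaf_def using opens_trans sheaf_on_restrict by blast

section \<open>The action of the algebroid on functions\<close>

locale smooth_algebroid =
  fixes X :: "'x topology" and A :: "'x atlas" and P :: "'x set \<Rightarrow> 'x vfield set"
    and B :: "('x, 'b) lie_algd"
  assumes mf: "smooth_manifold X A" and dist: "integrable_distribution X A P"
    and algd: "lie_algebroid X A P B"
    and lff: "locally_free_finite X (topspace X) (OXP X A P) B"
begin

abbreviation "R \<equiv> OXP X A P"
abbreviation "F V \<equiv> carrier (OXP X A P V)"
abbreviation "Bc V \<equiv> carrier (Mod B V)"
abbreviation "ac \<equiv> alg_act X B"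
abbreviation "br \<equiv> lbr B"

lemmas F_ext = OXP_ext[OF mf dist]
lemmas F_restrict = OXP_restrict[OF mf dist]
lemmas F_local = OXP_local[OF mf dist]
lemmas F_const = OXP_const[OF mf dist]
lemmas F_inverse = OXP_inverse[OF mf dist]

lemma B_sheaf: "module_sheaf X (topspace X) R B"
  using algd unfolding lie_algebroid_def by blast

lemma B_module: "openin X V \<Longrightarrow> module (R V) (Mod B V)"
  using module_sheafD(1)[OF B_sheaf opens_topspace] .

lemma B_res: "openin X V \<Longrightarrow> W \<in> opens X V \<Longrightarrow> b \<in> Bc V \<Longrightarrow> mres B V W b \<in> Bc W"
  using module_sheafD(2)[OF B_sheaf opens_topspace] .

lemma B_res_res: "openin X V \<Longrightarrow> W \<in> opens X V \<Longrightarrow> Z \<in> opens X W \<Longrightarrow> b \<in> Bc V \<Longrightarrow>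
    mres B W Z (mres B V W b) = mres B V Z b"
  using sheaf_onD(3)[OF module_sheaf_sheaf[OF B_sheaf] opens_topspace] .

lemma B_res_id: "openin X V \<Longrightarrow> b \<in> Bc V \<Longrightarrow> mres B V V b = b"
  using sheaf_onD(1)[OF module_sheaf_sheaf[OF B_sheaf] opens_topspace] .

lemma cringR: "openin X V \<Longrightarrow> cring (R V)"
  using B_module by (simp add: module_def)

lemma F_add: "openin X V \<Longrightarrow> f \<in> F V \<Longrightarrow> g \<in> F V \<Longrightarrow> (\<lambda>x\<in>V. f x + g x) \<in> F V"
  using cring.cring_simprules(1)[OF cringR, of V f g] by (simp add: OXP_simps)

lemma F_mult: "openin X V \<Longrightarrow> f \<in> F V \<Longrightarrow> g \<in> F V \<Longrightarrow> (\<lambda>x\<in>V. f x * g x) \<in> F V"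
  using cring.cring_simprules(5)[OF cringR, of V f g] by (simp add: OXP_simps)

lemma F_cmult: "openin X V \<Longrightarrow> f \<in> F V \<Longrightarrow> (\<lambda>x\<in>V. c * f x) \<in> F V"
proof -
  assume V: "openin X V" and f: "f \<in> F V"
  have "(\<lambda>x\<in>V. (\<lambda>x\<in>V. c) x * f x) \<in> F V" by (rule F_mult[OF V F_const[OF V] f])
  then show ?thesis by (simp cong: restrict_cong)
qed

lemma F_minus: "openin X V \<Longrightarrow> f \<in> F V \<Longrightarrow> (\<lambda>x\<in>V. - f x) \<in> F V"
  using F_cmult[of V f "-1"] by simp

lemma F_diff: "openin X V \<Longrightarrow> f \<in> F V \<Longrightarrow> g \<in> F V \<Longrightarrow> (\<lambda>x\<in>V. f x - g x) \<in> F V"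
proof -
  assume V: "openin X V" and f: "f \<in> F V" and g: "g \<in> F V"
  have "(\<lambda>x\<in>V. f x + (\<lambda>x\<in>V. - g x) x) \<in> F V" by (rule F_add[OF V f F_minus[OF V g]])
  then show ?thesis by (simp cong: restrict_cong)
qed

lemma F_divide:
  assumes V: "openin X V" and f: "f \<in> F V" and g: "g \<in> F V" and nz: "\<And>x. x \<in> V \<Longrightarrow> g x \<noteq> 0"
  shows "(\<lambda>x\<in>V. f x / g x) \<in> F V"
proof -
  have "(\<lambda>x\<in>V. f x * (\<lambda>x\<in>V. inverse (g x)) x) \<in> F V" by (rule F_mult[OF V f F_inverse[OF V g nz]])
  then show ?thesis by (simp add: divide_inverse cong: restrict_cong)
qed

lemma anchorD:
  assumes "openin X V" "b \<in> Bc V"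
  shows "anchor B V b \<in> carrier (Mod (TXP X A P) V)"
    and "b' \<in> Bc V \<Longrightarrow> anchor B V (b \<oplus>[B,V] b') = anchor B V b \<oplus>\<^bsub>Mod (TXP X A P) V\<^esub> anchor B V b'"
    and "g \<in> F V \<Longrightarrow> anchor B V (g \<odot>[B,V] b) = g \<odot>\<^bsub>Mod (TXP X A P) V\<^esub> anchor B V b"
    and "W \<in> opens X V \<Longrightarrow> anchor B W (mres B V W b) = mres (TXP X A P) V W (anchor B V b)"
proof -
  have "sheaf_hom X (topspace X) R B (TXP X A P) (anchor B)"
    using algd unfolding lie_algebroid_def by blast
  note h = this[unfolded sheaf_hom_def, rule_format, OF opens_topspace[OF assms(1)]]
  show "anchor B V b \<in> carrier (Mod (TXP X A P) V)" using h assms(2) by blast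
  show "b' \<in> Bc V \<Longrightarrow> anchor B V (b \<oplus>[B,V] b') = anchor B V b \<oplus>\<^bsub>Mod (TXP X A P) V\<^esub> anchor B V b'"
    using h assms(2) by blast
  show "g \<in> F V \<Longrightarrow> anchor B V (g \<odot>[B,V] b) = g \<odot>\<^bsub>Mod (TXP X A P) V\<^esub> anchor B V b"
    using h assms(2) by blast
  show "W \<in> opens X V \<Longrightarrow> anchor B W (mres B V W b) = mres (TXP X A P) V W (anchor B V b)"
    using h assms(2) by blast
qed

lemma ac_closed: "openin X V \<Longrightarrow> b \<in> Bc V \<Longrightarrow> f \<in> F V \<Longrightarrow> ac V b f \<in> F V"
  unfolding alg_act_def using class_act_closed[OF mf dist _ anchorD(1)] .

lemma ac_restrict:
  assumes V: "openin X V" and b: "b \<in> Bc V" and f: "f \<in> F V" and W: "W \<in> opens X V"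
  shows "ac W (mres B V W b) (restrict f W) = restrict (ac V b f) W"
  unfolding alg_act_def anchorD(4)[OF V b W]
  by (rule class_act_res[OF mf dist V anchorD(1)[OF V b] W f])
     (use anchorD(1)[OF opens_openin[OF W] B_res[OF V W b]] anchorD(4)[OF V b W] in simp)

lemma ac_const: "openin X V \<Longrightarrow> b \<in> Bc V \<Longrightarrow> x \<in> V \<Longrightarrow> ac V b (\<lambda>x\<in>V. z) x = 0"
  unfolding alg_act_def using class_act_const[OF mf dist _ anchorD(1)] .

lemma ac_add:
  "openin X V \<Longrightarrow> b \<in> Bc V \<Longrightarrow> f \<in> F V \<Longrightarrow> g \<in> F V \<Longrightarrow> x \<in> V \<Longrightarrow>
    ac V b (\<lambda>x\<in>V. f x + g x) x = ac V b f x + ac V b g x"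
  and ac_mult:
  "openin X V \<Longrightarrow> b \<in> Bc V \<Longrightarrow> f \<in> F V \<Longrightarrow> g \<in> F V \<Longrightarrow> x \<in> V \<Longrightarrow>
    ac V b (\<lambda>x\<in>V. f x * g x) x = ac V b f x * g x + f x * ac V b g x"
  unfolding alg_act_def
  using class_act_add_mult[OF mf dist _ anchorD(1) _ _ _ F_add F_mult] by auto

lemma ac_plus:
  assumes V: "openin X V" and b: "b \<in> Bc V" and b': "b' \<in> Bc V" and f: "f \<in> F V" and x: "x \<in> V"
  shows "ac V (b \<oplus>[B,V] b') f x = ac V b f x + ac V b' f x"
proof -
  interpret M: module "R V" "Mod B V" by (rule B_module[OF V])
  have "b \<oplus>[B,V] b' \<in> Bc V" using b b' by simp
  from class_act_plus[OF mf dist V anchorD(1)[OF V b] anchorD(1)[OF V b'] _ f x] anchorD(1)[OF V this]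
  show ?thesis unfolding alg_act_def anchorD(2)[OF V b b'] by simp
qed

lemma ac_smult:
  assumes V: "openin X V" and b: "b \<in> Bc V" and g: "g \<in> F V" and f: "f \<in> F V" and x: "x \<in> V"
  shows "ac V (g \<odot>[B,V] b) f x = g x * ac V b f x"
  unfolding alg_act_def anchorD(3)[OF V b g]
  by (rule class_act_smult[OF mf dist V anchorD(1)[OF V b] _ f x])
     (use anchorD(1)[OF V module.smult_closed[OF B_module[OF V] g b]] anchorD(3)[OF V b g] in simp)

section \<open>Bracket identities; the anchor respects brackets\<close>

lemma brD:
  assumes V: "openin X V" and a: "a \<in> Bc V" and b: "b \<in> Bc V"
  shows "br V a b \<in> Bc V" and "br V a a = \<zero>\<^bsub>Mod B V\<^esub>"
    and "W \<in> opens X V \<Longrightarrow> mres B V W (br V a b) = br W (mres B V W a) (mres B V W b)"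
    and "c \<in> Bc V \<Longrightarrow> br V (a \<oplus>[B,V] b) c = br V a c \<oplus>[B,V] br V b c"
    and "c \<in> Bc V \<Longrightarrow> br V a (b \<oplus>[B,V] c) = br V a b \<oplus>[B,V] br V a c"
    and "c \<in> Bc V \<Longrightarrow> br V a (br V b c) \<oplus>[B,V] br V b (br V c a) \<oplus>[B,V]
             br V c (br V a b) = \<zero>\<^bsub>Mod B V\<^esub>"
    and "f \<in> F V \<Longrightarrow> br V a (f \<odot>[B,V] b) =
           ac V a f \<odot>[B,V] b \<oplus>[B,V] f \<odot>[B,V] br V a b"
proof -
  note h = algd[unfolded lie_algebroid_def, THEN conjunct2, THEN conjunct2, THEN spec[of _ V], THEN mp,
      OF V, THEN bspec, OF a, THEN bspec, OF b]
  show "br V a b \<in> Bc V" and "br V a a = \<zero>\<^bsub>Mod B V\<^esub>"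
    and "W \<in> opens X V \<Longrightarrow> mres B V W (br V a b) = br W (mres B V W a) (mres B V W b)"
    and "c \<in> Bc V \<Longrightarrow> br V (a \<oplus>[B,V] b) c = br V a c \<oplus>[B,V] br V b c"
    and "c \<in> Bc V \<Longrightarrow> br V a (b \<oplus>[B,V] c) = br V a b \<oplus>[B,V] br V a c"
    and "c \<in> Bc V \<Longrightarrow> br V a (br V b c) \<oplus>[B,V] br V b (br V c a) \<oplus>[B,V]
             br V c (br V a b) = \<zero>\<^bsub>Mod B V\<^esub>"
    and "f \<in> F V \<Longrightarrow> br V a (f \<odot>[B,V] b) =
           ac V a f \<odot>[B,V] b \<oplus>[B,V] f \<odot>[B,V] br V a b"
    using h by blast+
qed

text \<open>The algebroid axioms state only that \<open>br V a a\<close> vanishes; polarize at the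
  sum of \<open>a\<close> and \<open>b\<close>.\<close>

lemma br_antisym:
  assumes V: "openin X V" and a: "a \<in> Bc V" and b: "b \<in> Bc V"
  shows "br V b a = \<ominus>\<^bsub>Mod B V\<^esub> br V a b"
proof -
  interpret M: module "R V" "Mod B V" by (rule B_module[OF V])
  note cl = brD(1)[OF V a b] brD(1)[OF V b a]
  have ab: "a \<oplus>[B,V] b \<in> Bc V" using a b by simp
  have "\<zero>\<^bsub>Mod B V\<^esub> = br V (a \<oplus>[B,V] b) (a \<oplus>[B,V] b)" using brD(2)[OF V ab ab] by simp
  also have "\<dots> = (br V a a \<oplus>[B,V] br V b a) \<oplus>[B,V] (br V a b \<oplus>[B,V] br V b b)"
    using brD(5)[OF V ab a b] brD(4)[OF V a b a] brD(4)[OF V a b b] by simp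
  also have "\<dots> = br V b a \<oplus>[B,V] br V a b"
    using brD(2)[OF V a a] brD(2)[OF V b b] cl by simp
  finally show ?thesis using cl M.minus_equality by metis
qed

lemma br_minus:
  assumes V: "openin X V" and a: "a \<in> Bc V" and b: "b \<in> Bc V"
  shows "br V a (\<ominus>\<^bsub>Mod B V\<^esub> b) = \<ominus>\<^bsub>Mod B V\<^esub> br V a b"
proof -
  interpret M: module "R V" "Mod B V" by (rule B_module[OF V])
  have mb: "\<ominus>\<^bsub>Mod B V\<^esub> b \<in> Bc V" using b by simp
  have z: "br V a \<zero>\<^bsub>Mod B V\<^esub> = \<zero>\<^bsub>Mod B V\<^esub>"
    using brD(5)[OF V a M.M.zero_closed M.M.zero_closed] brD(1)[OF V a M.M.zero_closed]
    by (metis M.M.r_zero M.M.zero_closed M.M.add.r_cancel_one')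
  have "br V a (\<ominus>\<^bsub>Mod B V\<^esub> b) \<oplus>[B,V] br V a b = \<zero>\<^bsub>Mod B V\<^esub>"
    using brD(5)[OF V a mb b] z b by (simp add: M.l_neg)
  then show ?thesis using M.minus_equality brD(1)[OF V a b] brD(1)[OF V a mb] by metis
qed

text \<open>In this Leibniz form of the Jacobi identity both iterated brackets of
  \<open>ac_br_frame\<close> can be expanded in the same way.\<close>

lemma br_derivation:
  assumes V: "openin X V" and a: "a \<in> Bc V" and b: "b \<in> Bc V" and c: "c \<in> Bc V"
  shows "br V a (br V b c) = br V b (br V a c) \<oplus>[B,V] br V (br V a b) c"
proof -
  interpret M: module "R V" "Mod B V" by (rule B_module[OF V])
  note cl = brD(1)[OF V]
  have "br V b (br V c a) = \<ominus>\<^bsub>Mod B V\<^esub> br V b (br V a c)"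
    using br_antisym[OF V a c] br_minus[OF V b cl[OF a c]] by simp
  moreover have "br V c (br V a b) = \<ominus>\<^bsub>Mod B V\<^esub> br V (br V a b) c"
    using br_antisym[OF V cl[OF a b] c] by simp
  ultimately have "br V a (br V b c) \<oplus>[B,V] (\<ominus>\<^bsub>Mod B V\<^esub> br V b (br V a c)) \<oplus>[B,V]
      (\<ominus>\<^bsub>Mod B V\<^esub> br V (br V a b) c) = \<zero>\<^bsub>Mod B V\<^esub>"
    using brD(6)[OF V a b c] by simp
  then have "br V a (br V b c) \<oplus>[B,V] (\<ominus>\<^bsub>Mod B V\<^esub> (br V b (br V a c) \<oplus>[B,V] br V (br V a b) c)) = \<zero>\<^bsub>Mod B V\<^esub>"
    using cl a b c by (simp add: M.minus_add M.a_assoc)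
  then show ?thesis
    using cl a b c by (metis M.M.minus_equality M.M.minus_minus M.a_closed M.M.a_inv_closed)
qed

text \<open>Uniqueness of coordinates for the vectors (f, 0, ..., 0) and (g, 0, ..., 0): a frame
  element can be cancelled.\<close>

lemma frame_unit_coeff:
  assumes fr: "frame X R B V r e" and V: "openin X V" and r: "0 < r"
    and f: "f \<in> F V" and g: "g \<in> F V" and eq: "f \<odot>[B,V] e 0 = g \<odot>[B,V] e 0"
  shows "f = g"
proof -
  interpret M: module "R V" "Mod B V" by (rule B_module[OF V])
  have e: "e i \<in> Bc V" if "i < r" for i using fr that by (auto simp: frame_def)
  define cf where "cf h = (\<lambda>i\<in>{..<r}. if i = 0 then h else \<zero>\<^bsub>R V\<^esub>)" for h
  have cfin: "cf h \<in> {..<r} \<rightarrow>\<^sub>E F V" if "h \<in> F V" for h using that by (auto simp: cf_def)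
  have sum: "h \<odot>[B,V] e 0 = (\<Oplus>\<^bsub>Mod B V\<^esub>i\<in>{..<r}. cf h i \<odot>[B,V] mres B V V (e i))"
    if h: "h \<in> F V" for h
  proof -
    have "(\<Oplus>\<^bsub>Mod B V\<^esub>i\<in>{..<r}. cf h i \<odot>[B,V] mres B V V (e i)) =
        (\<Oplus>\<^bsub>Mod B V\<^esub>i\<in>{..<r}. if 0 = i then h \<odot>[B,V] e i else \<zero>\<^bsub>Mod B V\<^esub>)"
      using e h B_res_id[OF V] by (intro M.M.finsum_cong') (auto simp: cf_def)
    also have "\<dots> = h \<odot>[B,V] e 0"
      using M.M.finsum_singleton[of 0 "{..<r}" "\<lambda>i. h \<odot>[B,V] e i"] r e h by simp
    finally show ?thesis by simp
  qed
  have m: "f \<odot>[B,V] e 0 \<in> Bc V" using e r f by simp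
  have "\<exists>!c. c \<in> {..<r} \<rightarrow>\<^sub>E F V \<and>
        f \<odot>[B,V] e 0 = (\<Oplus>\<^bsub>Mod B V\<^esub>i\<in>{..<r}. c i \<odot>[B,V] mres B V V (e i))"
    using fr opens_self[OF V] m unfolding frame_def by blast
  then have "cf f = cf g"
    by (rule ex1_eqI) (intro conjI cfin f g sum trans[OF eq sum[OF g]])+
  then have "cf f 0 = cf g 0" by simp
  then show ?thesis using r by (simp add: cf_def)
qed

lemma ac_zero: "openin X V \<Longrightarrow> f \<in> F V \<Longrightarrow> x \<in> V \<Longrightarrow> ac V \<zero>\<^bsub>Mod B V\<^esub> f x = 0"
proof -
  assume V: "openin X V" and f: "f \<in> F V" and x: "x \<in> V"
  interpret M: module "R V" "Mod B V" by (rule B_module[OF V])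
  have "ac V (\<zero>\<^bsub>Mod B V\<^esub> \<oplus>[B,V] \<zero>\<^bsub>Mod B V\<^esub>) f x = ac V \<zero>\<^bsub>Mod B V\<^esub> f x + ac V \<zero>\<^bsub>Mod B V\<^esub> f x"
    by (rule ac_plus[OF V _ _ f x]) simp_all
  then show ?thesis by simp
qed

text \<open>The anchor of an algebroid respects brackets: compare the coefficients of a frame element \<open>c\<close> in
  the Jacobi identity for \<open>a\<close>, \<open>b\<close> and \<open>f c\<close>.\<close>

lemma ac_br_frame:
  assumes V: "openin X V" and a: "a \<in> Bc V" and b: "b \<in> Bc V" and f: "f \<in> F V" and x: "x \<in> V"
    and fr: "frame X R B V r e"
  shows "ac V (br V a b) f x = ac V a (ac V b f) x - ac V b (ac V a f) x"
\<comment> \<open>An empty frame offers no element whose coefficients could be compared, but then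
  the module is zero and the zero section acts by zero.\<close>
proof (cases "r = 0")
  case True
  interpret M: module "R V" "Mod B V" by (rule B_module[OF V])
  have z: "m = \<zero>\<^bsub>Mod B V\<^esub>" if "m \<in> Bc V" for m
    using fr opens_self[OF V] that unfolding frame_def True by fastforce
  have "ac V m g x = 0" if "m \<in> Bc V" "g \<in> F V" for m g
    using z[OF that(1)] ac_zero[OF V that(2) x] by simp
  then show ?thesis using a b f brD(1)[OF V a b] ac_closed[OF V] by simp
next
  case False
  then have r: "0 < r" by simp
  interpret M: module "R V" "Mod B V" by (rule B_module[OF V])
  have c: "e 0 \<in> Bc V" using fr r by (auto simp: frame_def)
  let ?c = "e 0"
  note cl = brD(1)[OF V] ac_closed[OF V]
  have L2: "br V a (br V b (f \<odot>[B,V] ?c)) =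
      (ac V a (ac V b f) \<odot>[B,V] ?c \<oplus>[B,V] ac V b f \<odot>[B,V] br V a ?c) \<oplus>[B,V]
      (ac V a f \<odot>[B,V] br V b ?c \<oplus>[B,V] f \<odot>[B,V] br V a (br V b ?c))"
    if a: "a \<in> Bc V" and b: "b \<in> Bc V" for a b
  proof -
    have "br V a (br V b (f \<odot>[B,V] ?c)) =
        br V a (ac V b f \<odot>[B,V] ?c) \<oplus>[B,V] br V a (f \<odot>[B,V] br V b ?c)"
      unfolding brD(7)[OF V b c f] by (rule brD(5)[OF V a]) (use cl a b c f in auto)
    then show ?thesis
      unfolding brD(7)[OF V a c cl(2)[OF b f]] brD(7)[OF V a cl(1)[OF b c] f] .
  qed
  have fc: "f \<odot>[B,V] ?c \<in> Bc V" using f c by simp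
  \<comment> \<open>These four terms occur in both expansions of the Jacobi identity. Once they are
    cancelled, only multiples of \<open>?c\<close> remain.\<close>
  define T1 T2 J2 J3 where "T1 = ac V b f \<odot>[B,V] br V a ?c" "T2 = ac V a f \<odot>[B,V] br V b ?c"
     "J2 = f \<odot>[B,V] br V b (br V a ?c)" "J3 = f \<odot>[B,V] br V (br V a b) ?c"
  have J: "T1 \<in> Bc V" "T2 \<in> Bc V" "J2 \<in> Bc V" "J3 \<in> Bc V"
    unfolding T1_T2_J2_J3_def using cl a b c f by auto
  have J1: "f \<odot>[B,V] br V a (br V b ?c) = J2 \<oplus>[B,V] J3"
    unfolding br_derivation[OF V a b c] T1_T2_J2_J3_def using cl a b c f by (simp add: M.smult_r_distr)
  let ?A = "ac V a (ac V b f)" and ?A' = "ac V b (ac V a f)" and ?G = "ac V (br V a b) f"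
  have AF: "?A \<in> F V" "?A' \<in> F V" "?G \<in> F V" using cl a b f by auto
  have Ac: "?A \<odot>[B,V] ?c \<in> Bc V" "?A' \<odot>[B,V] ?c \<in> Bc V" "?G \<odot>[B,V] ?c \<in> Bc V"
    using AF c by auto
  have "br V a (br V b (f \<odot>[B,V] ?c)) = br V b (br V a (f \<odot>[B,V] ?c)) \<oplus>[B,V] br V (br V a b) (f \<odot>[B,V] ?c)"
    by (rule br_derivation[OF V a b fc])
  then have E: "(?A \<odot>[B,V] ?c \<oplus>[B,V] T1) \<oplus>[B,V] (T2 \<oplus>[B,V] (J2 \<oplus>[B,V] J3)) =
     (?A' \<odot>[B,V] ?c \<oplus>[B,V] T2) \<oplus>[B,V] (T1 \<oplus>[B,V] J2) \<oplus>[B,V] (?G \<odot>[B,V] ?c \<oplus>[B,V] J3)"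
    unfolding L2[OF a b] L2[OF b a] brD(7)[OF V cl(1)[OF a b] c f] J1
    unfolding T1_T2_J2_J3_def .
  have "?A \<odot>[B,V] ?c \<oplus>[B,V] (T1 \<oplus>[B,V] (T2 \<oplus>[B,V] (J2 \<oplus>[B,V] J3))) =
     (?A' \<odot>[B,V] ?c \<oplus>[B,V] ?G \<odot>[B,V] ?c) \<oplus>[B,V] (T1 \<oplus>[B,V] (T2 \<oplus>[B,V] (J2 \<oplus>[B,V] J3)))"
    using E J Ac by (simp add: M.a_ac)
  then have "?A \<odot>[B,V] ?c = ?A' \<odot>[B,V] ?c \<oplus>[B,V] ?G \<odot>[B,V] ?c"
    using J Ac by (subst (asm) M.M.add.right_cancel) auto
  also have "\<dots> = (?A' \<oplus>\<^bsub>R V\<^esub> ?G) \<odot>[B,V] ?c" using AF c by (simp add: M.smult_l_distr)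
  finally have "?A = ?A' \<oplus>\<^bsub>R V\<^esub> ?G"
    using frame_unit_coeff[OF fr V r AF(1)] AF(2,3) by simp
  then have "?A x = ?A' x + ?G x" using x by (simp add: OXP_simps)
  then show ?thesis by simp
qed

text \<open>The identity is pointwise and frames exist near every point. A frame restricts to a
  frame because \<open>frame\<close> already demands unique coordinates over every smaller open
  set.\<close>

lemma ac_br:
  assumes V: "openin X V" and a: "a \<in> Bc V" and b: "b \<in> Bc V" and f: "f \<in> F V" and x: "x \<in> V"
  shows "ac V (br V a b) f x = ac V a (ac V b f) x - ac V b (ac V a f) x"
proof -
  have "x \<in> topspace X" using x openin_subset[OF V] by blast
  then obtain W r e where W: "W \<in> opens X (topspace X)" "x \<in> W" "frame X R B W r e"
    using lff unfolding locally_free_finite_def by blast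
  let ?Z = "W \<inter> V"
  have Z: "?Z \<in> opens X W" "?Z \<in> opens X V" "openin X ?Z"
    using opens_Int[OF W(1) V] opens_Int'[OF opens_self[OF V] opens_openin[OF W(1)]] opens_openin by auto
  have "frame X R B ?Z r (\<lambda>i. mres B W ?Z (e i))"
    unfolding frame_def
  proof (intro conjI allI impI ballI)
    have e: "e i \<in> Bc W" if "i < r" for i using W(3) that by (auto simp: frame_def)
    show "mres B W ?Z (e i) \<in> Bc ?Z" if "i < r" for i
      using B_res[OF opens_openin[OF W(1)] Z(1) e[OF that]] .
    fix Y m assume Y: "Y \<in> opens X ?Z" and m: "m \<in> Bc Y"
    interpret M: module "R Y" "Mod B Y" by (rule B_module[OF opens_openin[OF Y]])
    have "\<exists>!c. c \<in> {..<r} \<rightarrow>\<^sub>E F Y \<and> m = (\<Oplus>\<^bsub>Mod B Y\<^esub>i\<in>{..<r}. c i \<odot>[B,Y] mres B W Y (e i))"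
      using W(3) opens_trans[OF Z(1) Y] m unfolding frame_def by blast
    moreover have "(\<Oplus>\<^bsub>Mod B Y\<^esub>i\<in>{..<r}. c i \<odot>[B,Y] mres B ?Z Y (mres B W ?Z (e i))) =
        (\<Oplus>\<^bsub>Mod B Y\<^esub>i\<in>{..<r}. c i \<odot>[B,Y] mres B W Y (e i))" if "c \<in> {..<r} \<rightarrow>\<^sub>E F Y" for c
    proof (rule M.M.finsum_cong')
      show "(\<lambda>i. c i \<odot>[B,Y] mres B W Y (e i)) \<in> {..<r} \<rightarrow> Bc Y"
        using that e B_res[OF opens_openin[OF W(1)] opens_trans[OF Z(1) Y]] by (auto intro!: M.smult_closed)
      show "c i \<odot>[B,Y] mres B ?Z Y (mres B W ?Z (e i)) = c i \<odot>[B,Y] mres B W Y (e i)"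
        if "i \<in> {..<r}" for i using B_res_res[OF opens_openin[OF W(1)] Z(1) Y e] that by simp
    qed simp
    ultimately show "\<exists>!c. c \<in> {..<r} \<rightarrow>\<^sub>E F Y \<and>
        m = (\<Oplus>\<^bsub>Mod B Y\<^esub>i\<in>{..<r}. c i \<odot>[B,Y] mres B ?Z Y (mres B W ?Z (e i)))"
      by (simp cong: conj_cong)
  qed
  note fr = this
  let ?a = "mres B V ?Z a" and ?b = "mres B V ?Z b" and ?f = "restrict f ?Z"
  have xZ: "x \<in> ?Z" using W(2) x by blast
  note ab = B_res[OF V Z(2) a] B_res[OF V Z(2) b]
  note fZ = F_restrict[OF f Z(2)]
  have "ac ?Z (br ?Z ?a ?b) ?f x = ac ?Z ?a (ac ?Z ?b ?f) x - ac ?Z ?b (ac ?Z ?a ?f) x"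
    by (rule ac_br_frame[OF Z(3) ab fZ xZ fr])
  then show ?thesis
    using ac_restrict[OF V brD(1)[OF V a b] f Z(2)] brD(3)[OF V a b Z(2)]
      ac_restrict[OF V a ac_closed[OF V b f] Z(2)] ac_restrict[OF V b f Z(2)]
      ac_restrict[OF V b ac_closed[OF V a f] Z(2)] ac_restrict[OF V a f Z(2)] xZ
    by (metis restrict_apply')
qed

end

section \<open>Sheaves with an action of functions\<close>

text \<open>\<open>K\<close> is merely a multiplicative system: all of \<open>OXP\<close> for
  modules, the units for torsors. Addition is left out so that line bundles and torsors share one
  theory of generators and values.\<close>

locale act_sheaf =
  fixes X :: "'x topology" and U :: "'x set" and K :: "'x set \<Rightarrow> 'x cfun set"
    and S :: "'x set \<Rightarrow> 'a set" and r :: "'x set \<Rightarrow> 'x set \<Rightarrow> 'a \<Rightarrow> 'a"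
    and a :: "'x set \<Rightarrow> 'x cfun \<Rightarrow> 'a \<Rightarrow> 'a"
  assumes sheaf: "sheaf_on X U S r"
    and K_ext: "V \<in> opens X U \<Longrightarrow> k \<in> K V \<Longrightarrow> k \<in> extensional V"
    and K_one: "V \<in> opens X U \<Longrightarrow> (\<lambda>x\<in>V. 1) \<in> K V"
    and K_mult: "V \<in> opens X U \<Longrightarrow> k \<in> K V \<Longrightarrow> l \<in> K V \<Longrightarrow> (\<lambda>x\<in>V. k x * l x) \<in> K V"
    and K_restrict: "V \<in> opens X U \<Longrightarrow> k \<in> K V \<Longrightarrow> W \<in> opens X V \<Longrightarrow> restrict k W \<in> K W"
    and act_closed: "V \<in> opens X U \<Longrightarrow> k \<in> K V \<Longrightarrow> m \<in> S V \<Longrightarrow> a V k m \<in> S V"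
    and act_one: "V \<in> opens X U \<Longrightarrow> m \<in> S V \<Longrightarrow> a V (\<lambda>x\<in>V. 1) m = m"
    and act_mult: "V \<in> opens X U \<Longrightarrow> k \<in> K V \<Longrightarrow> l \<in> K V \<Longrightarrow> m \<in> S V \<Longrightarrow>
      a V (\<lambda>x\<in>V. k x * l x) m = a V k (a V l m)"
    and act_res: "V \<in> opens X U \<Longrightarrow> k \<in> K V \<Longrightarrow> m \<in> S V \<Longrightarrow> W \<in> opens X V \<Longrightarrow>
      r V W (a V k m) = a W (restrict k W) (r V W m)"
begin

text \<open>For \<open>OXP\<close> this is a frame of a line bundle, for the units it is any section
  of a torsor. Freeness is asked over all smaller open sets, whose sections need not extend to
  \<open>V\<close>.\<close>

definition generator :: "'x set \<Rightarrow> 'a \<Rightarrow> bool" where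
  "generator V q \<longleftrightarrow> V \<in> opens X U \<and> q \<in> S V \<and>
     (\<forall>W\<in>opens X V. \<forall>m\<in>S W. \<exists>!k. k \<in> K W \<and> m = a W k (r V W q))"

lemmas res_id = sheaf_onD(1)[OF sheaf]
lemmas res_closed = sheaf_onD(2)[OF sheaf]
lemmas res_res = sheaf_onD(3)[OF sheaf]

lemma generatorD:
  assumes "generator V q"
  shows "V \<in> opens X U" "q \<in> S V"
    and "W \<in> opens X V \<Longrightarrow> m \<in> S W \<Longrightarrow> \<exists>k\<in>K W. m = a W k (r V W q)"
    and "W \<in> opens X V \<Longrightarrow> k \<in> K W \<Longrightarrow> l \<in> K W \<Longrightarrow> a W k (r V W q) = a W l (r V W q) \<Longrightarrow> k = l"
proof -
  show V: "V \<in> opens X U" and q: "q \<in> S V" using assms by (auto simp: generator_def)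
  have ex: "\<exists>!k. k \<in> K W \<and> m = a W k (r V W q)" if "W \<in> opens X V" "m \<in> S W" for W m
    using assms that unfolding generator_def by blast
  show "W \<in> opens X V \<Longrightarrow> m \<in> S W \<Longrightarrow> \<exists>k\<in>K W. m = a W k (r V W q)" using ex[of W m] by blast
  assume W: "W \<in> opens X V" and k: "k \<in> K W" "l \<in> K W" "a W k (r V W q) = a W l (r V W q)"
  have "a W k (r V W q) \<in> S W"
    by (rule act_closed[OF opens_trans[OF V W] k(1) res_closed[OF V q W]])
  from ex1_eqI[OF ex[OF W this], of k l] k show "k = l" by simp
qed

lemma generator_res:
  assumes g: "generator V q" and W: "W \<in> opens X V"
  shows "generator W (r V W q)"
  unfolding generator_def
proof (intro conjI ballI)
  note V = generatorD(1,2)[OF g]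
  show "W \<in> opens X U" "r V W q \<in> S W" using opens_trans[OF V(1) W] res_closed[OF V W] by auto
  fix Z m assume Z: "Z \<in> opens X W" and m: "m \<in> S Z"
  show "\<exists>!k. k \<in> K Z \<and> m = a Z k (r W Z (r V W q))"
    using g opens_trans[OF W Z] m unfolding generator_def res_res[OF V W Z] by blast
qed

text \<open>A value map realizes the sections as functions.\<close>

definition is_val :: "('x set \<Rightarrow> 'a \<Rightarrow> 'x cfun) \<Rightarrow> bool" where
  "is_val val \<longleftrightarrow> (\<forall>V\<in>opens X U. \<forall>m\<in>S V. val V m \<in> extensional V \<and>
     (\<forall>W\<in>opens X V. val W (r V W m) = restrict (val V m) W) \<and>
     (\<forall>k\<in>K V. val V (a V k m) = (\<lambda>x\<in>V. k x * val V m x)) \<and>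
     (\<forall>m'\<in>S V. val V m = val V m' \<longrightarrow> m = m')) \<and>
     (\<forall>V q. generator V q \<longrightarrow> (\<forall>x\<in>V. val V q x \<noteq> 0))"

lemma is_valD:
  assumes "is_val val" "V \<in> opens X U" "m \<in> S V"
  shows "val V m \<in> extensional V"
    and "W \<in> opens X V \<Longrightarrow> val W (r V W m) = restrict (val V m) W"
    and "k \<in> K V \<Longrightarrow> val V (a V k m) = (\<lambda>x\<in>V. k x * val V m x)"
    and "m' \<in> S V \<Longrightarrow> val V m = val V m' \<Longrightarrow> m = m'"
  using assms unfolding is_val_def by blast+

lemma is_val_nz: "is_val val \<Longrightarrow> generator V q \<Longrightarrow> x \<in> V \<Longrightarrow> val V q x \<noteq> 0"
  unfolding is_val_def by blast

text \<open>Each point gets a generator of its own, and a section is evaluated at the point by its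
  coefficient. Unrelated generators at different points do no harm, because every requirement in
  \<open>is_val\<close> can be checked one point at a time.\<close>

lemma val_exists:
  assumes cover: "\<And>x. x \<in> U \<Longrightarrow> \<exists>V q. x \<in> V \<and> generator V q"
  shows "\<exists>val. is_val val"
proof -
  obtain N q where N: "\<And>x. x \<in> U \<Longrightarrow> x \<in> N x \<and> generator (N x) (q x)"
    using cover by metis
  \<comment> \<open>\<open>kf V m x\<close> is a function around \<open>x\<close>, but
    \<open>val\<close> keeps only its value at \<open>x\<close> itself, so the generators
    \<open>q x\<close> never have to be compared with each other.\<close>
  define kf where "kf V m x = (THE k. k \<in> K (V \<inter> N x) \<and> r V (V \<inter> N x) m = a (V \<inter> N x) k (r (N x) (V \<inter> N x) (q x)))" for V m x
  define val where "val V m = (\<lambda>x\<in>V. kf V m x x)" for V m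
  have VN: "V \<inter> N x \<in> opens X V" "V \<inter> N x \<in> opens X (N x)" "N x \<in> opens X U" "x \<in> N x"
    "generator (N x) (q x)" if "V \<in> opens X U" "x \<in> V" for V x
  proof -
    have x: "x \<in> U" using that opens_subset by blast
    show "generator (N x) (q x)" "x \<in> N x" using N[OF x] by auto
    then show "N x \<in> opens X U" using generatorD(1) by blast
    then show "V \<inter> N x \<in> opens X V" "V \<inter> N x \<in> opens X (N x)"
      by (rule opens_Int[OF that(1) opens_openin], rule opens_Int'[OF _ opens_openin[OF that(1)]])
  qed
  have kf_eq: "kf V m x = k"
    if V: "V \<in> opens X U" "x \<in> V" and k: "k \<in> K (V \<inter> N x)"
      "r V (V \<inter> N x) m = a (V \<inter> N x) k (r (N x) (V \<inter> N x) (q x))" for V m x k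
    unfolding kf_def
  proof (rule the_equality)
    fix l assume "l \<in> K (V \<inter> N x) \<and> r V (V \<inter> N x) m = a (V \<inter> N x) l (r (N x) (V \<inter> N x) (q x))"
    then show "l = k" using generatorD(4)[OF VN(5)[OF V] VN(2)[OF V]] k by metis
  qed (use k in blast)
  have kf_ex: "\<exists>k\<in>K (V \<inter> N x). r V (V \<inter> N x) m = a (V \<inter> N x) k (r (N x) (V \<inter> N x) (q x))"
    if V: "V \<in> opens X U" "x \<in> V" and m: "m \<in> S V" for V x m
    by (rule generatorD(3)[OF VN(5)[OF V] VN(2)[OF V] res_closed[OF V(1) m VN(1)[OF V]]])
  have val_res: "val W (r V W m) = restrict (val V m) W"
    if V: "V \<in> opens X U" and m: "m \<in> S V" and W: "W \<in> opens X V" for V W m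
  proof (rule extensionalityI[of _ W])
    fix x assume x: "x \<in> W"
    then have xV: "x \<in> V" using W opens_subset by blast
    have WU: "W \<in> opens X U" by (rule opens_trans[OF V W])
    let ?Z = "V \<inter> N x" and ?Y = "W \<inter> N x"
    obtain k where k: "k \<in> K ?Z" "r V ?Z m = a ?Z k (r (N x) ?Z (q x))" using kf_ex[OF V xV m] by blast
    have ZU: "?Z \<in> opens X U" using opens_trans[OF V VN(1)[OF V xV]] .
    have YZ: "?Y \<in> opens X ?Z"
      using opens_openin[OF VN(1)[OF WU x]] opens_subset[OF W] by (auto intro: opensI)
    note qx = generatorD(1,2)[OF VN(5)[OF V xV]]
    have "r W ?Y (r V W m) = r ?Z ?Y (r V ?Z m)"
      using res_res[OF V m W VN(1)[OF WU x]] res_res[OF V m VN(1)[OF V xV] YZ] by simp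
    also have "\<dots> = a ?Y (restrict k ?Y) (r (N x) ?Y (q x))"
      unfolding k(2) act_res[OF ZU k(1) res_closed[OF qx VN(2)[OF V xV]] YZ] res_res[OF qx VN(2)[OF V xV] YZ] ..
    finally have "kf W (r V W m) x = restrict k ?Y" by (rule kf_eq[OF WU x K_restrict[OF ZU k(1) YZ]])
    then show "val W (r V W m) x = restrict (val V m) W x"
      using kf_eq[OF V xV k] x xV VN(4)[OF V xV] by (simp add: val_def)
  qed (auto simp: val_def restrict_def extensional_def)
  have val_act: "val V (a V k m) = (\<lambda>x\<in>V. k x * val V m x)"
    if V: "V \<in> opens X U" and m: "m \<in> S V" and k: "k \<in> K V" for V m k
  proof (rule extensionalityI[of _ V])
    fix x assume x: "x \<in> V"
    let ?Z = "V \<inter> N x"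
    obtain l where l: "l \<in> K ?Z" "r V ?Z m = a ?Z l (r (N x) ?Z (q x))" using kf_ex[OF V x m] by blast
    have ZU: "?Z \<in> opens X U" using opens_trans[OF V VN(1)[OF V x]] .
    have kZ: "restrict k ?Z \<in> K ?Z" by (rule K_restrict[OF V k VN(1)[OF V x]])
    note qx = generatorD(1,2)[OF VN(5)[OF V x]]
    have "r V ?Z (a V k m) = a ?Z (\<lambda>x\<in>?Z. restrict k ?Z x * l x) (r (N x) ?Z (q x))"
      unfolding act_res[OF V k m VN(1)[OF V x]] l(2)
      by (rule act_mult[symmetric, OF ZU kZ l(1) res_closed[OF qx VN(2)[OF V x]]])
    from kf_eq[OF V x K_mult[OF ZU kZ l(1)] this] kf_eq[OF V x l]
    show "val V (a V k m) x = (\<lambda>x\<in>V. k x * val V m x) x"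
      using x VN(4)[OF V x] by (simp add: val_def)
  qed (simp_all add: val_def)
  \<comment> \<open>Expressing \<open>q x\<close> back through \<open>p\<close> produces an inverse
    of the coefficient \<open>k\<close>, so \<open>k\<close> has no zero.\<close>
  have nz: "val V p x \<noteq> 0" if p: "generator V p" and x: "x \<in> V" for V p x
  proof -
    note V = generatorD(1,2)[OF p]
    let ?Z = "V \<inter> N x"
    have ZU: "?Z \<in> opens X U" using opens_trans[OF V(1) VN(1)[OF V(1) x]] .
    note qx = generatorD(1,2)[OF VN(5)[OF V(1) x]]
    note qZ = res_closed[OF qx VN(2)[OF V(1) x]]
    obtain k where k: "k \<in> K ?Z" "r V ?Z p = a ?Z k (r (N x) ?Z (q x))" using kf_ex[OF V(1) x V(2)] by blast
    obtain l where l: "l \<in> K ?Z" "r (N x) ?Z (q x) = a ?Z l (r V ?Z p)"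
      using generatorD(3)[OF p VN(1)[OF V(1) x] qZ] by blast
    have "a ?Z (\<lambda>x\<in>?Z. l x * k x) (r (N x) ?Z (q x)) = a ?Z (\<lambda>x\<in>?Z. 1) (r (N x) ?Z (q x))"
      unfolding act_mult[OF ZU l(1) k(1) qZ] act_one[OF ZU qZ] using k l by metis
    from generatorD(4)[OF VN(5)[OF V(1) x] VN(2)[OF V(1) x] K_mult[OF ZU l(1) k(1)] K_one[OF ZU] this]
    have "(\<lambda>x\<in>?Z. l x * k x) x = (\<lambda>x\<in>?Z. 1) x" by (rule fun_cong)
    then have "k x \<noteq> 0" using x VN(4)[OF V(1) x] by auto
    then show ?thesis using kf_eq[OF V(1) x k] x by (simp add: val_def)
  qed
  \<comment> \<open>With respect to one common generator equal values give equal coefficients, since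
    the values of a generator can be cancelled.\<close>
  have inj: "m = m'" if V: "V \<in> opens X U" and m: "m \<in> S V" "m' \<in> S V" and eq: "val V m = val V m'" for V m m'
  proof (rule sheaf_sep[OF sheaf V m])
    fix x assume x: "x \<in> V"
    let ?Z = "V \<inter> N x"
    note ZV = VN(1)[OF V x]
    have ZU: "?Z \<in> opens X U" using opens_trans[OF V ZV] .
    note g = generator_res[OF VN(5)[OF V x] VN(2)[OF V x]]
    obtain k where k: "k \<in> K ?Z" "r V ?Z m = a ?Z k (r (N x) ?Z (q x))" using kf_ex[OF V x m(1)] by blast
    obtain l where l: "l \<in> K ?Z" "r V ?Z m' = a ?Z l (r (N x) ?Z (q x))" using kf_ex[OF V x m(2)] by blast
    have "k = l"
    proof (rule extensionalityI[OF K_ext[OF ZU k(1)] K_ext[OF ZU l(1)]])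
      fix y assume y: "y \<in> ?Z"
      have "val ?Z (r V ?Z m) y = val ?Z (r V ?Z m') y"
        unfolding val_res[OF V m(1) ZV] val_res[OF V m(2) ZV] eq ..
      then have "k y * val ?Z (r (N x) ?Z (q x)) y = l y * val ?Z (r (N x) ?Z (q x)) y"
        unfolding k(2) l(2) val_act[OF ZU generatorD(2)[OF g] k(1)] val_act[OF ZU generatorD(2)[OF g] l(1)]
        using y by simp
      then show "k y = l y" using nz[OF g y] by simp
    qed
    then show "\<exists>W\<in>opens X V. x \<in> W \<and> r V W m = r V W m'"
      using ZV x VN(4)[OF V x] k l by (intro bexI[of _ ?Z]) auto
  qed
  have "is_val val"
    unfolding is_val_def using val_res val_act nz inj by (auto simp: val_def)
  then show ?thesis by blast
qed

end

section \<open>Equivariant maps prescribed on generators\<close>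

definition equivariant :: "'x topology \<Rightarrow> 'x set \<Rightarrow> ('x set \<Rightarrow> 'x cfun set) \<Rightarrow> ('x set \<Rightarrow> 'a set)
    \<Rightarrow> ('x set \<Rightarrow> 'x set \<Rightarrow> 'a \<Rightarrow> 'a) \<Rightarrow> ('x set \<Rightarrow> 'x cfun \<Rightarrow> 'a \<Rightarrow> 'a) \<Rightarrow> ('x set \<Rightarrow> 'c set)
    \<Rightarrow> ('x set \<Rightarrow> 'x set \<Rightarrow> 'c \<Rightarrow> 'c) \<Rightarrow> ('x set \<Rightarrow> 'x cfun \<Rightarrow> 'c \<Rightarrow> 'c) \<Rightarrow> ('x set \<Rightarrow> 'a \<Rightarrow> 'c) \<Rightarrow> bool" where
  "equivariant X U K S r a S' r' a' h \<longleftrightarrow> (\<forall>V\<in>opens X U. \<forall>m\<in>S V. h V m \<in> S' V \<and>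
     (\<forall>W\<in>opens X V. h W (r V W m) = r' V W (h V m)) \<and> (\<forall>k\<in>K V. h V (a V k m) = a' V k (h V m)))"

lemma equivariantD:
  assumes "equivariant X U K S r a S' r' a' h" "V \<in> opens X U" "m \<in> S V"
  shows "h V m \<in> S' V" "W \<in> opens X V \<Longrightarrow> h W (r V W m) = r' V W (h V m)"
    "k \<in> K V \<Longrightarrow> h V (a V k m) = a' V k (h V m)"
  using assms unfolding equivariant_def by blast+

text \<open>Near any point a section is a multiple of a generator on which the maps agree, and both
  maps commute with multiples and with restriction.\<close>

lemma generator_unique:
  assumes S: "act_sheaf X U K S r a" and S': "act_sheaf X U K S' r' a'"
    and h: "equivariant X U K S r a S' r' a' h" and h': "equivariant X U K S r a S' r' a' h'"
    and cover: "\<And>x. x \<in> U \<Longrightarrow> \<exists>V q. x \<in> V \<and> act_sheaf.generator X U K S r a V q \<and> h V q = h' V q"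
    and V: "V \<in> opens X U" and m: "m \<in> S V"
  shows "h V m = h' V m"
proof (rule sheaf_sep[OF act_sheaf.sheaf[OF S'] V equivariantD(1)[OF h V m] equivariantD(1)[OF h' V m]])
  interpret S: act_sheaf X U K S r a by (rule S)
  interpret S': act_sheaf X U K S' r' a' by (rule S')
  fix x assume x: "x \<in> V"
  then obtain N q where N: "x \<in> N" "S.generator N q" "h N q = h' N q" using cover opens_subset[OF V] by blast
  note q = S.generatorD(1,2)[OF N(2)]
  let ?Z = "V \<inter> N"
  have Z: "?Z \<in> opens X V" "?Z \<in> opens X N"
    using opens_Int[OF V opens_openin[OF q(1)]] opens_Int'[OF q(1) opens_openin[OF V]] by auto
  have ZU: "?Z \<in> opens X U" by (rule opens_trans[OF V Z(1)])
  obtain k where k: "k \<in> K ?Z" "r V ?Z m = a ?Z k (r N ?Z q)"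
    using S.generatorD(3)[OF N(2) Z(2) S.res_closed[OF V m Z(1)]] by blast
  have "g ?Z (r V ?Z m) = a' ?Z k (r' N ?Z (g N q))" if g: "equivariant X U K S r a S' r' a' g" for g
    unfolding k(2) using equivariantD(3)[OF g ZU S.res_closed[OF q Z(2)] k(1)] equivariantD(2)[OF g q Z(2)] by simp
  from this[OF h] this[OF h'] N(3)
  have "r' V ?Z (h V m) = r' V ?Z (h' V m)"
    using equivariantD(2)[OF h V m Z(1)] equivariantD(2)[OF h' V m Z(1)] by simp
  then show "\<exists>W\<in>opens X V. x \<in> W \<and> r' V W (h V m) = r' V W (h' V m)"
    using Z(1) x N(1) by blast
qed

text \<open>The map is forced on multiples of the prescribed generators. By \<open>compat\<close>
  source and target change by the same function from one generator to another, so the result does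
  not depend on the generator. Torsor morphisms, linear maps of line bundles and maps out of tensor
  products are all built in this way.\<close>

lemma generator_extend:
  assumes S: "act_sheaf X U K S r a" and S': "act_sheaf X U K S' r' a'"
    and D: "\<And>V q q'. (V, q, q') \<in> D \<Longrightarrow> act_sheaf.generator X U K S r a V q \<and> q' \<in> S' V"
    and cover: "\<And>x. x \<in> U \<Longrightarrow> \<exists>V q q'. x \<in> V \<and> (V, q, q') \<in> D"
    and compat: "\<And>V q q' W p p' Z. (V, q, q') \<in> D \<Longrightarrow> (W, p, p') \<in> D \<Longrightarrow> Z \<in> opens X V \<Longrightarrow> Z \<in> opens X W \<Longrightarrow>
      \<exists>k\<in>K Z. r W Z p = a Z k (r V Z q) \<and> r' W Z p' = a' Z k (r' V Z q')"
  shows "\<exists>h\<in>ext_family X U S. equivariant X U K S r a S' r' a' h \<and> (\<forall>(V, q, q')\<in>D. h V q = q')"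
proof -
  interpret S: act_sheaf X U K S r a by (rule S)
  interpret S': act_sheaf X U K S' r' a' by (rule S')
  define Rel where "Rel Z m m' \<longleftrightarrow> Z \<in> opens X U \<and> (\<exists>V q q' k. (V, q, q') \<in> D \<and> Z \<in> opens X V \<and> k \<in> K Z \<and>
    m = a Z k (r V Z q) \<and> m' = a' Z k (r' V Z q'))" for Z m m'
  have gen: "S.generator V q" "V \<in> opens X U" "q \<in> S V" "q' \<in> S' V" if "(V, q, q') \<in> D" for V q q'
    using D[OF that] S.generatorD by auto
  have Rel_res: "Rel W (r V W m) (r' V W m')" if R: "Rel V m m'" and W: "W \<in> opens X V" for V W m m'
  proof -
    obtain N q q' k where N: "V \<in> opens X U" "(N, q, q') \<in> D" "V \<in> opens X N" "k \<in> K V"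
      "m = a V k (r N V q)" "m' = a' V k (r' N V q')" using R unfolding Rel_def by blast
    note g = gen[OF N(2)]
    have "r V W m = a W (restrict k W) (r N W q)"
      unfolding N(5) S.act_res[OF N(1,4) S.res_closed[OF g(2,3) N(3)] W] S.res_res[OF g(2,3) N(3) W] ..
    moreover have "r' V W m' = a' W (restrict k W) (r' N W q')"
      unfolding N(6) S'.act_res[OF N(1,4) S'.res_closed[OF g(2,4) N(3)] W] S'.res_res[OF g(2,4) N(3) W] ..
    ultimately show ?thesis
      unfolding Rel_def using opens_trans[OF N(1) W] N(2) opens_trans[OF N(3) W] S.K_restrict[OF N(1,4) W] by blast
  qed
  have Rel_act: "Rel V (a V l m) (a' V l m')" if R: "Rel V m m'" and l: "l \<in> K V" for V l m m'
  proof -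
    obtain N q q' k where N: "V \<in> opens X U" "(N, q, q') \<in> D" "V \<in> opens X N" "k \<in> K V"
      "m = a V k (r N V q)" "m' = a' V k (r' N V q')" using R unfolding Rel_def by blast
    note g = gen[OF N(2)]
    have "a V l m = a V (\<lambda>x\<in>V. l x * k x) (r N V q)"
      unfolding N(5) by (rule S.act_mult[symmetric, OF N(1) l N(4) S.res_closed[OF g(2,3) N(3)]])
    moreover have "a' V l m' = a' V (\<lambda>x\<in>V. l x * k x) (r' N V q')"
      unfolding N(6) by (rule S'.act_mult[symmetric, OF N(1) l N(4) S'.res_closed[OF g(2,4) N(3)]])
    ultimately show ?thesis
      unfolding Rel_def using N(1-3) S.K_mult[OF N(1) l N(4)] by blast
  qed
  have Rel_loc: "\<exists>W\<in>opens X V. x \<in> W \<and> (\<exists>m'. Rel W (r V W m) m')"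
    if V: "V \<in> opens X U" and m: "m \<in> S V" and x: "x \<in> V" for V m x
  proof -
    obtain N q q' where N: "x \<in> N" "(N, q, q') \<in> D" using cover x opens_subset[OF V] by blast
    note g = gen[OF N(2)]
    let ?Z = "V \<inter> N"
    have Z: "?Z \<in> opens X V" "?Z \<in> opens X N"
      using opens_Int[OF V opens_openin[OF g(2)]] opens_Int'[OF g(2) opens_openin[OF V]] by auto
    obtain k where k: "k \<in> K ?Z" "r V ?Z m = a ?Z k (r N ?Z q)"
      using S.generatorD(3)[OF g(1) Z(2) S.res_closed[OF V m Z(1)]] by blast
    then have "Rel ?Z (r V ?Z m) (a' ?Z k (r' N ?Z q'))"
      unfolding Rel_def using opens_trans[OF V Z(1)] N(2) Z(2) by blast
    then show ?thesis using Z(1) x N(1) by blast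
  qed
  have "\<exists>h\<in>ext_family X U S. (\<forall>V\<in>opens X U. \<forall>m\<in>S V. h V m \<in> S' V \<and>
      (\<forall>W\<in>opens X V. h W (r V W m) = r' V W (h V m))) \<and> (\<forall>V m m'. Rel V m m' \<longrightarrow> h V m = m')"
  proof (rule sheaf_map_ext[OF S.sheaf S'.sheaf _ Rel_res _ Rel_loc])
    fix V m m' assume "Rel V m m'"
    then obtain N q q' k where N: "V \<in> opens X U" "(N, q, q') \<in> D" "V \<in> opens X N" "k \<in> K V"
      "m = a V k (r N V q)" "m' = a' V k (r' N V q')" unfolding Rel_def by blast
    note g = gen[OF N(2)]
    show "V \<in> opens X U \<and> m \<in> S V \<and> m' \<in> S' V"
      using N S.act_closed[OF N(1,4) S.res_closed[OF g(2,3) N(3)]]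
        S'.act_closed[OF N(1,4) S'.res_closed[OF g(2,4) N(3)]] by blast
  next
    fix V m m' m'' assume R: "Rel V m m'" "Rel V m m''"
    obtain N q q' k where N: "V \<in> opens X U" "(N, q, q') \<in> D" "V \<in> opens X N" "k \<in> K V"
      "m = a V k (r N V q)" "m' = a' V k (r' N V q')" using R(1) unfolding Rel_def by blast
    obtain M p p' l where M: "(M, p, p') \<in> D" "V \<in> opens X M" "l \<in> K V"
      "m = a V l (r M V p)" "m'' = a' V l (r' M V p')" using R(2) unfolding Rel_def by blast
    note g = gen[OF N(2)]
    \<comment> \<open>\<open>j\<close> is the transition function between the two generators, common
      to source and target; freeness of the source then gives \<open>k = l * j\<close>.\<close>
    obtain j where j: "j \<in> K V" "r M V p = a V j (r N V q)" "r' M V p' = a' V j (r' N V q')"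
      using compat[OF N(2) M(1) N(3) M(2)] by blast
    have "a V k (r N V q) = a V (\<lambda>x\<in>V. l x * j x) (r N V q)"
      using N(5) M(4) j(2) S.act_mult[OF N(1) M(3) j(1) S.res_closed[OF g(2,3) N(3)]] by simp
    then have "k = (\<lambda>x\<in>V. l x * j x)"
      using S.generatorD(4)[OF g(1) N(3) N(4) S.K_mult[OF N(1) M(3) j(1)]] by blast
    then show "m' = m''"
      using N(6) M(5) j(3) S'.act_mult[OF N(1) M(3) j(1) S'.res_closed[OF g(2,4) N(3)]] by simp
  qed
  then obtain h where h: "h \<in> ext_family X U S"
    "\<And>V m. V \<in> opens X U \<Longrightarrow> m \<in> S V \<Longrightarrow> h V m \<in> S' V"
    "\<And>V m W. V \<in> opens X U \<Longrightarrow> m \<in> S V \<Longrightarrow> W \<in> opens X V \<Longrightarrow> h W (r V W m) = r' V W (h V m)"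
    "\<And>V m m'. Rel V m m' \<Longrightarrow> h V m = m'" by blast
  have hact: "h V (a V k m) = a' V k (h V m)" if V: "V \<in> opens X U" and m: "m \<in> S V" and k: "k \<in> K V" for V m k
  proof (rule sheaf_sep[OF S'.sheaf V h(2)[OF V S.act_closed[OF V k m]] S'.act_closed[OF V k h(2)[OF V m]]])
    fix x assume "x \<in> V"
    then obtain W m' where W: "W \<in> opens X V" "x \<in> W" "Rel W (r V W m) m'" using Rel_loc[OF V m] by blast
    have "r' V W (h V (a V k m)) = h W (a W (restrict k W) (r V W m))"
      using h(3)[OF V S.act_closed[OF V k m] W(1)] S.act_res[OF V k m W(1)] by simp
    also have "\<dots> = a' W (restrict k W) m'"
      by (rule h(4)[OF Rel_act[OF W(3) S.K_restrict[OF V k W(1)]]])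
    also have "m' = r' V W (h V m)" using h(3)[OF V m W(1)] h(4)[OF W(3)] by simp
    also have "a' W (restrict k W) (r' V W (h V m)) = r' V W (a' V k (h V m))"
      using S'.act_res[OF V k h(2)[OF V m] W(1)] by simp
    finally show "\<exists>W\<in>opens X V. x \<in> W \<and> r' V W (h V (a V k m)) = r' V W (a' V k (h V m))" using W by blast
  qed
  have hD: "h V q = q'" if d: "(V, q, q') \<in> D" for V q q'
  proof (rule h(4))
    note g = gen[OF d]
    note VV = opens_self[OF opens_openin[OF g(2)]]
    have "q = a V (\<lambda>x\<in>V. 1) (r V V q)" "q' = a' V (\<lambda>x\<in>V. 1) (r' V V q')"
      using S.act_one[OF g(2,3)] S.res_id[OF g(2,3)] S'.act_one[OF g(2,4)] S'.res_id[OF g(2,4)] by simp_all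
    then show "Rel V q q'" unfolding Rel_def using g(2) d VV S.K_one[OF g(2)] by blast
  qed
  show ?thesis
    using h(1) h(2,3) hact hD unfolding equivariant_def by (intro bexI[of _ h]) auto
qed

section \<open>Units and closed forms\<close>

lemma form_args_1: "form_args M (Suc 0) V = {[b] | b. b \<in> carrier (Mod M V)}"
  by (auto simp: form_args_def length_Suc_conv)

lemma form_args_1_ball: "(\<forall>bs\<in>form_args M (Suc 0) V. Q bs) \<longleftrightarrow> (\<forall>b\<in>carrier (Mod M V). Q [b])"
  by (auto simp: form_args_1)

lemma form_args_2: "form_args M (Suc (Suc 0)) V = {[b, b'] | b b'. b \<in> carrier (Mod M V) \<and> b' \<in> carrier (Mod M V)}"
  by (auto simp: form_args_def length_Suc_conv)

context smooth_algebroid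
begin

definition Uts :: "'x set \<Rightarrow> 'x cfun set" where
  "Uts V = {f \<in> F V. \<forall>x\<in>V. f x \<noteq> 0}"

abbreviation "FO U L \<equiv> F_Ob X A P B U L"
abbreviation "nab U L V \<equiv> nabla X A P B U L V"
abbreviation "G \<equiv> Ounits X A P"
abbreviation "H \<equiv> Omega1cl X A P B"
abbreviation "d \<equiv> dlog X B"
abbreviation "TMor U S T \<equiv> Tors_Mor X G H d U S T"
abbreviation "Cl V \<equiv> carrier (Grp (Omega1cl X A P B) V)"

lemma UtsD: "f \<in> Uts V \<Longrightarrow> f \<in> F V" "f \<in> Uts V \<Longrightarrow> x \<in> V \<Longrightarrow> f x \<noteq> 0"
  by (auto simp: Uts_def)

text \<open>The pointwise inverse of a nowhere zero function is again killed by \<open>P\<close>, by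
  the quotient rule; the other inclusion evaluates the product at a point.\<close>

lemma Units_R: "openin X V \<Longrightarrow> Units (R V) = Uts V"
proof (intro equalityI subsetI)
  fix f assume V: "openin X V" and "f \<in> Units (R V)"
  then obtain g where f: "f \<in> F V" and g: "(\<lambda>x\<in>V. g x * f x) = (\<lambda>x\<in>V. 1)"
    by (auto simp: Units_def OXP_simps)
  have "f x \<noteq> 0" if "x \<in> V" for x using fun_cong[OF g, of x] that by auto
  then show "f \<in> Uts V" using f by (simp add: Uts_def)
next
  fix f assume V: "openin X V" and f: "f \<in> Uts V"
  have "(\<lambda>x\<in>V. inverse (f x)) \<in> F V" by (rule F_inverse[OF V UtsD(1)[OF f] UtsD(2)[OF f]])
  moreover have "(\<lambda>x\<in>V. (\<lambda>x\<in>V. inverse (f x)) x * f x) = (\<lambda>x\<in>V. 1)"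
    "(\<lambda>x\<in>V. f x * (\<lambda>x\<in>V. inverse (f x)) x) = (\<lambda>x\<in>V. 1)"
    using UtsD(2)[OF f] by (auto simp: restrict_def fun_eq_iff)
  ultimately show "f \<in> Units (R V)" using UtsD(1)[OF f] unfolding Units_def OXP_simps by blast
qed

lemma G_simps:
  "openin X V \<Longrightarrow> carrier (Grp G V) = Uts V"
  "f \<otimes>[G,V] g = (\<lambda>x\<in>V. f x * g x)" "\<one>\<^bsub>Grp G V\<^esub> = (\<lambda>x\<in>V. 1)"
  "gres G V W f = restrict f W"
  by (simp_all add: Ounits_def units_of_def Units_R OXP_simps)

lemma Uts_one: "openin X V \<Longrightarrow> (\<lambda>x\<in>V. 1) \<in> Uts V"
  using F_const by (simp add: Uts_def)

lemma Uts_mult: "openin X V \<Longrightarrow> f \<in> Uts V \<Longrightarrow> g \<in> Uts V \<Longrightarrow> (\<lambda>x\<in>V. f x * g x) \<in> Uts V"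
  using F_mult by (simp add: Uts_def)

lemma Uts_restrict: "f \<in> Uts V \<Longrightarrow> W \<in> opens X V \<Longrightarrow> restrict f W \<in> Uts W"
  using F_restrict opens_subset by (fastforce simp: Uts_def)

section \<open>Closed one-forms and the logarithmic derivative\<close>

lemma ac_minus:
  assumes V: "openin X V" and b: "b \<in> Bc V" and f: "f \<in> F V" and x: "x \<in> V"
  shows "ac V b (\<lambda>x\<in>V. - f x) x = - ac V b f x"
proof -
  have "(\<lambda>x\<in>V. (\<lambda>x\<in>V. - 1) x * f x) = (\<lambda>x\<in>V. - f x)" by auto
  then show ?thesis
    using ac_mult[OF V b F_const[OF V, of "-1"] f x] ac_const[OF V b x, of "-1"] x by simp
qed

lemma ac_diff:
  assumes V: "openin X V" and b: "b \<in> Bc V" and f: "f \<in> F V" and g: "g \<in> F V" and x: "x \<in> V"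
  shows "ac V b (\<lambda>x\<in>V. f x - g x) x = ac V b f x - ac V b g x"
proof -
  have "(\<lambda>x\<in>V. f x + (\<lambda>x\<in>V. - g x) x) = (\<lambda>x\<in>V. f x - g x)" by auto
  then show ?thesis
    using ac_add[OF V b f F_minus[OF V g] x] ac_minus[OF V b g x] by simp
qed

text \<open>Solve the Leibniz rule for the product of \<open>u / f\<close> and
  \<open>f\<close>.\<close>

lemma ac_divide:
  assumes V: "openin X V" and b: "b \<in> Bc V" and u: "u \<in> F V" and f: "f \<in> Uts V" and x: "x \<in> V"
  shows "ac V b (\<lambda>x\<in>V. u x / f x) x = ac V b u x / f x - u x * ac V b f x / (f x * f x)"
proof -
  have uF: "(\<lambda>x\<in>V. u x / f x) \<in> F V" by (rule F_divide[OF V u UtsD(1)[OF f] UtsD(2)[OF f]])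
  have "(\<lambda>x\<in>V. (\<lambda>x\<in>V. u x / f x) x * f x) = u"
    using UtsD(2)[OF f] F_ext[OF u] by (auto simp: restrict_def fun_eq_iff extensional_def)
  then have "ac V b u x = ac V b (\<lambda>x\<in>V. u x / f x) x * f x + u x / f x * ac V b f x"
    using ac_mult[OF V b uF UtsD(1)[OF f] x] x by simp
  then show ?thesis using UtsD(2)[OF f x] by (simp add: field_simps)
qed

text \<open>The conditions on a closed one-form, freed from the list argument and from
  extensionality. A formula in \<open>b\<close> can be tested directly, and
  \<open>mk_form_Cl\<close> then packages it as a form.\<close>

definition closed_on :: "'x set \<Rightarrow> ('x set \<Rightarrow> 'b \<Rightarrow> 'x cfun) \<Rightarrow> bool" where
  "closed_on V \<eta> \<longleftrightarrow> (\<forall>W\<in>opens X V. \<forall>b\<in>Bc W. \<eta> W b \<in> F W \<and>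
     (\<forall>Z\<in>opens X W. \<eta> Z (mres B W Z b) = restrict (\<eta> W b) Z) \<and>
     (\<forall>b'\<in>Bc W. \<eta> W (b \<oplus>[B,W] b') = (\<lambda>x\<in>W. \<eta> W b x + \<eta> W b' x) \<and>
        (\<forall>x\<in>W. ac W b (\<eta> W b') x - ac W b' (\<eta> W b) x = \<eta> W (br W b b') x)) \<and>
     (\<forall>f\<in>F W. \<eta> W (f \<odot>[B,W] b) = (\<lambda>x\<in>W. f x * \<eta> W b x)))"

lemma closed_onD:
  assumes "closed_on V \<eta>" "W \<in> opens X V" "b \<in> Bc W"
  shows "\<eta> W b \<in> F W" and "Z \<in> opens X W \<Longrightarrow> \<eta> Z (mres B W Z b) = restrict (\<eta> W b) Z"
    and "b' \<in> Bc W \<Longrightarrow> \<eta> W (b \<oplus>[B,W] b') = (\<lambda>x\<in>W. \<eta> W b x + \<eta> W b' x)"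
    and "b' \<in> Bc W \<Longrightarrow> x \<in> W \<Longrightarrow> ac W b (\<eta> W b') x - ac W b' (\<eta> W b) x = \<eta> W (br W b b') x"
    and "f \<in> F W \<Longrightarrow> \<eta> W (f \<odot>[B,W] b) = (\<lambda>x\<in>W. f x * \<eta> W b x)"
  using assms unfolding closed_on_def by blast+

lemma dB_1:
  assumes "W \<in> opens X V" "b \<in> Bc W" "b' \<in> Bc W" "x \<in> W"
  shows "dB X B (Suc 0) V \<omega> W [b, b'] x = ac W b (\<omega> W [b']) x - ac W b' (\<omega> W [b]) x - \<omega> W [br W b b'] x"
  using assms by (simp add: ce_diff_def mk_form_def form_args_2 atMost_Suc lessThan_Suc drop_nth_def)

lemma forms_1:
  "\<omega> \<in> forms X R B (Suc 0) V \<longleftrightarrow> \<omega> \<in> ext_family X V (form_args B (Suc 0)) \<and>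
    (\<forall>W\<in>opens X V. \<forall>b\<in>Bc W. \<omega> W [b] \<in> F W \<and>
     (\<forall>Z\<in>opens X W. \<omega> Z [mres B W Z b] = restrict (\<omega> W [b]) Z) \<and>
     (\<forall>b'\<in>Bc W. \<omega> W [b \<oplus>[B,W] b'] = (\<lambda>x\<in>W. \<omega> W [b] x + \<omega> W [b'] x)) \<and>
     (\<forall>f\<in>F W. \<omega> W [f \<odot>[B,W] b] = (\<lambda>x\<in>W. f x * \<omega> W [b] x)))"
  unfolding forms_def form_args_1_ball mem_Collect_eq OXP_simps by simp

text \<open>In degree one the alternating condition is void, and a two-form vanishes once its values
  on pairs do; these are computed by \<open>dB_1\<close>.\<close>

lemma Cl_iff:
  assumes V: "openin X V"
  shows "\<omega> \<in> Cl V \<longleftrightarrow> \<omega> \<in> ext_family X V (form_args B (Suc 0)) \<and> closed_on V (\<lambda>W b. \<omega> W [b])"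
proof -
  have cl: "(dB X B (Suc 0) V \<omega> = mk_form X B (Suc (Suc 0)) V (\<lambda>V bs x. 0)) \<longleftrightarrow>
    (\<forall>W\<in>opens X V. \<forall>b\<in>Bc W. \<forall>b'\<in>Bc W. \<forall>x\<in>W. ac W b (\<omega> W [b']) x - ac W b' (\<omega> W [b]) x = \<omega> W [br W b b'] x)"
    (is "?l \<longleftrightarrow> ?r")
  proof
    assume l: ?l
    show ?r
    proof (intro ballI)
      fix W b b' x assume W: "W \<in> opens X V" "b \<in> Bc W" "b' \<in> Bc W" "x \<in> W"
      have "dB X B (Suc 0) V \<omega> W [b, b'] x = 0" unfolding l using W by (simp add: mk_form_def form_args_2)
      then show "ac W b (\<omega> W [b']) x - ac W b' (\<omega> W [b]) x = \<omega> W [br W b b'] x" using dB_1[OF W, of \<omega>] by simp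
    qed
  next
    assume r: ?r
    have ext: "dB X B (Suc 0) V \<omega> \<in> ext_family X V (form_args B (Suc (Suc 0)))"
      "mk_form X B (Suc (Suc 0)) V (\<lambda>V bs x. 0) \<in> ext_family X V (form_args B (Suc (Suc 0)))"
      by (simp_all add: ce_diff_def mk_form_def ext_family_def)
    show ?l
    proof (rule ext_family_eqI[OF ext])
      fix W bs assume W: "W \<in> opens X V" and bs: "bs \<in> form_args B (Suc (Suc 0)) W"
      obtain b b' where b: "bs = [b, b']" "b \<in> Bc W" "b' \<in> Bc W" using bs by (auto simp: form_args_2)
      show "dB X B (Suc 0) V \<omega> W bs = mk_form X B (Suc (Suc 0)) V (\<lambda>V bs x. 0) W bs"
      proof (rule extensionalityI[of _ W])
        show "dB X B (Suc 0) V \<omega> W bs \<in> extensional W" using W bs by (simp add: ce_diff_def mk_form_def)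
        show "mk_form X B (Suc (Suc 0)) V (\<lambda>V bs x. 0) W bs \<in> extensional W" using W bs by (simp add: mk_form_def)
        fix x assume x: "x \<in> W"
        have "dB X B (Suc 0) V \<omega> W bs x = 0"
          unfolding b(1) dB_1[OF W b(2,3) x] using r W b(2,3) x by simp
        then show "dB X B (Suc 0) V \<omega> W bs x = mk_form X B (Suc (Suc 0)) V (\<lambda>V bs x. 0) W bs x"
          using W bs x by (simp add: mk_form_def)
      qed
    qed
  qed
  have "\<omega> \<in> Cl V \<longleftrightarrow> \<omega> \<in> forms X R B (Suc 0) V \<and> dB X B (Suc 0) V \<omega> = mk_form X B (Suc (Suc 0)) V (\<lambda>V bs x. 0)"
    by (simp add: Omega1cl_def form_sheaf_def numeral_2_eq_2)
  then show ?thesis unfolding cl forms_1 closed_on_def by blast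
qed

lemma ClD:
  assumes "openin X V" "\<omega> \<in> Cl V" "W \<in> opens X V" "b \<in> Bc W"
  shows "\<omega> W [b] \<in> F W" and "Z \<in> opens X W \<Longrightarrow> \<omega> Z [mres B W Z b] = restrict (\<omega> W [b]) Z"
    and "b' \<in> Bc W \<Longrightarrow> \<omega> W [b \<oplus>[B,W] b'] = (\<lambda>x\<in>W. \<omega> W [b] x + \<omega> W [b'] x)"
    and "b' \<in> Bc W \<Longrightarrow> x \<in> W \<Longrightarrow> ac W b (\<omega> W [b']) x - ac W b' (\<omega> W [b]) x = \<omega> W [br W b b'] x"
    and "f \<in> F W \<Longrightarrow> \<omega> W [f \<odot>[B,W] b] = (\<lambda>x\<in>W. f x * \<omega> W [b] x)"
  using closed_onD[of V "\<lambda>W b. \<omega> W [b]", OF _ assms(3,4)] assms(2) Cl_iff[OF assms(1)] by auto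

lemma Cl_eqI:
  assumes V: "openin X V" and w: "\<omega> \<in> Cl V" "\<omega>' \<in> Cl V"
    and eq: "\<And>W b x. W \<in> opens X V \<Longrightarrow> b \<in> Bc W \<Longrightarrow> x \<in> W \<Longrightarrow> \<omega> W [b] x = \<omega>' W [b] x"
  shows "\<omega> = \<omega>'"
proof (rule ext_family_eqI[of _ X V "form_args B (Suc 0)"])
  show "\<omega> \<in> ext_family X V (form_args B (Suc 0))" "\<omega>' \<in> ext_family X V (form_args B (Suc 0))"
    using w Cl_iff[OF V] by auto
  fix W bs assume W: "W \<in> opens X V" and "bs \<in> form_args B (Suc 0) W"
  then obtain b where b: "bs = [b]" "b \<in> Bc W" by (auto simp: form_args_1)
  show "\<omega> W bs = \<omega>' W bs"
    unfolding b(1)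
    by (rule extensionalityI[OF F_ext[OF ClD(1)[OF V w(1) W b(2)]] F_ext[OF ClD(1)[OF V w(2) W b(2)]]])
       (rule eq[OF W b(2)])
qed

lemma closed_on_cong:
  assumes \<eta>: "closed_on V \<eta>" and eq: "\<And>W b. W \<in> opens X V \<Longrightarrow> b \<in> Bc W \<Longrightarrow> \<eta>' W b = \<eta> W b"
  shows "closed_on V \<eta>'"
  unfolding closed_on_def
proof (intro ballI conjI)
  fix W b assume W: "W \<in> opens X V" "b \<in> Bc W"
  have oW: "openin X W" using W opens_openin by blast
  interpret M: module "R W" "Mod B W" by (rule B_module[OF oW])
  note c = closed_onD[OF \<eta> W]
  show "\<eta>' W b \<in> F W" using c(1) eq W by simp
  show "\<eta>' Z (mres B W Z b) = restrict (\<eta>' W b) Z" if "Z \<in> opens X W" for Z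
    using c(2)[OF that] eq[OF W] eq[OF opens_trans[OF W(1) that] B_res[OF oW that W(2)]] by simp
  show "\<eta>' W (f \<odot>[B,W] b) = (\<lambda>x\<in>W. f x * \<eta>' W b x)" if "f \<in> F W" for f
    using c(5)[OF that] eq[OF W] eq[OF W(1) M.smult_closed[OF that W(2)]] by simp
  fix b' assume b': "b' \<in> Bc W"
  show "\<eta>' W (b \<oplus>[B,W] b') = (\<lambda>x\<in>W. \<eta>' W b x + \<eta>' W b' x)"
    using c(3)[OF b'] eq[OF W] eq[OF W(1) b'] eq[OF W(1) M.M.add.m_closed[OF W(2) b']] by simp
  show "ac W b (\<eta>' W b') x - ac W b' (\<eta>' W b) x = \<eta>' W (br W b b') x" if "x \<in> W" for x
    using c(4)[OF b' that] eq[OF W] eq[OF W(1) b'] eq[OF W(1) brD(1)[OF oW W(2) b']] by simp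
qed

lemma mk_form_1_apply:
  "W \<in> opens X V \<Longrightarrow> b \<in> Bc W \<Longrightarrow> mk_form X B (Suc 0) V h W [b] = restrict (h W [b]) W"
  by (simp add: mk_form_def form_args_1)

lemma mk_form_Cl:
  assumes V: "openin X V" and \<eta>: "closed_on V \<eta>"
    and eq: "\<And>W b x. W \<in> opens X V \<Longrightarrow> b \<in> Bc W \<Longrightarrow> x \<in> W \<Longrightarrow> h W [b] x = \<eta> W b x"
  shows "mk_form X B (Suc 0) V h \<in> Cl V"
    and "W \<in> opens X V \<Longrightarrow> b \<in> Bc W \<Longrightarrow> mk_form X B (Suc 0) V h W [b] = \<eta> W b"
proof -
  have ap: "mk_form X B (Suc 0) V h W [b] = \<eta> W b" if W: "W \<in> opens X V" "b \<in> Bc W" for W b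
    unfolding mk_form_1_apply[OF W]
    by (rule extensionalityI[OF _ F_ext[OF closed_onD(1)[OF \<eta> W]]]) (use eq[OF W] in auto)
  then show "W \<in> opens X V \<Longrightarrow> b \<in> Bc W \<Longrightarrow> mk_form X B (Suc 0) V h W [b] = \<eta> W b" .
  have "closed_on V (\<lambda>W b. mk_form X B (Suc 0) V h W [b])"
    by (rule closed_on_cong[OF \<eta> ap])
  moreover have "mk_form X B (Suc 0) V h \<in> ext_family X V (form_args B (Suc 0))"
    by (simp add: mk_form_def ext_family_def)
  ultimately show "mk_form X B (Suc 0) V h \<in> Cl V" using Cl_iff[OF V] by blast
qed

lemma H_simps:
  "\<omega> \<otimes>[H,V] \<omega>' = mk_form X B (Suc 0) V (\<lambda>V bs x. \<omega> V bs x + \<omega>' V bs x)"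
  "gres H V W \<omega> = restrict \<omega> (opens X W)"
  by (simp_all add: Omega1cl_def form_sheaf_def)

lemma Cl_mult:
  assumes V: "openin X V" and w: "\<omega> \<in> Cl V" "\<omega>' \<in> Cl V"
  shows "\<omega> \<otimes>[H,V] \<omega>' \<in> Cl V"
    and "W \<in> opens X V \<Longrightarrow> b \<in> Bc W \<Longrightarrow> (\<omega> \<otimes>[H,V] \<omega>') W [b] = (\<lambda>x\<in>W. \<omega> W [b] x + \<omega>' W [b] x)"
proof -
  define \<eta> where "\<eta> W b = (\<lambda>x\<in>W. \<omega> W [b] x + \<omega>' W [b] x)" for W b
  have cl: "closed_on V \<eta>"
    unfolding closed_on_def
  proof (intro ballI conjI)
    fix W b assume W: "W \<in> opens X V" "b \<in> Bc W"
    have oW: "openin X W" using W opens_openin by blast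
    interpret M: module "R W" "Mod B W" by (rule B_module[OF oW])
    note c = ClD[OF V w(1) W] and c' = ClD[OF V w(2) W]
    show "\<eta> W b \<in> F W" unfolding \<eta>_def by (rule F_add[OF oW c(1) c'(1)])
    show "\<eta> Z (mres B W Z b) = restrict (\<eta> W b) Z" if "Z \<in> opens X W" for Z
      unfolding \<eta>_def c(2)[OF that] c'(2)[OF that] using opens_subset[OF that]
      by (auto simp: restrict_def fun_eq_iff)
    show "\<eta> W (f \<odot>[B,W] b) = (\<lambda>x\<in>W. f x * \<eta> W b x)" if "f \<in> F W" for f
      unfolding \<eta>_def c(5)[OF that] c'(5)[OF that] by (auto simp: restrict_def fun_eq_iff algebra_simps)
    fix b' assume b': "b' \<in> Bc W"
    show "\<eta> W (b \<oplus>[B,W] b') = (\<lambda>x\<in>W. \<eta> W b x + \<eta> W b' x)"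
      unfolding \<eta>_def c(3)[OF b'] c'(3)[OF b'] by (auto simp: restrict_def fun_eq_iff)
    fix x assume x: "x \<in> W"
    show "ac W b (\<eta> W b') x - ac W b' (\<eta> W b) x = \<eta> W (br W b b') x"
      unfolding \<eta>_def ac_add[OF oW W(2) ClD(1)[OF V w(1) W(1) b'] ClD(1)[OF V w(2) W(1) b'] x]
        ac_add[OF oW b' c(1) c'(1) x]
      using x by (simp add: c(4)[OF b' x, symmetric] c'(4)[OF b' x, symmetric])
  qed
  note m = mk_form_Cl[OF V cl, of "\<lambda>V bs x. \<omega> V bs x + \<omega>' V bs x"]
  show "\<omega> \<otimes>[H,V] \<omega>' \<in> Cl V" unfolding H_simps by (rule m(1)) (simp add: \<eta>_def)
  show "W \<in> opens X V \<Longrightarrow> b \<in> Bc W \<Longrightarrow> (\<omega> \<otimes>[H,V] \<omega>') W [b] = (\<lambda>x\<in>W. \<omega> W [b] x + \<omega>' W [b] x)"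
    unfolding H_simps using m(2) by (simp add: \<eta>_def)
qed

lemma Cl_restrict:
  assumes V: "openin X V" and w: "\<omega> \<in> Cl V" and W: "W \<in> opens X V"
  shows "restrict \<omega> (opens X W) \<in> Cl W"
proof -
  have oW: "openin X W" using W opens_openin by blast
  have O: "opens X W \<subseteq> opens X V" using opens_trans[OF W] by blast
  have "closed_on W (\<lambda>Z b. restrict \<omega> (opens X W) Z [b])"
    unfolding closed_on_def using ClD[OF V w] O opens_trans[of _ X W] by (auto simp: subset_iff)
  moreover have "restrict \<omega> (opens X W) \<in> ext_family X W (form_args B (Suc 0))"
    using w Cl_iff[OF V] O by (auto simp: ext_family_def)
  ultimately show ?thesis using Cl_iff[OF oW] by blast
qed

lemma dlog_apply:
  assumes "W \<in> opens X V" "b \<in> Bc W"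
  shows "d V f W [b] = (\<lambda>x\<in>W. ac W b (restrict f W) x / f x)"
proof -
  have "form0 X B V f W [] = restrict f W" using assms by (simp add: form0_def mk_form_def form_args_def)
  then have "dB X B 0 V (form0 X B V f) W [b] = (\<lambda>x\<in>W. ac W b (restrict f W) x)"
    using assms by (simp add: ce_diff_def mk_form_1_apply drop_nth_def)
  then show ?thesis using assms by (simp add: dlog_def mk_form_1_apply cong: restrict_cong)
qed

text \<open>In b(b'(f) / f) - b'(b(f) / f) the terms b(f) b'(f) / f^2 are symmetric and cancel. What
  is left is the value at the bracket precisely because the anchor respects brackets,
  \<open>ac_br\<close>.\<close>

lemma dlog_Cl:
  assumes V: "openin X V" and f: "f \<in> Uts V"
  shows "d V f \<in> Cl V"
proof -
  define \<eta> where "\<eta> W b = (\<lambda>x\<in>W. ac W b (restrict f W) x / restrict f W x)" for W b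
  have cl: "closed_on V \<eta>"
    unfolding closed_on_def
  proof (intro ballI conjI)
    fix W b assume W: "W \<in> opens X V" "b \<in> Bc W"
    have oW: "openin X W" using W opens_openin by blast
    interpret M: module "R W" "Mod B W" by (rule B_module[OF oW])
    have g: "restrict f W \<in> Uts W" by (rule Uts_restrict[OF f W(1)])
    note gF = UtsD(1)[OF g]
    show "\<eta> W b \<in> F W" unfolding \<eta>_def by (rule F_divide[OF oW ac_closed[OF oW W(2) gF] gF UtsD(2)[OF g]])
    show "\<eta> Z (mres B W Z b) = restrict (\<eta> W b) Z" if Z: "Z \<in> opens X W" for Z
    proof -
      have "restrict (restrict f W) Z = restrict f Z" using opens_subset[OF Z] by (simp add: Int_absorb1)
      then show ?thesis
        using ac_restrict[OF oW W(2) gF Z] opens_subset[OF Z]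
        unfolding \<eta>_def by (auto simp: restrict_def fun_eq_iff)
    qed
    show "\<eta> W (h \<odot>[B,W] b) = (\<lambda>x\<in>W. h x * \<eta> W b x)" if "h \<in> F W" for h
      unfolding \<eta>_def using ac_smult[OF oW W(2) that gF] by (auto simp: restrict_def fun_eq_iff)
    fix b' assume b': "b' \<in> Bc W"
    show "\<eta> W (b \<oplus>[B,W] b') = (\<lambda>x\<in>W. \<eta> W b x + \<eta> W b' x)"
      unfolding \<eta>_def using ac_plus[OF oW W(2) b' gF] by (auto simp: restrict_def fun_eq_iff add_divide_distrib)
    fix x assume x: "x \<in> W"
    show "ac W b (\<eta> W b') x - ac W b' (\<eta> W b) x = \<eta> W (br W b b') x"
      unfolding \<eta>_def ac_divide[OF oW W(2) ac_closed[OF oW b' gF] g x] ac_divide[OF oW b' ac_closed[OF oW W(2) gF] g x]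
      using ac_br[OF oW W(2) b' gF x] x by (simp add: diff_divide_distrib)
  qed
  have 1: "d V f = mk_form X B (Suc 0) V (\<lambda>W bs x. dB X B 0 V (form0 X B V f) W bs x / f x)"
    by (simp add: dlog_def)
  have 2: "dB X B 0 V (form0 X B V f) W [b] x / f x = \<eta> W b x"
    if W: "W \<in> opens X V" "b \<in> Bc W" "x \<in> W" for W b x
  proof -
    have "d V f W [b] x = dB X B 0 V (form0 X B V f) W [b] x / f x"
      using W by (simp add: dlog_def mk_form_1_apply)
    then show ?thesis unfolding dlog_apply[OF W(1,2)] using W(3) by (auto simp: \<eta>_def)
  qed
  show ?thesis unfolding 1 by (rule mk_form_Cl(1)[OF V cl 2])
qed

end

section \<open>Torsors with trivialization\<close>

lemma is_torsorD:
  assumes "is_torsor X Gr U T"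
  shows "sheaf_on X U (tsec T) (tres T)"
    and "x \<in> U \<Longrightarrow> \<exists>V\<in>opens X U. x \<in> V \<and> (\<exists>t. t \<in> tsec T V)"
    and "V \<in> opens X U \<Longrightarrow> t \<in> tsec T V \<Longrightarrow> tact T V \<one>\<^bsub>Grp Gr V\<^esub> t = t"
    and "V \<in> opens X U \<Longrightarrow> t \<in> tsec T V \<Longrightarrow> g \<in> carrier (Grp Gr V) \<Longrightarrow> tact T V g t \<in> tsec T V"
    and "V \<in> opens X U \<Longrightarrow> t \<in> tsec T V \<Longrightarrow> g \<in> carrier (Grp Gr V) \<Longrightarrow> h \<in> carrier (Grp Gr V) \<Longrightarrow>
      tact T V (g \<otimes>[Gr,V] h) t = tact T V g (tact T V h t)"
    and "V \<in> opens X U \<Longrightarrow> t \<in> tsec T V \<Longrightarrow> g \<in> carrier (Grp Gr V) \<Longrightarrow> W \<in> opens X V \<Longrightarrow>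
      tres T V W (tact T V g t) = tact T W (gres Gr V W g) (tres T V W t)"
    and "V \<in> opens X U \<Longrightarrow> t \<in> tsec T V \<Longrightarrow> t' \<in> tsec T V \<Longrightarrow> \<exists>!g. g \<in> carrier (Grp Gr V) \<and> tact T V g t = t'"
proof -
  note a = assms[unfolded is_torsor_def]
  show "sheaf_on X U (tsec T) (tres T)" using a by blast
  show "x \<in> U \<Longrightarrow> \<exists>V\<in>opens X U. x \<in> V \<and> (\<exists>t. t \<in> tsec T V)" using a by blast
  assume "V \<in> opens X U" "t \<in> tsec T V"
  note b = a[THEN conjunct2, THEN conjunct1, THEN bspec, OF this(1), THEN bspec, OF this(2)]
  show "tact T V \<one>\<^bsub>Grp Gr V\<^esub> t = t"
    and "g \<in> carrier (Grp Gr V) \<Longrightarrow> tact T V g t \<in> tsec T V"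
    and "g \<in> carrier (Grp Gr V) \<Longrightarrow> h \<in> carrier (Grp Gr V) \<Longrightarrow>
      tact T V (g \<otimes>[Gr,V] h) t = tact T V g (tact T V h t)"
    and "g \<in> carrier (Grp Gr V) \<Longrightarrow> W \<in> opens X V \<Longrightarrow>
      tres T V W (tact T V g t) = tact T W (gres Gr V W g) (tres T V W t)"
    and "t' \<in> tsec T V \<Longrightarrow> \<exists>!g. g \<in> carrier (Grp Gr V) \<and> tact T V g t = t'"
    using b by blast+
qed

lemma (in smooth_algebroid) torsor_act:
  assumes U: "openin X U" and T: "is_torsor X G U T"
  shows "act_sheaf X U Uts (tsec T) (tres T) (tact T)"
proof
  note t = is_torsorD[OF T]
  have o: "openin X V" if "V \<in> opens X U" for V using opens_openin[OF that] .
  note GV = G_simps(1)[OF o]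
  show "sheaf_on X U (tsec T) (tres T)" by (rule t(1))
  fix V assume V: "V \<in> opens X U"
  show "(\<lambda>x\<in>V. 1) \<in> Uts V" by (rule Uts_one[OF o[OF V]])
  show "k \<in> extensional V" if "k \<in> Uts V" for k using F_ext[OF UtsD(1)[OF that]] .
  show "(\<lambda>x\<in>V. k x * l x) \<in> Uts V" if "k \<in> Uts V" "l \<in> Uts V" for k l
    using Uts_mult[OF o[OF V] that] .
  show "restrict k W \<in> Uts W" if "k \<in> Uts V" "W \<in> opens X V" for k W using Uts_restrict[OF that] .
  show "tact T V (\<lambda>x\<in>V. 1) m = m" if "m \<in> tsec T V" for m
    using t(3)[OF V that] by (simp add: G_simps)
  show "tact T V k m \<in> tsec T V" if "k \<in> Uts V" "m \<in> tsec T V" for k m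
    using t(4)[OF V that(2)] that(1) by (simp add: GV[OF V])
  show "tact T V (\<lambda>x\<in>V. k x * l x) m = tact T V k (tact T V l m)" if "k \<in> Uts V" "l \<in> Uts V" "m \<in> tsec T V" for k l m
    using t(5)[OF V that(3)] that(1,2) by (simp add: GV[OF V] G_simps(2))
  show "tres T V W (tact T V k m) = tact T W (restrict k W) (tres T V W m)"
    if "k \<in> Uts V" "m \<in> tsec T V" "W \<in> opens X V" for k m W
    using t(6)[OF V that(2) _ that(3)] that(1) by (simp add: GV[OF V] G_simps(4))
qed

text \<open>Torsors without trivialization are kept apart because the criterion
  \<open>quot_sections_ttorsorI\<close>, which establishes the trivialization of a new torsor,
  already uses the torsor axioms.\<close>

locale gtorsor = smooth_algebroid X A P B for X :: "'x topology" and A P and B :: "('x, 'b) lie_algd" +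
  fixes U :: "'x set" and T :: "('x, 'x cfun, ('x, 'b) form, 'u) ttorsor"
  assumes U: "openin X U" and torsor: "is_torsor X (Ounits X A P) U T"
begin

sublocale sec: act_sheaf X U Uts "tsec T" "tres T" "tact T"
  by (rule torsor_act[OF U torsor])

lemma oU: "V \<in> opens X U \<Longrightarrow> openin X V" using opens_openin .

lemma torsor_trans:
  assumes "V \<in> opens X U" "t \<in> tsec T V" "t' \<in> tsec T V"
  shows "\<exists>g\<in>Uts V. t' = tact T V g t"
  using is_torsorD(7)[OF torsor assms] G_simps(1)[OF oU[OF assms(1)]] by auto

text \<open>Units act simply transitively on the sections over every smaller open set.\<close>

lemma torsor_generator: "V \<in> opens X U \<Longrightarrow> t \<in> tsec T V \<Longrightarrow> sec.generator V t"
proof -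
  assume V: "V \<in> opens X U" and t: "t \<in> tsec T V"
  have "\<exists>!k. k \<in> Uts W \<and> m = tact T W k (tres T V W t)" if W: "W \<in> opens X V" and m: "m \<in> tsec T W" for W m
    using is_torsorD(7)[OF torsor opens_trans[OF V W] sec.res_closed[OF V t W] m]
      G_simps(1)[OF opens_openin[OF W]] by (simp add: eq_commute)
  then show ?thesis unfolding sec.generator_def using V t by blast
qed

lemma torsor_cover: "x \<in> U \<Longrightarrow> \<exists>V q. x \<in> V \<and> sec.generator V q"
  using is_torsorD(2)[OF torsor] torsor_generator by blast

lemma ind_rel_iff:
  assumes V: "V \<in> opens X U"
  shows "((t, \<omega>), (t', \<omega>')) \<in> ind_rel G H d T V \<longleftrightarrow>
    (\<exists>g\<in>Uts V. t' \<in> tsec T V \<and> \<omega> \<in> Cl V \<and> t = tact T V g t' \<and> \<omega>' = d V g \<otimes>[H,V] \<omega>)"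
  unfolding ind_rel_def G_simps(1)[OF oU[OF V]] by auto

lemma dlog_one_mult:
  assumes V: "openin X V" and w: "\<omega> \<in> Cl V" shows "d V (\<lambda>x\<in>V. 1) \<otimes>[H,V] \<omega> = \<omega>"
proof (rule Cl_eqI[OF V _ w])
  note d1 = dlog_Cl[OF V Uts_one[OF V]]
  show "d V (\<lambda>x\<in>V. 1) \<otimes>[H,V] \<omega> \<in> Cl V" by (rule Cl_mult(1)[OF V d1 w])
  fix W b x assume W: "W \<in> opens X V" "b \<in> Bc W" "x \<in> W"
  have "restrict (\<lambda>x\<in>V. 1) W = (\<lambda>x\<in>W. 1::complex)" using opens_subset[OF W(1)] by (simp add: Int_absorb1)
  then show "(d V (\<lambda>x\<in>V. 1) \<otimes>[H,V] \<omega>) W [b] x = \<omega> W [b] x"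
    unfolding Cl_mult(2)[OF V d1 w W(1,2)] dlog_apply[OF W(1,2)]
    using W(3) ac_const[OF opens_openin[OF W(1)] W(2,3), of 1] by simp
qed

lemma ind_rel_refl:
  "V \<in> opens X U \<Longrightarrow> t \<in> tsec T V \<Longrightarrow> \<omega> \<in> Cl V \<Longrightarrow> ((t, \<omega>), (t, \<omega>)) \<in> ind_rel G H d T V"
  unfolding ind_rel_iff using Uts_one[OF oU] sec.act_one dlog_one_mult[OF oU] by metis

lemma Cl_res_id:
  assumes V: "openin X V" and w: "\<omega> \<in> Cl V" shows "restrict \<omega> (opens X V) = \<omega>"
  using w Cl_iff[OF V] by (auto simp: ext_family_def intro: extensional_restrict)

text \<open>Being a fixed point of \<open>quot_close\<close> is split into two closure properties
  that are easier to check: stability under the identification of \<open>(g t, a)\<close> with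
  \<open>(t, d(g) a)\<close>, and locality.\<close>

lemma quot_sections_ttorsorI:
  assumes off: "\<And>V. V \<notin> opens X U \<Longrightarrow> c V = {}"
    and sub: "\<And>V t \<omega>. V \<in> opens X U \<Longrightarrow> (t, \<omega>) \<in> c V \<Longrightarrow> t \<in> tsec T V \<and> \<omega> \<in> Cl V"
    and res: "\<And>V W t \<omega>. V \<in> opens X U \<Longrightarrow> W \<in> opens X V \<Longrightarrow> (t, \<omega>) \<in> c V \<Longrightarrow>
      (tres T V W t, restrict \<omega> (opens X W)) \<in> c W"
    and rel: "\<And>V t \<omega> t' \<omega>'. V \<in> opens X U \<Longrightarrow> (t, \<omega>) \<in> c V \<Longrightarrow> (t', \<omega>') \<in> c V \<Longrightarrow>
      ((t, \<omega>), (t', \<omega>')) \<in> ind_rel G H d T V"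
    and ex: "\<And>x. x \<in> U \<Longrightarrow> \<exists>V\<in>opens X U. x \<in> V \<and> c V \<noteq> {}"
    and act: "\<And>V g t \<omega>. V \<in> opens X U \<Longrightarrow> g \<in> Uts V \<Longrightarrow> \<omega> \<in> Cl V \<Longrightarrow> (t, d V g \<otimes>[H,V] \<omega>) \<in> c V \<Longrightarrow>
      (tact T V g t, \<omega>) \<in> c V"
    and loc: "\<And>V t \<omega>. V \<in> opens X U \<Longrightarrow> t \<in> tsec T V \<Longrightarrow> \<omega> \<in> Cl V \<Longrightarrow>
      (\<And>x. x \<in> V \<Longrightarrow> \<exists>W\<in>opens X V. x \<in> W \<and> (tres T V W t, restrict \<omega> (opens X W)) \<in> c W) \<Longrightarrow> (t, \<omega>) \<in> c V"
  shows "c \<in> quot_sections X (ind_sec H T) (ind_res H T) (ind_rel G H d T) U"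
  unfolding quot_sections_def
proof (intro CollectI conjI ballI)
  show "quot_close X (ind_sec H T) (ind_res H T) (ind_rel G H d T) U c = c"
  proof (rule HOL.ext, rule Set.set_eqI)
    fix V p
    show "p \<in> quot_close X (ind_sec H T) (ind_res H T) (ind_rel G H d T) U c V \<longleftrightarrow> p \<in> c V"
    proof (cases "V \<in> opens X U")
      case False
      then show ?thesis using off by (simp add: quot_close_def)
    next
      case V: True
      obtain t \<omega> where p: "p = (t, \<omega>)" by force
      show ?thesis
      proof
        assume "p \<in> quot_close X (ind_sec H T) (ind_res H T) (ind_rel G H d T) U c V"
        then have q: "t \<in> tsec T V" "\<omega> \<in> Cl V" "\<And>x. x \<in> V \<Longrightarrow> \<exists>W\<in>opens X V. x \<in> W \<and>
          (\<exists>q\<in>c W. ((tres T V W t, restrict \<omega> (opens X W)), q) \<in> ind_rel G H d T W)"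
          using V unfolding p by (auto simp: quot_close_def ind_sec_def ind_res_def H_simps)
        have "(t, \<omega>) \<in> c V"
        proof (rule loc[OF V q(1,2)])
          fix x assume "x \<in> V"
          then obtain W t' \<omega>' where W: "W \<in> opens X V" "x \<in> W" "(t', \<omega>') \<in> c W"
            "((tres T V W t, restrict \<omega> (opens X W)), (t', \<omega>')) \<in> ind_rel G H d T W" using q(3) by fastforce
          have WU: "W \<in> opens X U" by (rule opens_trans[OF V W(1)])
          obtain g where "g \<in> Uts W" "restrict \<omega> (opens X W) \<in> Cl W" "tres T V W t = tact T W g t'"
            "\<omega>' = d W g \<otimes>[H,W] restrict \<omega> (opens X W)" using W(4) unfolding ind_rel_iff[OF WU] by blast
          then have "(tres T V W t, restrict \<omega> (opens X W)) \<in> c W" using act[OF WU] W(3) by metis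
          then show "\<exists>W\<in>opens X V. x \<in> W \<and> (tres T V W t, restrict \<omega> (opens X W)) \<in> c W" using W by blast
        qed
        then show "p \<in> c V" using p by simp
      next
        assume "p \<in> c V"
        then have t: "t \<in> tsec T V" "\<omega> \<in> Cl V" "(t, \<omega>) \<in> c V" using sub[OF V] p by auto
        have "ind_res H T V V (t, \<omega>) = (t, \<omega>)"
          using sec.res_id[OF V t(1)] Cl_res_id[OF oU[OF V] t(2)] by (simp add: ind_res_def H_simps)
        then have "\<exists>W\<in>opens X V. x \<in> W \<and> (\<exists>q\<in>c W. (ind_res H T V W (t, \<omega>), q) \<in> ind_rel G H d T W)"
          if "x \<in> V" for x
          using that opens_self[OF oU[OF V]] t(3) ind_rel_refl[OF V t(1,2)] by metis
        then show "p \<in> quot_close X (ind_sec H T) (ind_res H T) (ind_rel G H d T) U c V"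
          using V t(1,2) unfolding p by (simp add: quot_close_def ind_sec_def)
      qed
    qed
  qed
  show "ind_res H T V W s \<in> c W" if "V \<in> opens X U" "W \<in> opens X V" "s \<in> c V" for V W s
    using res[OF that(1,2)] that(3) by (cases s) (simp add: ind_res_def H_simps)
  show "c V \<times> c V \<subseteq> ind_rel G H d T V" if "V \<in> opens X U" for V
    using rel[OF that] by auto
  show "\<exists>V\<in>opens X U. x \<in> V \<and> c V \<noteq> {}" if "x \<in> U" for x by (rule ex[OF that])
qed

end

section \<open>Representatives of a trivialization\<close>

locale ttorsor = gtorsor X A P B U T for X :: "'x topology" and A P and B :: "('x, 'b) lie_algd" and U
    and T :: "('x, 'x cfun, ('x, 'b) form, 'u) ttorsor" +
  assumes triv: "triv T \<in> quot_sections X (ind_sec (Omega1cl X A P B) T) (ind_res (Omega1cl X A P B) T)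
    (ind_rel (Ounits X A P) (Omega1cl X A P B) (dlog X B) T) U"
begin

lemma trivD: "(t, \<omega>) \<in> triv T V \<Longrightarrow> V \<in> opens X U" "(t, \<omega>) \<in> triv T V \<Longrightarrow> t \<in> tsec T V"
   "(t, \<omega>) \<in> triv T V \<Longrightarrow> \<omega> \<in> Cl V"
proof -
  assume t: "(t, \<omega>) \<in> triv T V"
  show V: "V \<in> opens X U" using quot_sectionsD(6)[OF triv] t by blast
  have "(t, \<omega>) \<in> ind_sec H T V" by (rule quot_sectionsD(4)[OF triv V t])
  then show "t \<in> tsec T V" "\<omega> \<in> Cl V" by (auto simp: ind_sec_def)
qed

lemma triv_res: "(t, \<omega>) \<in> triv T V \<Longrightarrow> W \<in> opens X V \<Longrightarrow> (tres T V W t, restrict \<omega> (opens X W)) \<in> triv T W"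
  using quot_sectionsD(1)[OF triv trivD(1), of t \<omega> V W "(t, \<omega>)"] by (simp add: ind_res_def H_simps)

lemma triv_rel: "(t, \<omega>) \<in> triv T V \<Longrightarrow> (t', \<omega>') \<in> triv T V \<Longrightarrow>
    \<exists>g\<in>Uts V. t = tact T V g t' \<and> \<omega>' = d V g \<otimes>[H,V] \<omega>"
  using quot_sectionsD(2)[OF triv trivD(1), of t \<omega> V] ind_rel_iff[OF trivD(1)] by blast

lemma triv_exists: "x \<in> U \<Longrightarrow> \<exists>V t \<omega>. x \<in> V \<and> (t, \<omega>) \<in> triv T V"
  using quot_sectionsD(3)[OF triv] by fastforce

lemma triv_exists_in:
  assumes V: "V \<in> opens X U" and x: "x \<in> V"
  shows "\<exists>W t \<omega>. W \<in> opens X V \<and> x \<in> W \<and> (t, \<omega>) \<in> triv T W"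
proof -
  obtain N t \<omega> where N: "x \<in> N" "(t, \<omega>) \<in> triv T N" using triv_exists x opens_subset[OF V] by blast
  have "V \<inter> N \<in> opens X N" "V \<inter> N \<in> opens X V"
    using opens_Int'[OF trivD(1)[OF N(2)] oU[OF V]] opens_Int[OF V oU[OF trivD(1)[OF N(2)]]] .
  then show ?thesis using triv_res[OF N(2)] x N(1) by blast
qed

lemma triv_local:
  assumes V: "V \<in> opens X U" and t: "t \<in> tsec T V" "\<omega> \<in> Cl V"
    and loc: "\<And>x. x \<in> V \<Longrightarrow> \<exists>W\<in>opens X V. x \<in> W \<and>
      (\<exists>t' \<omega>'. (t', \<omega>') \<in> triv T W \<and> ((tres T V W t, restrict \<omega> (opens X W)), (t', \<omega>')) \<in> ind_rel G H d T W)"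
  shows "(t, \<omega>) \<in> triv T V"
proof (rule quot_sectionsD(5)[OF triv V])
  show "(t, \<omega>) \<in> ind_sec H T V" using t by (simp add: ind_sec_def)
  fix x assume "x \<in> V"
  then show "\<exists>W\<in>opens X V. x \<in> W \<and> (\<exists>q\<in>triv T W. (ind_res H T V W (t, \<omega>), q) \<in> ind_rel G H d T W)"
    using loc unfolding ind_res_def map_prod_simp H_simps by blast
qed

lemma triv_act:
  assumes t: "(t, \<omega>') \<in> triv T V" and g: "g \<in> Uts V" and w: "\<omega> \<in> Cl V"
    and eq: "\<omega>' = d V g \<otimes>[H,V] \<omega>"
  shows "(tact T V g t, \<omega>) \<in> triv T V"
proof (rule triv_local[OF trivD(1)[OF t] sec.act_closed[OF trivD(1)[OF t] g trivD(2)[OF t]] w])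
  note V = trivD(1)[OF t]
  fix x assume x: "x \<in> V"
  have "((tact T V g t, \<omega>), (t, \<omega>')) \<in> ind_rel G H d T V"
    unfolding ind_rel_iff[OF V] using g trivD(2)[OF t] w eq by blast
  then show "\<exists>W\<in>opens X V. x \<in> W \<and> (\<exists>t' \<omega>'. (t', \<omega>') \<in> triv T W \<and>
      ((tres T V W (tact T V g t), restrict \<omega> (opens X W)), (t', \<omega>')) \<in> ind_rel G H d T W)"
    using opens_self[OF oU[OF V]] x t sec.res_id[OF V sec.act_closed[OF V g trivD(2)[OF t]]]
      Cl_res_id[OF oU[OF V] w] by metis
qed

text \<open>Any two representatives of \<open>triv T\<close> over the same open set are related, so
  a subfamily that is present near every point already determines the section of the quotient
  sheaf.\<close>

lemma ind_class_eq:
  assumes sub: "\<And>V p. V \<in> opens X U \<Longrightarrow> p \<in> c V \<Longrightarrow> p \<in> triv T V"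
    and ex: "\<And>V x. V \<in> opens X U \<Longrightarrow> x \<in> V \<Longrightarrow> \<exists>W\<in>opens X V. x \<in> W \<and> (\<exists>p. p \<in> c W)"
  shows "ind_class X G H d T U c = triv T"
proof (rule HOL.ext, rule Set.set_eqI)
  fix V p
  show "p \<in> ind_class X G H d T U c V \<longleftrightarrow> p \<in> triv T V"
  proof (cases "V \<in> opens X U")
    case False
    then show ?thesis using quot_sectionsD(6)[OF triv] by (simp add: ind_class_def quot_close_def)
  next
    case V: True
    obtain t \<omega> where p: "p = (t, \<omega>)" by force
    show ?thesis
    proof
      assume "p \<in> ind_class X G H d T U c V"
      then have q: "t \<in> tsec T V" "\<omega> \<in> Cl V" "\<And>x. x \<in> V \<Longrightarrow> \<exists>W\<in>opens X V. x \<in> W \<and>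
          (\<exists>q\<in>c W. ((tres T V W t, restrict \<omega> (opens X W)), q) \<in> ind_rel G H d T W)"
        using V unfolding p by (auto simp: ind_class_def quot_close_def ind_sec_def ind_res_def H_simps)
      show "p \<in> triv T V" unfolding p
      proof (rule triv_local[OF V q(1,2)])
        fix x assume "x \<in> V"
        then obtain W q where W: "W \<in> opens X V" "x \<in> W" "q \<in> c W"
          "((tres T V W t, restrict \<omega> (opens X W)), q) \<in> ind_rel G H d T W" using q(3) by blast
        have "q \<in> triv T W" by (rule sub[OF opens_trans[OF V W(1)] W(3)])
        then show "\<exists>W\<in>opens X V. x \<in> W \<and> (\<exists>t' \<omega>'. (t', \<omega>') \<in> triv T W \<and>
          ((tres T V W t, restrict \<omega> (opens X W)), (t', \<omega>')) \<in> ind_rel G H d T W)"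
          using W by (cases q) blast
      qed
    next
      assume p': "p \<in> triv T V"
      have "\<exists>W\<in>opens X V. x \<in> W \<and> (\<exists>q\<in>c W. (ind_res H T V W p, q) \<in> ind_rel G H d T W)" if x: "x \<in> V" for x
      proof -
        obtain W q where W: "W \<in> opens X V" "x \<in> W" "q \<in> c W" using ex[OF V x] by blast
        have "ind_res H T V W p \<in> triv T W" by (rule quot_sectionsD(1)[OF triv V W(1) p'])
        from quot_sectionsD(2)[OF triv opens_trans[OF V W(1)] this sub[OF opens_trans[OF V W(1)] W(3)]] W
        show ?thesis by blast
      qed
      then show "p \<in> ind_class X G H d T U c V"
        using V quot_sectionsD(4)[OF triv V p'] by (simp add: ind_class_def quot_close_def)
    qed
  qed
qed

lemma ind_class_sub:
  assumes eq: "ind_class X G H d T U c = triv T" and V: "V \<in> opens X U" and p: "(t, \<omega>) \<in> c V"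
    and t: "t \<in> tsec T V" "\<omega> \<in> Cl V"
  shows "(t, \<omega>) \<in> triv T V"
proof -
  have "\<exists>W\<in>opens X V. x \<in> W \<and> (\<exists>q\<in>c W. (ind_res H T V W (t, \<omega>), q) \<in> ind_rel G H d T W)" if "x \<in> V" for x
  proof -
    have "ind_res H T V V (t, \<omega>) = (t, \<omega>)"
      using sec.res_id[OF V t(1)] Cl_res_id[OF oU[OF V] t(2)] by (simp add: ind_res_def H_simps)
    then show ?thesis using that opens_self[OF oU[OF V]] p ind_rel_refl[OF V t] by metis
  qed
  then have "(t, \<omega>) \<in> ind_class X G H d T U c V"
    using V t by (simp add: ind_class_def quot_close_def ind_sec_def)
  then show ?thesis using eq by simp
qed

end

lemma (in smooth_algebroid) ttorsorI:
  "openin X U \<Longrightarrow> T \<in> Tors_Ob X G H d U \<Longrightarrow> ttorsor X A P B U T"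
  by unfold_locales (auto simp: Tors_Ob_def)

section \<open>Line bundles\<close>

lemma (in smooth_algebroid) module_act:
  assumes U: "openin X U" and L: "module_sheaf X U R L"
  shows "act_sheaf X U F (\<lambda>V. carrier (Mod L V)) (mres L) (\<lambda>V f m. f \<odot>[L,V] m)"
proof
  show "sheaf_on X U (\<lambda>V. carrier (Mod L V)) (mres L)" by (rule module_sheaf_sheaf[OF L])
  fix V assume V: "V \<in> opens X U"
  have oV: "openin X V" using V opens_openin by blast
  interpret M: module "R V" "Mod L V" by (rule module_sheafD(1)[OF L V])
  show "(\<lambda>x\<in>V. 1) \<in> F V" by (rule F_const[OF oV])
  show "k \<in> extensional V" if "k \<in> F V" for k using F_ext[OF that] .
  show "(\<lambda>x\<in>V. k x * l x) \<in> F V" if "k \<in> F V" "l \<in> F V" for k l using F_mult[OF oV that] .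
  show "restrict k W \<in> F W" if "k \<in> F V" "W \<in> opens X V" for k W using F_restrict[OF that] .
  show "(\<lambda>x\<in>V. 1) \<odot>[L,V] m = m" if "m \<in> carrier (Mod L V)" for m
    using M.smult_one[OF that] by (simp add: OXP_simps)
  show "k \<odot>[L,V] m \<in> carrier (Mod L V)" if "k \<in> F V" "m \<in> carrier (Mod L V)" for k m
    using M.smult_closed that .
  show "(\<lambda>x\<in>V. k x * l x) \<odot>[L,V] m = k \<odot>[L,V] (l \<odot>[L,V] m)"
    if "k \<in> F V" "l \<in> F V" "m \<in> carrier (Mod L V)" for k l m
    using M.smult_assoc1[OF that] by (simp add: OXP_simps)
  show "mres L V W (k \<odot>[L,V] m) = restrict k W \<odot>[L,W] mres L V W m"
    if "k \<in> F V" "m \<in> carrier (Mod L V)" "W \<in> opens X V" for k m W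
    using module_sheafD(4)[OF L V that(3,1,2)] .
qed

locale line_bundle = smooth_algebroid X A P B for X :: "'x topology" and A P and B :: "('x, 'b) lie_algd" +
  fixes U :: "'x set" and L :: "('x, 'u, 'z) mod_sheaf_scheme"
  assumes U: "openin X U" and L_sheaf: "module_sheaf X U (OXP X A P) L"
    and L_free: "locally_free_rank X U (OXP X A P) L 1"
begin

abbreviation "Lc V \<equiv> carrier (Mod L V)"

sublocale sec: act_sheaf X U F "\<lambda>V. carrier (Mod L V)" "mres L" "\<lambda>V f m. f \<odot>[L,V] m"
  by (rule module_act[OF U L_sheaf])

lemma oU: "V \<in> opens X U \<Longrightarrow> openin X V" using opens_openin .

lemma L_module: "V \<in> opens X U \<Longrightarrow> module (R V) (Mod L V)"
  by (rule module_sheafD(1)[OF L_sheaf])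

lemma frame_generator:
  assumes V: "V \<in> opens X U" and fr: "frame X R L V 1 e"
  shows "sec.generator V (e 0)"
  unfolding sec.generator_def
proof (intro conjI ballI V)
  show e: "e 0 \<in> Lc V" using fr by (simp add: frame_def)
  fix W m assume W: "W \<in> opens X V" and m: "m \<in> Lc W"
  interpret M: module "R W" "Mod L W" by (rule L_module[OF opens_trans[OF V W]])
  let ?e = "mres L V W (e 0)"
  have eW: "?e \<in> Lc W" by (rule sec.res_closed[OF V e W])
  have ex: "\<exists>!c. c \<in> {..<1} \<rightarrow>\<^sub>E F W \<and> m = (\<Oplus>\<^bsub>Mod L W\<^esub>i\<in>{..<1::nat}. c i \<odot>[L,W] mres L V W (e i))"
    by (rule fr[unfolded frame_def, THEN conjunct2, THEN bspec, OF W, THEN bspec, OF m])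
  have sum: "(\<Oplus>\<^bsub>Mod L W\<^esub>i\<in>{..<1::nat}. c i \<odot>[L,W] mres L V W (e i)) = c 0 \<odot>[L,W] ?e"
    if "c 0 \<in> F W" for c
  proof -
    have 1: "{..<1::nat} = insert 0 {}" by auto
    show ?thesis unfolding 1 using that eW by (subst M.M.finsum_insert) auto
  qed
  show "\<exists>!k. k \<in> F W \<and> m = k \<odot>[L,W] ?e"
  proof (rule ex_ex1I)
    obtain c where c: "c \<in> {..<1} \<rightarrow>\<^sub>E F W"
      "m = (\<Oplus>\<^bsub>Mod L W\<^esub>i\<in>{..<1::nat}. c i \<odot>[L,W] mres L V W (e i))" using ex by blast
    have "c 0 \<in> F W" using c(1) by auto
    then show "\<exists>k. k \<in> F W \<and> m = k \<odot>[L,W] ?e" using c(2) sum[of c] by auto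
  next
    fix k l assume kl: "k \<in> F W \<and> m = k \<odot>[L,W] ?e" "l \<in> F W \<and> m = l \<odot>[L,W] ?e"
    have P: "(\<lambda>i\<in>{..<1::nat}. h) \<in> {..<1} \<rightarrow>\<^sub>E F W \<and>
        m = (\<Oplus>\<^bsub>Mod L W\<^esub>i\<in>{..<1::nat}. (\<lambda>i\<in>{..<1::nat}. h) i \<odot>[L,W] mres L V W (e i))"
      if "h \<in> F W \<and> m = h \<odot>[L,W] ?e" for h
      using that sum[of "\<lambda>i\<in>{..<1::nat}. h"] by auto
    have "(\<lambda>i\<in>{..<1::nat}. k) = (\<lambda>i\<in>{..<1::nat}. l)" 
      using ex by (rule ex1_eqI) (rule P[OF kl(1)], rule P[OF kl(2)])
    then have "(\<lambda>i\<in>{..<1::nat}. k) 0 = (\<lambda>i\<in>{..<1::nat}. l) 0" by (rule fun_cong)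
    then show "k = l" by simp
  qed
qed

lemma L_cover: "x \<in> U \<Longrightarrow> \<exists>V q. x \<in> V \<and> sec.generator V q"
  using L_free frame_generator unfolding locally_free_rank_def by meson

section \<open>Values of sections and nowhere vanishing sections\<close>

definition val :: "'x set \<Rightarrow> 'u \<Rightarrow> 'x cfun" where
  "val = (SOME v. sec.is_val v)"

lemma val: "sec.is_val val"
  unfolding val_def using sec.val_exists[OF L_cover] by (rule someI_ex)

lemmas val_ext = sec.is_valD(1)[OF val]
lemmas val_res = sec.is_valD(2)[OF val]
lemmas val_smult = sec.is_valD(3)[OF val]
lemmas val_inj = sec.is_valD(4)[OF val]
lemmas val_nz = sec.is_val_nz[OF val]

lemma val_apply:
  assumes V: "V \<in> opens X U" and m: "m \<in> Lc V" and W: "W \<in> opens X V" and k: "k \<in> F W" and q: "q \<in> Lc W"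
    and eq: "mres L V W m = k \<odot>[L,W] q" and y: "y \<in> W"
  shows "val V m y = k y * val W q y"
proof -
  have "restrict (val V m) W = (\<lambda>x\<in>W. k x * val W q x)"
    using val_res[OF V m W] val_smult[OF opens_trans[OF V W] q k] eq by metis
  from fun_cong[OF this, of y] show ?thesis using y by simp
qed

lemma L_cover_in:
  assumes V: "V \<in> opens X U" and x: "x \<in> V"
  shows "\<exists>W q. W \<in> opens X V \<and> x \<in> W \<and> sec.generator W q"
proof -
  obtain N q where N: "x \<in> N" "sec.generator N q" using L_cover x opens_subset[OF V] by blast
  have "V \<inter> N \<in> opens X N" "V \<inter> N \<in> opens X V"
    using opens_Int'[OF sec.generatorD(1)[OF N(2)] oU[OF V]] opens_Int[OF V oU[OF sec.generatorD(1)[OF N(2)]]] .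
  then show ?thesis using sec.generator_res[OF N(2)] x N(1) by blast
qed

text \<open>\<open>is_val\<close> speaks of multiplication only. Additivity follows since near
  \<open>x\<close> both sections are multiples of one generator.\<close>

lemma val_plus:
  assumes V: "V \<in> opens X U" and m: "m \<in> Lc V" "m' \<in> Lc V" and x: "x \<in> V"
  shows "val V (m \<oplus>[L,V] m') x = val V m x + val V m' x"
proof -
  obtain W q where W: "W \<in> opens X V" "x \<in> W" "sec.generator W q" using L_cover_in[OF V x] by blast
  note WW = opens_self[OF opens_openin[OF W(1)]]
  note WU = opens_trans[OF V W(1)]
  note q = sec.generatorD(1,2)[OF W(3)]
  interpret M: module "R V" "Mod L V" by (rule L_module[OF V])
  interpret N: module "R W" "Mod L W" by (rule L_module[OF WU])
  note r = sec.res_closed[OF V m(1) W(1)] sec.res_closed[OF V m(2) W(1)]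
  obtain k where k: "k \<in> F W" "mres L V W m = k \<odot>[L,W] q"
    using sec.generatorD(3)[OF W(3) WW r(1)] sec.res_id[OF q] by auto
  obtain l where l: "l \<in> F W" "mres L V W m' = l \<odot>[L,W] q"
    using sec.generatorD(3)[OF W(3) WW r(2)] sec.res_id[OF q] by auto
  have "mres L V W (m \<oplus>[L,V] m') = (k \<oplus>\<^bsub>R W\<^esub> l) \<odot>[L,W] q"
    using module_sheafD(3)[OF L_sheaf V W(1) m] k l q N.smult_l_distr by simp
  moreover have "k \<oplus>\<^bsub>R W\<^esub> l \<in> F W" using k l by simp
  moreover have mm: "m \<oplus>[L,V] m' \<in> Lc V" using m by simp
  ultimately have "val V (m \<oplus>[L,V] m') x = (k x + l x) * val W q x"
    using val_apply[OF V mm W(1) _ q(2) _ W(2), of "k \<oplus>\<^bsub>R W\<^esub> l"] W(2) by (simp add: OXP_simps)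
  then show ?thesis
    using val_apply[OF V m(1) W(1) k(1) q(2) k(2) W(2)] val_apply[OF V m(2) W(1) l(1) q(2) l(2) W(2)]
    by (simp add: algebra_simps)
qed

lemma val_minus:
  assumes V: "V \<in> opens X U" and m: "m \<in> Lc V" "m' \<in> Lc V" and x: "x \<in> V"
  shows "val V (m \<ominus>\<^bsub>Mod L V\<^esub> m') x = val V m x - val V m' x"
proof -
  interpret M: module "R V" "Mod L V" by (rule L_module[OF V])
  have mm: "m \<ominus>\<^bsub>Mod L V\<^esub> m' \<in> Lc V" using m by simp
  have "(m \<ominus>\<^bsub>Mod L V\<^esub> m') \<oplus>[L,V] m' = m"
    using m by (simp add: a_minus_def M.M.a_assoc M.M.l_neg)
  then show ?thesis using val_plus[OF V mm m(2) x] by simp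
qed

lemma val_eqI:
  "V \<in> opens X U \<Longrightarrow> m \<in> Lc V \<Longrightarrow> m' \<in> Lc V \<Longrightarrow> (\<And>x. x \<in> V \<Longrightarrow> val V m x = val V m' x) \<Longrightarrow> m = m'"
  by (rule val_inj) (auto intro: extensionalityI[OF val_ext val_ext])

abbreviation "nv V \<equiv> nonvanishing X (OXP X A P) L V"

text \<open>Near \<open>x\<close> a section is a multiple \<open>k q\<close> of a generator
  \<open>q\<close> with nonzero value at \<open>x\<close>, so vanishing in the fibre and vanishing
  of the value both mean \<open>k x = 0\<close>.\<close>

lemma nv_iff:
  assumes V: "V \<in> opens X U"
  shows "s \<in> nv V \<longleftrightarrow> s \<in> Lc V \<and> (\<forall>x\<in>V. val V s x \<noteq> 0)"
proof -
  have "vanishes_at X R L V s x \<longleftrightarrow> val V s x = 0" if s: "s \<in> Lc V" and x: "x \<in> V" for x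
  proof
    assume "vanishes_at X R L V s x"
    then obtain W f t where W: "W \<in> opens X V" "x \<in> W" "f \<in> F W" "t \<in> Lc W" "f x = 0"
      "mres L V W s = f \<odot>[L,W] t" unfolding vanishes_at_def by blast
    show "val V s x = 0" using val_apply[OF V s W(1,3,4,6,2)] W(5) by simp
  next
    assume 0: "val V s x = 0"
    obtain W q where W: "W \<in> opens X V" "x \<in> W" "sec.generator W q" using L_cover_in[OF V x] by blast
    note q = sec.generatorD(1,2)[OF W(3)]
    obtain k where k: "k \<in> F W" "mres L V W s = k \<odot>[L,W] q"
      using sec.generatorD(3)[OF W(3) opens_self[OF opens_openin[OF W(1)]] sec.res_closed[OF V s W(1)]]
        sec.res_id[OF q] by auto
    have "k x = 0" using val_apply[OF V s W(1) k(1) q(2) k(2) W(2)] 0 val_nz[OF W(3,2)] by simp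
    then show "vanishes_at X R L V s x" unfolding vanishes_at_def using W k q by blast
  qed
  then show ?thesis unfolding nonvanishing_def by blast
qed

text \<open>Single values need not belong to \<open>OXP\<close>, but near each point the generator
  cancels from the quotient and leaves a quotient of coefficients. This is the way back from values
  to scalars.\<close>

lemma nv_quotient:
  assumes V: "V \<in> opens X U" and s: "s \<in> nv V" and m: "m \<in> Lc V"
  shows "(\<lambda>x\<in>V. val V m x / val V s x) \<in> F V"
    and "m = (\<lambda>x\<in>V. val V m x / val V s x) \<odot>[L,V] s"
proof -
  have s': "s \<in> Lc V" "\<And>x. x \<in> V \<Longrightarrow> val V s x \<noteq> 0" using s nv_iff[OF V] by auto
  show q: "(\<lambda>x\<in>V. val V m x / val V s x) \<in> F V"
  proof (rule F_local[OF oU[OF V]])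
    fix x assume x: "x \<in> V"
    obtain W q where W: "W \<in> opens X V" "x \<in> W" "sec.generator W q" using L_cover_in[OF V x] by blast
    note WW = opens_self[OF opens_openin[OF W(1)]]
    note q = sec.generatorD(1,2)[OF W(3)]
    obtain k where k: "k \<in> F W" "mres L V W m = k \<odot>[L,W] q"
      using sec.generatorD(3)[OF W(3) WW sec.res_closed[OF V m W(1)]] sec.res_id[OF q] by auto
    obtain l where l: "l \<in> F W" "mres L V W s = l \<odot>[L,W] q"
      using sec.generatorD(3)[OF W(3) WW sec.res_closed[OF V s'(1) W(1)]] sec.res_id[OF q] by auto
    have vm: "val V m y = k y * val W q y" "val V s y = l y * val W q y" if "y \<in> W" for y
      using val_apply[OF V m W(1) k(1) q(2) k(2) that] val_apply[OF V s'(1) W(1) l(1) q(2) l(2) that] .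
    have lnz: "l y \<noteq> 0" if "y \<in> W" for y using vm(2)[OF that] s'(2) that opens_subset[OF W(1)] by auto
    have "restrict (\<lambda>x\<in>V. val V m x / val V s x) W = (\<lambda>x\<in>W. k x / l x)"
      using vm val_nz[OF W(3)] opens_subset[OF W(1)] by (auto simp: restrict_def fun_eq_iff)
    then have "restrict (\<lambda>x\<in>V. val V m x / val V s x) W \<in> F W"
      using F_divide[OF oU[OF q(1)] k(1) l(1) lnz] by simp
    then show "\<exists>W\<in>opens X V. x \<in> W \<and> restrict (\<lambda>x\<in>V. val V m x / val V s x) W \<in> F W" using W by blast
  qed simp
  show "m = (\<lambda>x\<in>V. val V m x / val V s x) \<odot>[L,V] s"
    by (rule val_eqI[OF V m sec.act_closed[OF V q s'(1)]]) (use val_smult[OF V s'(1) q] s'(2) in simp)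
qed

text \<open>The coefficient of a section is the quotient of values from \<open>nv_quotient\<close>.
  Together with \<open>generator_nv\<close> this identifies frames with nowhere vanishing
  sections.\<close>

lemma nv_generator:
  assumes V: "V \<in> opens X U" and s: "s \<in> nv V"
  shows "sec.generator V s"
  unfolding sec.generator_def
proof (intro conjI ballI V)
  show s': "s \<in> Lc V" using s nv_iff[OF V] by blast
  fix W m assume W: "W \<in> opens X V" and m: "m \<in> Lc W"
  note WU = opens_trans[OF V W]
  have sW: "mres L V W s \<in> nv W"
    using s sec.res_closed[OF V s' W] val_res[OF V s' W] opens_subset[OF W] unfolding nv_iff[OF V] nv_iff[OF WU] by auto
  then have sW': "mres L V W s \<in> Lc W" "\<And>x. x \<in> W \<Longrightarrow> val W (mres L V W s) x \<noteq> 0"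
    using nv_iff[OF WU] by auto
  show "\<exists>!k. k \<in> F W \<and> m = k \<odot>[L,W] mres L V W s"
  proof (rule ex_ex1I)
    show "\<exists>k. k \<in> F W \<and> m = k \<odot>[L,W] mres L V W s" using nv_quotient[OF WU sW m] by blast
    fix k l assume "k \<in> F W \<and> m = k \<odot>[L,W] mres L V W s" "l \<in> F W \<and> m = l \<odot>[L,W] mres L V W s"
    then have kl: "k \<in> F W" "l \<in> F W" "k \<odot>[L,W] mres L V W s = l \<odot>[L,W] mres L V W s" by auto
    show "k = l"
    proof (rule extensionalityI[OF F_ext[OF kl(1)] F_ext[OF kl(2)]])
      fix x assume x: "x \<in> W"
      have "(\<lambda>x\<in>W. k x * val W (mres L V W s) x) x = (\<lambda>x\<in>W. l x * val W (mres L V W s) x) x"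
        using val_smult[OF WU sW'(1) kl(1)] val_smult[OF WU sW'(1) kl(2)] kl(3) by metis
      then show "k x = l x" using sW'(2)[OF x] x by simp
    qed
  qed
qed

lemma generator_nv: "sec.generator V s \<Longrightarrow> s \<in> nv V"
  using nv_iff[OF sec.generatorD(1)] sec.generatorD(2) val_nz by blast

lemma nv_res: "V \<in> opens X U \<Longrightarrow> s \<in> nv V \<Longrightarrow> W \<in> opens X V \<Longrightarrow> mres L V W s \<in> nv W"
  using generator_nv sec.generator_res nv_generator by blast

lemma nv_smult:
  assumes V: "V \<in> opens X U" and s: "s \<in> nv V" and g: "g \<in> Uts V" shows "g \<odot>[L,V] s \<in> nv V"
  using s UtsD[OF g] sec.act_closed[OF V UtsD(1)[OF g]] val_smult[OF V _ UtsD(1)[OF g]] unfolding nv_iff[OF V] by auto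

end

section \<open>The torsor of a line bundle with an action\<close>

lemma F_Ob_simps:
  "tsec (F_Ob X A P B U L) = nonvanishing X (OXP X A P) L" "tres (F_Ob X A P B U L) = mres L"
  "tact (F_Ob X A P B U L) = (\<lambda>V f s. f \<odot>[L,V] s)" "triv (F_Ob X A P B U L) = nabla X A P B U L"
  by (simp_all add: F_Ob_def)

lemma ext_structure_eq_iff:
  "ext_structure X B L V D = ext_structure X B L V D' \<longleftrightarrow>
    (\<forall>W\<in>opens X V. \<forall>b\<in>carrier (Mod B W). \<forall>m\<in>carrier (Mod L W). D W b m = D' W b m)"
proof
  assume eq: "ext_structure X B L V D = ext_structure X B L V D'"
  show "\<forall>W\<in>opens X V. \<forall>b\<in>carrier (Mod B W). \<forall>m\<in>carrier (Mod L W). D W b m = D' W b m"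
  proof (intro ballI)
    fix W b m assume "W \<in> opens X V" "b \<in> carrier (Mod B W)" "m \<in> carrier (Mod L W)"
    then show "D W b m = D' W b m"
      using fun_cong[OF fun_cong[OF fun_cong[OF eq, of W], of b], of m] by (simp add: ext_structure_def)
  qed
qed (auto simp: ext_structure_def intro!: restrict_ext)

locale B_line_bundle = line_bundle X A P B U L for X :: "'x topology" and A P and B :: "('x, 'b) lie_algd"
    and U and L :: "('x, 'u, 'b) bmod" +
  assumes Bstr: "B_module_structure X A P B U L (bact L)"
begin

lemma bactD:
  assumes V: "V \<in> opens X U" and b: "b \<in> Bc V" and m: "m \<in> Lc V"
  shows "bact L V b m \<in> Lc V"
    and "W \<in> opens X V \<Longrightarrow> mres L V W (bact L V b m) = bact L W (mres B V W b) (mres L V W m)"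
    and "m' \<in> Lc V \<Longrightarrow> bact L V b (m \<oplus>[L,V] m') = bact L V b m \<oplus>[L,V] bact L V b m'"
    and "b' \<in> Bc V \<Longrightarrow> bact L V (b \<oplus>[B,V] b') m = bact L V b m \<oplus>[L,V] bact L V b' m"
    and "b' \<in> Bc V \<Longrightarrow> bact L V (br V b b') m =
      bact L V b (bact L V b' m) \<ominus>\<^bsub>Mod L V\<^esub> bact L V b' (bact L V b m)"
    and "f \<in> F V \<Longrightarrow> bact L V (f \<odot>[B,V] b) m = f \<odot>[L,V] bact L V b m"
    and "f \<in> F V \<Longrightarrow> bact L V b (f \<odot>[L,V] m) =
      ac V b f \<odot>[L,V] m \<oplus>[L,V] f \<odot>[L,V] bact L V b m"
proof -
  note h = Bstr[unfolded B_module_structure_def, THEN bspec, OF V, THEN bspec, OF b, THEN bspec, OF m]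
  show "bact L V b m \<in> Lc V"
    and "W \<in> opens X V \<Longrightarrow> mres L V W (bact L V b m) = bact L W (mres B V W b) (mres L V W m)"
    and "m' \<in> Lc V \<Longrightarrow> bact L V b (m \<oplus>[L,V] m') = bact L V b m \<oplus>[L,V] bact L V b m'"
    and "b' \<in> Bc V \<Longrightarrow> bact L V (b \<oplus>[B,V] b') m = bact L V b m \<oplus>[L,V] bact L V b' m"
    and "b' \<in> Bc V \<Longrightarrow> bact L V (br V b b') m =
      bact L V b (bact L V b' m) \<ominus>\<^bsub>Mod L V\<^esub> bact L V b' (bact L V b m)"
    and "f \<in> F V \<Longrightarrow> bact L V (f \<odot>[B,V] b) m = f \<odot>[L,V] bact L V b m"
    and "f \<in> F V \<Longrightarrow> bact L V b (f \<odot>[L,V] m) =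
      ac V b f \<odot>[L,V] m \<oplus>[L,V] f \<odot>[L,V] bact L V b m"
    using h by blast+
qed

lemma val_smult': "V \<in> opens X U \<Longrightarrow> m \<in> Lc V \<Longrightarrow> f \<in> F V \<Longrightarrow> x \<in> V \<Longrightarrow> val V (f \<odot>[L,V] m) x = f x * val V m x"
  using val_smult by simp

lemma val_res': "V \<in> opens X U \<Longrightarrow> m \<in> Lc V \<Longrightarrow> W \<in> opens X V \<Longrightarrow> x \<in> W \<Longrightarrow> val W (mres L V W m) x = val V m x"
  using val_res by simp

lemma val_bact_smult:
  assumes V: "V \<in> opens X U" and b: "b \<in> Bc V" and m: "m \<in> Lc V" and f: "f \<in> F V" and x: "x \<in> V"
  shows "val V (bact L V b (f \<odot>[L,V] m)) x = ac V b f x * val V m x + f x * val V (bact L V b m) x"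
proof -
  note a = ac_closed[OF oU[OF V] b f] and bm = bactD(1)[OF V b m]
  show ?thesis
    unfolding bactD(7)[OF V b m f] val_plus[OF V sec.act_closed[OF V a m] sec.act_closed[OF V f bm] x]
    using val_smult'[OF V m a x] val_smult'[OF V bm f x] by simp
qed

lemma val_bact_res:
  assumes V: "V \<in> opens X U" and b: "b \<in> Bc V" and m: "m \<in> Lc V" and W: "W \<in> opens X V" and x: "x \<in> W"
  shows "val W (bact L W (mres B V W b) (mres L V W m)) x = val V (bact L V b m) x"
  using val_res'[OF V bactD(1)[OF V b m] W x] bactD(2)[OF V b m W] by simp

text \<open>By the Leibniz rule a structure is determined by its effect on the generator
  \<open>s\<close>. As \<open>dlog_section\<close> has b.s = 0 and \<open>conn_act\<close> subtracts
  the form, the equality of structures in \<open>nabla\<close> reduces to b.s = - \<omega>(b) s,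
  written here with values.\<close>

lemma nabla_iff:
  assumes V: "V \<in> opens X U"
  shows "(s, \<omega>) \<in> nab U L V \<longleftrightarrow> s \<in> nv V \<and> \<omega> \<in> Cl V \<and>
    (\<forall>W\<in>opens X V. \<forall>b\<in>Bc W. \<forall>x\<in>W. val W (bact L W b (mres L V W s)) x = - \<omega> W [b] x * val V s x)"
proof (cases "s \<in> nv V \<and> \<omega> \<in> Cl V")
  case False
  then show ?thesis using V by (auto simp: nabla_def)
next
  case True
  then have s: "s \<in> nv V" and w: "\<omega> \<in> Cl V" by auto
  note g = nv_generator[OF V s]
  note sL = sec.generatorD(2)[OF g]
  let ?D = "dlog_section X R B L V s"
  \<comment> \<open>The definite description in \<open>dlog_section\<close> finds the coefficient
    because \<open>s\<close> is a generator.\<close>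
  have D: "?D W b (f \<odot>[L,W] mres L V W s) = ac W b f \<odot>[L,W] mres L V W s"
    if W: "W \<in> opens X V" and b: "b \<in> Bc W" and f: "f \<in> F W" for W b f
  proof -
    have "(THE h. h \<in> F W \<and> f \<odot>[L,W] mres L V W s = h \<odot>[L,W] mres L V W s) = f"
      by (rule the_equality) (use f sec.generatorD(4)[OF g W] in auto)
    then show ?thesis
      using W b sec.act_closed[OF opens_trans[OF V W] f sec.res_closed[OF V sL W]]
      by (simp add: dlog_section_def ext_structure_def)
  qed
  have "(s, \<omega>) \<in> nab U L V \<longleftrightarrow>
    (\<forall>W\<in>opens X V. \<forall>b\<in>Bc W. \<forall>m\<in>Lc W. ?D W b m \<ominus>\<^bsub>Mod L W\<^esub> \<omega> W [b] \<odot>[L,W] m = bact L W b m)"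
    using V s w by (simp add: nabla_def conn_act_def ext_structure_eq_iff)
  also have "\<dots> \<longleftrightarrow> (\<forall>W\<in>opens X V. \<forall>b\<in>Bc W. \<forall>x\<in>W. val W (bact L W b (mres L V W s)) x = - \<omega> W [b] x * val V s x)"
    (is "?l \<longleftrightarrow> ?r")
  proof (intro ball_cong refl)
    fix W b assume W: "W \<in> opens X V" and b: "b \<in> Bc W"
    note WU = opens_trans[OF V W]
    note sW = sec.res_closed[OF V sL W]
    note wb = ClD(1)[OF oU[OF V] w W b]
    note bs = bactD(1)[OF WU b sW]
    interpret M: module "R W" "Mod L W" by (rule L_module[OF WU])
    have E: "?D W b (f \<odot>[L,W] mres L V W s) \<ominus>\<^bsub>Mod L W\<^esub> \<omega> W [b] \<odot>[L,W] (f \<odot>[L,W] mres L V W s) \<in> Lc W"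
      "x \<in> W \<Longrightarrow> val W (?D W b (f \<odot>[L,W] mres L V W s) \<ominus>\<^bsub>Mod L W\<^esub> \<omega> W [b] \<odot>[L,W] (f \<odot>[L,W] mres L V W s)) x
        = ac W b f x * val V s x - \<omega> W [b] x * (f x * val V s x)"
      if f: "f \<in> F W" for f x
    proof -
      note a = ac_closed[OF oU[OF WU] b f]
      note fs = sec.act_closed[OF WU f sW]
      show "?D W b (f \<odot>[L,W] mres L V W s) \<ominus>\<^bsub>Mod L W\<^esub> \<omega> W [b] \<odot>[L,W] (f \<odot>[L,W] mres L V W s) \<in> Lc W"
        unfolding D[OF W b f] using a wb fs sW by simp
      assume x: "x \<in> W"
      show "val W (?D W b (f \<odot>[L,W] mres L V W s) \<ominus>\<^bsub>Mod L W\<^esub> \<omega> W [b] \<odot>[L,W] (f \<odot>[L,W] mres L V W s)) x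
        = ac W b f x * val V s x - \<omega> W [b] x * (f x * val V s x)"
        unfolding D[OF W b f] val_minus[OF WU sec.act_closed[OF WU a sW] sec.act_closed[OF WU wb fs] x]
          val_smult'[OF WU sW a x] val_smult'[OF WU fs wb x] val_smult'[OF WU sW f x] val_res'[OF V sL W x] ..
    qed
    show "(\<forall>m\<in>Lc W. ?D W b m \<ominus>\<^bsub>Mod L W\<^esub> \<omega> W [b] \<odot>[L,W] m = bact L W b m) \<longleftrightarrow>
      (\<forall>x\<in>W. val W (bact L W b (mres L V W s)) x = - \<omega> W [b] x * val V s x)"
    proof
      assume l: "\<forall>m\<in>Lc W. ?D W b m \<ominus>\<^bsub>Mod L W\<^esub> \<omega> W [b] \<odot>[L,W] m = bact L W b m"
      show "\<forall>x\<in>W. val W (bact L W b (mres L V W s)) x = - \<omega> W [b] x * val V s x"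
      proof
        fix x assume x: "x \<in> W"
        \<comment> \<open>The section \<open>s\<close> itself has the constant coefficient 1, which
          \<open>b\<close> kills, so the form is isolated.\<close>
        have 1: "(\<lambda>x\<in>W. 1) \<odot>[L,W] mres L V W s = mres L V W s" by (rule sec.act_one[OF WU sW])
        note E1 = E(2)[OF F_const[OF oU[OF WU], of 1] x, unfolded 1]
        show "val W (bact L W b (mres L V W s)) x = - \<omega> W [b] x * val V s x"
          using E1 l sW ac_const[OF oU[OF WU] b x, of 1] x by simp
      qed
    next
      assume r: "\<forall>x\<in>W. val W (bact L W b (mres L V W s)) x = - \<omega> W [b] x * val V s x"
      show "\<forall>m\<in>Lc W. ?D W b m \<ominus>\<^bsub>Mod L W\<^esub> \<omega> W [b] \<odot>[L,W] m = bact L W b m"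
      proof
        fix m assume m: "m \<in> Lc W"
        obtain f where f: "f \<in> F W" "m = f \<odot>[L,W] mres L V W s" using sec.generatorD(3)[OF g W m] by blast
        show "?D W b m \<ominus>\<^bsub>Mod L W\<^esub> \<omega> W [b] \<odot>[L,W] m = bact L W b m"
          unfolding f(2)
        proof (rule val_eqI[OF WU E(1)[OF f(1)] bactD(1)[OF WU b sec.act_closed[OF WU f(1) sW]]])
          fix x assume x: "x \<in> W"
          show "val W (?D W b (f \<odot>[L,W] mres L V W s) \<ominus>\<^bsub>Mod L W\<^esub> \<omega> W [b] \<odot>[L,W] (f \<odot>[L,W] mres L V W s)) x
            = val W (bact L W b (f \<odot>[L,W] mres L V W s)) x"
            unfolding E(2)[OF f(1) x] val_bact_smult[OF WU b sW f(1) x] val_res'[OF V sL W x]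
            using r x by (simp add: algebra_simps)
        qed
      qed
    qed
  qed
  finally show ?thesis using s w by simp
qed

lemma nablaD:
  assumes "(s, \<omega>) \<in> nab U L V"
  shows "V \<in> opens X U" "s \<in> nv V" "s \<in> Lc V" "\<omega> \<in> Cl V"
proof -
  show V: "V \<in> opens X U" using assms by (simp add: nabla_def split: if_splits)
  show "s \<in> nv V" "\<omega> \<in> Cl V" using assms nabla_iff[OF V] by auto
  then show "s \<in> Lc V" using nv_iff[OF V] by blast
qed

text \<open>For m = h s the Leibniz rule gives b.m = (b(h) - \<omega>(b) h) s. The same expression
  is later taken as a definition, in \<open>loc_act\<close>, when actions are constructed.\<close>

lemma nabla_bact:
  assumes s: "(s, \<omega>) \<in> nab U L V" and W: "W \<in> opens X V" and b: "b \<in> Bc W" and m: "m \<in> Lc W"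
    and h: "h \<in> F W" and eq: "\<And>y. y \<in> W \<Longrightarrow> val W m y = h y * val V s y" and x: "x \<in> W"
  shows "val W (bact L W b m) x = (ac W b h x - \<omega> W [b] x * h x) * val V s x"
proof -
  note V = nablaD(1)[OF s] and sL = nablaD(3)[OF s]
  note WU = opens_trans[OF V W]
  note sW = sec.res_closed[OF V sL W]
  have "m = h \<odot>[L,W] mres L V W s"
    by (rule val_eqI[OF WU m sec.act_closed[OF WU h sW]])
       (use eq val_smult'[OF WU sW h] val_res'[OF V sL W] in simp)
  moreover have "val W (bact L W b (mres L V W s)) x = - \<omega> W [b] x * val V s x"
    using s b x W unfolding nabla_iff[OF V] by blast
  ultimately show ?thesis
    using val_bact_smult[OF WU b sW h x] val_res'[OF V sL W x] by (simp add: algebra_simps)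
qed

text \<open>The form is minus the coefficient of b.s with respect to \<open>s\<close>. That
  coefficient lies in \<open>OXP\<close> by \<open>nv_quotient\<close>, and flatness of the action
  becomes closedness of the form.\<close>

lemma nabla_exists:
  assumes V: "V \<in> opens X U" and s: "s \<in> nv V"
  shows "\<exists>\<omega>. (s, \<omega>) \<in> nab U L V"
proof -
  have s': "s \<in> Lc V" "\<And>x. x \<in> V \<Longrightarrow> val V s x \<noteq> 0" using s nv_iff[OF V] by auto
  define k where "k W b = (\<lambda>x\<in>W. val W (bact L W b (mres L V W s)) x / val V s x)" for W b
  define \<eta> where "\<eta> W b = (\<lambda>x\<in>W. - k W b x)" for W b
  have kv: "val W (bact L W b (mres L V W s)) x = k W b x * val V s x"
    if "W \<in> opens X V" "x \<in> W" for W b x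
    using that s'(2) opens_subset[OF that(1)] by (auto simp: k_def)
  have kF: "k W b \<in> F W" if W: "W \<in> opens X V" and b: "b \<in> Bc W" for W b
  proof -
    note WU = opens_trans[OF V W]
    have "k W b = (\<lambda>x\<in>W. val W (bact L W b (mres L V W s)) x / val W (mres L V W s) x)"
      unfolding k_def using val_res'[OF V s'(1) W] by (auto simp: restrict_def fun_eq_iff)
    then show ?thesis
      using nv_quotient(1)[OF WU nv_res[OF V s W] bactD(1)[OF WU b sec.res_closed[OF V s'(1) W]]] by simp
  qed
  have cl: "closed_on V \<eta>"
    unfolding closed_on_def
  proof (intro ballI conjI)
    fix W b assume W: "W \<in> opens X V" and b: "b \<in> Bc W"
    note WU = opens_trans[OF V W]
    note oW = oU[OF WU]
    note sW = sec.res_closed[OF V s'(1) W]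
    interpret M: module "R W" "Mod B W" by (rule B_module[OF oW])
    have nz: "val V s x \<noteq> 0" if "x \<in> W" for x using that s'(2) opens_subset[OF W] by auto
    show "\<eta> W b \<in> F W" unfolding \<eta>_def by (rule F_minus[OF oW kF[OF W b]])
    show "\<eta> Z (mres B W Z b) = restrict (\<eta> W b) Z" if Z: "Z \<in> opens X W" for Z
    proof -
      have "k Z (mres B W Z b) x = k W b x" if x: "x \<in> Z" for x
        using val_bact_res[OF WU b sW Z x] sec.res_res[OF V s'(1) W Z] x opens_subset[OF Z] by (auto simp: k_def)
      then show ?thesis using opens_subset[OF Z] by (auto simp: \<eta>_def restrict_def fun_eq_iff)
    qed
    show "\<eta> W (f \<odot>[B,W] b) = (\<lambda>x\<in>W. f x * \<eta> W b x)" if f: "f \<in> F W" for f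
    proof -
      have "k W (f \<odot>[B,W] b) x = f x * k W b x" if x: "x \<in> W" for x
        using bactD(6)[OF WU b sW f] val_smult'[OF WU bactD(1)[OF WU b sW] f x] x by (simp add: k_def)
      then show ?thesis by (auto simp: \<eta>_def restrict_def fun_eq_iff)
    qed
    fix b' assume b': "b' \<in> Bc W"
    show "\<eta> W (b \<oplus>[B,W] b') = (\<lambda>x\<in>W. \<eta> W b x + \<eta> W b' x)"
    proof -
      have "k W (b \<oplus>[B,W] b') x = k W b x + k W b' x" if x: "x \<in> W" for x
        using bactD(4)[OF WU b sW b'] val_plus[OF WU bactD(1)[OF WU b sW] bactD(1)[OF WU b' sW] x] x
        by (simp add: k_def add_divide_distrib)
      then show ?thesis by (auto simp: \<eta>_def restrict_def fun_eq_iff)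
    qed
    fix x assume x: "x \<in> W"
    \<comment> \<open>The product of the two coefficients in b.(b'.s) is symmetric in
      \<open>b\<close> and \<open>b'\<close>, so it drops out of the commutator.\<close>
    have L2: "val W (bact L W c (bact L W c' (mres L V W s))) x = (ac W c (k W c') x + k W c' x * k W c x) * val V s x"
      if c: "c \<in> Bc W" and c': "c' \<in> Bc W" for c c'
    proof -
      have "bact L W c' (mres L V W s) = k W c' \<odot>[L,W] mres L V W s"
        by (rule val_eqI[OF WU bactD(1)[OF WU c' sW] sec.act_closed[OF WU kF[OF W c'] sW]])
           (use kv[OF W] val_smult'[OF WU sW kF[OF W c']] val_res'[OF V s'(1) W] in simp)
      then show ?thesis
        using val_bact_smult[OF WU c sW kF[OF W c'] x] kv[OF W x, of c] val_res'[OF V s'(1) W x]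
        by (simp add: algebra_simps)
    qed
    note bb = bactD(1)[OF WU b bactD(1)[OF WU b' sW]] and bb' = bactD(1)[OF WU b' bactD(1)[OF WU b sW]]
    have "k W (br W b b') x * val V s x = (ac W b (k W b') x - ac W b' (k W b) x) * val V s x"
      using kv[OF W x, of "br W b b'"] val_minus[OF WU bb bb' x] bactD(5)[OF WU b sW b'] L2[OF b b'] L2[OF b' b]
      by (simp add: algebra_simps)
    then have "k W (br W b b') x = ac W b (k W b') x - ac W b' (k W b) x" using nz[OF x] by simp
    then show "ac W b (\<eta> W b') x - ac W b' (\<eta> W b) x = \<eta> W (br W b b') x"
      unfolding \<eta>_def ac_minus[OF oW b kF[OF W b'] x] ac_minus[OF oW b' kF[OF W b] x] using x by simp
  qed
  \<comment> \<open>\<open>hd\<close> adapts the one-argument \<open>\<eta>\<close> to the list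
    convention of forms.\<close>
  note m = mk_form_Cl[OF oU[OF V] cl, of "\<lambda>W bs. \<eta> W (hd bs)", simplified]
  have "(s, mk_form X B (Suc 0) V (\<lambda>W bs. \<eta> W (hd bs))) \<in> nab U L V"
    unfolding nabla_iff[OF V]
  proof (intro conjI ballI s m(1))
    fix W b x assume W: "W \<in> opens X V" "b \<in> Bc W" "x \<in> W"
    show "val W (bact L W b (mres L V W s)) x = - mk_form X B (Suc 0) V (\<lambda>W bs. \<eta> W (hd bs)) W [b] x * val V s x"
      unfolding m(2)[OF W(1,2)] using kv[OF W(1,3)] W(3) by (simp add: \<eta>_def)
  qed
  then show ?thesis by blast
qed

section \<open>The torsor of nowhere vanishing sections and its trivialization\<close>

lemma nv_sheaf: "sheaf_on X U (nonvanishing X (OXP X A P) L) (mres L)"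
  unfolding sheaf_on_def
proof (intro conjI ballI allI impI)
  have nvL: "s \<in> Lc V" if "V \<in> opens X U" "s \<in> nv V" for V s using that nv_iff by blast
  show "mres L V V s = s" if "V \<in> opens X U" "s \<in> nv V" for V s by (rule sec.res_id[OF that(1) nvL[OF that]])
  show "mres L V W s \<in> nv W" if "V \<in> opens X U" "W \<in> opens X V" "s \<in> nv V" for V W s
    by (rule nv_res[OF that(1,3,2)])
  show "mres L W Z (mres L V W s) = mres L V Z s"
    if "V \<in> opens X U" "W \<in> opens X V" "Z \<in> opens X W" "s \<in> nv V" for V W Z s
    by (rule sec.res_res[OF that(1) nvL[OF that(1,4)] that(2,3)])
  fix C t assume C: "C \<subseteq> opens X U" and t: "\<forall>V\<in>C. t V \<in> nv V"
    and agree: "\<forall>V\<in>C. \<forall>W\<in>C. mres L V (V \<inter> W) (t V) = mres L W (V \<inter> W) (t W)"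
  have tL: "\<forall>V\<in>C. t V \<in> Lc V" using t nvL C by blast
  have CU: "\<Union>C \<in> opens X U" using C by (auto simp: opens_def)
  have ex: "\<exists>!s. s \<in> Lc (\<Union>C) \<and> (\<forall>V\<in>C. mres L (\<Union>C) V s = t V)"
    using sec.sheaf C tL agree unfolding sheaf_on_def by (elim conjE allE[of _ C] allE[of _ t]) blast
  then obtain s where s: "s \<in> Lc (\<Union>C)" "\<forall>V\<in>C. mres L (\<Union>C) V s = t V" by blast
  have nz: "\<forall>x\<in>\<Union>C. val (\<Union>C) s x \<noteq> 0"
  proof
    fix x assume x: "x \<in> \<Union>C"
    obtain V where V: "V \<in> C" "x \<in> V" using x by blast
    have VC: "V \<in> opens X (\<Union>C)" using V C by (auto simp: opens_def)
    have "val V (t V) x \<noteq> 0" using t V C nv_iff by blast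
    then show "val (\<Union>C) s x \<noteq> 0" using val_res'[OF CU s(1) VC V(2)] s(2) V(1) by simp
  qed
  have "s \<in> nv (\<Union>C)" unfolding nv_iff[OF CU] by (rule conjI[OF s(1) nz])
  then show "\<exists>!s. s \<in> nv (\<Union>C) \<and> (\<forall>V\<in>C. mres L (\<Union>C) V s = t V)"
    using s(2) ex nvL[OF CU] by (intro ex1I[of _ s]) (blast, metis)
qed

lemma F_torsor: "is_torsor X G U (FO U L)"
  unfolding is_torsor_def F_Ob_simps
proof (intro conjI ballI nv_sheaf)
  show "\<exists>V\<in>opens X U. x \<in> V \<and> nonvanishing X R L V \<noteq> {}" if "x \<in> U" for x
  proof -
    obtain V s where s: "x \<in> V" "sec.generator V s" using L_cover[OF \<open>x \<in> U\<close>] by blast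
    show ?thesis using sec.generatorD(1)[OF s(2)] generator_nv[OF s(2)] s(1) by blast
  qed
  fix V s assume V: "V \<in> opens X U" and s: "s \<in> nonvanishing X R L V"
  note GV = G_simps(1)[OF oU[OF V]]
  have sL: "s \<in> Lc V" using s nv_iff[OF V] by blast
  show "\<one>\<^bsub>Grp G V\<^esub> \<odot>[L,V] s = s" unfolding G_simps by (rule sec.act_one[OF V sL])
  show "\<exists>!g. g \<in> carrier (Grp G V) \<and> g \<odot>[L,V] s = s'" if s': "s' \<in> nonvanishing X R L V" for s'
    unfolding GV
  proof (rule ex_ex1I)
    have s'': "s' \<in> Lc V" "\<And>x. x \<in> V \<Longrightarrow> val V s' x \<noteq> 0" "\<And>x. x \<in> V \<Longrightarrow> val V s x \<noteq> 0"
      using s' s nv_iff[OF V] by auto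
    show "\<exists>g. g \<in> Uts V \<and> g \<odot>[L,V] s = s'"
      using nv_quotient[OF V s s''(1)] s''(2,3)
      by (intro exI[of _ "\<lambda>x\<in>V. val V s' x / val V s x"]) (auto simp: Uts_def)
    fix g h assume "g \<in> Uts V \<and> g \<odot>[L,V] s = s'" "h \<in> Uts V \<and> h \<odot>[L,V] s = s'"
    then show "g = h"
      using sec.generatorD(4)[OF nv_generator[OF V s] opens_self[OF oU[OF V]], of g h] sec.res_id[OF V sL]
        UtsD(1) by metis
  qed
  fix g assume "g \<in> carrier (Grp G V)"
  then have g: "g \<in> Uts V" using GV by simp
  show "g \<odot>[L,V] s \<in> nonvanishing X R L V" by (rule nv_smult[OF V s g])
  show "mres L V W (g \<odot>[L,V] s) = gres G V W g \<odot>[L,W] mres L V W s" if "W \<in> opens X V" for W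
    unfolding G_simps by (rule sec.act_res[OF V UtsD(1)[OF g] sL that])
  fix h assume "h \<in> carrier (Grp G V)"
  then have h: "h \<in> Uts V" using GV by simp
  show "(g \<otimes>[G,V] h) \<odot>[L,V] s = g \<odot>[L,V] (h \<odot>[L,V] s)"
    unfolding G_simps by (rule sec.act_mult[OF V UtsD(1)[OF g] UtsD(1)[OF h] sL])
qed

sublocale FT: gtorsor X A P B U "FO U L"
  by unfold_locales (rule U, rule F_torsor)

text \<open>The value map of \<open>L\<close> realizes its torsor as well. Hence
  \<open>tensor_pair\<close> can form torsor sums and tensor products from the same
  functions.\<close>

lemma FT_val: "FT.sec.is_val val"
proof -
  have "s \<in> nv V" if "FT.sec.generator V s" for V s
    using FT.sec.generatorD(2)[OF that] by (simp add: F_Ob_simps)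
  then have nz: "val V s x \<noteq> 0" if "FT.sec.generator V s" "x \<in> V" for V s x
    using nv_iff[OF FT.sec.generatorD(1)[OF that(1)]] that by blast
  show ?thesis
    unfolding FT.sec.is_val_def
  proof (intro conjI ballI allI impI)
    fix V s assume V: "V \<in> opens X U" and "s \<in> tsec (FO U L) V"
    then have s: "s \<in> Lc V" using nv_iff[OF V] by (simp add: F_Ob_simps)
    show "val V s \<in> extensional V" by (rule val_ext[OF V s])
    show "val W (tres (FO U L) V W s) = restrict (val V s) W" if "W \<in> opens X V" for W
      using val_res[OF V s that] by (simp only: F_Ob_simps)
    show "val V (tact (FO U L) V k s) = (\<lambda>x\<in>V. k x * val V s x)" if "k \<in> Uts V" for k
      using val_smult[OF V s UtsD(1)[OF that]] by (simp only: F_Ob_simps)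
    fix s' assume "s' \<in> tsec (FO U L) V" "val V s = val V s'"
    then show "s = s'" using val_inj[OF V s] nv_iff[OF V] by (simp add: F_Ob_simps)
  qed (rule nz)
qed

text \<open>Two representatives are related by the quotient \<open>g\<close> of their sections, and
  two computations of b.t show that the forms differ by \<open>dlog g\<close>. Locality holds since
  b.s = - \<omega>(b) s is a pointwise equation.\<close>

lemma nabla_quot_sections:
  "nabla X A P B U L \<in> quot_sections X (ind_sec H (FO U L)) (ind_res H (FO U L))
     (ind_rel G H d (FO U L)) U"
proof (rule FT.quot_sections_ttorsorI)
  show "nab U L V = {}" if "V \<notin> opens X U" for V using that by (simp add: nabla_def)
  show "t \<in> tsec (FO U L) V \<and> \<omega> \<in> Cl V" if "(t, \<omega>) \<in> nab U L V" for V t \<omega>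
    using nablaD[OF that] by (simp add: F_Ob_simps)
  show "(tres (FO U L) V W t, restrict \<omega> (opens X W)) \<in> nab U L W"
    if V: "V \<in> opens X U" and W: "W \<in> opens X V" and t: "(t, \<omega>) \<in> nab U L V" for V W t \<omega>
  proof -
    note n = nablaD[OF t]
    note WU = opens_trans[OF V W]
    show ?thesis
      unfolding F_Ob_simps nabla_iff[OF WU]
    proof (intro conjI ballI nv_res[OF V n(2) W] Cl_restrict[OF oU[OF V] n(4) W])
      fix Z b x assume Z: "Z \<in> opens X W" and b: "b \<in> Bc Z" and x: "x \<in> Z"
      have xW: "x \<in> W" using x opens_subset[OF Z] by blast
      have "val Z (bact L Z b (mres L V Z t)) x = - \<omega> Z [b] x * val V t x"
        using t opens_trans[OF W Z] b x unfolding nabla_iff[OF V] by blast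
      then show "val Z (bact L Z b (mres L W Z (mres L V W t))) x
          = - restrict \<omega> (opens X W) Z [b] x * val W (mres L V W t) x"
        using sec.res_res[OF V n(3) W Z] val_res'[OF V n(3) W xW] Z by simp
    qed
  qed
  show "((t, \<omega>), (t', \<omega>')) \<in> ind_rel G H d (FO U L) V"
    if V: "V \<in> opens X U" and t: "(t, \<omega>) \<in> nab U L V" and t': "(t', \<omega>') \<in> nab U L V" for V t \<omega> t' \<omega>'
  proof -
    note n = nablaD[OF t] and n' = nablaD[OF t']
    note oV = oU[OF V]
    obtain g where g: "g \<in> Uts V" "t = g \<odot>[L,V] t'"
      using FT.torsor_trans[OF V, of t' t] n n' by (auto simp: F_Ob_simps)
    note dg = dlog_Cl[OF oV g(1)]
    have "\<omega>' = d V g \<otimes>[H,V] \<omega>"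
    proof (rule Cl_eqI[OF oV n'(4) Cl_mult(1)[OF oV dg n(4)]])
      fix W b x assume W: "W \<in> opens X V" and b: "b \<in> Bc W" and x: "x \<in> W"
      note WU = opens_trans[OF V W]
      have xV: "x \<in> V" using x opens_subset[OF W] by blast
      note gW = F_restrict[OF UtsD(1)[OF g(1)] W]
      \<comment> \<open>b.t is computed first in the frame \<open>t'\<close>, where \<open>t\<close>
        has coefficient \<open>g\<close>, and then in the frame \<open>t\<close> itself.\<close>
      have "val W (bact L W b (mres L V W t)) x = (ac W b (restrict g W) x - \<omega>' W [b] x * restrict g W x) * val V t' x"
      proof (rule nabla_bact[OF t' W b sec.res_closed[OF V n(3) W] gW _ x])
        fix y assume y: "y \<in> W"
        then have "y \<in> V" using opens_subset[OF W] by blast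
        then show "val W (mres L V W t) y = restrict g W y * val V t' y"
          using val_res'[OF V n(3) W y] val_smult'[OF V n'(3) UtsD(1)[OF g(1)]] g(2) y by simp
      qed
      moreover have "val W (bact L W b (mres L V W t)) x = - \<omega> W [b] x * val V t x"
        using t W b x unfolding nabla_iff[OF V] by blast
      moreover have "val V t x = g x * val V t' x"
        using val_smult'[OF V n'(3) UtsD(1)[OF g(1)] xV] g(2) by simp
      ultimately have e: "(ac W b (restrict g W) x - \<omega>' W [b] x * g x) * val V t' x = (- \<omega> W [b] x * g x) * val V t' x"
        using x by (simp add: mult.assoc)
      have nz: "val V t' x \<noteq> 0" using n'(2) xV nv_iff[OF V] by blast
      have "ac W b (restrict g W) x - \<omega>' W [b] x * g x = - \<omega> W [b] x * g x"
        by (rule mult_right_cancel[OF nz, THEN iffD1, OF e])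
      then show "\<omega>' W [b] x = (d V g \<otimes>[H,V] \<omega>) W [b] x"
        unfolding Cl_mult(2)[OF oV dg n(4) W b] dlog_apply[OF W b] using x UtsD(2)[OF g(1) xV]
        by (simp add: field_simps)
    qed
    then show ?thesis unfolding FT.ind_rel_iff[OF V] F_Ob_simps using g n n' by blast
  qed
  show "\<exists>V\<in>opens X U. x \<in> V \<and> nab U L V \<noteq> {}" if "x \<in> U" for x
  proof -
    obtain V s where s: "x \<in> V" "sec.generator V s" using L_cover[OF \<open>x \<in> U\<close>] by blast
    note V = sec.generatorD(1)[OF s(2)]
    obtain \<omega> where "(s, \<omega>) \<in> nab U L V" using nabla_exists[OF V generator_nv[OF s(2)]] by blast
    then show ?thesis using V s(1) by blast
  qed
  show "(tact (FO U L) V g t, \<omega>) \<in> nab U L V"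
    if V: "V \<in> opens X U" and g: "g \<in> Uts V" and w: "\<omega> \<in> Cl V" and t: "(t, d V g \<otimes>[H,V] \<omega>) \<in> nab U L V"
    for V g t \<omega>
  proof -
    note n = nablaD[OF t]
    note oV = oU[OF V]
    note dg = dlog_Cl[OF oV g]
    note gt = sec.act_closed[OF V UtsD(1)[OF g] n(3)]
    show ?thesis
      unfolding F_Ob_simps nabla_iff[OF V]
    proof (intro conjI ballI nv_smult[OF V n(2) g] w)
      fix W b x assume W: "W \<in> opens X V" and b: "b \<in> Bc W" and x: "x \<in> W"
      note WU = opens_trans[OF V W]
      have xV: "x \<in> V" using x opens_subset[OF W] by blast
      note gW = F_restrict[OF UtsD(1)[OF g] W]
      have "val W (bact L W b (mres L V W (g \<odot>[L,V] t))) x =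
         (ac W b (restrict g W) x - (d V g \<otimes>[H,V] \<omega>) W [b] x * restrict g W x) * val V t x"
      proof (rule nabla_bact[OF t W b sec.res_closed[OF V gt W] gW _ x])
        fix y assume y: "y \<in> W"
        then have "y \<in> V" using opens_subset[OF W] by blast
        then show "val W (mres L V W (g \<odot>[L,V] t)) y = restrict g W y * val V t y"
          using val_res'[OF V gt W y] val_smult'[OF V n(3) UtsD(1)[OF g]] y by simp
      qed
      then show "val W (bact L W b (mres L V W (g \<odot>[L,V] t))) x = - \<omega> W [b] x * val V (g \<odot>[L,V] t) x"
        unfolding Cl_mult(2)[OF oV dg w W b] dlog_apply[OF W b] val_smult'[OF V n(3) UtsD(1)[OF g] xV]
        using x UtsD(2)[OF g xV] by (simp add: field_simps)
    qed
  qed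
  show "(t, \<omega>) \<in> nab U L V"
    if V: "V \<in> opens X U" and t': "t \<in> tsec (FO U L) V" and w: "\<omega> \<in> Cl V"
      and loc: "\<And>x. x \<in> V \<Longrightarrow> \<exists>W\<in>opens X V. x \<in> W \<and>
        (tres (FO U L) V W t, restrict \<omega> (opens X W)) \<in> nab U L W" for V t \<omega>
  proof -
    have t: "t \<in> nv V" "t \<in> Lc V" using t' nv_iff[OF V] by (auto simp: F_Ob_simps)
    show ?thesis
      unfolding nabla_iff[OF V]
    proof (intro conjI ballI t w)
      fix W b x assume W: "W \<in> opens X V" and b: "b \<in> Bc W" and x: "x \<in> W"
      then have xV: "x \<in> V" using opens_subset by blast
      note WU = opens_trans[OF V W]
      obtain N where N: "N \<in> opens X V" "x \<in> N" "(mres L V N t, restrict \<omega> (opens X N)) \<in> nab U L N"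
        using loc[OF xV] by (auto simp: F_Ob_simps)
      let ?Z = "W \<inter> N"
      have Z: "?Z \<in> opens X W" "?Z \<in> opens X N"
        using opens_Int[OF W opens_openin[OF N(1)]] opens_Int'[OF N(1) opens_openin[OF W]] by auto
      have xZ: "x \<in> ?Z" using x N(2) by blast
      note bZ = B_res[OF oU[OF WU] Z(1) b]
      have "val ?Z (bact L ?Z (mres B W ?Z b) (mres L N ?Z (mres L V N t))) x =
        - restrict \<omega> (opens X N) ?Z [mres B W ?Z b] x * val N (mres L V N t) x"
        using N(3) Z(2) bZ xZ unfolding nabla_iff[OF nablaD(1)[OF N(3)]] by blast
      moreover have "mres L N ?Z (mres L V N t) = mres L W ?Z (mres L V W t)"
        using sec.res_res[OF V t(2) N(1) Z(2)] sec.res_res[OF V t(2) W Z(1)] by simp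
      moreover have "\<omega> ?Z [mres B W ?Z b] x = \<omega> W [b] x"
        using ClD(2)[OF oU[OF V] w W b Z(1)] xZ by simp
      ultimately show "val W (bact L W b (mres L V W t)) x = - \<omega> W [b] x * val V t x"
        using val_bact_res[OF WU b sec.res_closed[OF V t(2) W] Z(1) xZ] val_res'[OF V t(2) N(1,2)] Z(2) by simp
    qed
  qed
qed

sublocale FT: ttorsor X A P B U "FO U L"
  by unfold_locales (use nabla_quot_sections in \<open>simp add: F_Ob_simps\<close>)

lemma F_Ob_Tors: "FO U L \<in> Tors_Ob X G H d U"
  using F_torsor nabla_quot_sections by (simp add: Tors_Ob_def F_Ob_simps)

end

lemma (in smooth_algebroid) B_line_bundleI:
  "openin X U \<Longrightarrow> L \<in> PicB_Ob X A P B U \<Longrightarrow> B_line_bundle X A P B U L"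
  by unfold_locales (auto simp: PicB_Ob_def)

section \<open>Morphisms of torsors\<close>

context smooth_algebroid
begin

abbreviation "ttors U T \<equiv> ttorsor X A P B U T"
abbreviation "bline U L \<equiv> B_line_bundle X A P B U L"
abbreviation "teq U S T \<equiv> equivariant X U Uts (tsec S) (tres S) (tact S) (tsec T) (tres T) (tact T)"

text \<open>Trivializations have to be matched on one representative near each point only. Any other
  differs from it by a unit, which relates the images in the same way, while the forms are not
  touched by \<open>h\<close>.\<close>

lemma Tors_MorI:
  assumes S: "ttors U S" and T: "ttors U T"
    and h: "h \<in> ext_family X U (tsec S)" "teq U S T h"
    and ex: "\<And>x. x \<in> U \<Longrightarrow> \<exists>V s \<omega>. x \<in> V \<and> (s, \<omega>) \<in> triv S V \<and> (h V s, \<omega>) \<in> triv T V"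
  shows "h \<in> TMor U S T"
proof -
  interpret S: ttorsor X A P B U S by (rule S)
  interpret T: ttorsor X A P B U T by (rule T)
  note hD = equivariantD[OF h(2)]
  have pres: "(h V s, \<omega>) \<in> triv T V" if s: "(s, \<omega>) \<in> triv S V" for V s \<omega>
  proof (rule T.triv_local[OF S.trivD(1)[OF s] hD(1)[OF S.trivD(1,2)[OF s]] S.trivD(3)[OF s]])
    note V = S.trivD[OF s]
    fix x assume x: "x \<in> V"
    then obtain N s0 \<omega>0 where N: "x \<in> N" "(s0, \<omega>0) \<in> triv S N" "(h N s0, \<omega>0) \<in> triv T N"
      using ex opens_subset[OF V(1)] by blast
    note n = S.trivD[OF N(2)]
    let ?Z = "V \<inter> N"
    have Z: "?Z \<in> opens X V" "?Z \<in> opens X N"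
      using opens_Int[OF V(1) opens_openin[OF n(1)]] opens_Int'[OF n(1) opens_openin[OF V(1)]] by auto
    have ZU: "?Z \<in> opens X U" by (rule opens_trans[OF V(1) Z(1)])
    obtain g where g: "g \<in> Uts ?Z" "tres S V ?Z s = tact S ?Z g (tres S N ?Z s0)"
      "restrict \<omega>0 (opens X ?Z) = d ?Z g \<otimes>\<^bsub>Grp H ?Z\<^esub> restrict \<omega> (opens X ?Z)"
      using S.triv_rel[OF S.triv_res[OF s Z(1)] S.triv_res[OF N(2) Z(2)]] by blast
    have "tres T V ?Z (h V s) = tact T ?Z g (tres T N ?Z (h N s0))"
      using hD(2)[OF V(1,2) Z(1)] hD(2)[OF n(1,2) Z(2)] g(2) hD(3)[OF ZU S.sec.res_closed[OF n(1,2) Z(2)] g(1)] by metis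
    then have "((tres T V ?Z (h V s), restrict \<omega> (opens X ?Z)), (tres T N ?Z (h N s0), restrict \<omega>0 (opens X ?Z))) \<in> ind_rel G H d T ?Z"
      unfolding T.ind_rel_iff[OF ZU] using g(1,3) T.sec.res_closed[OF n(1) hD(1)[OF n(1,2)] Z(2)]
        Cl_restrict[OF S.oU[OF V(1)] V(3) Z(1)] by blast
    then show "\<exists>W\<in>opens X V. x \<in> W \<and> (\<exists>t' \<omega>'. (t', \<omega>') \<in> triv T W \<and>
        ((tres T V W (h V s), restrict \<omega> (opens X W)), (t', \<omega>')) \<in> ind_rel G H d T W)"
      using Z(1) x N(1) T.triv_res[OF N(3) Z(2)] by blast
  qed
  have "ind_class X G H d T U (\<lambda>V. {(h V s, a) | s a. (s, a) \<in> triv S V}) = triv T"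
  proof (rule T.ind_class_eq)
    show "p \<in> triv T V" if "p \<in> {(h V s, a) | s a. (s, a) \<in> triv S V}" for V p using that pres by blast
    show "\<exists>W\<in>opens X V. x \<in> W \<and> (\<exists>p. p \<in> {(h W s, a) | s a. (s, a) \<in> triv S W})"
      if V: "V \<in> opens X U" and x: "x \<in> V" for V x using S.triv_exists_in[OF that] by blast
  qed
  moreover have "h V (tact S V g s) = tact T V g (h V s)"
    if "V \<in> opens X U" "s \<in> tsec S V" "g \<in> carrier (Grp G V)" for V s g
    using hD(3)[OF that(1,2)] that(3) G_simps(1)[OF S.oU[OF that(1)]] by simp
  ultimately show ?thesis
    unfolding Tors_Mor_def using h(1) hD(1,2) by blast
qed

lemma Tors_MorD:
  assumes S: "ttors U S" and T: "ttors U T" and h: "h \<in> TMor U S T"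
  shows "h \<in> ext_family X U (tsec S)" and "teq U S T h"
    and "(s, \<omega>) \<in> triv S V \<Longrightarrow> (h V s, \<omega>) \<in> triv T V"
proof -
  interpret S: ttorsor X A P B U S by (rule S)
  interpret T: ttorsor X A P B U T by (rule T)
  show "h \<in> ext_family X U (tsec S)" using h unfolding Tors_Mor_def by blast
  have h1: "\<forall>V\<in>opens X U. \<forall>s\<in>tsec S V. h V s \<in> tsec T V \<and>
        (\<forall>g\<in>carrier (Grp G V). h V (tact S V g s) = tact T V g (h V s)) \<and>
        (\<forall>W\<in>opens X V. h W (tres S V W s) = tres T V W (h V s))"
    and h2: "ind_class X G H d T U (\<lambda>V. {(h V s, a) | s a. (s, a) \<in> triv S V}) = triv T"
    using h unfolding Tors_Mor_def by blast+
  show e: "teq U S T h"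
    unfolding equivariant_def using h1 G_simps(1)[OF S.oU] by simp
  assume s: "(s, \<omega>) \<in> triv S V"
  note n = S.trivD[OF s]
  show "(h V s, \<omega>) \<in> triv T V"
    by (rule T.ind_class_sub[OF h2 n(1) _ equivariantD(1)[OF e n(1,2)] n(3)]) (use s in blast)
qed

lemma Tors_Mor_unique:
  assumes S: "ttors U S" and T: "ttors U T"
    and h: "h \<in> TMor U S T" and h': "h' \<in> TMor U S T"
    and cover: "\<And>x. x \<in> U \<Longrightarrow> \<exists>V q. x \<in> V \<and> V \<in> opens X U \<and> q \<in> tsec S V \<and> h V q = h' V q"
  shows "h = h'"
proof -
  interpret S: ttorsor X A P B U S by (rule S)
  interpret T: ttorsor X A P B U T by (rule T)
  note hD = Tors_MorD[OF S T h] and hD' = Tors_MorD[OF S T h']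
  show ?thesis
  proof (rule ext_family_eqI[OF hD(1) hD'(1)])
    fix V s assume "V \<in> opens X U" "s \<in> tsec S V"
    then show "h V s = h' V s"
      by (rule generator_unique[OF S.sec.act_sheaf_axioms T.sec.act_sheaf_axioms hD(2) hD'(2), rotated])
         (use cover S.torsor_generator in blast)
  qed
qed

lemma Tors_extend:
  assumes S: "ttors U S" and T: "ttors U T"
    and D: "\<And>V q q'. (V, q, q') \<in> D \<Longrightarrow> V \<in> opens X U \<and> q \<in> tsec S V \<and> q' \<in> tsec T V"
    and cover: "\<And>x. x \<in> U \<Longrightarrow> \<exists>V q q' \<omega>. x \<in> V \<and> (V, q, q') \<in> D \<and> (q, \<omega>) \<in> triv S V \<and> (q', \<omega>) \<in> triv T V"
    and compat: "\<And>V q q' W p p' Z. (V, q, q') \<in> D \<Longrightarrow> (W, p, p') \<in> D \<Longrightarrow> Z \<in> opens X V \<Longrightarrow> Z \<in> opens X W \<Longrightarrow>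
      \<exists>k\<in>Uts Z. tres S W Z p = tact S Z k (tres S V Z q) \<and> tres T W Z p' = tact T Z k (tres T V Z q')"
  shows "\<exists>h\<in>TMor U S T. \<forall>(V, q, q')\<in>D. h V q = q'"
proof -
  interpret S: ttorsor X A P B U S by (rule S)
  interpret T: ttorsor X A P B U T by (rule T)
  have "\<exists>h\<in>ext_family X U (tsec S). teq U S T h \<and> (\<forall>(V, q, q')\<in>D. h V q = q')"
  proof (rule generator_extend[OF S.sec.act_sheaf_axioms T.sec.act_sheaf_axioms _ _ compat])
    show "S.sec.generator V q \<and> q' \<in> tsec T V" if "(V, q, q') \<in> D" for V q q'
      using D[OF that] S.torsor_generator by blast
    show "\<exists>V q q'. x \<in> V \<and> (V, q, q') \<in> D" if "x \<in> U" for x using cover[OF that] by blast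
  qed
  then obtain h where h: "h \<in> ext_family X U (tsec S)" "teq U S T h" "\<forall>(V, q, q')\<in>D. h V q = q'" by blast
  have "h \<in> TMor U S T"
  proof (rule Tors_MorI[OF S T h(1,2)])
    fix x assume "x \<in> U"
    then obtain V q q' \<omega> where V: "x \<in> V" "(V, q, q') \<in> D" "(q, \<omega>) \<in> triv S V" "(q', \<omega>) \<in> triv T V"
      using cover by blast
    have "h V q = q'" using bspec[OF h(3) V(2)] by simp
    then show "\<exists>V s \<omega>. x \<in> V \<and> (s, \<omega>) \<in> triv S V \<and> (h V s, \<omega>) \<in> triv T V" using V by blast
  qed
  then show ?thesis using h(3) by blast
qed

text \<open>The reversed pairs \<open>(f s, s)\<close> satisfy the hypotheses of
  \<open>Tors_extend\<close>, because the unit that compares two sections of \<open>S\<close> also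
  compares their images.\<close>

lemma Tors_inverse:
  assumes S: "ttors U S" and T: "ttors U T" and f: "f \<in> TMor U S T"
  shows "\<exists>g\<in>TMor U T S. (\<forall>V\<in>opens X U. \<forall>s\<in>tsec S V. g V (f V s) = s) \<and>
    (\<forall>V\<in>opens X U. \<forall>t\<in>tsec T V. f V (g V t) = t)"
proof -
  interpret S: ttorsor X A P B U S by (rule S)
  interpret T: ttorsor X A P B U T by (rule T)
  note fD = Tors_MorD[OF S T f]
  note fE = equivariantD[OF fD(2)]
  define D where "D = {(V, f V s, s) | V s. V \<in> opens X U \<and> s \<in> tsec S V}"
  have "\<exists>g\<in>TMor U T S. \<forall>(V, q, q')\<in>D. g V q = q'"
  proof (rule Tors_extend[OF T S])
    show "V \<in> opens X U \<and> q \<in> tsec T V \<and> q' \<in> tsec S V" if "(V, q, q') \<in> D" for V q q'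
      using that fE(1) by (auto simp: D_def)
    show "\<exists>V q q' \<omega>. x \<in> V \<and> (V, q, q') \<in> D \<and> (q, \<omega>) \<in> triv T V \<and> (q', \<omega>) \<in> triv S V" if x: "x \<in> U" for x
    proof -
      obtain V s \<omega> where V: "x \<in> V" "(s, \<omega>) \<in> triv S V" using S.triv_exists[OF x] by blast
      then show ?thesis using fD(3)[OF V(2)] S.trivD[OF V(2)] unfolding D_def by blast
    qed
    fix V q q' W p p' Z assume "(V, q, q') \<in> D" "(W, p, p') \<in> D" and Z: "Z \<in> opens X V" "Z \<in> opens X W"
    then have q: "V \<in> opens X U" "q' \<in> tsec S V" "q = f V q'" and p: "W \<in> opens X U" "p' \<in> tsec S W" "p = f W p'"
      by (auto simp: D_def)
    have ZU: "Z \<in> opens X U" by (rule opens_trans[OF q(1) Z(1)])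
    note r = S.sec.res_closed[OF q(1,2) Z(1)] S.sec.res_closed[OF p(1,2) Z(2)]
    obtain k where k: "k \<in> Uts Z" "tres S W Z p' = tact S Z k (tres S V Z q')" using S.torsor_trans[OF ZU r] by blast
    then have "tres T W Z p = tact T Z k (tres T V Z q)"
      using fE(2)[OF q(1,2) Z(1)] fE(2)[OF p(1,2) Z(2)] fE(3)[OF ZU r(1) k(1)] unfolding q(3) p(3) by simp
    then show "\<exists>k\<in>Uts Z. tres T W Z p = tact T Z k (tres T V Z q) \<and> tres S W Z p' = tact S Z k (tres S V Z q')"
      using k by blast
  qed
  then obtain g where g: "g \<in> TMor U T S" "\<forall>(V, q, q')\<in>D. g V q = q'" by blast
  have gf: "g V (f V s) = s" if "V \<in> opens X U" "s \<in> tsec S V" for V s 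
    using bspec[OF g(2), of "(V, f V s, s)"] that by (auto simp: D_def)
  note gE = equivariantD[OF Tors_MorD(2)[OF T S g(1)]]
  have "f V (g V t) = t" if V: "V \<in> opens X U" and t: "t \<in> tsec T V" for V t
  proof -
    note fg = fE(1)[OF V gE(1)[OF V t]]
    \<comment> \<open>\<open>t\<close> is \<open>k\<close> times \<open>f (g t)\<close>. Applying
      \<open>g\<close>, already known to undo \<open>f\<close>, shows that \<open>k\<close> fixes
      \<open>g t\<close>; applying \<open>f\<close> shows that it fixes
      \<open>f (g t)\<close>.\<close>
    obtain k where k: "k \<in> Uts V" "t = tact T V k (f V (g V t))" using T.torsor_trans[OF V fg t] by blast
    have "g V t = tact S V k (g V t)"
      using gE(3)[OF V fg k(1)] k(2) gf[OF V gE(1)[OF V t]] by simp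
    then have "f V (g V t) = tact T V k (f V (g V t))" using fE(3)[OF V gE(1)[OF V t] k(1)] by simp
    then show ?thesis using k(2) by simp
  qed
  then show ?thesis using g(1) gf by blast
qed

end

section \<open>Gluing a line bundle from functions\<close>

text \<open>Each member \<open>(W, v, \<omega>)\<close> of \<open>D\<close> is to become a frame \<open>v\<close> over \<open>W\<close> with \<open>b.v = - \<omega>(b) v\<close>; the sections are
  the functions that are locally multiples of such \<open>v\<close>, encoded by \<open>\<iota>\<close>.\<close>

locale line_data = smooth_algebroid X A P B for X :: "'x topology" and A P and B :: "('x, 'b) lie_algd" +
  fixes U :: "'x set" and D :: "('x set \<times> 'x cfun \<times> ('x, 'b) form) set" and \<iota> :: "'x cfun \<Rightarrow> 'u"
  assumes U: "openin X U" and inj: "inj \<iota>"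
    and D_open: "(W, v, \<omega>) \<in> D \<Longrightarrow> W \<in> opens X U" and D_ext: "(W, v, \<omega>) \<in> D \<Longrightarrow> v \<in> extensional W"
    and D_nz: "(W, v, \<omega>) \<in> D \<Longrightarrow> x \<in> W \<Longrightarrow> v x \<noteq> 0" and D_Cl: "(W, v, \<omega>) \<in> D \<Longrightarrow> \<omega> \<in> carrier (Grp (Omega1cl X A P B) W)"
    and D_cover: "x \<in> U \<Longrightarrow> \<exists>W v \<omega>. (W, v, \<omega>) \<in> D \<and> x \<in> W"
    and D_compat: "(W, v, \<omega>) \<in> D \<Longrightarrow> (W', v', \<omega>') \<in> D \<Longrightarrow> Z \<in> opens X W \<Longrightarrow> Z \<in> opens X W' \<Longrightarrow>
      \<exists>g\<in>smooth_algebroid.Uts X A P Z. (\<forall>y\<in>Z. v y = g y * v' y) \<and> (\<forall>Y\<in>opens X Z. \<forall>b\<in>carrier (Mod B Y). \<forall>y\<in>Y.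
        \<omega>' Y [b] y = alg_act X B Y b (restrict g Y) y / g y + \<omega> Y [b] y)"
begin

lemma oU: "V \<in> opens X U \<Longrightarrow> openin X V" using opens_openin .

text \<open>The frame functions \<open>v\<close> have no regularity in general, hence neither have
  the sections; regularity is asked of the quotients f / v. One frame near each point is enough by
  \<open>Nf_quot\<close>.\<close>

definition Nf :: "'x set \<Rightarrow> 'x cfun set" where
  "Nf V = {f \<in> extensional V. \<forall>x\<in>V. \<exists>W v \<omega> Z. (W, v, \<omega>) \<in> D \<and> Z \<in> opens X V \<and> Z \<in> opens X W \<and> x \<in> Z \<and>
     (\<lambda>y\<in>Z. f y / v y) \<in> F Z}"

lemma Nf_ext: "f \<in> Nf V \<Longrightarrow> f \<in> extensional V" by (simp add: Nf_def)

lemma D_cover_in: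
  assumes V: "V \<in> opens X U" and x: "x \<in> V"
  shows "\<exists>W v \<omega> Z. (W, v, \<omega>) \<in> D \<and> Z \<in> opens X V \<and> Z \<in> opens X W \<and> x \<in> Z"
proof -
  obtain W v \<omega> where W: "(W, v, \<omega>) \<in> D" "x \<in> W" using D_cover x opens_subset[OF V] by blast
  have "V \<inter> W \<in> opens X V" "V \<inter> W \<in> opens X W"
    using opens_Int[OF V oU[OF D_open[OF W(1)]]] opens_Int'[OF D_open[OF W(1)] oU[OF V]] .
  then show ?thesis using W x by blast
qed

text \<open>Over a common domain two frames differ by a unit \<open>g\<close>, and the quotient by
  one frame is \<open>g\<close> times the quotient by the other.\<close>

lemma Nf_quot:
  assumes V: "V \<in> opens X U" and f: "f \<in> Nf V" and W: "(W, v, \<omega>) \<in> D" and Z: "Z \<in> opens X V" "Z \<in> opens X W"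
  shows "(\<lambda>y\<in>Z. f y / v y) \<in> F Z"
proof (rule F_local[OF opens_openin[OF Z(1)]])
  fix x assume x: "x \<in> Z"
  then obtain W' v' \<omega>' Z' where W': "(W', v', \<omega>') \<in> D" "Z' \<in> opens X V" "Z' \<in> opens X W'" "x \<in> Z'"
    "(\<lambda>y\<in>Z'. f y / v' y) \<in> F Z'" using f opens_subset[OF Z(1)] unfolding Nf_def by blast
  let ?Y = "Z \<inter> Z'"
  have Y: "?Y \<in> opens X Z" "?Y \<in> opens X Z'"
    using opens_Int[OF Z(1) opens_openin[OF W'(2)]] opens_Int'[OF W'(2) opens_openin[OF Z(1)]] by auto
  have YW: "?Y \<in> opens X W" "?Y \<in> opens X W'" using opens_trans[OF Z(2) Y(1)] opens_trans[OF W'(3) Y(2)] .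
  obtain g where g: "g \<in> Uts ?Y" "\<forall>y\<in>?Y. v' y = g y * v y" using D_compat[OF W'(1) W YW(2,1)] by blast
  have "restrict (\<lambda>y\<in>Z. f y / v y) ?Y = (\<lambda>y\<in>?Y. g y * restrict (\<lambda>y\<in>Z'. f y / v' y) ?Y y)"
    using g(2) UtsD(2)[OF g(1)] by (auto simp: restrict_def fun_eq_iff)
  also have "\<dots> \<in> F ?Y" by (rule F_mult[OF opens_openin[OF Y(1)] UtsD(1)[OF g(1)] F_restrict[OF W'(5) Y(2)]])
  finally show "\<exists>Y\<in>opens X Z. x \<in> Y \<and> restrict (\<lambda>y\<in>Z. f y / v y) Y \<in> F Y" using Y(1) x W'(4) by blast
qed simp

lemma NfI:
  assumes f: "f \<in> extensional V" and V: "V \<in> opens X U"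
    and loc: "\<And>W v \<omega> Z. (W, v, \<omega>) \<in> D \<Longrightarrow> Z \<in> opens X V \<Longrightarrow> Z \<in> opens X W \<Longrightarrow> (\<lambda>y\<in>Z. f y / v y) \<in> F Z"
  shows "f \<in> Nf V"
  unfolding Nf_def
proof (intro CollectI conjI ballI f)
  fix x assume x: "x \<in> V"
  obtain W v \<omega> Z where "(W, v, \<omega>) \<in> D" "Z \<in> opens X V" "Z \<in> opens X W" "x \<in> Z" using D_cover_in[OF V x] by blast
  then show "\<exists>W v \<omega> Z. (W, v, \<omega>) \<in> D \<and> Z \<in> opens X V \<and> Z \<in> opens X W \<and> x \<in> Z \<and> (\<lambda>y\<in>Z. f y / v y) \<in> F Z"
    using loc by blast
qed

lemma Nf_local:
  assumes f: "f \<in> extensional V" and V: "V \<in> opens X U"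
    and loc: "\<And>x. x \<in> V \<Longrightarrow> \<exists>W\<in>opens X V. x \<in> W \<and> restrict f W \<in> Nf W"
  shows "f \<in> Nf V"
  unfolding Nf_def
proof (intro CollectI conjI ballI f)
  fix x assume "x \<in> V"
  then obtain N where N: "N \<in> opens X V" "x \<in> N" "restrict f N \<in> Nf N" using loc by blast
  then obtain W v \<omega> Z where W: "(W, v, \<omega>) \<in> D" "Z \<in> opens X N" "Z \<in> opens X W" "x \<in> Z"
    "(\<lambda>y\<in>Z. restrict f N y / v y) \<in> F Z" unfolding Nf_def by blast
  have "(\<lambda>y\<in>Z. restrict f N y / v y) = (\<lambda>y\<in>Z. f y / v y)"
    using opens_subset[OF W(2)] by (auto simp: restrict_def fun_eq_iff)
  then show "\<exists>W v \<omega> Z. (W, v, \<omega>) \<in> D \<and> Z \<in> opens X V \<and> Z \<in> opens X W \<and> x \<in> Z \<and> (\<lambda>y\<in>Z. f y / v y) \<in> F Z"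
    using W opens_trans[OF N(1) W(2)] by auto
qed

lemma Nf_restrict:
  assumes V: "V \<in> opens X U" and f: "f \<in> Nf V" and Y: "Y \<in> opens X V"
  shows "restrict f Y \<in> Nf Y"
proof (rule NfI)
  fix W v \<omega> Z assume W: "(W, v, \<omega>) \<in> D" and Z: "Z \<in> opens X Y" "Z \<in> opens X W"
  have "(\<lambda>y\<in>Z. restrict f Y y / v y) = (\<lambda>y\<in>Z. f y / v y)"
    using opens_subset[OF Z(1)] by (auto simp: restrict_def fun_eq_iff)
  then show "(\<lambda>y\<in>Z. restrict f Y y / v y) \<in> F Z" using Nf_quot[OF V f W opens_trans[OF Y Z(1)] Z(2)] by simp
qed (use opens_trans[OF V Y] in auto)

lemma Nf_add:
  assumes V: "V \<in> opens X U" and f: "f \<in> Nf V" and g: "g \<in> Nf V"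
  shows "(\<lambda>x\<in>V. f x + g x) \<in> Nf V"
proof (rule NfI[OF _ V])
  fix W v \<omega> Z assume W: "(W, v, \<omega>) \<in> D" and Z: "Z \<in> opens X V" "Z \<in> opens X W"
  have "(\<lambda>y\<in>Z. (\<lambda>x\<in>V. f x + g x) y / v y) = (\<lambda>y\<in>Z. (\<lambda>y\<in>Z. f y / v y) y + (\<lambda>y\<in>Z. g y / v y) y)"
    using opens_subset[OF Z(1)] by (auto simp: restrict_def fun_eq_iff add_divide_distrib)
  then show "(\<lambda>y\<in>Z. (\<lambda>x\<in>V. f x + g x) y / v y) \<in> F Z"
    using F_add[OF opens_openin[OF Z(1)] Nf_quot[OF V f W Z] Nf_quot[OF V g W Z]] by metis
qed simp

lemma Nf_smult:
  assumes V: "V \<in> opens X U" and k: "k \<in> F V" and f: "f \<in> Nf V"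
  shows "(\<lambda>x\<in>V. k x * f x) \<in> Nf V"
proof (rule NfI[OF _ V])
  fix W v \<omega> Z assume W: "(W, v, \<omega>) \<in> D" and Z: "Z \<in> opens X V" "Z \<in> opens X W"
  have "(\<lambda>y\<in>Z. (\<lambda>x\<in>V. k x * f x) y / v y) = (\<lambda>y\<in>Z. restrict k Z y * (\<lambda>y\<in>Z. f y / v y) y)"
    using opens_subset[OF Z(1)] by (auto simp: restrict_def fun_eq_iff)
  then show "(\<lambda>y\<in>Z. (\<lambda>x\<in>V. k x * f x) y / v y) \<in> F Z"
    using F_mult[OF opens_openin[OF Z(1)] F_restrict[OF k Z(1)] Nf_quot[OF V f W Z]] by metis
qed simp

lemma Nf_zero: "V \<in> opens X U \<Longrightarrow> (\<lambda>x\<in>V. 0) \<in> Nf V"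
proof (rule NfI)
  fix W v \<omega> Z assume "(W, v, \<omega>) \<in> D" and Z: "Z \<in> opens X V"
  have "(\<lambda>y\<in>Z. (\<lambda>x\<in>V. 0) y / v y) = (\<lambda>y\<in>Z. 0)"
    using opens_subset[OF Z] by (auto simp: restrict_def fun_eq_iff)
  then show "(\<lambda>y\<in>Z. (\<lambda>x\<in>V. 0) y / v y) \<in> F Z" using F_const[OF opens_openin[OF Z], of 0] by simp
qed auto

lemma D_Nf: "(W, v, \<omega>) \<in> D \<Longrightarrow> v \<in> Nf W"
  unfolding Nf_def
proof (intro CollectI conjI ballI)
  assume W: "(W, v, \<omega>) \<in> D"
  show "v \<in> extensional W" by (rule D_ext[OF W])
  have oW: "openin X W" by (rule oU[OF D_open[OF W]])
  have "(\<lambda>y\<in>W. v y / v y) = (\<lambda>y\<in>W. 1)" using D_nz[OF W] by (auto simp: restrict_def fun_eq_iff)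
  then have "(\<lambda>y\<in>W. v y / v y) \<in> F W" using F_const[OF oW, of 1] by simp
  then show "\<exists>W' v' \<omega> Z. (W', v', \<omega>) \<in> D \<and> Z \<in> opens X W \<and> Z \<in> opens X W' \<and> x \<in> Z \<and> (\<lambda>y\<in>Z. v y / v' y) \<in> F Z"
    if "x \<in> W" for x using W that opens_self[OF oW] by blast
qed

text \<open>With h = f / v this is the value of b.(h v) that b.v = - \<omega>(b) v and the Leibniz
  rule prescribe.\<close>

definition loc_act :: "'x set \<Rightarrow> 'b \<Rightarrow> 'x cfun \<Rightarrow> 'x cfun \<Rightarrow> ('x, 'b) form \<Rightarrow> 'x \<Rightarrow> complex" where
  "loc_act Z b f v \<omega> x = (ac Z b (\<lambda>y\<in>Z. f y / v y) x - \<omega> Z [b] x * (f x / v x)) * v x"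

lemma loc_act_res:
  assumes W: "(W, v, \<omega>) \<in> D" and Z: "Z \<in> opens X W" and b: "b \<in> Bc Z" and f: "(\<lambda>y\<in>Z. f y / v y) \<in> F Z"
    and Y: "Y \<in> opens X Z" and x: "x \<in> Y"
  shows "loc_act Y (mres B Z Y b) f v \<omega> x = loc_act Z b f v \<omega> x"
proof -
  have oZ: "openin X Z" using Z opens_openin by blast
  have "restrict (\<lambda>y\<in>Z. f y / v y) Y = (\<lambda>y\<in>Y. f y / v y)"
    using opens_subset[OF Y] by (auto simp: restrict_def fun_eq_iff)
  then have "ac Y (mres B Z Y b) (\<lambda>y\<in>Y. f y / v y) x = ac Z b (\<lambda>y\<in>Z. f y / v y) x"
    using ac_restrict[OF oZ b f Y] x by simp
  moreover have "\<omega> Y [mres B Z Y b] x = \<omega> Z [b] x"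
    using ClD(2)[OF oU[OF D_open[OF W]] D_Cl[OF W] Z b Y] x by simp
  ultimately show ?thesis by (simp add: loc_act_def)
qed

text \<open>If v = g v', the coefficient with respect to v' is g h. The term b(g) h that Leibniz
  produces is cancelled by b(g) / g, the excess of \<omega>' over \<omega>.\<close>

lemma loc_act_change:
  assumes W: "(W, v, \<omega>) \<in> D" "(W', v', \<omega>') \<in> D" and Y: "Y \<in> opens X W" "Y \<in> opens X W'"
    and b: "b \<in> Bc Y" and f: "(\<lambda>y\<in>Y. f y / v y) \<in> F Y" and x: "x \<in> Y"
  shows "loc_act Y b f v \<omega> x = loc_act Y b f v' \<omega>' x"
proof -
  have oY: "openin X Y" using Y opens_openin by blast
  obtain g where g: "g \<in> Uts Y" "\<forall>y\<in>Y. v y = g y * v' y"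
    "\<forall>Z\<in>opens X Y. \<forall>b\<in>Bc Z. \<forall>y\<in>Z. \<omega>' Z [b] y = ac Z b (restrict g Z) y / g y + \<omega> Z [b] y"
    using D_compat[OF W Y] by blast
  have gr: "restrict g Y = g" using F_ext[OF UtsD(1)[OF g(1)]] by (simp add: extensional_restrict)
  have w: "\<omega>' Y [b] x = ac Y b g x / g x + \<omega> Y [b] x" using g(3) opens_self[OF oY] b x gr by metis
  have nz: "v' y \<noteq> 0" "g y \<noteq> 0" if "y \<in> Y" for y
    using D_nz[OF W(2)] UtsD(2)[OF g(1)] that opens_subset[OF Y(2)] by auto
  have "(\<lambda>y\<in>Y. f y / v' y) = (\<lambda>y\<in>Y. g y * (\<lambda>y\<in>Y. f y / v y) y)"
    using g(2) nz by (auto simp: restrict_def fun_eq_iff)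
  then have "ac Y b (\<lambda>y\<in>Y. f y / v' y) x = ac Y b g x * (f x / v x) + g x * ac Y b (\<lambda>y\<in>Y. f y / v y) x"
    using ac_mult[OF oY b UtsD(1)[OF g(1)] f x] x by simp
  then show ?thesis
    unfolding loc_act_def w using g(2) x nz[OF x] by (simp add: field_simps)
qed

text \<open>The choice is made separately at each point among all frames and neighbourhoods; by
  \<open>dact_eq\<close> they all give the same value.\<close>

definition dact :: "'x set \<Rightarrow> 'b \<Rightarrow> 'x cfun \<Rightarrow> 'x cfun" where
  "dact V b f = (\<lambda>x\<in>V. SOME z. \<exists>W v \<omega> Z. (W, v, \<omega>) \<in> D \<and> Z \<in> opens X V \<and> Z \<in> opens X W \<and> x \<in> Z \<and>
     z = loc_act Z (mres B V Z b) f v \<omega> x)"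

text \<open>Two admissible neighbourhoods are compared on their intersection:
  \<open>loc_act_res\<close> passes to it on either side and \<open>loc_act_change\<close> switches
  the frame there.\<close>

lemma dact_eq:
  assumes V: "V \<in> opens X U" and b: "b \<in> Bc V" and f: "f \<in> Nf V"
    and W: "(W, v, \<omega>) \<in> D" and Z: "Z \<in> opens X V" "Z \<in> opens X W" and x: "x \<in> Z"
  shows "dact V b f x = (ac Z (mres B V Z b) (\<lambda>y\<in>Z. f y / v y) x - \<omega> Z [mres B V Z b] x * (f x / v x)) * v x"
proof -
  let ?P = "\<lambda>z. \<exists>W v \<omega> Z. (W, v, \<omega>) \<in> D \<and> Z \<in> opens X V \<and> Z \<in> opens X W \<and> x \<in> Z \<and>
     z = loc_act Z (mres B V Z b) f v \<omega> x"
  have xV: "x \<in> V" using x opens_subset[OF Z(1)] by blast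
  have "?P (dact V b f x)"
    using someI[of ?P "loc_act Z (mres B V Z b) f v \<omega> x"] W Z x xV unfolding dact_def by auto
  then obtain W' v' \<omega>' Z' where W': "(W', v', \<omega>') \<in> D" "Z' \<in> opens X V" "Z' \<in> opens X W'" "x \<in> Z'"
    "dact V b f x = loc_act Z' (mres B V Z' b) f v' \<omega>' x" by blast
  let ?Y = "Z \<inter> Z'"
  have Y: "?Y \<in> opens X Z" "?Y \<in> opens X Z'"
    using opens_Int[OF Z(1) opens_openin[OF W'(2)]] opens_Int'[OF W'(2) opens_openin[OF Z(1)]] by auto
  have xY: "x \<in> ?Y" using x W'(4) by blast
  note oV = oU[OF V]
  note YV = opens_trans[OF Z(1) Y(1)]
  have 1: "loc_act ?Y (mres B V ?Y b) f v \<omega> x = loc_act Z (mres B V Z b) f v \<omega> x"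
    using loc_act_res[OF W Z(2) B_res[OF oV Z(1) b] Nf_quot[OF V f W Z] Y(1) xY] B_res_res[OF oV Z(1) Y(1) b] by simp
  have 2: "loc_act ?Y (mres B V ?Y b) f v' \<omega>' x = loc_act Z' (mres B V Z' b) f v' \<omega>' x"
    using loc_act_res[OF W'(1,3) B_res[OF oV W'(2) b] Nf_quot[OF V f W'(1,2,3)] Y(2) xY] B_res_res[OF oV W'(2) Y(2) b] by simp
  have 3: "loc_act ?Y (mres B V ?Y b) f v \<omega> x = loc_act ?Y (mres B V ?Y b) f v' \<omega>' x"
    by (rule loc_act_change[OF W W'(1) opens_trans[OF Z(2) Y(1)] opens_trans[OF W'(3) Y(2)] B_res[OF oV YV b]
          Nf_quot[OF V f W YV opens_trans[OF Z(2) Y(1)]] xY])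
  have "dact V b f x = loc_act Z (mres B V Z b) f v \<omega> x" using 1 2 3 W'(5) by simp
  then show ?thesis unfolding loc_act_def .
qed

lemma dact_quot:
  assumes V: "V \<in> opens X U" and b: "b \<in> Bc V" and f: "f \<in> Nf V"
    and W: "(W, v, \<omega>) \<in> D" and Z: "Z \<in> opens X V" "Z \<in> opens X W"
  shows "(\<lambda>y\<in>Z. dact V b f y / v y) =
    (\<lambda>y\<in>Z. ac Z (mres B V Z b) (\<lambda>y\<in>Z. f y / v y) y - \<omega> Z [mres B V Z b] y * (\<lambda>y\<in>Z. f y / v y) y)"
  using dact_eq[OF V b f W Z] D_nz[OF W] opens_subset[OF Z(2)] by (auto simp: restrict_def fun_eq_iff)

lemma dact_closed:
  assumes V: "V \<in> opens X U" and b: "b \<in> Bc V" and f: "f \<in> Nf V"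
  shows "dact V b f \<in> Nf V"
proof (rule NfI[OF _ V])
  show "dact V b f \<in> extensional V" by (simp add: dact_def)
  fix W v \<omega> Z assume W: "(W, v, \<omega>) \<in> D" and Z: "Z \<in> opens X V" "Z \<in> opens X W"
  note oZ = opens_openin[OF Z(1)]
  note bZ = B_res[OF oU[OF V] Z(1) b]
  note h = Nf_quot[OF V f W Z]
  note w = ClD(1)[OF oU[OF D_open[OF W]] D_Cl[OF W] Z(2) bZ]
  have "(\<lambda>y\<in>Z. ac Z (mres B V Z b) (\<lambda>y\<in>Z. f y / v y) y - (\<lambda>y\<in>Z. \<omega> Z [mres B V Z b] y * (\<lambda>y\<in>Z. f y / v y) y) y) \<in> F Z"
    by (rule F_diff[OF oZ ac_closed[OF oZ bZ h] F_mult[OF oZ w h]])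
  then show "(\<lambda>y\<in>Z. dact V b f y / v y) \<in> F Z"
    unfolding dact_quot[OF V b f W Z] by (simp cong: restrict_cong)
qed

end

context B_line_bundle
begin

lemma nablaI:
  assumes V: "V \<in> opens X U" and s: "s \<in> nv V" and w: "\<omega> \<in> Cl V"
    and eq: "\<And>W b. W \<in> opens X V \<Longrightarrow> b \<in> Bc W \<Longrightarrow>
      bact L W b (mres L V W s) = (\<lambda>x\<in>W. - \<omega> W [b] x) \<odot>[L,W] mres L V W s"
  shows "(s, \<omega>) \<in> nab U L V"
  unfolding nabla_iff[OF V]
proof (intro conjI ballI s w)
  have sL: "s \<in> Lc V" using s nv_iff[OF V] by blast
  fix W b x assume W: "W \<in> opens X V" and b: "b \<in> Bc W" and x: "x \<in> W"
  note WU = opens_trans[OF V W]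
  show "val W (bact L W b (mres L V W s)) x = - \<omega> W [b] x * val V s x"
    unfolding eq[OF W b]
    using val_smult'[OF WU sec.res_closed[OF V sL W] F_minus[OF oU[OF WU] ClD(1)[OF oU[OF V] w W b]] x]
      val_res'[OF V sL W x] x by simp
qed

end

text \<open>Converse of \<open>frame_generator\<close>: from the multiplicative notion of generator
  to the finite sums in \<open>frame\<close>, which have a single summand here.\<close>

lemma (in smooth_algebroid) frame_rank1I:
  assumes L: "module_sheaf X U R L" and V: "V \<in> opens X U" and e: "e \<in> carrier (Mod L V)"
    and gen: "\<And>W m. W \<in> opens X V \<Longrightarrow> m \<in> carrier (Mod L W) \<Longrightarrow> \<exists>!k. k \<in> F W \<and> m = k \<odot>[L,W] mres L V W e"
  shows "frame X R L V 1 (\<lambda>i. e)"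
  unfolding frame_def
proof (intro conjI allI impI ballI e)
  fix W m assume W: "W \<in> opens X V" and m: "m \<in> carrier (Mod L W)"
  interpret M: module "R W" "Mod L W" by (rule module_sheafD(1)[OF L opens_trans[OF V W]])
  have eW: "mres L V W e \<in> carrier (Mod L W)" by (rule module_sheafD(2)[OF L V W e])
  have sum: "(\<Oplus>\<^bsub>Mod L W\<^esub>i\<in>{..<1::nat}. c i \<odot>[L,W] mres L V W e) = c 0 \<odot>[L,W] mres L V W e"
    if "c \<in> {..<1} \<rightarrow>\<^sub>E F W" for c
  proof -
    have 1: "{..<1::nat} = insert 0 {}" by auto
    have "c 0 \<in> F W" using that by auto
    then show ?thesis unfolding 1 using eW by (subst M.M.finsum_insert) auto
  qed
  obtain k where k: "k \<in> F W" "m = k \<odot>[L,W] mres L V W e" using gen[OF W m] by blast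
  show "\<exists>!c. c \<in> {..<1} \<rightarrow>\<^sub>E F W \<and> m = (\<Oplus>\<^bsub>Mod L W\<^esub>i\<in>{..<1::nat}. c i \<odot>[L,W] mres L V W e)"
  proof (rule ex_ex1I)
    have "(\<lambda>i\<in>{..<1::nat}. k) \<in> {..<1} \<rightarrow>\<^sub>E F W" using k(1) by auto
    from this sum[OF this] show "\<exists>c. c \<in> {..<1} \<rightarrow>\<^sub>E F W \<and> m = (\<Oplus>\<^bsub>Mod L W\<^esub>i\<in>{..<1::nat}. c i \<odot>[L,W] mres L V W e)"
      using k(2) by (intro exI[of _ "\<lambda>i\<in>{..<1::nat}. k"]) simp
    fix c c' assume c: "c \<in> {..<1} \<rightarrow>\<^sub>E F W \<and> m = (\<Oplus>\<^bsub>Mod L W\<^esub>i\<in>{..<1::nat}. c i \<odot>[L,W] mres L V W e)"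
      and c': "c' \<in> {..<1} \<rightarrow>\<^sub>E F W \<and> m = (\<Oplus>\<^bsub>Mod L W\<^esub>i\<in>{..<1::nat}. c' i \<odot>[L,W] mres L V W e)"
    have "c 0 = c' 0"
      using gen[OF W m] by (rule ex1_eqI) (use c c' sum[of c] sum[of c'] in auto)
    then show "c = c'" using c c' by (intro extensionalityI[of _ "{..<1::nat}"]) (auto simp: PiE_def)
  qed
qed

section \<open>The glued line bundle and its trivialization\<close>

context line_data
begin

definition dec :: "'u \<Rightarrow> 'x cfun" where "dec = inv_into UNIV \<iota>"

lemma dec[simp]: "dec (\<iota> f) = f" by (simp add: dec_def inv_f_f[OF inj])

text \<open>Sections must have type \<open>'u\<close>, so functions are carried along
  \<open>\<iota>\<close>: every operation decodes, computes with functions and encodes the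
  result.\<close>

definition LN :: "('x, 'u, 'b) bmod" where
  "LN = \<lparr>Mod = (\<lambda>V. \<lparr>carrier = \<iota> ` Nf V, mult = undefined, one = undefined, zero = \<iota> (\<lambda>x\<in>V. 0),
       add = (\<lambda>m n. \<iota> (\<lambda>x\<in>V. dec m x + dec n x)), smult = (\<lambda>k m. \<iota> (\<lambda>x\<in>V. k x * dec m x))\<rparr>),
     mres = (\<lambda>V W m. \<iota> (restrict (dec m) W)), bact = (\<lambda>V b m. \<iota> (dact V b (dec m)))\<rparr>"

lemma LN_simps[simp]:
  "carrier (Mod LN V) = \<iota> ` Nf V" "\<zero>\<^bsub>Mod LN V\<^esub> = \<iota> (\<lambda>x\<in>V. 0)"
  "m \<oplus>[LN,V] n = \<iota> (\<lambda>x\<in>V. dec m x + dec n x)"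
  "k \<odot>[LN,V] m = \<iota> (\<lambda>x\<in>V. k x * dec m x)"
  "mres LN V W m = \<iota> (restrict (dec m) W)" "bact LN V b m = \<iota> (dact V b (dec m))"
  by (simp_all add: LN_def)

lemma LN_module:
  assumes V: "V \<in> opens X U" shows "module (R V) (Mod LN V)"
proof (rule moduleI)
  show "cring (R V)" by (rule cringR[OF oU[OF V]])
  show "abelian_group (Mod LN V)"
  proof (rule abelian_groupI)
    show "\<zero>\<^bsub>Mod LN V\<^esub> \<in> carrier (Mod LN V)" using Nf_zero[OF V] by simp
    fix x assume "x \<in> carrier (Mod LN V)"
    then obtain f where f: "x = \<iota> f" "f \<in> Nf V" by auto
    show "\<zero>\<^bsub>Mod LN V\<^esub> \<oplus>[LN,V] x = x"
      using Nf_ext[OF f(2)] f(1) by (auto simp: restrict_def fun_eq_iff extensional_def intro!: arg_cong[of _ _ \<iota>])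
    have "(\<lambda>x\<in>V. (\<lambda>x\<in>V. - 1) x * f x) \<in> Nf V" by (rule Nf_smult[OF V F_const[OF oU[OF V]] f(2)])
    then show "\<exists>y\<in>carrier (Mod LN V). y \<oplus>[LN,V] x = \<zero>\<^bsub>Mod LN V\<^esub>"
      using f(1) by (intro bexI[of _ "\<iota> (\<lambda>x\<in>V. (\<lambda>x\<in>V. - 1) x * f x)"])
        (auto simp: restrict_def fun_eq_iff intro!: arg_cong[of _ _ \<iota>])
    fix y assume "y \<in> carrier (Mod LN V)"
    then obtain g where g: "y = \<iota> g" "g \<in> Nf V" by auto
    show "x \<oplus>[LN,V] y \<in> carrier (Mod LN V)" using Nf_add[OF V f(2) g(2)] f(1) g(1) by simp
    show "x \<oplus>[LN,V] y = y \<oplus>[LN,V] x" by (simp add: add.commute)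
    fix z assume "z \<in> carrier (Mod LN V)"
    show "x \<oplus>[LN,V] y \<oplus>[LN,V] z = x \<oplus>[LN,V] (y \<oplus>[LN,V] z)"
      by (auto simp: restrict_def fun_eq_iff intro!: arg_cong[of _ _ \<iota>])
  qed
  fix k x assume k: "k \<in> F V" and "x \<in> carrier (Mod LN V)"
  then obtain f where f: "x = \<iota> f" "f \<in> Nf V" by auto
  show "k \<odot>[LN,V] x \<in> carrier (Mod LN V)" using Nf_smult[OF V k f(2)] f(1) by simp
  fix l
  show "(k \<oplus>\<^bsub>R V\<^esub> l) \<odot>[LN,V] x = k \<odot>[LN,V] x \<oplus>[LN,V] l \<odot>[LN,V] x"
    "(k \<otimes>\<^bsub>R V\<^esub> l) \<odot>[LN,V] x = k \<odot>[LN,V] (l \<odot>[LN,V] x)"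
    by (auto simp: OXP_simps restrict_def fun_eq_iff algebra_simps intro!: arg_cong[of _ _ \<iota>])
  fix y
  show "k \<odot>[LN,V] (x \<oplus>[LN,V] y) = k \<odot>[LN,V] x \<oplus>[LN,V] k \<odot>[LN,V] y"
    by (auto simp: restrict_def fun_eq_iff algebra_simps intro!: arg_cong[of _ _ \<iota>])
next
  fix x assume "x \<in> carrier (Mod LN V)"
  then obtain f where f: "x = \<iota> f" "f \<in> Nf V" by auto
  show "\<one>\<^bsub>R V\<^esub> \<odot>[LN,V] x = x"
    using Nf_ext[OF f(2)] f(1) by (auto simp: OXP_simps restrict_def fun_eq_iff extensional_def intro!: arg_cong[of _ _ \<iota>])
qed

text \<open>Subtraction is not a field of the record but derived from the additive inverse; it is
  identified by adding \<open>\<iota> g\<close> back.\<close>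

lemma LN_minus:
  assumes V: "V \<in> opens X U" and f: "f \<in> Nf V" and g: "g \<in> Nf V"
  shows "\<iota> f \<ominus>\<^bsub>Mod LN V\<^esub> \<iota> g = \<iota> (\<lambda>x\<in>V. f x - g x)"
proof -
  interpret M: module "R V" "Mod LN V" by (rule LN_module[OF V])
  have fg: "\<iota> f \<in> carrier (Mod LN V)" "\<iota> g \<in> carrier (Mod LN V)" using f g by simp_all
  then have "\<iota> f \<ominus>\<^bsub>Mod LN V\<^esub> \<iota> g \<in> carrier (Mod LN V)" by (rule M.M.minus_closed)
  then obtain h where h: "\<iota> f \<ominus>\<^bsub>Mod LN V\<^esub> \<iota> g = \<iota> h" "h \<in> Nf V" by auto
  have "(\<iota> f \<ominus>\<^bsub>Mod LN V\<^esub> \<iota> g) \<oplus>[LN,V] \<iota> g = \<iota> f"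
    using fg M.M.a_inv_closed[OF fg(2)] M.M.a_assoc[OF fg(1) M.M.a_inv_closed[OF fg(2)] fg(2)]
      M.M.l_neg[OF fg(2)] M.M.r_zero[OF fg(1)] unfolding a_minus_def by metis
  then have "\<iota> (\<lambda>x\<in>V. h x + g x) = \<iota> f" unfolding h(1) by simp
  then have e: "(\<lambda>x\<in>V. h x + g x) = f" by (rule injD[OF inj])
  have "h = (\<lambda>x\<in>V. f x - g x)"
  proof (rule extensionalityI[OF Nf_ext[OF h(2)]])
    fix x assume "x \<in> V"
    then show "h x = (\<lambda>x\<in>V. f x - g x) x" using fun_cong[OF e, of x] by (simp add: algebra_simps)
  qed simp
  then show ?thesis using h(1) by simp
qed

lemma LN_sheaf_on: "sheaf_on X U (\<lambda>V. carrier (Mod LN V)) (mres LN)"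
  unfolding sheaf_on_def
proof (intro conjI ballI allI impI)
  show "mres LN V V s = s" if "s \<in> carrier (Mod LN V)" for V s
    using that Nf_ext by (auto simp: extensional_restrict)
  show "mres LN V W s \<in> carrier (Mod LN W)" if "V \<in> opens X U" "W \<in> opens X V" "s \<in> carrier (Mod LN V)" for V W s
    using that Nf_restrict by auto
  show "mres LN W Z (mres LN V W s) = mres LN V Z s" if "Z \<in> opens X W" for V W Z s
    using opens_subset[OF that] by (simp add: Int_absorb1)
  fix C t assume C: "C \<subseteq> opens X U" and t: "\<forall>V\<in>C. t V \<in> carrier (Mod LN V)"
    and agree: "\<forall>V\<in>C. \<forall>W\<in>C. mres LN V (V \<inter> W) (t V) = mres LN W (V \<inter> W) (t W)"
  have tN: "dec (t V) \<in> Nf V" "t V = \<iota> (dec (t V))" if "V \<in> C" for V using t that by auto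
  have CU: "\<Union>C \<in> opens X U" using C by (auto simp: opens_def)
  have ag: "dec (t V) x = dec (t W) x" if "V \<in> C" "W \<in> C" "x \<in> V" "x \<in> W" for V W x
  proof -
    have "\<iota> (restrict (dec (t V)) (V \<inter> W)) = \<iota> (restrict (dec (t W)) (V \<inter> W))"
      using agree that(1,2) unfolding LN_simps by blast
    then have "restrict (dec (t V)) (V \<inter> W) = restrict (dec (t W)) (V \<inter> W)" by (rule injD[OF inj])
    from fun_cong[OF this, of x] show ?thesis using that by simp
  qed
  \<comment> \<open>The glued function takes at \<open>x\<close> the value of an arbitrary member of
    the cover through \<open>x\<close>; \<open>ag\<close> makes this choice irrelevant.\<close>
  define N where "N x = (SOME V. V \<in> C \<and> x \<in> V)" for x
  have N: "N x \<in> C" "x \<in> N x" if "x \<in> \<Union>C" for x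
    using that someI_ex[of "\<lambda>V. V \<in> C \<and> x \<in> V"] unfolding N_def by blast+
  define f where "f = (\<lambda>x\<in>\<Union>C. dec (t (N x)) x)"
  have fV: "restrict f V = dec (t V)" if V: "V \<in> C" for V
  proof (rule extensionalityI[OF _ Nf_ext[OF tN(1)[OF V]]])
    fix x assume x: "x \<in> V"
    then have xC: "x \<in> \<Union>C" using V by blast
    show "restrict f V x = dec (t V) x" using ag[OF N(1)[OF xC] V N(2)[OF xC] x] x xC by (simp add: f_def)
  qed simp
  have fN: "f \<in> Nf (\<Union>C)"
  proof (rule Nf_local[OF _ CU])
    show "f \<in> extensional (\<Union>C)" by (simp add: f_def)
    fix x assume "x \<in> \<Union>C"
    then obtain V where V: "V \<in> C" "x \<in> V" by blast
    have "V \<in> opens X (\<Union>C)" using V C by (auto simp: opens_def)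
    then show "\<exists>W\<in>opens X (\<Union>C). x \<in> W \<and> restrict f W \<in> Nf W" using V fV[OF V(1)] tN(1)[OF V(1)] by auto
  qed
  show "\<exists>!s. s \<in> carrier (Mod LN (\<Union>C)) \<and> (\<forall>V\<in>C. mres LN (\<Union>C) V s = t V)"
  proof (rule ex1I[of _ "\<iota> f"])
    show "\<iota> f \<in> carrier (Mod LN (\<Union>C)) \<and> (\<forall>V\<in>C. mres LN (\<Union>C) V (\<iota> f) = t V)"
      using fN fV tN(2) by simp
    fix s assume s: "s \<in> carrier (Mod LN (\<Union>C)) \<and> (\<forall>V\<in>C. mres LN (\<Union>C) V s = t V)"
    then obtain g where g: "s = \<iota> g" "g \<in> Nf (\<Union>C)" by auto
    have "g = f"
    proof (rule extensionalityI[OF Nf_ext[OF g(2)] Nf_ext[OF fN]])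
      fix x assume "x \<in> \<Union>C"
      then obtain V where V: "V \<in> C" "x \<in> V" by blast
      have "\<iota> (restrict g V) = t V" using s V(1) g(1) by simp
      then have "restrict g V = restrict f V" using fV[OF V(1)] by (metis dec)
      from fun_cong[OF this, of x] show "g x = f x" using V(2) by simp
    qed
    then show "s = \<iota> f" using g by simp
  qed
qed

lemma LN_module_sheaf: "module_sheaf X U R LN"
  unfolding module_sheaf_def
proof (intro conjI ballI LN_sheaf_on LN_module)
  fix V W m assume W: "W \<in> opens X V"
  note s = opens_subset[OF W]
  show "mres LN V W (m \<oplus>[LN,V] m') = mres LN V W m \<oplus>[LN,W] mres LN V W m'" for m'
    using s by (auto simp: restrict_def fun_eq_iff intro!: arg_cong[of _ _ \<iota>])
  show "mres LN V W (f \<odot>[LN,V] m) = restrict f W \<odot>[LN,W] mres LN V W m" for f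
    using s by (auto simp: restrict_def fun_eq_iff intro!: arg_cong[of _ _ \<iota>])
qed

lemma D_gen:
  assumes W: "(W, v, \<omega>) \<in> D" and Z: "Z \<in> opens X W" and m: "m \<in> carrier (Mod LN Z)"
  shows "\<exists>!k. k \<in> F Z \<and> m = k \<odot>[LN,Z] mres LN W Z (\<iota> v)"
proof -
  obtain f where f: "m = \<iota> f" "f \<in> Nf Z" using m by auto
  have ZU: "Z \<in> opens X U" by (rule opens_trans[OF D_open[OF W] Z])
  have nz: "v x \<noteq> 0" if "x \<in> Z" for x using D_nz[OF W] that opens_subset[OF Z] by blast
  show ?thesis
  proof (rule ex1I[of _ "\<lambda>x\<in>Z. f x / v x"])
    show "(\<lambda>x\<in>Z. f x / v x) \<in> F Z \<and> m = (\<lambda>x\<in>Z. f x / v x) \<odot>[LN,Z] mres LN W Z (\<iota> v)"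
      using Nf_quot[OF ZU f(2) W opens_self[OF oU[OF ZU]] Z] f(1) nz Nf_ext[OF f(2)]
      by (auto simp: restrict_def fun_eq_iff extensional_def intro!: arg_cong[of _ _ \<iota>])
    fix k assume k: "k \<in> F Z \<and> m = k \<odot>[LN,Z] mres LN W Z (\<iota> v)"
    then have "\<iota> f = \<iota> (\<lambda>x\<in>Z. k x * restrict v Z x)" using f(1) by simp
    then have e: "f = (\<lambda>x\<in>Z. k x * restrict v Z x)" by (rule injD[OF inj])
    show "k = (\<lambda>x\<in>Z. f x / v x)"
      by (rule extensionalityI[of _ Z]) (use F_ext k nz e in auto)
  qed
qed

lemma LN_free: "locally_free_rank X U R LN 1"
  unfolding locally_free_rank_def
proof
  fix x assume "x \<in> U"
  then obtain W v \<omega> where W: "(W, v, \<omega>) \<in> D" "x \<in> W" using D_cover by blast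
  have "frame X R LN W 1 (\<lambda>i. \<iota> v)"
    by (rule frame_rank1I[OF LN_module_sheaf D_open[OF W(1)] _ D_gen[OF W(1)]]) (use D_Nf[OF W(1)] in simp)
  then show "\<exists>V\<in>opens X U. x \<in> V \<and> (\<exists>e. frame X R LN V 1 e)" using W D_open by blast
qed

lemma dact_res:
  assumes V: "V \<in> opens X U" and b: "b \<in> Bc V" and f: "f \<in> Nf V" and Y: "Y \<in> opens X V"
  shows "restrict (dact V b f) Y = dact Y (mres B V Y b) (restrict f Y)"
proof (rule extensionalityI[of _ Y])
  fix x assume x: "x \<in> Y"
  note YU = opens_trans[OF V Y]
  obtain W v \<omega> Z where W: "(W, v, \<omega>) \<in> D" and Z: "Z \<in> opens X Y" "Z \<in> opens X W" "x \<in> Z"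
    using D_cover_in[OF YU x] by blast
  have "(\<lambda>y\<in>Z. restrict f Y y / v y) = (\<lambda>y\<in>Z. f y / v y)"
    using opens_subset[OF Z(1)] by (auto simp: restrict_def fun_eq_iff)
  then show "restrict (dact V b f) Y x = dact Y (mres B V Y b) (restrict f Y) x"
    using dact_eq[OF V b f W opens_trans[OF Y Z(1)] Z(2,3)]
      dact_eq[OF YU B_res[OF oU[OF V] Y b] Nf_restrict[OF V f Y] W Z] B_res_res[OF oU[OF V] Y Z(1) b] x by simp
qed (rule restrict_extensional, simp add: dact_def)

text \<open>Every point lies in the domain of some frame, where \<open>dact_eq\<close> makes the
  action explicit. The identities below are all checked in this form.\<close>

lemma dact_eqI:
  assumes V: "V \<in> opens X U" and g: "g \<in> extensional V"
    and eq: "\<And>W v \<omega> Z x. (W, v, \<omega>) \<in> D \<Longrightarrow> Z \<in> opens X V \<Longrightarrow> Z \<in> opens X W \<Longrightarrow> x \<in> Z \<Longrightarrow> dact V b f x = g x"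
  shows "dact V b f = g"
proof (rule extensionalityI[OF _ g])
  show "dact V b f \<in> extensional V" by (simp add: dact_def)
  fix x assume "x \<in> V"
  then show "dact V b f x = g x" using D_cover_in[OF V] eq by meson
qed

lemma dact_add:
  assumes V: "V \<in> opens X U" and b: "b \<in> Bc V" and f: "f \<in> Nf V" and g: "g \<in> Nf V"
  shows "dact V b (\<lambda>x\<in>V. f x + g x) = (\<lambda>x\<in>V. dact V b f x + dact V b g x)"
proof (rule dact_eqI[OF V])
  fix W v \<omega> Z x assume W: "(W, v, \<omega>) \<in> D" and Z: "Z \<in> opens X V" "Z \<in> opens X W" and x: "x \<in> Z"
  have xV: "x \<in> V" using x opens_subset[OF Z(1)] by blast
  have nz: "v x \<noteq> 0" using D_nz[OF W] x opens_subset[OF Z(2)] by blast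
  have e: "(\<lambda>y\<in>Z. (\<lambda>x\<in>V. f x + g x) y / v y) = (\<lambda>y\<in>Z. (\<lambda>y\<in>Z. f y / v y) y + (\<lambda>y\<in>Z. g y / v y) y)"
    using opens_subset[OF Z(1)] by (auto simp: restrict_def fun_eq_iff add_divide_distrib)
  show "dact V b (\<lambda>x\<in>V. f x + g x) x = (\<lambda>x\<in>V. dact V b f x + dact V b g x) x"
    unfolding dact_eq[OF V b Nf_add[OF V f g] W Z x] e
      ac_add[OF opens_openin[OF Z(1)] B_res[OF oU[OF V] Z(1) b] Nf_quot[OF V f W Z] Nf_quot[OF V g W Z] x]
    using xV nz by (simp add: dact_eq[OF V b f W Z x] dact_eq[OF V b g W Z x] field_simps)
qed simp

lemma dact_leibniz:
  assumes V: "V \<in> opens X U" and b: "b \<in> Bc V" and f: "f \<in> Nf V" and k: "k \<in> F V"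
  shows "dact V b (\<lambda>x\<in>V. k x * f x) = (\<lambda>x\<in>V. ac V b k x * f x + k x * dact V b f x)"
proof (rule dact_eqI[OF V])
  fix W v \<omega> Z x assume W: "(W, v, \<omega>) \<in> D" and Z: "Z \<in> opens X V" "Z \<in> opens X W" and x: "x \<in> Z"
  have xV: "x \<in> V" using x opens_subset[OF Z(1)] by blast
  have nz: "v x \<noteq> 0" using D_nz[OF W] x opens_subset[OF Z(2)] by blast
  have e: "(\<lambda>y\<in>Z. (\<lambda>x\<in>V. k x * f x) y / v y) = (\<lambda>y\<in>Z. restrict k Z y * (\<lambda>y\<in>Z. f y / v y) y)"
    using opens_subset[OF Z(1)] by (auto simp: restrict_def fun_eq_iff)
  note bZ = B_res[OF oU[OF V] Z(1) b]
  have k: "ac Z (mres B V Z b) (restrict k Z) x = ac V b k x" using ac_restrict[OF oU[OF V] b k Z(1)] x by simp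
  show "dact V b (\<lambda>x\<in>V. k x * f x) x = (\<lambda>x\<in>V. ac V b k x * f x + k x * dact V b f x) x"
    unfolding dact_eq[OF V b Nf_smult[OF V \<open>k \<in> F V\<close> f] W Z x] e
      ac_mult[OF opens_openin[OF Z(1)] bZ F_restrict[OF \<open>k \<in> F V\<close> Z(1)] Nf_quot[OF V f W Z] x] k
    using xV x nz by (simp add: dact_eq[OF V b f W Z x] field_simps)
qed simp

lemma dact_plus:
  assumes V: "V \<in> opens X U" and b: "b \<in> Bc V" and b': "b' \<in> Bc V" and f: "f \<in> Nf V"
  shows "dact V (b \<oplus>[B,V] b') f = (\<lambda>x\<in>V. dact V b f x + dact V b' f x)"
proof (rule dact_eqI[OF V])
  fix W v \<omega> Z x assume W: "(W, v, \<omega>) \<in> D" and Z: "Z \<in> opens X V" "Z \<in> opens X W" and x: "x \<in> Z"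
  interpret M: module "R V" "Mod B V" by (rule B_module[OF oU[OF V]])
  have xV: "x \<in> V" using x opens_subset[OF Z(1)] by blast
  note bZ = B_res[OF oU[OF V] Z(1) b] and bZ' = B_res[OF oU[OF V] Z(1) b']
  have bb: "b \<oplus>[B,V] b' \<in> Bc V" using b b' by simp
  note r = module_sheafD(3)[OF B_sheaf opens_topspace[OF oU[OF V]] Z(1) b b']
  show "dact V (b \<oplus>[B,V] b') f x = (\<lambda>x\<in>V. dact V b f x + dact V b' f x) x"
    unfolding dact_eq[OF V bb f W Z x] r ac_plus[OF opens_openin[OF Z(1)] bZ bZ' Nf_quot[OF V f W Z] x]
      ClD(3)[OF oU[OF D_open[OF W]] D_Cl[OF W] Z(2) bZ bZ']
    using xV x D_nz[OF W] opens_subset[OF Z(2)]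
    by (auto simp: dact_eq[OF V b f W Z x] dact_eq[OF V b' f W Z x] field_simps)
qed simp

lemma dact_smult:
  assumes V: "V \<in> opens X U" and b: "b \<in> Bc V" and k: "k \<in> F V" and f: "f \<in> Nf V"
  shows "dact V (k \<odot>[B,V] b) f = (\<lambda>x\<in>V. k x * dact V b f x)"
proof (rule dact_eqI[OF V])
  fix W v \<omega> Z x assume W: "(W, v, \<omega>) \<in> D" and Z: "Z \<in> opens X V" "Z \<in> opens X W" and x: "x \<in> Z"
  interpret M: module "R V" "Mod B V" by (rule B_module[OF oU[OF V]])
  have xV: "x \<in> V" using x opens_subset[OF Z(1)] by blast
  note bZ = B_res[OF oU[OF V] Z(1) b]
  have kb: "k \<odot>[B,V] b \<in> Bc V" using b k by simp
  note r = module_sheafD(4)[OF B_sheaf opens_topspace[OF oU[OF V]] Z(1) k b]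
  note kZ = F_restrict[OF k Z(1)]
  show "dact V (k \<odot>[B,V] b) f x = (\<lambda>x\<in>V. k x * dact V b f x) x"
    unfolding dact_eq[OF V kb f W Z x] r ac_smult[OF opens_openin[OF Z(1)] bZ kZ Nf_quot[OF V f W Z] x]
      ClD(5)[OF oU[OF D_open[OF W]] D_Cl[OF W] Z(2) bZ kZ]
    using xV x by (simp add: dact_eq[OF V b f W Z x] ring_distribs)
qed simp

text \<open>Flatness combines \<open>ac_br\<close>, for the second derivatives of the coefficient,
  with closedness of the form, for the derivatives of its values. All other terms of the iterated
  action are symmetric in the two sections and cancel.\<close>

lemma dact_br:
  assumes V: "V \<in> opens X U" and b: "b \<in> Bc V" and b': "b' \<in> Bc V" and f: "f \<in> Nf V"
  shows "dact V (br V b b') f = (\<lambda>x\<in>V. dact V b (dact V b' f) x - dact V b' (dact V b f) x)"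
proof (rule dact_eqI[OF V])
  fix W v \<omega> Z x assume W: "(W, v, \<omega>) \<in> D" and Z: "Z \<in> opens X V" "Z \<in> opens X W" and x: "x \<in> Z"
  have xV: "x \<in> V" using x opens_subset[OF Z(1)] by blast
  note oZ = opens_openin[OF Z(1)]
  define c c' where "c = mres B V Z b" and "c' = mres B V Z b'"
  have cB: "c \<in> Bc Z" "c' \<in> Bc Z" unfolding c_def c'_def using B_res[OF oU[OF V] Z(1)] b b' by auto
  have brZ: "mres B V Z (br V b b') = br Z c c'" unfolding c_def c'_def by (rule brD(3)[OF oU[OF V] b b' Z(1)])
  define h where "h = (\<lambda>y\<in>Z. f y / v y)"
  have h: "h \<in> F Z" unfolding h_def by (rule Nf_quot[OF V f W Z])
  define w where "w e = \<omega> Z [e]" for e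
  have wF: "w e \<in> F Z" if "e \<in> Bc Z" for e
    unfolding w_def by (rule ClD(1)[OF oU[OF D_open[OF W]] D_Cl[OF W] Z(2) that])
  have dw: "ac Z c (w c') x - ac Z c' (w c) x = w (br Z c c') x"
    unfolding w_def by (rule ClD(4)[OF oU[OF D_open[OF W]] D_Cl[OF W] Z(2) cB x])
  have nz: "v x \<noteq> 0" using D_nz[OF W] x opens_subset[OF Z(2)] by blast
  have two: "dact V e (dact V e' f) x = (ac Z c (ac Z c' h) x - (ac Z c (w c') x * h x + w c' x * ac Z c h x)
      - w c x * (ac Z c' h x - w c' x * h x)) * v x"
    if e: "e \<in> Bc V" "e' \<in> Bc V" and c: "c = mres B V Z e" "c' = mres B V Z e'" "c \<in> Bc Z" "c' \<in> Bc Z" for e e' c c'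
  proof -
    have q: "(\<lambda>y\<in>Z. dact V e' f y / v y) = (\<lambda>y\<in>Z. ac Z c' h y - (\<lambda>y\<in>Z. w c' y * h y) y)"
      unfolding dact_quot[OF V e(2) f W Z] c(2) w_def h_def by (simp cong: restrict_cong)
    have "ac Z c (\<lambda>y\<in>Z. dact V e' f y / v y) x = ac Z c (ac Z c' h) x - (ac Z c (w c') x * h x + w c' x * ac Z c h x)"
      unfolding q ac_diff[OF oZ c(3) ac_closed[OF oZ c(4) h] F_mult[OF oZ wF[OF c(4)] h] x]
        ac_mult[OF oZ c(3) wF[OF c(4)] h x] ..
    moreover have "dact V e' f x / v x = ac Z c' h x - w c' x * h x"
      using fun_cong[OF q, of x] x by simp
    ultimately show ?thesis
      using dact_eq[OF V e(1) dact_closed[OF V e(2) f] W Z x] unfolding c(1)[symmetric] w_def[symmetric] by simp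
  qed
  have "dact V (br V b b') f x = (ac Z (br Z c c') h x - w (br Z c c') x * h x) * v x"
    using dact_eq[OF V brD(1)[OF oU[OF V] b b'] f W Z x] x unfolding brZ w_def h_def by simp
  note 1 = this
  show "dact V (br V b b') f x = (\<lambda>x\<in>V. dact V b (dact V b' f) x - dact V b' (dact V b f) x) x"
    unfolding 1 ac_br[OF oZ cB h x] dw[symmetric]
    using xV by (simp add: two[OF b b' c_def c'_def cB] two[OF b' b c'_def c_def cB(2,1)] algebra_simps)
qed simp

lemma LN_B_structure: "B_module_structure X A P B U LN (bact LN)"
  unfolding B_module_structure_def
proof (intro ballI)
  fix V b m assume V: "V \<in> opens X U" and b: "b \<in> Bc V" and "m \<in> carrier (Mod LN V)"
  then obtain f where f: "m = \<iota> f" "f \<in> Nf V" by auto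
  note oV = oU[OF V]
  have const: "dact V b (\<lambda>x\<in>V. (\<lambda>x\<in>V. z) x * f x) = (\<lambda>x\<in>V. (\<lambda>x\<in>V. z) x * dact V b f x)" for z
    unfolding dact_leibniz[OF V b f(2) F_const[OF oV]] using ac_const[OF oV b]
    by (auto simp: restrict_def fun_eq_iff)
  show "bact LN V b m \<in> carrier (Mod LN V) \<and>
        (\<forall>W\<in>opens X V. mres LN V W (bact LN V b m) = bact LN W (mres B V W b) (mres LN V W m)) \<and>
        (\<forall>m'\<in>carrier (Mod LN V). bact LN V b (m \<oplus>[LN,V] m') = bact LN V b m \<oplus>[LN,V] bact LN V b m') \<and>
        (\<forall>z. bact LN V b ((\<lambda>x\<in>V. z) \<odot>[LN,V] m) = (\<lambda>x\<in>V. z) \<odot>[LN,V] bact LN V b m) \<and>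
        (\<forall>b'\<in>carrier (Mod B V).
           bact LN V (b \<oplus>[B,V] b') m = bact LN V b m \<oplus>[LN,V] bact LN V b' m \<and>
           bact LN V (lbr B V b b') m = bact LN V b (bact LN V b' m) \<ominus>\<^bsub>Mod LN V\<^esub> bact LN V b' (bact LN V b m)) \<and>
        (\<forall>f\<in>carrier (OXP X A P V).
           bact LN V (f \<odot>[B,V] b) m = f \<odot>[LN,V] bact LN V b m \<and>
           bact LN V b (f \<odot>[LN,V] m) =
             alg_act X B V b f \<odot>[LN,V] m \<oplus>[LN,V] f \<odot>[LN,V] bact LN V b m)"
  proof (intro conjI ballI allI)
    show "bact LN V b m \<in> carrier (Mod LN V)" using dact_closed[OF V b f(2)] f(1) by simp
    show "mres LN V W (bact LN V b m) = bact LN W (mres B V W b) (mres LN V W m)" if "W \<in> opens X V" for W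
      using dact_res[OF V b f(2) that] f(1) by simp
    show "bact LN V b ((\<lambda>x\<in>V. z) \<odot>[LN,V] m) = (\<lambda>x\<in>V. z) \<odot>[LN,V] bact LN V b m" for z
      unfolding LN_simps f(1) dec const ..
    show "bact LN V b (m \<oplus>[LN,V] m') = bact LN V b m \<oplus>[LN,V] bact LN V b m'"
      if m': "m' \<in> carrier (Mod LN V)" for m'
    proof -
      obtain g where g: "m' = \<iota> g" "g \<in> Nf V" using m' by auto
      show ?thesis unfolding LN_simps f(1) g(1) dec dact_add[OF V b f(2) g(2)] ..
    qed
    show "bact LN V (b \<oplus>[B,V] b') m = bact LN V b m \<oplus>[LN,V] bact LN V b' m" if "b' \<in> Bc V" for b'
      unfolding LN_simps f(1) dec dact_plus[OF V b that f(2)] ..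
    show "bact LN V (br V b b') m = bact LN V b (bact LN V b' m) \<ominus>\<^bsub>Mod LN V\<^esub> bact LN V b' (bact LN V b m)"
      if b': "b' \<in> Bc V" for b'
      unfolding LN_simps f(1) dec dact_br[OF V b b' f(2)]
      by (rule LN_minus[symmetric, OF V dact_closed[OF V b dact_closed[OF V b' f(2)]] dact_closed[OF V b' dact_closed[OF V b f(2)]]])
    show "bact LN V (k \<odot>[B,V] b) m = k \<odot>[LN,V] bact LN V b m" if "k \<in> F V" for k
      unfolding LN_simps f(1) dec dact_smult[OF V b that f(2)] ..
    show "bact LN V b (k \<odot>[LN,V] m) = ac V b k \<odot>[LN,V] m \<oplus>[LN,V] k \<odot>[LN,V] bact LN V b m"
      if "k \<in> F V" for k
      unfolding LN_simps f(1) dec dact_leibniz[OF V b f(2) that] by (simp cong: restrict_cong)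
  qed
qed

lemma LN_Ob: "LN \<in> PicB_Ob X A P B U"
  unfolding PicB_Ob_def using LN_module_sheaf LN_free LN_B_structure by blast

sublocale LN: B_line_bundle X A P B U LN
  by unfold_locales (rule U LN_module_sheaf LN_free LN_B_structure)+

lemma D_generator: "(W, v, \<omega>) \<in> D \<Longrightarrow> LN.sec.generator W (\<iota> v)"
  unfolding LN.sec.generator_def using D_open D_Nf D_gen by (metis LN_simps(1) image_eqI)

text \<open>\<open>LN.val\<close> is a chosen value map and need not return the encoded functions.
  The two are linked through the frames, in which \<open>f\<close> has the coefficient f /
  v.\<close>

lemma LN_nv:
  assumes V: "V \<in> opens X U" and f: "f \<in> Nf V" and nz: "\<And>x. x \<in> V \<Longrightarrow> f x \<noteq> 0"
  shows "\<iota> f \<in> nonvanishing X R LN V"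
  unfolding LN.nv_iff[OF V]
proof (intro conjI ballI)
  show fL: "\<iota> f \<in> carrier (Mod LN V)" using f by simp
  fix x assume x: "x \<in> V"
  obtain W v \<omega> Z where W: "(W, v, \<omega>) \<in> D" and Z: "Z \<in> opens X V" "Z \<in> opens X W" "x \<in> Z"
    using D_cover_in[OF V x] by blast
  note g = LN.sec.generator_res[OF D_generator[OF W] Z(2)]
  have vz: "v y \<noteq> 0" if "y \<in> Z" for y using D_nz[OF W] that opens_subset[OF Z(2)] by blast
  have "mres LN V Z (\<iota> f) = (\<lambda>y\<in>Z. f y / v y) \<odot>[LN,Z] mres LN W Z (\<iota> v)"
    using vz by (auto simp: restrict_def fun_eq_iff intro!: arg_cong[of _ _ \<iota>])
  from LN.val_apply[OF V fL Z(1) Nf_quot[OF V f W Z(1,2)] LN.sec.generatorD(2)[OF g] this Z(3)]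
  show "LN.val V (\<iota> f) x \<noteq> 0" using LN.val_nz[OF g Z(3)] nz[OF x] vz[OF Z(3)] Z(3) by simp
qed

text \<open>In its own frame \<open>v\<close> has coefficient 1, which \<open>b\<close> kills, so
  only the form survives in \<open>dact\<close>.\<close>

lemma D_nabla: "(W, v, \<omega>) \<in> D \<Longrightarrow> (\<iota> v, \<omega>) \<in> nab U LN W"
proof -
  assume W: "(W, v, \<omega>) \<in> D"
  show ?thesis
  proof (rule LN.nablaI[OF D_open[OF W] LN.generator_nv[OF D_generator[OF W]] D_Cl[OF W]])
    fix Z b assume Z: "Z \<in> opens X W" and b: "b \<in> Bc Z"
    note ZU = opens_trans[OF D_open[OF W] Z]
    note oZ = oU[OF ZU]
    note ZZ = opens_self[OF oZ]
    have vz: "v y \<noteq> 0" if "y \<in> Z" for y using D_nz[OF W] that opens_subset[OF Z] by blast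
    have q: "(\<lambda>y\<in>Z. restrict v Z y / v y) = (\<lambda>y\<in>Z. 1)" using vz by (auto simp: restrict_def fun_eq_iff)
    have "dact Z b (restrict v Z) = (\<lambda>x\<in>Z. (\<lambda>x\<in>Z. - \<omega> Z [b] x) x * restrict v Z x)"
    proof (rule extensionalityI[of _ Z])
      fix x assume x: "x \<in> Z"
      show "dact Z b (restrict v Z) x = (\<lambda>x\<in>Z. (\<lambda>x\<in>Z. - \<omega> Z [b] x) x * restrict v Z x) x"
        using dact_eq[OF ZU b Nf_restrict[OF D_open[OF W] D_Nf[OF W] Z] W ZZ Z x] vz[OF x] x
          ac_const[OF oZ b x, of 1] B_res_id[OF oZ b] unfolding q by simp
    qed (simp_all add: dact_def)
    then show "bact LN Z b (mres LN W Z (\<iota> v)) = (\<lambda>x\<in>Z. - \<omega> Z [b] x) \<odot>[LN,Z] mres LN W Z (\<iota> v)" by simp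
  qed
qed

end

section \<open>Essential surjectivity and sums\<close>

context ttorsor
begin

text \<open>Spells out \<open>triv_rel\<close> over a smaller open set in the shape of
  \<open>D_compat\<close>, so that trivialized torsors can be fed into
  \<open>line_data\<close>.\<close>

lemma triv_rel_apply:
  assumes t: "(t, \<omega>) \<in> triv T V" "(t', \<omega>') \<in> triv T V'" and Z: "Z \<in> opens X V" "Z \<in> opens X V'"
  shows "\<exists>g\<in>Uts Z. tres T V Z t = tact T Z g (tres T V' Z t') \<and> (\<forall>Y\<in>opens X Z. \<forall>b\<in>Bc Y. \<forall>y\<in>Y.
    \<omega>' Y [b] y = ac Y b (restrict g Y) y / g y + \<omega> Y [b] y)"
proof -
  note V = trivD[OF t(1)] and V' = trivD[OF t(2)]
  have oZ: "openin X Z" using Z opens_openin by blast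
  obtain g where g: "g \<in> Uts Z" "tres T V Z t = tact T Z g (tres T V' Z t')"
    "restrict \<omega>' (opens X Z) = d Z g \<otimes>[H,Z] restrict \<omega> (opens X Z)"
    using triv_rel[OF triv_res[OF t(1) Z(1)] triv_res[OF t(2) Z(2)]] by blast
  have "\<omega>' Y [b] y = ac Y b (restrict g Y) y / g y + \<omega> Y [b] y" if Y: "Y \<in> opens X Z" "b \<in> Bc Y" "y \<in> Y" for Y b y
  proof -
    have "\<omega>' Y [b] y = (d Z g \<otimes>[H,Z] restrict \<omega> (opens X Z)) Y [b] y"
      using g(3) Y(1) by (metis restrict_apply')
    then show ?thesis
      unfolding Cl_mult(2)[OF oZ dlog_Cl[OF oZ g(1)] Cl_restrict[OF oU[OF V(1)] V(3) Z(1)] Y(1,2)] dlog_apply[OF Y(1,2)]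
      using Y(1,3) by simp
  qed
  then show ?thesis using g by blast
qed

end

lemma (in gtorsor) val_rel:
  assumes v: "sec.is_val v" and V: "V \<in> opens X U" "t \<in> tsec T V" and V': "V' \<in> opens X U" "t' \<in> tsec T V'"
    and Z: "Z \<in> opens X V" "Z \<in> opens X V'" and g: "g \<in> Uts Z" "tres T V Z t = tact T Z g (tres T V' Z t')"
    and y: "y \<in> Z"
  shows "v V t y = g y * v V' t' y"
proof -
  note vD = sec.is_valD[OF v]
  have "restrict (v V t) Z = (\<lambda>y\<in>Z. g y * restrict (v V' t') Z y)"
    using vD(2)[OF V Z(1)] vD(2)[OF V' Z(2)] vD(3)[OF opens_trans[OF V(1) Z(1)] sec.res_closed[OF V' Z(2)] g(1)] g(2)
    by metis
  from fun_cong[OF this, of y] show ?thesis using y by simp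
qed

context smooth_algebroid
begin

text \<open>A morphism is all that has to be produced, since \<open>Tors_inverse\<close> makes it an
  isomorphism.\<close>

lemma ess_surj:
  fixes T :: "('x, 'x cfun, ('x, 'b) form, 'u) ttorsor" and \<iota> :: "'x cfun \<Rightarrow> 'u"
  assumes T: "ttors U T" and inj: "inj \<iota>"
  shows "\<exists>L\<in>PicB_Ob X A P B U. \<exists>f. f \<in> TMor U (FO U L) T"
proof -
  interpret T: ttorsor X A P B U T by (rule T)
  obtain v where v: "T.sec.is_val v" using T.sec.val_exists[OF T.torsor_cover] by blast
  note vD = T.sec.is_valD[OF v]
  \<comment> \<open>Each representative \<open>(t, \<omega>)\<close> contributes a frame: the value
    function of \<open>t\<close>, with unchanged form.\<close>
  define D where "D = {(W, v W t, \<omega>) | W t \<omega>. (t, \<omega>) \<in> triv T W}"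
  have DE: "\<exists>t. (t, \<omega>) \<in> triv T W \<and> f = v W t" if "(W, f, \<omega>) \<in> D" for W f \<omega>
    using that by (auto simp: D_def)
  interpret N: line_data X A P B U D \<iota>
  proof
    show "openin X U" by (rule T.U)
    show "inj \<iota>" by (rule inj)
    show "W \<in> opens X U" "f \<in> extensional W" "\<omega> \<in> Cl W" if "(W, f, \<omega>) \<in> D" for W f \<omega>
      using DE[OF that] T.trivD vD(1) by blast+
    show "f x \<noteq> 0" if "(W, f, \<omega>) \<in> D" "x \<in> W" for W f \<omega> x
      using DE[OF that(1)] T.trivD T.sec.is_val_nz[OF v T.torsor_generator that(2)] by blast
    show "\<exists>W f \<omega>. (W, f, \<omega>) \<in> D \<and> x \<in> W" if "x \<in> U" for x
      using T.triv_exists[OF that] by (auto simp: D_def)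
    fix W f \<omega> W' f' \<omega>' Z assume "(W, f, \<omega>) \<in> D" "(W', f', \<omega>') \<in> D" and Z: "Z \<in> opens X W" "Z \<in> opens X W'"
    then obtain t t' where t: "(t, \<omega>) \<in> triv T W" "f = v W t" "(t', \<omega>') \<in> triv T W'" "f' = v W' t'" using DE by meson
    obtain g where g: "g \<in> Uts Z" "tres T W Z t = tact T Z g (tres T W' Z t')"
      "\<forall>Y\<in>opens X Z. \<forall>b\<in>Bc Y. \<forall>y\<in>Y. \<omega>' Y [b] y = ac Y b (restrict g Y) y / g y + \<omega> Y [b] y"
      using T.triv_rel_apply[OF t(1,3) Z] by blast
    have "\<forall>y\<in>Z. f y = g y * f' y"
      using T.val_rel[OF v T.trivD(1,2)[OF t(1)] T.trivD(1,2)[OF t(3)] Z g(1,2)] t(2,4) by blast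
    then show "\<exists>g\<in>Uts Z. (\<forall>y\<in>Z. f y = g y * f' y) \<and> (\<forall>Y\<in>opens X Z. \<forall>b\<in>Bc Y. \<forall>y\<in>Y.
        \<omega>' Y [b] y = ac Y b (restrict g Y) y / g y + \<omega> Y [b] y)" using g by blast
  qed
  \<comment> \<open>The morphism sends the frame coming from \<open>t\<close> back to
    \<open>t\<close>.\<close>
  define E where "E = {(W, \<iota> (v W t), t) | W t. \<exists>\<omega>. (t, \<omega>) \<in> triv T W}"
  have EE: "\<exists>\<omega>. (q', \<omega>) \<in> triv T W \<and> q = \<iota> (v W q')" if "(W, q, q') \<in> E" for W q q'
    using that by (auto simp: E_def)
  have nab: "(\<iota> (v W t), \<omega>) \<in> nabla X A P B U N.LN W" if "(t, \<omega>) \<in> triv T W" for W t \<omega>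
    by (rule N.D_nabla) (use that in \<open>auto simp: D_def\<close>)
  have "\<exists>h\<in>TMor U (FO U N.LN) T. \<forall>(V, q, q')\<in>E. h V q = q'"
  proof (rule Tors_extend[OF N.LN.FT.ttorsor_axioms T])
    show "W \<in> opens X U \<and> q \<in> tsec (FO U N.LN) W \<and> q' \<in> tsec T W" if "(W, q, q') \<in> E" for W q q'
      using EE[OF that] nab N.LN.nablaD(2) T.trivD unfolding F_Ob_simps by blast
    show "\<exists>V q q' \<omega>. x \<in> V \<and> (V, q, q') \<in> E \<and> (q, \<omega>) \<in> triv (FO U N.LN) V \<and> (q', \<omega>) \<in> triv T V"
      if x: "x \<in> U" for x
    proof -
      obtain V t \<omega> where V: "x \<in> V" "(t, \<omega>) \<in> triv T V" using T.triv_exists[OF x] by blast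
      then have "(V, \<iota> (v V t), t) \<in> E" by (auto simp: E_def)
      then show ?thesis using V nab[OF V(2)] unfolding F_Ob_simps by blast
    qed
    fix V q q' W p p' Z assume "(V, q, q') \<in> E" "(W, p, p') \<in> E" and Z: "Z \<in> opens X V" "Z \<in> opens X W"
    then obtain \<omega> \<omega>' where t: "(q', \<omega>) \<in> triv T V" "q = \<iota> (v V q')" "(p', \<omega>') \<in> triv T W" "p = \<iota> (v W p')" using EE by meson
    obtain g where g: "g \<in> Uts Z" "tres T W Z p' = tact T Z g (tres T V Z q')"
      using T.triv_rel_apply[OF t(3,1) Z(2,1)] by blast
    have "restrict (v W p') Z = (\<lambda>y\<in>Z. g y * restrict (v V q') Z y)"
      using T.val_rel[OF v T.trivD(1,2)[OF t(3)] T.trivD(1,2)[OF t(1)] Z(2,1) g] by (auto simp: restrict_def fun_eq_iff)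
    then have "tres (FO U N.LN) W Z p = tact (FO U N.LN) Z g (tres (FO U N.LN) V Z q)"
      unfolding F_Ob_simps t(2,4) by simp
    then show "\<exists>k\<in>Uts Z. tres (FO U N.LN) W Z p = tact (FO U N.LN) Z k (tres (FO U N.LN) V Z q) \<and>
       tres T W Z p' = tact T Z k (tres T V Z q')" using g by blast
  qed
  then show ?thesis using N.LN_Ob by blast
qed

end

text \<open>The value maps are parameters so that, for torsors of line bundles, those of the bundles
  can be inserted; the sum then carries the tensor product as well.\<close>

locale torsor_sum = S: ttorsor X A P B U S + T: ttorsor X A P B U T
  for X :: "'x topology" and A P and B :: "('x, 'b) lie_algd" and U
    and S :: "('x, 'x cfun, ('x, 'b) form, 'u) ttorsor" and T :: "('x, 'x cfun, ('x, 'b) form, 'u) ttorsor" +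
  fixes vS vT :: "'x set \<Rightarrow> 'u \<Rightarrow> 'x cfun" and \<iota> :: "'x cfun \<Rightarrow> 'u"
  assumes vS: "S.sec.is_val vS" and vT: "T.sec.is_val vT" and inj: "inj \<iota>"
begin

text \<open>In the contracted product a unit may be moved from one factor to the other; pointwise
  products of values have this property built in. The forms are added, that being the group law of
  \<open>H\<close>.\<close>

definition SD :: "('x set \<times> 'x cfun \<times> ('x, 'b) form) set" where
  "SD = {(W, (\<lambda>x\<in>W. vS W s x * vT W t x), a \<otimes>[S.H,W] b) | W s a t b. (s, a) \<in> triv S W \<and> (t, b) \<in> triv T W}"

lemma SDE:
  assumes "(W, f, \<omega>) \<in> SD"
  obtains s a t b where "(s, a) \<in> triv S W" "(t, b) \<in> triv T W" "f = (\<lambda>x\<in>W. vS W s x * vT W t x)"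
    "\<omega> = a \<otimes>[S.H,W] b"
  using assms by (auto simp: SD_def)

lemma SDI: "(s, a) \<in> triv S W \<Longrightarrow> (t, b) \<in> triv T W \<Longrightarrow> (W, (\<lambda>x\<in>W. vS W s x * vT W t x), a \<otimes>[S.H,W] b) \<in> SD"
  by (auto simp: SD_def)

lemma both_exist:
  assumes V: "V \<in> opens X U" and x: "x \<in> V"
  shows "\<exists>W s a t b. W \<in> opens X V \<and> x \<in> W \<and> (s, a) \<in> triv S W \<and> (t, b) \<in> triv T W"
proof -
  obtain W s a where W: "W \<in> opens X V" "x \<in> W" "(s, a) \<in> triv S W" using S.triv_exists_in[OF V x] by blast
  obtain Z t b where Z: "Z \<in> opens X W" "x \<in> Z" "(t, b) \<in> triv T Z"
    using T.triv_exists_in[OF opens_trans[OF V W(1)] W(2)] by blast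
  show ?thesis using S.triv_res[OF W(3) Z(1)] Z opens_trans[OF W(1) Z(1)] by blast
qed

sublocale line_data X A P B U SD \<iota>
proof
  show "openin X U" by (rule S.U)
  show "inj \<iota>" by (rule inj)
  fix W f \<omega> assume "(W, f, \<omega>) \<in> SD"
  then obtain s a t b where st: "(s, a) \<in> triv S W" "(t, b) \<in> triv T W" "f = (\<lambda>x\<in>W. vS W s x * vT W t x)"
    "\<omega> = a \<otimes>[S.H,W] b" by (rule SDE)
  note s = S.trivD[OF st(1)] and t = T.trivD[OF st(2)]
  show "W \<in> opens X U" by (rule s(1))
  show "f \<in> extensional W" using st(3) by simp
  show "f x \<noteq> 0" if "x \<in> W" for x
    using S.sec.is_val_nz[OF vS S.torsor_generator[OF s(1,2)] that]
      T.sec.is_val_nz[OF vT T.torsor_generator[OF t(1,2)] that] st(3) that by simp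
  show "\<omega> \<in> S.Cl W" using S.Cl_mult(1)[OF S.oU[OF s(1)] s(3) t(3)] st(4) by simp
  fix W' f' \<omega>' Z assume "(W', f', \<omega>') \<in> SD" and Z: "Z \<in> opens X W" "Z \<in> opens X W'"
  then obtain s' a' t' b' where st': "(s', a') \<in> triv S W'" "(t', b') \<in> triv T W'" "f' = (\<lambda>x\<in>W'. vS W' s' x * vT W' t' x)"
    "\<omega>' = a' \<otimes>[S.H,W'] b'" by (elim SDE)
  note s' = S.trivD[OF st'(1)] and t' = T.trivD[OF st'(2)]
  have oZ: "openin X Z" using Z opens_openin by blast
  obtain g where g: "g \<in> S.Uts Z" "tres S W Z s = tact S Z g (tres S W' Z s')"
    "\<forall>Y\<in>opens X Z. \<forall>b\<in>S.Bc Y. \<forall>y\<in>Y. a' Y [b] y = S.ac Y b (restrict g Y) y / g y + a Y [b] y"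
    using S.triv_rel_apply[OF st(1) st'(1) Z] by blast
  obtain h where h: "h \<in> S.Uts Z" "tres T W Z t = tact T Z h (tres T W' Z t')"
    "\<forall>Y\<in>opens X Z. \<forall>e\<in>S.Bc Y. \<forall>y\<in>Y. b' Y [e] y = S.ac Y e (restrict h Y) y / h y + b Y [e] y"
    using T.triv_rel_apply[OF st(2) st'(2) Z] by blast
  note vg = S.val_rel[OF vS s(1,2) s'(1,2) Z g(1,2)] and vh = T.val_rel[OF vT t(1,2) t'(1,2) Z h(1,2)]
  \<comment> \<open>\<open>dlog\<close> turns this product of transition functions into the sum of
    the changes of the two forms.\<close>
  define k where "k = (\<lambda>x\<in>Z. g x * h x)"
  have kU: "k \<in> S.Uts Z" unfolding k_def by (rule S.Uts_mult[OF oZ g(1) h(1)])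
  have "\<forall>y\<in>Z. f y = k y * f' y"
    using vg vh opens_subset[OF Z(1)] opens_subset[OF Z(2)] by (auto simp: st(3) st'(3) k_def)
  moreover have "\<omega>' Y [e] y = S.ac Y e (restrict k Y) y / k y + \<omega> Y [e] y"
    if Y: "Y \<in> opens X Z" and e: "e \<in> S.Bc Y" and y: "y \<in> Y" for Y e y
  proof -
    have oY: "openin X Y" using Y opens_openin by blast
    note YW = opens_trans[OF Z(1) Y] and YW' = opens_trans[OF Z(2) Y]
    have yZ: "y \<in> Z" using y opens_subset[OF Y] by blast
    have kY: "restrict k Y = (\<lambda>x\<in>Y. restrict g Y x * restrict h Y x)"
      using opens_subset[OF Y] by (auto simp: k_def restrict_def fun_eq_iff)
    have "S.ac Y e (restrict k Y) y = S.ac Y e (restrict g Y) y * h y + g y * S.ac Y e (restrict h Y) y"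
      unfolding kY using S.ac_mult[OF oY e S.F_restrict[OF S.UtsD(1)[OF g(1)] Y] S.F_restrict[OF S.UtsD(1)[OF h(1)] Y] y] y by simp
    then have "S.ac Y e (restrict k Y) y / k y = S.ac Y e (restrict g Y) y / g y + S.ac Y e (restrict h Y) y / h y"
      using S.UtsD(2)[OF g(1) yZ] S.UtsD(2)[OF h(1) yZ] yZ by (simp add: k_def field_simps)
    moreover have "a' Y [e] y = S.ac Y e (restrict g Y) y / g y + a Y [e] y" using g(3) Y e y by blast
    moreover have "b' Y [e] y = S.ac Y e (restrict h Y) y / h y + b Y [e] y" using h(3) Y e y by blast
    ultimately show ?thesis
      unfolding st(4) st'(4) S.Cl_mult(2)[OF S.oU[OF s(1)] s(3) t(3) YW e] S.Cl_mult(2)[OF S.oU[OF s'(1)] s'(3) t'(3) YW' e]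
      using y by simp
  qed
  ultimately show "\<exists>g\<in>S.Uts Z. (\<forall>y\<in>Z. f y = g y * f' y) \<and> (\<forall>Y\<in>opens X Z. \<forall>b\<in>S.Bc Y. \<forall>y\<in>Y.
        \<omega>' Y [b] y = S.ac Y b (restrict g Y) y / g y + \<omega> Y [b] y)" using kU by blast
next
  fix x assume "x \<in> U"
  then show "\<exists>W f \<omega>. (W, f, \<omega>) \<in> SD \<and> x \<in> W"
    using both_exist[OF opens_self[OF S.U]] SDI by meson
qed

section \<open>The universal map of the sum\<close>

definition tens :: "'x set \<Rightarrow> 'u \<Rightarrow> 'u \<Rightarrow> 'u" where
  "tens V s t = \<iota> (\<lambda>x\<in>V. vS V s x * vT V t x)"

lemma tens_nv:
  assumes V: "V \<in> opens X U" and s: "s \<in> tsec S V" and t: "t \<in> tsec T V"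
  shows "tens V s t \<in> nonvanishing X S.R LN V"
  unfolding tens_def
proof (rule LN_nv[OF V])
  show "(\<lambda>x\<in>V. vS V s x * vT V t x) x \<noteq> 0" if "x \<in> V" for x
    using S.sec.is_val_nz[OF vS S.torsor_generator[OF V s] that]
      T.sec.is_val_nz[OF vT T.torsor_generator[OF V t] that] that by simp
  show "(\<lambda>x\<in>V. vS V s x * vT V t x) \<in> Nf V"
  proof (rule NfI[OF _ V])
    fix W f \<omega> Z assume "(W, f, \<omega>) \<in> SD" and Z: "Z \<in> opens X V" "Z \<in> opens X W"
    then obtain s0 a t0 b where st: "(s0, a) \<in> triv S W" "(t0, b) \<in> triv T W" "f = (\<lambda>x\<in>W. vS W s0 x * vT W t0 x)"
      by (elim SDE)
    have oZ: "openin X Z" using Z opens_openin by blast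
    note s0 = S.trivD[OF st(1)] and t0 = T.trivD[OF st(2)]
    note ZU = opens_trans[OF V Z(1)]
    obtain g where g: "g \<in> S.Uts Z" "tres S V Z s = tact S Z g (tres S W Z s0)"
      using S.torsor_trans[OF ZU S.sec.res_closed[OF s0(1,2) Z(2)] S.sec.res_closed[OF V s Z(1)]] by blast
    obtain h where h: "h \<in> S.Uts Z" "tres T V Z t = tact T Z h (tres T W Z t0)"
      using T.torsor_trans[OF ZU T.sec.res_closed[OF t0(1,2) Z(2)] T.sec.res_closed[OF V t Z(1)]] by blast
    have "(\<lambda>y\<in>Z. (\<lambda>x\<in>V. vS V s x * vT V t x) y / f y) = (\<lambda>y\<in>Z. g y * h y)"
    proof (rule restrict_ext)
      fix y assume y: "y \<in> Z"
      have nz: "vS W s0 y \<noteq> 0" "vT W t0 y \<noteq> 0"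
        using S.sec.is_val_nz[OF vS S.torsor_generator[OF s0(1,2)]] T.sec.is_val_nz[OF vT T.torsor_generator[OF t0(1,2)]]
          y opens_subset[OF Z(2)] by auto
      show "(\<lambda>x\<in>V. vS V s x * vT V t x) y / f y = g y * h y"
        using S.val_rel[OF vS V s s0(1,2) Z g y] T.val_rel[OF vT V t t0(1,2) Z h y] nz y
          opens_subset[OF Z(1)] opens_subset[OF Z(2)] by (auto simp: st(3))
    qed
    then show "(\<lambda>y\<in>Z. (\<lambda>x\<in>V. vS V s x * vT V t x) y / f y) \<in> S.F Z"
      using S.UtsD(1)[OF S.Uts_mult[OF oZ g(1) h(1)]] by simp
  qed simp
qed

lemma tens_nabla: "(s, a) \<in> triv S V \<Longrightarrow> (t, b) \<in> triv T V \<Longrightarrow> (tens V s t, a \<otimes>[S.H,V] b) \<in> nabla X A P B U LN V"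
  unfolding tens_def by (rule D_nabla[OF SDI])

lemma Tors_sum_tens: "Tors_sum X S.G S.H S.d U S T (F_Ob X A P B U LN) tens"
  unfolding Tors_sum_def
proof (intro conjI ballI)
  fix V s t assume V: "V \<in> opens X U" and s: "s \<in> tsec S V" and t: "t \<in> tsec T V"
  show "tens V s t \<in> tsec (F_Ob X A P B U LN) V" unfolding F_Ob_simps by (rule tens_nv[OF V s t])
  note vSD = S.sec.is_valD[OF vS V s] and vTD = T.sec.is_valD[OF vT V t]
  show "tres (F_Ob X A P B U LN) V W (tens V s t) = tens W (tres S V W s) (tres T V W t)" if W: "W \<in> opens X V" for W
    unfolding F_Ob_simps tens_def vSD(2)[OF W] vTD(2)[OF W] using opens_subset[OF W]
    by (auto simp: restrict_def fun_eq_iff intro!: arg_cong[of _ _ \<iota>])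
  fix g assume "g \<in> carrier (Grp S.G V)"
  then have g: "g \<in> S.Uts V" using S.G_simps(1)[OF S.oU[OF V]] by simp
  show "tens V (tact S V g s) t = tact (F_Ob X A P B U LN) V g (tens V s t)"
    "tens V s (tact T V g t) = tact (F_Ob X A P B U LN) V g (tens V s t)"
    unfolding F_Ob_simps tens_def vSD(3)[OF g] vTD(3)[OF g]
    by (auto simp: restrict_def fun_eq_iff intro!: arg_cong[of _ _ \<iota>])
next
  show "triv (F_Ob X A P B U LN) = ind_class X S.G S.H S.d (F_Ob X A P B U LN) U
     (\<lambda>V. {(tens V s t, a \<otimes>[S.H,V] b) | s t a b. (s, a) \<in> triv S V \<and> (t, b) \<in> triv T V})"
  proof (rule LN.FT.ind_class_eq[symmetric])
    fix V p assume "p \<in> {(tens V s t, a \<otimes>[S.H,V] b) | s t a b. (s, a) \<in> triv S V \<and> (t, b) \<in> triv T V}"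
    then show "p \<in> triv (F_Ob X A P B U LN) V" unfolding F_Ob_simps using tens_nabla by blast
  next
    fix V x assume "V \<in> opens X U" "x \<in> V"
    then obtain W s a t b where "W \<in> opens X V" "x \<in> W" "(s, a) \<in> triv S W" "(t, b) \<in> triv T W"
      using both_exist by meson
    then show "\<exists>W\<in>opens X V. x \<in> W \<and> (\<exists>p. p \<in> {(tens W s t, a \<otimes>[S.H,W] b) | s t a b. (s, a) \<in> triv S W \<and> (t, b) \<in> triv T W})"
      by blast
  qed
qed

end

text \<open>The sum is found as the torsor of a line bundle, so the quotient of S \<times> T by the
  units is never formed.\<close>

lemma (in smooth_algebroid) Tors_sum_exists:
  fixes S T :: "('x, 'x cfun, ('x, 'b) form, 'u) ttorsor" and \<iota> :: "'x cfun \<Rightarrow> 'u"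
  assumes S: "ttorsor X A P B U S" and T: "ttorsor X A P B U T" and inj: "inj \<iota>"
  shows "\<exists>Q \<beta>. Q \<in> Tors_Ob X G H d U \<and> Tors_sum X G H d U S T Q \<beta>"
proof -
  interpret S: ttorsor X A P B U S by (rule S)
  interpret T: ttorsor X A P B U T by (rule T)
  obtain vS where vS: "S.sec.is_val vS" using S.sec.val_exists[OF S.torsor_cover] by blast
  obtain vT where vT: "T.sec.is_val vT" using T.sec.val_exists[OF T.torsor_cover] by blast
  interpret Q: torsor_sum X A P B U S T vS vT \<iota> by unfold_locales (rule vS vT inj)+
  show ?thesis using Q.LN.F_Ob_Tors Q.Tors_sum_tens by blast
qed

section \<open>Tensor products and full faithfulness\<close>

lemma (in smooth_algebroid) sheaf_hom_equivariant:
  "sheaf_hom X U R L N \<phi> \<Longrightarrow> equivariant X U F (\<lambda>V. carrier (Mod L V)) (mres L) (\<lambda>V f m. f \<odot>[L,V] m)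
    (\<lambda>V. carrier (Mod N V)) (mres N) (\<lambda>V f m. f \<odot>[N,V] m) \<phi>"
  unfolding sheaf_hom_def equivariant_def by (simp add: Pi_iff)

section \<open>Linear and bilinear maps of line bundles; tensor products\<close>

context line_bundle
begin

abbreviation "leq N \<equiv> equivariant X U F (\<lambda>V. carrier (Mod L V)) (mres L) (\<lambda>V f m. f \<odot>[L,V] m)
    (\<lambda>V. carrier (Mod N V)) (mres N) (\<lambda>V f m. f \<odot>[N,V] m)"

text \<open>Additivity is automatic in rank one: near a point both arguments are multiples of one
  generator, so their sum is a sum of coefficients.\<close>

lemma equivariant_sheaf_hom:
  assumes N: "module_sheaf X U R N" and h: "leq N h"
  shows "sheaf_hom X U R L N h"
  unfolding sheaf_hom_def
proof (intro ballI conjI funcsetI)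
  interpret N: act_sheaf X U F "\<lambda>V. carrier (Mod N V)" "mres N" "\<lambda>V f m. f \<odot>[N,V] m"
    by (rule module_act[OF U N])
  note hD = equivariantD[OF h]
  fix V assume V: "V \<in> opens X U"
  interpret MV: module "R V" "Mod N V" by (rule module_sheafD(1)[OF N V])
  interpret LV: module "R V" "Mod L V" by (rule L_module[OF V])
  fix m assume m: "m \<in> Lc V"
  show "h V m \<in> carrier (Mod N V)" by (rule hD(1)[OF V m])
  show "h V (f \<odot>[L,V] m) = f \<odot>[N,V] h V m" if "f \<in> F V" for f by (rule hD(3)[OF V m that])
  show "h W (mres L V W m) = mres N V W (h V m)" if "W \<in> opens X V" for W by (rule hD(2)[OF V m that])
  fix m' assume m': "m' \<in> Lc V"
  have mm: "m \<oplus>[L,V] m' \<in> Lc V" using m m' by simp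
  show "h V (m \<oplus>[L,V] m') = h V m \<oplus>[N,V] h V m'"
  proof (rule sheaf_sep[OF N.sheaf V hD(1)[OF V mm]])
    show "h V m \<oplus>[N,V] h V m' \<in> carrier (Mod N V)" using hD(1)[OF V m] hD(1)[OF V m'] by simp
    fix x assume "x \<in> V"
    then obtain W q where W: "W \<in> opens X V" "x \<in> W" "sec.generator W q" using L_cover_in[OF V] by blast
    note WU = opens_trans[OF V W(1)]
    note WW = opens_self[OF oU[OF WU]]
    note q = sec.generatorD(1,2)[OF W(3)]
    interpret LW: module "R W" "Mod L W" by (rule L_module[OF WU])
    interpret NW: module "R W" "Mod N W" by (rule module_sheafD(1)[OF N WU])
    obtain k where k: "k \<in> F W" "mres L V W m = k \<odot>[L,W] q"
      using sec.generatorD(3)[OF W(3) WW sec.res_closed[OF V m W(1)]] sec.res_id[OF q] by auto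
    obtain l where l: "l \<in> F W" "mres L V W m' = l \<odot>[L,W] q"
      using sec.generatorD(3)[OF W(3) WW sec.res_closed[OF V m' W(1)]] sec.res_id[OF q] by auto
    have kl: "k \<oplus>\<^bsub>R W\<^esub> l \<in> F W" using k l by simp
    have hq: "h W q \<in> carrier (Mod N W)" by (rule hD(1)[OF q])
    have "mres L V W (m \<oplus>[L,V] m') = (k \<oplus>\<^bsub>R W\<^esub> l) \<odot>[L,W] q"
      using module_sheafD(3)[OF L_sheaf V W(1) m m'] k l q LW.smult_l_distr by simp
    then have "mres N V W (h V (m \<oplus>[L,V] m')) = (k \<oplus>\<^bsub>R W\<^esub> l) \<odot>[N,W] h W q"
      using hD(2)[OF V mm W(1)] hD(3)[OF q kl] by simp
    also have "\<dots> = k \<odot>[N,W] h W q \<oplus>[N,W] l \<odot>[N,W] h W q"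
      by (rule NW.smult_l_distr[OF k(1) l(1) hq])
    also have "\<dots> = mres N V W (h V m) \<oplus>[N,W] mres N V W (h V m')"
      using hD(2)[OF V m W(1)] hD(2)[OF V m' W(1)] hD(3)[OF q k(1)] hD(3)[OF q l(1)] k(2) l(2) by simp
    also have "\<dots> = mres N V W (h V m \<oplus>[N,V] h V m')"
      by (rule module_sheafD(3)[OF N V W(1) hD(1)[OF V m] hD(1)[OF V m'], symmetric])
    finally show "\<exists>W\<in>opens X V. x \<in> W \<and> mres N V W (h V (m \<oplus>[L,V] m')) = mres N V W (h V m \<oplus>[N,V] h V m')"
      using W by blast
  qed
qed

end

context B_line_bundle
begin

lemma nabla_bact_eq:
  assumes s: "(s, \<omega>) \<in> nab U L V" and W: "W \<in> opens X V" and b: "b \<in> Bc W"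
  shows "bact L W b (mres L V W s) = (\<lambda>x\<in>W. - \<omega> W [b] x) \<odot>[L,W] mres L V W s"
proof -
  note V = nablaD[OF s]
  note WU = opens_trans[OF V(1) W]
  note sW = sec.res_closed[OF V(1,3) W]
  note wF = F_minus[OF oU[OF WU] ClD(1)[OF oU[OF V(1)] V(4) W b]]
  show ?thesis
  proof (rule val_eqI[OF WU bactD(1)[OF WU b sW] sec.act_closed[OF WU wF sW]])
    fix x assume x: "x \<in> W"
    have "val W (bact L W b (mres L V W s)) x = - \<omega> W [b] x * val V s x"
      using s W b x unfolding nabla_iff[OF V(1)] by blast
    then show "val W (bact L W b (mres L V W s)) x = val W ((\<lambda>x\<in>W. - \<omega> W [b] x) \<odot>[L,W] mres L V W s) x"
      using val_smult'[OF WU sW wF x] val_res'[OF V(1,3) W x] x by simp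
  qed
qed

lemma nv_quot_F:
  assumes V: "V \<in> opens X U" "m \<in> Lc V" and W: "W \<in> opens X U" "s \<in> nv W" and Z: "Z \<in> opens X V" "Z \<in> opens X W"
  shows "(\<lambda>y\<in>Z. val V m y / val W s y) \<in> F Z"
proof -
  note ZU = opens_trans[OF V(1) Z(1)]
  have sL: "s \<in> Lc W" using W nv_iff by blast
  have "(\<lambda>y\<in>Z. val V m y / val W s y) = (\<lambda>y\<in>Z. val Z (mres L V Z m) y / val Z (mres L W Z s) y)"
    using val_res'[OF V Z(1)] val_res'[OF W(1) sL Z(2)] by (auto simp: restrict_def fun_eq_iff)
  then show ?thesis using nv_quotient(1)[OF ZU nv_res[OF W Z(2)] sec.res_closed[OF V Z(1)]] by simp
qed

end

context smooth_algebroid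
begin

lemma bilinear_mapD:
  assumes "bilinear_map X U R L M N \<beta>" and "V \<in> opens X U" "l \<in> carrier (Mod L V)" "m \<in> carrier (Mod M V)"
  shows "\<beta> V l m \<in> carrier (Mod N V)"
    and "W \<in> opens X V \<Longrightarrow> mres N V W (\<beta> V l m) = \<beta> W (mres L V W l) (mres M V W m)"
    and "l' \<in> carrier (Mod L V) \<Longrightarrow> \<beta> V (l \<oplus>[L,V] l') m = \<beta> V l m \<oplus>[N,V] \<beta> V l' m"
    and "m' \<in> carrier (Mod M V) \<Longrightarrow> \<beta> V l (m \<oplus>[M,V] m') = \<beta> V l m \<oplus>[N,V] \<beta> V l m'"
    and "f \<in> F V \<Longrightarrow> \<beta> V (f \<odot>[L,V] l) m = f \<odot>[N,V] \<beta> V l m"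
    and "f \<in> F V \<Longrightarrow> \<beta> V l (f \<odot>[M,V] m) = f \<odot>[N,V] \<beta> V l m"
  using assms(1)[unfolded bilinear_map_def, THEN bspec, OF assms(2), THEN bspec, OF assms(3), THEN bspec, OF assms(4)]
  by blast+

lemma bilinear_map_compose:
  assumes b: "bilinear_map X U R L' M' N \<beta>" and f: "sheaf_hom X U R L L' f" and g: "sheaf_hom X U R M M' g"
  shows "bilinear_map X U R L M N (\<lambda>V l m. \<beta> V (f V l) (g V m))"
  unfolding bilinear_map_def
proof (intro ballI conjI)
  fix V l m assume V: "V \<in> opens X U" and l: "l \<in> carrier (Mod L V)" and m: "m \<in> carrier (Mod M V)"
  note fE = equivariantD[OF sheaf_hom_equivariant[OF f] V] and gE = equivariantD[OF sheaf_hom_equivariant[OF g] V]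
  note fl = fE(1)[OF l] and gm = gE(1)[OF m]
  note bD = bilinear_mapD[OF b V fl gm]
  show "\<beta> V (f V l) (g V m) \<in> carrier (Mod N V)" by (rule bD(1))
  show "mres N V W (\<beta> V (f V l) (g V m)) = \<beta> W (f W (mres L V W l)) (g W (mres M V W m))" if "W \<in> opens X V" for W
    unfolding fE(2)[OF l that] gE(2)[OF m that] by (rule bD(2)[OF that])
  show "\<beta> V (f V (l \<oplus>[L,V] l')) (g V m) = \<beta> V (f V l) (g V m) \<oplus>[N,V] \<beta> V (f V l') (g V m)"
    if l': "l' \<in> carrier (Mod L V)" for l'
    using bD(3)[OF fE(1)[OF l']] f V l l' unfolding sheaf_hom_def by simp
  show "\<beta> V (f V l) (g V (m \<oplus>[M,V] m')) = \<beta> V (f V l) (g V m) \<oplus>[N,V] \<beta> V (f V l) (g V m')"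
    if m': "m' \<in> carrier (Mod M V)" for m'
    using bD(4)[OF gE(1)[OF m']] g V m m' unfolding sheaf_hom_def by simp
  show "\<beta> V (f V (k \<odot>[L,V] l)) (g V m) = k \<odot>[N,V] \<beta> V (f V l) (g V m)" if "k \<in> F V" for k
    unfolding fE(3)[OF l that] by (rule bD(5)[OF that])
  show "\<beta> V (f V l) (g V (k \<odot>[M,V] m)) = k \<odot>[N,V] \<beta> V (f V l) (g V m)" if "k \<in> F V" for k
    unfolding gE(3)[OF m that] by (rule bD(6)[OF that])
qed

lemma bilinear_map_hom:
  assumes b: "bilinear_map X U R L M N \<beta>" and f: "sheaf_hom X U R N N' f"
  shows "bilinear_map X U R L M N' (\<lambda>V l m. f V (\<beta> V l m))"
  unfolding bilinear_map_def
proof (intro ballI conjI)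
  fix V l m assume V: "V \<in> opens X U" and l: "l \<in> carrier (Mod L V)" and m: "m \<in> carrier (Mod M V)"
  note bD = bilinear_mapD[OF b V] and fE = equivariantD[OF sheaf_hom_equivariant[OF f] V]
  note add = f[unfolded sheaf_hom_def, THEN bspec, OF V, THEN conjunct2, THEN conjunct1, rule_format]
  note lm = bD(1)[OF l m]
  show "f V (\<beta> V l m) \<in> carrier (Mod N' V)" by (rule fE(1)[OF lm])
  show "mres N' V W (f V (\<beta> V l m)) = f W (\<beta> W (mres L V W l) (mres M V W m))" if W: "W \<in> opens X V" for W
    unfolding bD(2)[OF l m W, symmetric] fE(2)[OF lm W] ..
  show "f V (\<beta> V (l \<oplus>[L,V] l') m) = f V (\<beta> V l m) \<oplus>[N',V] f V (\<beta> V l' m)" if "l' \<in> carrier (Mod L V)" for l'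
    unfolding bD(3)[OF l m that] by (rule add[OF lm bD(1)[OF that m]])
  show "f V (\<beta> V l (m \<oplus>[M,V] m')) = f V (\<beta> V l m) \<oplus>[N',V] f V (\<beta> V l m')" if "m' \<in> carrier (Mod M V)" for m'
    unfolding bD(4)[OF l m that] by (rule add[OF lm bD(1)[OF l that]])
  show "f V (\<beta> V (k \<odot>[L,V] l) m) = k \<odot>[N',V] f V (\<beta> V l m)" if "k \<in> F V" for k
    unfolding bD(5)[OF l m that] by (rule fE(3)[OF lm that])
  show "f V (\<beta> V l (k \<odot>[M,V] m)) = k \<odot>[N',V] f V (\<beta> V l m)" if "k \<in> F V" for k
    unfolding bD(6)[OF l m that] by (rule fE(3)[OF lm that])
qed

lemma bilinear_map_swap:
  assumes b: "bilinear_map X U R L M N \<beta>" shows "bilinear_map X U R M L N (\<lambda>V m l. \<beta> V l m)"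
  unfolding bilinear_map_def by (intro ballI conjI; rule bilinear_mapD[OF b]; assumption)

lemma bilinear_map_restrict:
  assumes b: "bilinear_map X U R L M N \<beta>" and V: "V \<in> opens X U" shows "bilinear_map X V R L M N \<beta>"
  unfolding bilinear_map_def by (intro ballI conjI; rule bilinear_mapD[OF b opens_trans[OF V]]; assumption)

end

context B_line_bundle
begin

lemma nv_Lc: "V \<in> opens X U \<Longrightarrow> s \<in> nv V \<Longrightarrow> s \<in> Lc V"
  using nv_iff by blast

lemma local_multiple:
  assumes V: "V \<in> opens X U" and l: "l \<in> Lc V" and x: "x \<in> V"
  shows "\<exists>W s k. W \<in> opens X V \<and> x \<in> W \<and> s \<in> nv W \<and> k \<in> F W \<and> mres L V W l = k \<odot>[L,W] s"
proof -
  obtain W q where W: "W \<in> opens X V" "x \<in> W" "sec.generator W q" using L_cover_in[OF V x] by blast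
  note q = sec.generatorD(1,2)[OF W(3)]
  obtain k where "k \<in> F W" "mres L V W l = k \<odot>[L,W] q"
    using sec.generatorD(3)[OF W(3) opens_self[OF oU[OF q(1)]] sec.res_closed[OF V l W(1)]] sec.res_id[OF q] by auto
  then show ?thesis using W generator_nv by blast
qed

lemma multiple_res:
  assumes "W \<in> opens X U" "s \<in> nv W" "k \<in> F W" and V: "V \<in> opens X U" "l \<in> Lc V" "W \<in> opens X V"
    and "mres L V W l = k \<odot>[L,W] s" and Z: "Z \<in> opens X W"
  shows "mres L V Z l = restrict k Z \<odot>[L,Z] mres L W Z s"
  using sec.act_res[OF assms(1,3) nv_Lc[OF assms(1,2)] Z] sec.res_res[OF V Z] assms(7) by simp

end

context smooth_algebroid
begin

text \<open>Near each point every section is a multiple of a nowhere vanishing one. The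
  neighbourhood is shrunk once for each factor, and bilinearity pulls the two coefficients
  out.\<close>

lemma bilinear_agree:
  assumes L: "bline U L" and M: "bline U M" and N: "module_sheaf X U R N"
    and b: "bilinear_map X U R L M N \<beta>" and c: "bilinear_map X U R L M N \<gamma>"
    and eq: "\<And>V s t. V \<in> opens X U \<Longrightarrow> s \<in> nonvanishing X R L V \<Longrightarrow> t \<in> nonvanishing X R M V \<Longrightarrow> \<beta> V s t = \<gamma> V s t"
    and V: "V \<in> opens X U" and l: "l \<in> carrier (Mod L V)" and m: "m \<in> carrier (Mod M V)"
  shows "\<beta> V l m = \<gamma> V l m"
proof (rule sheaf_sep[OF module_sheaf_sheaf[OF N] V bilinear_mapD(1)[OF b V l m] bilinear_mapD(1)[OF c V l m]])
  interpret L: B_line_bundle X A P B U L by (rule L)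
  interpret M: B_line_bundle X A P B U M by (rule M)
  fix x assume x: "x \<in> V"
  obtain W s k where W: "W \<in> opens X V" "x \<in> W" "s \<in> L.nv W" "k \<in> F W" "mres L V W l = k \<odot>[L,W] s"
    using L.local_multiple[OF V l x] by blast
  note WU = opens_trans[OF V W(1)]
  obtain Z t j where Z: "Z \<in> opens X W" "x \<in> Z" "t \<in> M.nv Z" "j \<in> F Z" "mres M W Z (mres M V W m) = j \<odot>[M,Z] t"
    using M.local_multiple[OF WU M.sec.res_closed[OF V m W(1)] W(2)] by blast
  note ZU = opens_trans[OF WU Z(1)] and ZV = opens_trans[OF W(1) Z(1)]
  have l: "mres L V Z l = restrict k Z \<odot>[L,Z] mres L W Z s" by (rule L.multiple_res[OF WU W(3,4) V l W(1,5) Z(1)])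
  have m: "mres M V Z m = j \<odot>[M,Z] t" using Z(5) M.sec.res_res[OF V m W(1) Z(1)] by simp
  note s = L.nv_res[OF WU W(3) Z(1)]
  note sL = L.nv_Lc[OF ZU s] and tM = M.nv_Lc[OF ZU Z(3)]
  note k = F_restrict[OF W(4) Z(1)]
  have "h Z (mres L V Z l) (mres M V Z m) = restrict k Z \<odot>[N,Z] (j \<odot>[N,Z] h Z (mres L W Z s) t)"
    if h: "bilinear_map X U R L M N h" for h
    unfolding l m bilinear_mapD(5)[OF h ZU sL M.sec.act_closed[OF ZU Z(4) tM] k] bilinear_mapD(6)[OF h ZU sL tM Z(4)] ..
  from this[OF b] this[OF c] have "mres N V Z (\<beta> V l m) = mres N V Z (\<gamma> V l m)"
    using bilinear_mapD(2)[OF b V \<open>l \<in> L.Lc V\<close> \<open>m \<in> M.Lc V\<close> ZV] bilinear_mapD(2)[OF c V \<open>l \<in> L.Lc V\<close> \<open>m \<in> M.Lc V\<close> ZV]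
      eq[OF ZU s Z(3)] by simp
  then show "\<exists>W\<in>opens X V. x \<in> W \<and> mres N V W (\<beta> V l m) = mres N V W (\<gamma> V l m)" using ZV Z(2) by blast
qed

end

text \<open>The torsor sum formed with the value maps of the bundles is reused: \<open>tens\<close>
  makes sense for all sections, is biequivariant on the nowhere vanishing ones and bilinear on
  all.\<close>

locale tensor_pair = L: B_line_bundle X A P B U L + M: B_line_bundle X A P B U M
  for X :: "'x topology" and A P and B :: "('x, 'b) lie_algd" and U
    and L :: "('x, 'u, 'b) bmod" and M :: "('x, 'u, 'b) bmod" +
  fixes \<iota> :: "'x cfun \<Rightarrow> 'u"
  assumes inj_\<iota>: "inj \<iota>"
begin

sublocale torsor_sum X A P B U "F_Ob X A P B U L" "F_Ob X A P B U M" L.val M.val \<iota>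
  by unfold_locales (rule L.FT_val M.FT_val inj_\<iota>)+

lemma SDE': 
  assumes "(W, f, \<omega>) \<in> SD"
  obtains s a t b where "(s, a) \<in> nabla X A P B U L W" "(t, b) \<in> nabla X A P B U M W"
    "f = (\<lambda>x\<in>W. L.val W s x * M.val W t x)" "\<omega> = a \<otimes>[L.H,W] b"
  using SDE[OF assms] unfolding F_Ob_simps by blast

lemma quot_prod:
  assumes V: "V \<in> opens X U" and l: "l \<in> L.Lc V" and m: "m \<in> M.Lc V"
    and s: "(s, a) \<in> nabla X A P B U L W" and t: "(t, b) \<in> nabla X A P B U M W"
    and Z: "Z \<in> opens X V" "Z \<in> opens X W"
  shows "(\<lambda>y\<in>Z. (\<lambda>x\<in>V. L.val V l x * M.val V m x) y / (\<lambda>x\<in>W. L.val W s x * M.val W t x) y)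
    = (\<lambda>y\<in>Z. (\<lambda>y\<in>Z. L.val V l y / L.val W s y) y * (\<lambda>y\<in>Z. M.val V m y / M.val W t y) y)"
  using opens_subset[OF Z(1)] opens_subset[OF Z(2)] by (auto simp: restrict_def fun_eq_iff)

lemma tens_Nf:
  assumes V: "V \<in> opens X U" and l: "l \<in> L.Lc V" and m: "m \<in> M.Lc V"
  shows "(\<lambda>x\<in>V. L.val V l x * M.val V m x) \<in> Nf V"
proof (rule NfI[OF _ V])
  fix W f \<omega> Z assume "(W, f, \<omega>) \<in> SD" and Z: "Z \<in> opens X V" "Z \<in> opens X W"
  then obtain s a t b where st: "(s, a) \<in> nabla X A P B U L W" "(t, b) \<in> nabla X A P B U M W"
    "f = (\<lambda>x\<in>W. L.val W s x * M.val W t x)" by (elim SDE')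
  show "(\<lambda>y\<in>Z. (\<lambda>x\<in>V. L.val V l x * M.val V m x) y / f y) \<in> L.F Z"
    unfolding st(3) quot_prod[OF V l m st(1,2) Z]
    by (rule L.F_mult[OF opens_openin[OF Z(1)] L.nv_quot_F[OF V l L.nablaD(1,2)[OF st(1)] Z]
          M.nv_quot_F[OF V m M.nablaD(1,2)[OF st(2)] Z]])
qed simp

lemma tens_bilinear: "bilinear_map X U L.R L M LN tens"
  unfolding bilinear_map_def
proof (intro ballI conjI)
  fix V l m assume V: "V \<in> opens X U" and l: "l \<in> L.Lc V" and m: "m \<in> M.Lc V"
  show "tens V l m \<in> carrier (Mod LN V)" using tens_Nf[OF V l m] by (simp add: tens_def)
  show "mres LN V W (tens V l m) = tens W (mres L V W l) (mres M V W m)" if W: "W \<in> opens X V" for W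
    using opens_subset[OF W] L.val_res[OF V l W] M.val_res[OF V m W]
    by (auto simp: tens_def restrict_def fun_eq_iff intro!: arg_cong[of _ _ \<iota>])
  show "tens V (l \<oplus>[L,V] l') m = tens V l m \<oplus>[LN,V] tens V l' m" if l': "l' \<in> L.Lc V" for l'
    using L.val_plus[OF V l l'] by (auto simp: tens_def restrict_def fun_eq_iff algebra_simps intro!: arg_cong[of _ _ \<iota>])
  show "tens V l (m \<oplus>[M,V] m') = tens V l m \<oplus>[LN,V] tens V l m'" if m': "m' \<in> M.Lc V" for m'
    using M.val_plus[OF V m m'] by (auto simp: tens_def restrict_def fun_eq_iff algebra_simps intro!: arg_cong[of _ _ \<iota>])
  fix f assume f: "f \<in> L.F V"
  show "tens V (f \<odot>[L,V] l) m = f \<odot>[LN,V] tens V l m"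
    using L.val_smult'[OF V l f] by (auto simp: tens_def restrict_def fun_eq_iff algebra_simps intro!: arg_cong[of _ _ \<iota>])
  show "tens V l (f \<odot>[M,V] m) = f \<odot>[LN,V] tens V l m"
    using M.val_smult'[OF V m f] by (auto simp: tens_def restrict_def fun_eq_iff algebra_simps intro!: arg_cong[of _ _ \<iota>])
qed

text \<open>In frames with forms \<open>a\<close>, \<open>c\<close> and coefficients
  \<open>h\<close>, \<open>k\<close> the product has form a + c and coefficient h k, and b(h k) -
  (a(b) + c(b)) h k splits into the contributions of the two factors.\<close>

lemma tens_bact:
  assumes V: "V \<in> opens X U" and b: "b \<in> L.Bc V" and l: "l \<in> L.Lc V" and m: "m \<in> M.Lc V"
  shows "bact LN V b (tens V l m) = tens V (bact L V b l) m \<oplus>[LN,V] tens V l (bact M V b m)"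
proof -
  have "dact V b (\<lambda>x\<in>V. L.val V l x * M.val V m x)
    = (\<lambda>x\<in>V. L.val V (bact L V b l) x * M.val V m x + L.val V l x * M.val V (bact M V b m) x)"
  proof (rule dact_eqI[OF V])
    fix W f \<omega> Z x assume D: "(W, f, \<omega>) \<in> SD" and Z: "Z \<in> opens X V" "Z \<in> opens X W" and x: "x \<in> Z"
    then obtain s a t c where st: "(s, a) \<in> nabla X A P B U L W" "(t, c) \<in> nabla X A P B U M W"
      "f = (\<lambda>x\<in>W. L.val W s x * M.val W t x)" "\<omega> = a \<otimes>[L.H,W] c" by (elim SDE')
    note s = L.nablaD[OF st(1)] and t = M.nablaD[OF st(2)]
    have oZ: "openin X Z" using Z opens_openin by blast
    have xV: "x \<in> V" and xW: "x \<in> W" using x opens_subset[OF Z(1)] opens_subset[OF Z(2)] by auto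
    note bZ = L.B_res[OF L.oU[OF V] Z(1) b]
    define h where "h = (\<lambda>y\<in>Z. L.val V l y / L.val W s y)"
    define k where "k = (\<lambda>y\<in>Z. M.val V m y / M.val W t y)"
    have hF: "h \<in> L.F Z" unfolding h_def by (rule L.nv_quot_F[OF V l s(1,2) Z])
    have kF: "k \<in> L.F Z" unfolding k_def by (rule M.nv_quot_F[OF V m t(1,2) Z])
    have nz: "L.val W s y \<noteq> 0" "M.val W t y \<noteq> 0" if "y \<in> Z" for y
      using s(2) t(2) L.nv_iff[OF s(1)] M.nv_iff[OF t(1)] that opens_subset[OF Z(2)] by auto
    have lx: "L.val V l y = h y * L.val W s y" "M.val V m y = k y * M.val W t y" if "y \<in> Z" for y
      using nz[OF that] that by (auto simp: h_def k_def)
    have A: "L.val V (bact L V b l) x = (L.ac Z (mres B V Z b) h x - a Z [mres B V Z b] x * h x) * L.val W s x"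
      using L.val_bact_res[OF V b l Z(1) x] L.nabla_bact[OF st(1) Z(2) bZ L.sec.res_closed[OF V l Z(1)] hF _ x]
        L.val_res'[OF V l Z(1)] lx(1) by simp
    have Bq: "M.val V (bact M V b m) x = (L.ac Z (mres B V Z b) k x - c Z [mres B V Z b] x * k x) * M.val W t x"
      using M.val_bact_res[OF V b m Z(1) x] M.nabla_bact[OF st(2) Z(2) bZ M.sec.res_closed[OF V m Z(1)] kF _ x]
        M.val_res'[OF V m Z(1)] lx(2) by simp
    have q: "(\<lambda>y\<in>Z. (\<lambda>x\<in>V. L.val V l x * M.val V m x) y / f y) = (\<lambda>y\<in>Z. h y * k y)"
      unfolding st(3) quot_prod[OF V l m st(1,2) Z] h_def k_def ..
    have q': "(\<lambda>x\<in>V. L.val V l x * M.val V m x) x / f x = h x * k x" using fun_cong[OF q, of x] x by simp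
    have w: "\<omega> Z [mres B V Z b] x = a Z [mres B V Z b] x + c Z [mres B V Z b] x"
      unfolding st(4) L.Cl_mult(2)[OF L.oU[OF s(1)] s(4) t(4) Z(2) bZ] using x by simp
    show "dact V b (\<lambda>x\<in>V. L.val V l x * M.val V m x) x
      = (\<lambda>x\<in>V. L.val V (bact L V b l) x * M.val V m x + L.val V l x * M.val V (bact M V b m) x) x"
      unfolding dact_eq[OF V b tens_Nf[OF V l m] D Z x] q q' w L.ac_mult[OF oZ bZ hF kF x]
      using xV xW by (simp add: A Bq lx[OF x] st(3) algebra_simps)
  qed simp
  then show ?thesis by (auto simp: tens_def restrict_def fun_eq_iff intro!: arg_cong[of _ _ \<iota>])
qed

lemma tens_gen:
  assumes V: "V \<in> opens X U" and s: "s \<in> L.nv V" and t: "t \<in> M.nv V"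
  shows "LN.sec.generator V (tens V s t)"
  by (rule LN.nv_generator[OF V tens_nv[OF V]]) (use s t in \<open>simp_all add: F_Ob_simps\<close>)

text \<open>\<open>LN\<close> is generated near each point by \<open>tens\<close> of nowhere
  vanishing sections, where the map is forced; \<open>generator_extend\<close> produces it, and
  \<open>bilinear_agree\<close> extends the equation to all sections.\<close>

lemma tens_universal:
  assumes N: "module_sheaf X U L.R N" and \<gamma>: "bilinear_map X U L.R L M N \<gamma>"
  shows "\<exists>!\<phi>. \<phi> \<in> ext_family X U (\<lambda>V. carrier (Mod LN V)) \<and> sheaf_hom X U L.R LN N \<phi> \<and>
           (\<forall>V\<in>opens X U. \<forall>l\<in>carrier (Mod L V). \<forall>m\<in>carrier (Mod M V). \<phi> V (tens V l m) = \<gamma> V l m)"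
    (is "\<exists>!\<phi>. ?P \<phi>")
proof (rule ex_ex1I)
  interpret N: act_sheaf X U L.F "\<lambda>V. carrier (Mod N V)" "mres N" "\<lambda>V f m. f \<odot>[N,V] m"
    by (rule L.module_act[OF L.U N])
  note g = L.bilinear_mapD[OF \<gamma>] and bt = L.bilinear_mapD[OF tens_bilinear]
  have cover: "\<exists>W s t. W \<in> opens X U \<and> x \<in> W \<and> s \<in> L.nv W \<and> t \<in> M.nv W" if x: "x \<in> U" for x
  proof -
    obtain W s a t b where "W \<in> opens X U" "x \<in> W" "(s, a) \<in> nabla X A P B U L W" "(t, b) \<in> nabla X A P B U M W"
      using both_exist[OF opens_self[OF L.U] x] unfolding F_Ob_simps by meson
    then show ?thesis using L.nablaD(2) M.nablaD(2) by blast
  qed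
  define E where "E = {(W, tens W s t, \<gamma> W s t) | W s t. W \<in> opens X U \<and> s \<in> L.nv W \<and> t \<in> M.nv W}"
  have "\<exists>h\<in>ext_family X U (\<lambda>V. carrier (Mod LN V)). LN.leq N h \<and> (\<forall>(V, q, q')\<in>E. h V q = q')"
  proof (rule generator_extend[OF LN.sec.act_sheaf_axioms N.act_sheaf_axioms])
    show "LN.sec.generator V q \<and> q' \<in> carrier (Mod N V)" if "(V, q, q') \<in> E" for V q q'
      using that tens_gen g(1) L.nv_Lc M.nv_Lc by (auto simp: E_def)
    show "\<exists>V q q'. x \<in> V \<and> (V, q, q') \<in> E" if x: "x \<in> U" for x
      using cover[OF x] unfolding E_def by blast
    fix V q q' W p p' Z assume "(V, q, q') \<in> E" "(W, p, p') \<in> E" and Z: "Z \<in> opens X V" "Z \<in> opens X W"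
    then obtain s t s' t' where q: "V \<in> opens X U" "s \<in> L.nv V" "t \<in> M.nv V" "q = tens V s t" "q' = \<gamma> V s t"
      and p: "W \<in> opens X U" "s' \<in> L.nv W" "t' \<in> M.nv W" "p = tens W s' t'" "p' = \<gamma> W s' t'" by (auto simp: E_def)
    note ZU = opens_trans[OF q(1) Z(1)]
    have oZ: "openin X Z" using Z opens_openin by blast
    note sL = L.nv_Lc[OF q(1,2)] L.nv_Lc[OF p(1,2)] and tM = M.nv_Lc[OF q(1,3)] M.nv_Lc[OF p(1,3)]
    note sZ = L.sec.res_closed[OF q(1) sL(1) Z(1)] and tZ = M.sec.res_closed[OF q(1) tM(1) Z(1)]
    obtain k where k: "k \<in> L.F Z" "mres L W Z s' = k \<odot>[L,Z] mres L V Z s"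
      using L.sec.generatorD(3)[OF L.nv_generator[OF q(1,2)] Z(1) L.sec.res_closed[OF p(1) sL(2) Z(2)]] by blast
    obtain l where l: "l \<in> L.F Z" "mres M W Z t' = l \<odot>[M,Z] mres M V Z t"
      using M.sec.generatorD(3)[OF M.nv_generator[OF q(1,3)] Z(1) M.sec.res_closed[OF p(1) tM(2) Z(2)]] by blast
    note lt = M.sec.act_closed[OF ZU l(1) tZ]
    define j where "j = (\<lambda>x\<in>Z. k x * l x)"
    have jF: "j \<in> L.F Z" unfolding j_def by (rule L.F_mult[OF oZ k(1) l(1)])
    have "mres LN W Z p = j \<odot>[LN,Z] mres LN V Z q"
      unfolding p(4) q(4) bt(2)[OF p(1) sL(2) tM(2) Z(2)] bt(2)[OF q(1) sL(1) tM(1) Z(1)] k(2) l(2)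
        bt(5)[OF ZU sZ lt k(1)] bt(6)[OF ZU sZ tZ l(1)] j_def
      by (rule LN.sec.act_mult[symmetric, OF ZU k(1) l(1) bt(1)[OF ZU sZ tZ]])
    moreover have "mres N W Z p' = j \<odot>[N,Z] mres N V Z q'"
      unfolding p(5) q(5) g(2)[OF p(1) sL(2) tM(2) Z(2)] g(2)[OF q(1) sL(1) tM(1) Z(1)] k(2) l(2)
        g(5)[OF ZU sZ lt k(1)] g(6)[OF ZU sZ tZ l(1)] j_def
      by (rule N.act_mult[symmetric, OF ZU k(1) l(1) g(1)[OF ZU sZ tZ]])
    ultimately show "\<exists>k\<in>L.F Z. mres LN W Z p = k \<odot>[LN,Z] mres LN V Z q \<and> mres N W Z p' = k \<odot>[N,Z] mres N V Z q'"
      using jF by blast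
  qed
  then obtain h where h: "h \<in> ext_family X U (\<lambda>V. carrier (Mod LN V))" "LN.leq N h" "\<forall>(V, q, q')\<in>E. h V q = q'" by blast
  have hE: "h W (tens W s t) = \<gamma> W s t" if "W \<in> opens X U" "s \<in> L.nv W" "t \<in> M.nv W" for W s t
    using bspec[OF h(3), of "(W, tens W s t, \<gamma> W s t)"] that by (auto simp: E_def)
  have hom: "sheaf_hom X U L.R LN N h" by (rule LN.equivariant_sheaf_hom[OF N h(2)])
  have "h V (tens V l m) = \<gamma> V l m" if "V \<in> opens X U" "l \<in> L.Lc V" "m \<in> M.Lc V" for V l m
    by (rule L.bilinear_agree[OF L.B_line_bundle_axioms M.B_line_bundle_axioms N
          L.bilinear_map_hom[OF tens_bilinear hom] \<gamma> hE that])
  then show "\<exists>\<phi>. ?P \<phi>" using h(1) hom by blast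
  fix \<phi> \<psi> assume \<phi>: "?P \<phi>" and \<psi>: "?P \<psi>"
  have eqs: "LN.leq N \<phi>" "LN.leq N \<psi>" using \<phi> \<psi> L.sheaf_hom_equivariant by blast+
  show "\<phi> = \<psi>"
  proof (rule ext_family_eqI[OF conjunct1[OF \<phi>] conjunct1[OF \<psi>]])
    fix V s assume "V \<in> opens X U" "s \<in> carrier (Mod LN V)"
    then show "\<phi> V s = \<psi> V s"
    proof (rule generator_unique[OF LN.sec.act_sheaf_axioms N.act_sheaf_axioms eqs, rotated])
      fix x assume "x \<in> U"
      then obtain W s t where W: "W \<in> opens X U" "x \<in> W" "s \<in> L.nv W" "t \<in> M.nv W" using cover by blast
      have "\<phi> W (tens W s t) = \<psi> W (tens W s t)" using \<phi> \<psi> W(1) L.nv_Lc[OF W(1,3)] M.nv_Lc[OF W(1,4)] by metis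
      then show "\<exists>V q. x \<in> V \<and> LN.sec.generator V q \<and> \<phi> V q = \<psi> V q" using W(2) tens_gen[OF W(1,3,4)] by blast
    qed
  qed
qed

lemma tens_tensor: "PicB_tensor X A P B U L M LN tens"
  unfolding PicB_tensor_def using tens_bilinear tens_universal tens_bact by blast

end

text \<open>The tensor product in \<open>PicB\<close> is an arbitrary choice, so an arbitrary
  solution \<open>T\<close> of the universal problem is treated here, by comparing it with the
  concrete \<open>LN\<close>.\<close>

lemma (in tensor_pair) tensor_Tors_sum:
  assumes T: "T \<in> PicB_Ob X A P B U" and ten: "PicB_tensor X A P B U L M T \<beta>"
  shows "Tors_sum X L.G L.H L.d U (F_Ob X A P B U L) (F_Ob X A P B U M) (F_Ob X A P B U T) \<beta>"
proof -
  interpret T: B_line_bundle X A P B U T by (rule L.B_line_bundleI[OF L.U T])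
  \<comment> \<open>The universal property quantifies over plain \<open>mod_sheaf\<close> records,
    so the action is stripped from \<open>LN\<close>.\<close>
  define N where "N = \<lparr>Mod = Mod LN, mres = mres LN\<rparr>"
  have Ns: "Mod N = Mod LN" "mres N = mres LN" by (simp_all add: N_def)
  have bil: "bilinear_map X U L.R L M T \<beta>"
    and univ: "\<And>(N :: ('x, 'u) mod_sheaf) \<gamma>. module_sheaf X U L.R N \<Longrightarrow> bilinear_map X U L.R L M N \<gamma> \<Longrightarrow>
        \<exists>!\<phi>. \<phi> \<in> ext_family X U (\<lambda>V. carrier (Mod T V)) \<and> sheaf_hom X U L.R T N \<phi> \<and>
           (\<forall>V\<in>opens X U. \<forall>l\<in>carrier (Mod L V). \<forall>m\<in>carrier (Mod M V). \<phi> V (\<beta> V l m) = \<gamma> V l m)"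
    and Bl: "\<forall>V\<in>opens X U. \<forall>b\<in>carrier (Mod B V). \<forall>l\<in>carrier (Mod L V). \<forall>m\<in>carrier (Mod M V).
        bact T V b (\<beta> V l m) = \<beta> V (bact L V b l) m \<oplus>[T,V] \<beta> V l (bact M V b m)"
    using ten unfolding PicB_tensor_def by blast+
  note bt = L.bilinear_mapD[OF bil]
  have N1: "module_sheaf X U L.R N" using LN_module_sheaf unfolding module_sheaf_def Ns .
  have N2: "bilinear_map X U L.R L M N tens" using tens_bilinear unfolding bilinear_map_def Ns .
  obtain \<phi> where \<phi>: "sheaf_hom X U L.R T N \<phi>"
    "\<forall>V\<in>opens X U. \<forall>l\<in>carrier (Mod L V). \<forall>m\<in>carrier (Mod M V). \<phi> V (\<beta> V l m) = tens V l m"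
    using ex1_implies_ex[OF univ[OF N1 N2]] by blast
  have \<phi>E: "T.leq LN \<phi>" using L.sheaf_hom_equivariant[OF \<phi>(1)] unfolding Ns .
  note \<phi>D = equivariantD[OF \<phi>E]
  \<comment> \<open>If \<open>\<beta> V s t\<close> vanished at a point, so would its image under
    the linear map \<open>\<phi>\<close>, which is the nowhere vanishing section
    \<open>tens V s t\<close>.\<close>
  have nv: "\<beta> V s t \<in> T.nv V" if V: "V \<in> opens X U" and s: "s \<in> L.nv V" and t: "t \<in> M.nv V" for V s t
  proof -
    have sL: "s \<in> L.Lc V" "t \<in> M.Lc V" using s t L.nv_iff[OF V] M.nv_iff[OF V] by auto
    have tn: "tens V s t \<in> nonvanishing X L.R LN V" using tens_nv[OF V] s t by (simp add: F_Ob_simps)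
    note b = bt(1)[OF V sL]
    have "\<not> vanishes_at X L.R T V (\<beta> V s t) x" if x: "x \<in> V" for x
    proof
      assume "vanishes_at X L.R T V (\<beta> V s t) x"
      then obtain W f q where W: "W \<in> opens X V" "x \<in> W" "f \<in> L.F W" "q \<in> T.Lc W" "f x = 0"
        "mres T V W (\<beta> V s t) = f \<odot>[T,W] q" unfolding vanishes_at_def by blast
      note WU = opens_trans[OF V W(1)]
      have "\<phi> V (\<beta> V s t) = tens V s t" using \<phi>(2) V sL by blast
      then have "mres LN V W (tens V s t) = f \<odot>[LN,W] \<phi> W q"
        using \<phi>D(2)[OF V b W(1)] \<phi>D(3)[OF WU W(4,3)] W(6) by simp
      then have "vanishes_at X L.R LN V (tens V s t) x"
        unfolding vanishes_at_def using W \<phi>D(1)[OF WU W(4)] by blast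
      then show False using tn x unfolding nonvanishing_def by blast
    qed
    then show ?thesis unfolding nonvanishing_def using b by blast
  qed
  \<comment> \<open>Each factor contributes minus its form, and the product rule adds the
    two.\<close>
  have nab: "(\<beta> V s t, a \<otimes>[L.H,V] b) \<in> nabla X A P B U T V"
    if s: "(s, a) \<in> nabla X A P B U L V" and t: "(t, b) \<in> nabla X A P B U M V" for V s a t b
  proof -
    note s' = L.nablaD[OF s] and t' = M.nablaD[OF t]
    note V = s'(1)
    show ?thesis
    proof (rule T.nablaI[OF V nv[OF V s'(2) t'(2)] L.Cl_mult(1)[OF L.oU[OF V] s'(4) t'(4)]])
      fix W e assume W: "W \<in> opens X V" and e: "e \<in> L.Bc W"
      note WU = opens_trans[OF V W]
      note sW = L.sec.res_closed[OF V s'(3) W] and tW = M.sec.res_closed[OF V t'(3) W]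
      interpret TW: module "L.R W" "Mod T W" by (rule T.L_module[OF WU])
      have aF: "(\<lambda>x\<in>W. - a W [e] x) \<in> L.F W" "(\<lambda>x\<in>W. - b W [e] x) \<in> L.F W"
        using L.F_minus[OF L.oU[OF WU] L.ClD(1)[OF L.oU[OF V] s'(4) W e]]
          L.F_minus[OF L.oU[OF WU] L.ClD(1)[OF L.oU[OF V] t'(4) W e]] .
      have "bact T W e (\<beta> W (mres L V W s) (mres M V W t)) = (\<lambda>x\<in>W. - a W [e] x) \<odot>[T,W] \<beta> W (mres L V W s) (mres M V W t)
         \<oplus>[T,W] (\<lambda>x\<in>W. - b W [e] x) \<odot>[T,W] \<beta> W (mres L V W s) (mres M V W t)"
        unfolding Bl[THEN bspec, OF WU, THEN bspec, OF e, THEN bspec, OF sW, THEN bspec, OF tW]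
          L.nabla_bact_eq[OF s W e] M.nabla_bact_eq[OF t W e] bt(5)[OF WU sW tW aF(1)] bt(6)[OF WU sW tW aF(2)] ..
      also have "\<dots> = ((\<lambda>x\<in>W. - a W [e] x) \<oplus>\<^bsub>L.R W\<^esub> (\<lambda>x\<in>W. - b W [e] x)) \<odot>[T,W] \<beta> W (mres L V W s) (mres M V W t)"
        by (rule TW.smult_l_distr[OF aF bt(1)[OF WU sW tW], symmetric])
      also have "(\<lambda>x\<in>W. - a W [e] x) \<oplus>\<^bsub>L.R W\<^esub> (\<lambda>x\<in>W. - b W [e] x) = (\<lambda>x\<in>W. - (a \<otimes>[L.H,V] b) W [e] x)"
        unfolding OXP_simps L.Cl_mult(2)[OF L.oU[OF V] s'(4) t'(4) W e] by (auto simp: restrict_def fun_eq_iff)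
      finally show "bact T W e (mres T V W (\<beta> V s t)) = (\<lambda>x\<in>W. - (a \<otimes>[L.H,V] b) W [e] x) \<odot>[T,W] mres T V W (\<beta> V s t)"
        unfolding bt(2)[OF V s'(3) t'(3) W] .
    qed
  qed
  show ?thesis
    unfolding Tors_sum_def
  proof (intro conjI ballI)
    fix V s t assume V: "V \<in> opens X U" and "s \<in> tsec (F_Ob X A P B U L) V" "t \<in> tsec (F_Ob X A P B U M) V"
    then have s: "s \<in> L.nv V" and t: "t \<in> M.nv V" by (simp_all add: F_Ob_simps)
    have sL: "s \<in> L.Lc V" "t \<in> M.Lc V" using s t L.nv_iff[OF V] M.nv_iff[OF V] by auto
    show "\<beta> V s t \<in> tsec (F_Ob X A P B U T) V" using nv[OF V s t] by (simp add: F_Ob_simps)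
    show "tres (F_Ob X A P B U T) V W (\<beta> V s t) = \<beta> W (tres (F_Ob X A P B U L) V W s) (tres (F_Ob X A P B U M) V W t)"
      if "W \<in> opens X V" for W using bt(2)[OF V sL that] by (simp add: F_Ob_simps)
    fix g assume "g \<in> carrier (Grp L.G V)"
    then have g: "g \<in> L.F V" using L.G_simps(1)[OF L.oU[OF V]] L.UtsD(1) by blast
    show "\<beta> V (tact (F_Ob X A P B U L) V g s) t = tact (F_Ob X A P B U T) V g (\<beta> V s t)"
      "\<beta> V s (tact (F_Ob X A P B U M) V g t) = tact (F_Ob X A P B U T) V g (\<beta> V s t)"
      using bt(5,6)[OF V sL g] by (simp_all add: F_Ob_simps)
  next
    show "triv (F_Ob X A P B U T) = ind_class X L.G L.H L.d (F_Ob X A P B U T) U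
     (\<lambda>V. {(\<beta> V s t, a \<otimes>[L.H,V] b) | s t a b. (s, a) \<in> triv (F_Ob X A P B U L) V \<and> (t, b) \<in> triv (F_Ob X A P B U M) V})"
    proof (rule T.FT.ind_class_eq[symmetric])
      fix V p assume "p \<in> {(\<beta> V s t, a \<otimes>[L.H,V] b) | s t a b. (s, a) \<in> triv (F_Ob X A P B U L) V \<and> (t, b) \<in> triv (F_Ob X A P B U M) V}"
      then show "p \<in> triv (F_Ob X A P B U T) V" unfolding F_Ob_simps using nab by blast
    next
      fix V x assume "V \<in> opens X U" "x \<in> V"
      then obtain W s a t b where "W \<in> opens X V" "x \<in> W" "(s, a) \<in> triv (F_Ob X A P B U L) W" "(t, b) \<in> triv (F_Ob X A P B U M) W"
        using both_exist by meson
      then show "\<exists>W\<in>opens X V. x \<in> W \<and> (\<exists>p. p \<in> {(\<beta> W s t, a \<otimes>[L.H,W] b) | s t a b.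
          (s, a) \<in> triv (F_Ob X A P B U L) W \<and> (t, b) \<in> triv (F_Ob X A P B U M) W})" by blast
    qed
  qed
qed

section \<open>Morphisms of line bundles and of their torsors\<close>

context smooth_algebroid
begin

lemma F_Mor_apply: "V \<in> opens X U \<Longrightarrow> s \<in> nonvanishing X R L V \<Longrightarrow> F_Mor X A P U L M \<phi> V s = \<phi> V s"
  by (simp add: F_Mor_def)

lemma PicB_MorD:
  assumes "\<phi> \<in> PicB_Mor X A P B U L M"
  shows "\<phi> \<in> ext_family X U (\<lambda>V. carrier (Mod L V))" "sheaf_hom X U R L M \<phi>"
    "V \<in> opens X U \<Longrightarrow> bij_betw (\<phi> V) (carrier (Mod L V)) (carrier (Mod M V))"
    "V \<in> opens X U \<Longrightarrow> b \<in> Bc V \<Longrightarrow> m \<in> carrier (Mod L V) \<Longrightarrow> \<phi> V (bact L V b m) = bact M V b (\<phi> V m)"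
  using assms unfolding PicB_Mor_def by blast+

text \<open>A witness for the vanishing of the image pulls back along the bijection, so nowhere
  vanishing sections are preserved. The form is kept because linearity carries b.s = - \<omega>(b) s
  over.\<close>

lemma F_Mor_Tors:
  assumes L: "bline U L" and M: "bline U M" and \<phi>: "\<phi> \<in> PicB_Mor X A P B U L M"
  shows "F_Mor X A P U L M \<phi> \<in> TMor U (FO U L) (FO U M)"
proof -
  interpret L: B_line_bundle X A P B U L by (rule L)
  interpret M: B_line_bundle X A P B U M by (rule M)
  note p = PicB_MorD[OF \<phi>]
  note pE = equivariantD[OF sheaf_hom_equivariant[OF p(2)]]
  have nv: "\<phi> V s \<in> M.nv V" if V: "V \<in> opens X U" and s: "s \<in> L.nv V" for V s
  proof -
    have sL: "s \<in> L.Lc V" using s L.nv_iff[OF V] by blast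
    have "\<not> vanishes_at X R M V (\<phi> V s) x" if x: "x \<in> V" for x
    proof
      assume "vanishes_at X R M V (\<phi> V s) x"
      then obtain W f q where W: "W \<in> opens X V" "x \<in> W" "f \<in> F W" "q \<in> M.Lc W" "f x = 0"
        "mres M V W (\<phi> V s) = f \<odot>[M,W] q" unfolding vanishes_at_def by blast
      note WU = opens_trans[OF V W(1)]
      note sW = L.sec.res_closed[OF V sL W(1)]
      obtain q' where q': "q' \<in> L.Lc W" "q = \<phi> W q'" using p(3)[OF WU] W(4) by (auto simp: bij_betw_def)
      have "\<phi> W (mres L V W s) = \<phi> W (f \<odot>[L,W] q')"
        using pE(2)[OF V sL W(1)] pE(3)[OF WU q'(1) W(3)] W(6) q'(2) by simp
      then have "mres L V W s = f \<odot>[L,W] q'"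
        by (rule inj_onD[OF bij_betw_imp_inj_on[OF p(3)[OF WU]] _ sW L.sec.act_closed[OF WU W(3) q'(1)]])
      then have "vanishes_at X R L V s x" unfolding vanishes_at_def using W q'(1) by blast
      then show False using s x unfolding nonvanishing_def by blast
    qed
    then show ?thesis unfolding nonvanishing_def using pE(1)[OF V sL] by blast
  qed
  show ?thesis
  proof (rule Tors_MorI[OF L.FT.ttorsor_axioms M.FT.ttorsor_axioms])
    show "F_Mor X A P U L M \<phi> \<in> ext_family X U (tsec (FO U L))"
      by (simp add: F_Mor_def ext_family_def F_Ob_simps)
    show "teq U (FO U L) (FO U M) (F_Mor X A P U L M \<phi>)"
      unfolding equivariant_def F_Ob_simps
    proof (intro ballI conjI)
      fix V s assume V: "V \<in> opens X U" and s: "s \<in> L.nv V"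
      have sL: "s \<in> L.Lc V" using s L.nv_iff[OF V] by blast
      show "F_Mor X A P U L M \<phi> V s \<in> M.nv V" using nv[OF V s] F_Mor_apply[OF V s] by simp
      show "F_Mor X A P U L M \<phi> W (mres L V W s) = mres M V W (F_Mor X A P U L M \<phi> V s)" if W: "W \<in> opens X V" for W
        unfolding F_Mor_apply[OF opens_trans[OF V W] L.nv_res[OF V s W]] F_Mor_apply[OF V s] by (rule pE(2)[OF V sL W])
      show "F_Mor X A P U L M \<phi> V (g \<odot>[L,V] s) = g \<odot>[M,V] F_Mor X A P U L M \<phi> V s" if g: "g \<in> Uts V" for g
        unfolding F_Mor_apply[OF V L.nv_smult[OF V s g]] F_Mor_apply[OF V s] by (rule pE(3)[OF V sL UtsD(1)[OF g]])
    qed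
    fix x assume "x \<in> U"
    then obtain V s \<omega> where V: "x \<in> V" "(s, \<omega>) \<in> nab U L V"
      using L.FT.triv_exists unfolding F_Ob_simps by blast
    note n = L.nablaD[OF V(2)]
    have "(\<phi> V s, \<omega>) \<in> nab U M V"
    proof (rule M.nablaI[OF n(1) nv[OF n(1,2)] n(4)])
      fix W b assume W: "W \<in> opens X V" and b: "b \<in> Bc W"
      note WU = opens_trans[OF n(1) W]
      note sW = L.sec.res_closed[OF n(1,3) W]
      note wF = F_minus[OF L.oU[OF WU] ClD(1)[OF L.oU[OF n(1)] n(4) W b]]
      show "bact M W b (mres M V W (\<phi> V s)) = (\<lambda>x\<in>W. - \<omega> W [b] x) \<odot>[M,W] mres M V W (\<phi> V s)"
        unfolding pE(2)[OF n(1,3) W, symmetric] p(4)[OF WU b sW, symmetric] L.nabla_bact_eq[OF V(2) W b]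
        by (rule pE(3)[OF WU sW wF])
    qed
    then show "\<exists>V s \<omega>. x \<in> V \<and> (s, \<omega>) \<in> triv (FO U L) V \<and> (F_Mor X A P U L M \<phi> V s, \<omega>) \<in> triv (FO U M) V"
      unfolding F_Ob_simps using V F_Mor_apply[OF n(1,2)] by metis
  qed
qed

lemma PicB_Mor_unique:
  assumes L: "bline U L" and M: "bline U M"
    and \<phi>: "\<phi> \<in> PicB_Mor X A P B U L M" and \<psi>: "\<psi> \<in> PicB_Mor X A P B U L M"
    and cover: "\<And>x. x \<in> U \<Longrightarrow> \<exists>V s. x \<in> V \<and> V \<in> opens X U \<and> s \<in> nonvanishing X R L V \<and> \<phi> V s = \<psi> V s"
  shows "\<phi> = \<psi>"
proof -
  interpret L: B_line_bundle X A P B U L by (rule L)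
  interpret M: B_line_bundle X A P B U M by (rule M)
  note p = PicB_MorD[OF \<phi>] and q = PicB_MorD[OF \<psi>]
  show ?thesis
  proof (rule ext_family_eqI[OF p(1) q(1)])
    fix V m assume "V \<in> opens X U" "m \<in> L.Lc V"
    then show "\<phi> V m = \<psi> V m"
    proof (rule generator_unique[OF L.sec.act_sheaf_axioms M.sec.act_sheaf_axioms sheaf_hom_equivariant[OF p(2)]
          sheaf_hom_equivariant[OF q(2)], rotated])
      fix x assume "x \<in> U"
      then show "\<exists>V q. x \<in> V \<and> L.sec.generator V q \<and> \<phi> V q = \<psi> V q" using cover L.nv_generator by blast
    qed
  qed
qed

lemma Tors_hom_extend:
  assumes L: "bline U L" and M: "bline U M"
    and \<psi>: "\<psi> \<in> TMor U (FO U L) (FO U M)"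
  shows "\<exists>\<phi>\<in>ext_family X U (\<lambda>V. carrier (Mod L V)). sheaf_hom X U R L M \<phi> \<and>
     (\<forall>V\<in>opens X U. \<forall>s\<in>nonvanishing X R L V. \<phi> V s = \<psi> V s)"
proof -
  interpret L: B_line_bundle X A P B U L by (rule L)
  interpret M: B_line_bundle X A P B U M by (rule M)
  note e = equivariantD[OF Tors_MorD(2)[OF L.FT.ttorsor_axioms M.FT.ttorsor_axioms \<psi>], unfolded F_Ob_simps]
  define E where "E = {(V, s, \<psi> V s) | V s. V \<in> opens X U \<and> s \<in> L.nv V}"
  have nvM: "\<psi> V s \<in> M.Lc V" if "V \<in> opens X U" "s \<in> L.nv V" for V s using e(1)[OF that] M.nv_iff[OF that(1)] by blast
  have "\<exists>h\<in>ext_family X U (\<lambda>V. carrier (Mod L V)). L.leq M h \<and> (\<forall>(V, q, q')\<in>E. h V q = q')"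
  proof (rule generator_extend[OF L.sec.act_sheaf_axioms M.sec.act_sheaf_axioms])
    show "L.sec.generator V q \<and> q' \<in> M.Lc V" if "(V, q, q') \<in> E" for V q q'
      using that L.nv_generator nvM by (auto simp: E_def)
    show "\<exists>V q q'. x \<in> V \<and> (V, q, q') \<in> E" if "x \<in> U" for x
    proof -
      obtain V s where "x \<in> V" "L.sec.generator V s" using L.L_cover[OF \<open>x \<in> U\<close>] by blast
      then have "(V, s, \<psi> V s) \<in> E" using L.generator_nv L.sec.generatorD(1) unfolding E_def by blast
      then show ?thesis using \<open>x \<in> V\<close> by blast
    qed
    fix V q q' W p p' Z assume "(V, q, q') \<in> E" "(W, p, p') \<in> E" and Z: "Z \<in> opens X V" "Z \<in> opens X W"
    then have q: "V \<in> opens X U" "q \<in> L.nv V" "q' = \<psi> V q" and p: "W \<in> opens X U" "p \<in> L.nv W" "p' = \<psi> W p" by (auto simp: E_def)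
    note ZU = opens_trans[OF q(1) Z(1)]
    note qZ = L.nv_res[OF q(1,2) Z(1)] and pZ = L.nv_res[OF p(1,2) Z(2)]
    obtain k where k: "k \<in> Uts Z" "mres L W Z p = k \<odot>[L,Z] mres L V Z q"
      using L.FT.torsor_trans[OF ZU, unfolded F_Ob_simps, OF qZ pZ] by blast
    have "mres M W Z p' = k \<odot>[M,Z] mres M V Z q'"
      using e(2)[OF p(1,2) Z(2)] e(2)[OF q(1,2) Z(1)] e(3)[OF ZU qZ k(1)] k(2) p(3) q(3) by simp
    then show "\<exists>k\<in>F Z. mres L W Z p = k \<odot>[L,Z] mres L V Z q \<and> mres M W Z p' = k \<odot>[M,Z] mres M V Z q'"
      using k UtsD(1) by blast
  qed
  then obtain h where h: "h \<in> ext_family X U (\<lambda>V. carrier (Mod L V))" "L.leq M h" "\<forall>(V, q, q')\<in>E. h V q = q'" by blast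
  have "h V s = \<psi> V s" if "V \<in> opens X U" "s \<in> L.nv V" for V s
    using bspec[OF h(3), of "(V, s, \<psi> V s)"] that by (auto simp: E_def)
  then show ?thesis using h(1) L.equivariant_sheaf_hom[OF M.L_sheaf h(2)] by blast
qed

text \<open>Extending the inverse torsor morphism as well gives bijectivity. Compatibility with
  \<open>B\<close> follows because \<open>s\<close> and its image represent the trivializations with
  the same form, so both actions obey the same formula for coefficients.\<close>

lemma F_Mor_surj:
  assumes L: "bline U L" and M: "bline U M"
    and \<psi>: "\<psi> \<in> TMor U (FO U L) (FO U M)"
  shows "\<exists>\<phi>\<in>PicB_Mor X A P B U L M. \<forall>V\<in>opens X U. \<forall>s\<in>nonvanishing X R L V. \<phi> V s = \<psi> V s"
proof -
  interpret L: B_line_bundle X A P B U L by (rule L)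
  interpret M: B_line_bundle X A P B U M by (rule M)
  note tD = Tors_MorD[OF L.FT.ttorsor_axioms M.FT.ttorsor_axioms \<psi>]
  note e = equivariantD[OF tD(2), unfolded F_Ob_simps]
  obtain \<phi> where \<phi>: "\<phi> \<in> ext_family X U (\<lambda>V. carrier (Mod L V))" "sheaf_hom X U R L M \<phi>"
     "\<forall>V\<in>opens X U. \<forall>s\<in>L.nv V. \<phi> V s = \<psi> V s" using Tors_hom_extend[OF L M \<psi>] by blast
  obtain \<psi>' where \<psi>': "\<psi>' \<in> TMor U (FO U M) (FO U L)"
    "\<forall>V\<in>opens X U. \<forall>s\<in>L.nv V. \<psi>' V (\<psi> V s) = s" "\<forall>V\<in>opens X U. \<forall>t\<in>M.nv V. \<psi> V (\<psi>' V t) = t"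
    using Tors_inverse[OF L.FT.ttorsor_axioms M.FT.ttorsor_axioms \<psi>] unfolding F_Ob_simps by blast
  note e' = equivariantD[OF Tors_MorD(2)[OF M.FT.ttorsor_axioms L.FT.ttorsor_axioms \<psi>'(1)], unfolded F_Ob_simps]
  obtain \<phi>' where \<phi>': "sheaf_hom X U R M L \<phi>'" "\<forall>V\<in>opens X U. \<forall>s\<in>M.nv V. \<phi>' V s = \<psi>' V s"
    using Tors_hom_extend[OF M L \<psi>'(1)] by blast
  note p = equivariantD[OF sheaf_hom_equivariant[OF \<phi>(2)]] and p' = equivariantD[OF sheaf_hom_equivariant[OF \<phi>'(1)]]
  \<comment> \<open>The composite is equivariant and fixes frames, hence
    \<open>generator_unique\<close> makes it the identity.\<close>
  have pp: "\<phi>' V (\<phi> V m) = m" if V: "V \<in> opens X U" and m: "m \<in> L.Lc V" for V m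
  proof -
    have "L.leq L (\<lambda>V m. \<phi>' V (\<phi> V m))" "L.leq L (\<lambda>V m. m)"
      unfolding equivariant_def using p p' L.sec.res_closed L.sec.act_closed by simp_all
    from generator_unique[OF L.sec.act_sheaf_axioms L.sec.act_sheaf_axioms this _ V m]
    show ?thesis
    proof
      fix x assume "x \<in> U"
      then obtain W s where W: "x \<in> W" "L.sec.generator W s" using L.L_cover by blast
      note WU = L.sec.generatorD(1)[OF W(2)] and s = L.generator_nv[OF W(2)]
      have "\<phi>' W (\<phi> W s) = s" using \<phi>(3) \<phi>'(2) \<psi>'(2) WU s e(1)[OF WU s] by simp
      then show "\<exists>V q. x \<in> V \<and> L.sec.generator V q \<and> \<phi>' V (\<phi> V q) = q" using W by blast
    qed simp
  qed
  have pp': "\<phi> V (\<phi>' V m) = m" if V: "V \<in> opens X U" and m: "m \<in> M.Lc V" for V m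
  proof -
    have "M.leq M (\<lambda>V m. \<phi> V (\<phi>' V m))" "M.leq M (\<lambda>V m. m)"
      unfolding equivariant_def using p p' M.sec.res_closed M.sec.act_closed by simp_all
    from generator_unique[OF M.sec.act_sheaf_axioms M.sec.act_sheaf_axioms this _ V m]
    show ?thesis
    proof
      fix x assume "x \<in> U"
      then obtain W s where W: "x \<in> W" "M.sec.generator W s" using M.L_cover by blast
      note WU = M.sec.generatorD(1)[OF W(2)] and s = M.generator_nv[OF W(2)]
      have "\<phi> W (\<phi>' W s) = s" using \<phi>(3) \<phi>'(2) \<psi>'(3) WU s e'(1)[OF WU s] by simp
      then show "\<exists>V q. x \<in> V \<and> M.sec.generator V q \<and> \<phi> V (\<phi>' V q) = q" using W by blast
    qed simp
  qed
  have Bl: "\<phi> V (bact L V b m) = bact M V b (\<phi> V m)" if V: "V \<in> opens X U" and b: "b \<in> Bc V" and m: "m \<in> L.Lc V" for V b m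
  proof (rule M.val_eqI[OF V p(1)[OF V L.bactD(1)[OF V b m]] M.bactD(1)[OF V b p(1)[OF V m]]])
    fix x assume x: "x \<in> V"
    obtain W s \<omega> where W: "W \<in> opens X V" "x \<in> W" "(s, \<omega>) \<in> nab U L W"
      using L.FT.triv_exists_in[OF V x] unfolding F_Ob_simps by blast
    have n': "(\<psi> W s, \<omega>) \<in> nab U M W" using tD(3) W(3) unfolding F_Ob_simps by blast
    note n = L.nablaD[OF W(3)]
    note WW = opens_self[OF L.oU[OF n(1)]]
    note bW = B_res[OF L.oU[OF V] W(1) b] and mW = L.sec.res_closed[OF V m W(1)]
    have psi: "\<phi> W s = \<psi> W s" using \<phi>(3) n(1,2) by blast
    \<comment> \<open>\<open>k\<close> and, below, \<open>j\<close> are the coefficients of m and of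
      b.m in the frame \<open>s\<close>. The relation \<open>jx\<close> between them is also the one
      that governs the frame \<open>\<psi> W s\<close> of \<open>M\<close>.\<close>
    define k where "k = (\<lambda>y\<in>W. L.val V m y / L.val W s y)"
    have kF: "k \<in> F W" unfolding k_def by (rule L.nv_quot_F[OF V m n(1,2) W(1) WW])
    have nz: "L.val W s y \<noteq> 0" if "y \<in> W" for y using n(2) L.nv_iff[OF n(1)] that by blast
    have mk: "mres L V W m = k \<odot>[L,W] s"
      by (rule L.val_eqI[OF n(1) mW L.sec.act_closed[OF n(1) kF n(3)]])
         (use L.val_res'[OF V m W(1)] L.val_smult'[OF n(1,3) kF] nz in \<open>simp add: k_def\<close>)
    note bm = L.bactD(1)[OF V b m]
    define j where "j = (\<lambda>y\<in>W. L.val V (bact L V b m) y / L.val W s y)"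
    have jF: "j \<in> F W" unfolding j_def by (rule L.nv_quot_F[OF V bm n(1,2) W(1) WW])
    have bj: "mres L V W (bact L V b m) = j \<odot>[L,W] s"
      by (rule L.val_eqI[OF n(1) L.sec.res_closed[OF V bm W(1)] L.sec.act_closed[OF n(1) jF n(3)]])
         (use L.val_res'[OF V bm W(1)] L.val_smult'[OF n(1,3) jF] nz in \<open>simp add: j_def\<close>)
    have "L.val V (bact L V b m) x = (ac W (mres B V W b) k x - \<omega> W [mres B V W b] x * k x) * L.val W s x"
      using L.val_bact_res[OF V b m W(1,2)] L.nabla_bact[OF W(3) WW bW mW kF _ W(2)] L.val_smult'[OF n(1,3) kF] mk by simp
    then have jx: "j x = ac W (mres B V W b) k x - \<omega> W [mres B V W b] x * k x" using nz[OF W(2)] W(2) by (simp add: j_def)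
    have ps: "\<psi> W s \<in> M.Lc W" using M.nablaD(3)[OF n'] .
    have "M.val V (\<phi> V (bact L V b m)) x = M.val W (mres M V W (\<phi> V (bact L V b m))) x"
      by (rule M.val_res'[OF V p(1)[OF V bm] W(1,2), symmetric])
    also have "\<dots> = j x * M.val W (\<psi> W s) x"
      using p(2)[OF V bm W(1)] p(3)[OF n(1,3) jF] bj psi M.val_smult'[OF n(1) ps jF W(2)] by simp
    also have "\<dots> = M.val W (bact M W (mres B V W b) (mres M V W (\<phi> V m))) x"
    proof -
      have "mres M V W (\<phi> V m) = k \<odot>[M,W] \<psi> W s"
        using p(2)[OF V m W(1)] p(3)[OF n(1,3) kF] mk psi by simp
      then show ?thesis
        using M.nabla_bact[OF n' WW bW M.sec.act_closed[OF n(1) kF ps] kF M.val_smult'[OF n(1) ps kF] W(2)] jx by simp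
    qed
    also have "\<dots> = M.val V (bact M V b (\<phi> V m)) x" by (rule M.val_bact_res[OF V b p(1)[OF V m] W(1,2)])
    finally show "M.val V (\<phi> V (bact L V b m)) x = M.val V (bact M V b (\<phi> V m)) x" .
  qed
  have bij: "bij_betw (\<phi> V) (L.Lc V) (M.Lc V)" if V: "V \<in> opens X U" for V
    by (rule bij_betw_byWitness[of _ "\<phi>' V"]) (use pp[OF V] pp'[OF V] p(1)[OF V] p'(1)[OF V] in auto)
  have "\<phi> \<in> PicB_Mor X A P B U L M" unfolding PicB_Mor_def using \<phi>(1,2) bij Bl by blast
  then show ?thesis using \<phi>(3) by blast
qed

end

section \<open>Sums and their constraints\<close>

context smooth_algebroid
begin


text \<open>This is the restriction functor of \<open>Tors\<close>. The lifts are emptied outside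
  \<open>V\<close> because \<open>quot_sections\<close> over \<open>V\<close> requires it.\<close>

definition ro :: "'x set \<Rightarrow> ('x, 'x cfun, ('x, 'b) form, 'u) ttorsor \<Rightarrow> ('x, 'x cfun, ('x, 'b) form, 'u) ttorsor" where
  "ro V T = T\<lparr>triv := \<lambda>W. if W \<in> opens X V then triv T W else {}\<rparr>"

lemma ro_simps: "tsec (ro V T) = tsec T" "tres (ro V T) = tres T" "tact (ro V T) = tact T"
  "triv (ro V T) W = (if W \<in> opens X V then triv T W else {})"
  by (simp_all add: ro_def)

text \<open>\<open>nabla\<close> is empty outside its open set by definition, so restriction
  commutes with the functor on the nose, as \<open>stack_functor\<close> demands.\<close>

lemma F_Ob_restrict: "V \<in> opens X U \<Longrightarrow> ro V (FO U L) = FO V L"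
  using opens_trans[of V X U] by (auto simp: ro_def F_Ob_def nabla_def fun_eq_iff)

lemma ttorsor_restrict:
  assumes T: "ttors U T" and V: "V \<in> opens X U" shows "ttors V (ro V T)"
proof -
  interpret T: ttorsor X A P B U T by (rule T)
  note O = opens_trans[OF V]
  have oV: "openin X V" using V opens_openin by blast
  have "is_torsor X G V (ro V T)"
    unfolding is_torsor_def ro_simps
  proof (intro conjI)
    show "sheaf_on X V (tsec T) (tres T)" by (rule sheaf_on_restrict[OF T.sec.sheaf V])
    show "\<forall>x\<in>V. \<exists>W\<in>opens X V. x \<in> W \<and> tsec T W \<noteq> {}"
    proof
      fix x assume "x \<in> V"
      then obtain W t \<omega> where "W \<in> opens X V" "x \<in> W" "(t, \<omega>) \<in> triv T W" using T.triv_exists_in[OF V] by blast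
      then show "\<exists>W\<in>opens X V. x \<in> W \<and> tsec T W \<noteq> {}" using T.trivD(2) by blast
    qed
    have a: "\<forall>V\<in>opens X U. \<forall>t\<in>tsec T V. tact T V \<one>\<^bsub>Grp G V\<^esub> t = t \<and>
        (\<forall>g\<in>carrier (Grp G V). tact T V g t \<in> tsec T V \<and>
           (\<forall>h\<in>carrier (Grp G V). tact T V (g \<otimes>[G,V] h) t = tact T V g (tact T V h t)) \<and>
           (\<forall>W\<in>opens X V. tres T V W (tact T V g t) = tact T W (gres G V W g) (tres T V W t))) \<and>
        (\<forall>t'\<in>tsec T V. \<exists>!g. g \<in> carrier (Grp G V) \<and> tact T V g t = t')"
      using T.torsor unfolding is_torsor_def by (elim conjE)
    show "\<forall>V'\<in>opens X V. \<forall>t\<in>tsec T V'. tact T V' \<one>\<^bsub>Grp G V'\<^esub> t = t \<and>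
        (\<forall>g\<in>carrier (Grp G V'). tact T V' g t \<in> tsec T V' \<and>
           (\<forall>h\<in>carrier (Grp G V'). tact T V' (g \<otimes>[G,V'] h) t = tact T V' g (tact T V' h t)) \<and>
           (\<forall>W\<in>opens X V'. tres T V' W (tact T V' g t) = tact T W (gres G V' W g) (tres T V' W t))) \<and>
        (\<forall>t'\<in>tsec T V'. \<exists>!g. g \<in> carrier (Grp G V') \<and> tact T V' g t = t')"
      by (rule ballI) (rule bspec[OF a O])
  qed
  then interpret V: gtorsor X A P B V "ro V T" by unfold_locales (rule oV)
  have "triv (ro V T) \<in> quot_sections X (ind_sec H (ro V T)) (ind_res H (ro V T)) (ind_rel G H d (ro V T)) V"
  proof (rule V.quot_sections_ttorsorI)
    show "triv (ro V T) W = {}" if "W \<notin> opens X V" for W using that by (simp add: ro_simps)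
    show "t \<in> tsec (ro V T) W \<and> \<omega> \<in> Cl W" if "W \<in> opens X V" "(t, \<omega>) \<in> triv (ro V T) W" for W t \<omega>
      using that T.trivD by (simp add: ro_simps)
    show "(tres (ro V T) W Z t, restrict \<omega> (opens X Z)) \<in> triv (ro V T) Z"
      if "W \<in> opens X V" "Z \<in> opens X W" "(t, \<omega>) \<in> triv (ro V T) W" for W Z t \<omega>
      using that T.triv_res opens_trans[OF that(1,2)] by (simp add: ro_simps)
    show "((t, \<omega>), (t', \<omega>')) \<in> ind_rel G H d (ro V T) W"
      if W: "W \<in> opens X V" and t: "(t, \<omega>) \<in> triv (ro V T) W" "(t', \<omega>') \<in> triv (ro V T) W" for W t \<omega> t' \<omega>'
    proof -
      have t: "(t, \<omega>) \<in> triv T W" "(t', \<omega>') \<in> triv T W" using W t by (simp_all add: ro_simps)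
      show ?thesis unfolding V.ind_rel_iff[OF W] ro_simps using T.triv_rel[OF t] T.trivD[OF t(1)] T.trivD[OF t(2)] by blast
    qed
    show "\<exists>W\<in>opens X V. x \<in> W \<and> triv (ro V T) W \<noteq> {}" if x: "x \<in> V" for x
    proof -
      obtain W t \<omega> where "W \<in> opens X V" "x \<in> W" "(t, \<omega>) \<in> triv T W" using T.triv_exists_in[OF V x] by blast
      then show ?thesis by (intro bexI[of _ W]) (auto simp: ro_simps)
    qed
    show "(tact (ro V T) W g t, \<omega>) \<in> triv (ro V T) W"
      if "W \<in> opens X V" "g \<in> Uts W" "\<omega> \<in> Cl W" "(t, d W g \<otimes>[H,W] \<omega>) \<in> triv (ro V T) W" for W g t \<omega>
      using that T.triv_act by (simp add: ro_simps)
    show "(t, \<omega>) \<in> triv (ro V T) W"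
      if W: "W \<in> opens X V" and t: "t \<in> tsec (ro V T) W" and w: "\<omega> \<in> Cl W" and
       loc: "\<And>x. x \<in> W \<Longrightarrow> \<exists>Z\<in>opens X W. x \<in> Z \<and> (tres (ro V T) W Z t, restrict \<omega> (opens X Z)) \<in> triv (ro V T) Z"
      for W t \<omega>
    proof -
      have "(t, \<omega>) \<in> triv T W"
      proof (rule T.triv_local[OF O[OF W] _ w])
        show "t \<in> tsec T W" using t by (simp add: ro_simps)
        fix x assume "x \<in> W"
        then obtain Z where Z: "Z \<in> opens X W" "x \<in> Z" "(tres T W Z t, restrict \<omega> (opens X Z)) \<in> triv T Z"
          using loc by (fastforce simp: ro_simps split: if_splits)
        note z = T.trivD[OF Z(3)]
        show "\<exists>Z\<in>opens X W. x \<in> Z \<and> (\<exists>t' \<omega>'. (t', \<omega>') \<in> triv T Z \<and>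
            ((tres T W Z t, restrict \<omega> (opens X Z)), (t', \<omega>')) \<in> ind_rel G H d T Z)"
          using Z T.ind_rel_refl[OF z] by blast
      qed
      then show ?thesis using W by (simp add: ro_simps)
    qed
  qed
  then show ?thesis by unfold_locales
qed

lemma TMor_id: "ttors U T \<Longrightarrow> (\<lambda>V\<in>opens X U. \<lambda>s\<in>tsec T V. s) \<in> TMor U T T"
proof -
  assume T: "ttors U T"
  interpret T: ttorsor X A P B U T by (rule T)
  show ?thesis
  proof (rule Tors_MorI[OF T T])
    show "(\<lambda>V\<in>opens X U. \<lambda>s\<in>tsec T V. s) \<in> ext_family X U (tsec T)" by (simp add: ext_family_def)
    show "teq U T T (\<lambda>V\<in>opens X U. \<lambda>s\<in>tsec T V. s)"
      unfolding equivariant_def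
    proof (intro ballI conjI)
      fix V s assume V: "V \<in> opens X U" and s: "s \<in> tsec T V"
      show "(\<lambda>V\<in>opens X U. \<lambda>s\<in>tsec T V. s) V s \<in> tsec T V" using V s by simp
      show "(\<lambda>V\<in>opens X U. \<lambda>s\<in>tsec T V. s) W (tres T V W s) = tres T V W ((\<lambda>V\<in>opens X U. \<lambda>s\<in>tsec T V. s) V s)"
        if "W \<in> opens X V" for W
        using V s opens_trans[OF V that] T.sec.res_closed[OF V s that] by simp
      show "(\<lambda>V\<in>opens X U. \<lambda>s\<in>tsec T V. s) V (tact T V k s) = tact T V k ((\<lambda>V\<in>opens X U. \<lambda>s\<in>tsec T V. s) V s)"
        if "k \<in> Uts V" for k
        using V s T.sec.act_closed[OF V that s] by simp
    qed
    fix x assume "x \<in> U"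
    then obtain V t \<omega> where V: "x \<in> V" "(t, \<omega>) \<in> triv T V" using T.triv_exists by blast
    then show "\<exists>V s \<omega>. x \<in> V \<and> (s, \<omega>) \<in> triv T V \<and> ((\<lambda>V\<in>opens X U. \<lambda>s\<in>tsec T V. s) V s, \<omega>) \<in> triv T V"
      using T.trivD[OF V(2)] by (intro exI[of _ V] exI[of _ t] exI[of _ \<omega>]) simp
  qed
qed

lemma TMor_comp:
  assumes S: "ttors U S" and T: "ttors U T" and Q: "ttors U Q"
    and f: "f \<in> TMor U S T" and g: "g \<in> TMor U T Q"
  shows "(\<lambda>V\<in>opens X U. \<lambda>s\<in>tsec S V. g V (f V s)) \<in> TMor U S Q"
proof -
  interpret S: ttorsor X A P B U S by (rule S)
  note fD = Tors_MorD[OF S T f] and gD = Tors_MorD[OF T Q g]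
  note fE = equivariantD[OF fD(2)] and gE = equivariantD[OF gD(2)]
  let ?h = "\<lambda>V\<in>opens X U. \<lambda>s\<in>tsec S V. g V (f V s)"
  show ?thesis
  proof (rule Tors_MorI[OF S Q])
    show "?h \<in> ext_family X U (tsec S)" by (simp add: ext_family_def)
    show "teq U S Q ?h"
      unfolding equivariant_def
    proof (intro ballI conjI)
      fix V s assume V: "V \<in> opens X U" and s: "s \<in> tsec S V"
      show "?h V s \<in> tsec Q V" using gE(1)[OF V fE(1)[OF V s]] V s by simp
      show "?h W (tres S V W s) = tres Q V W (?h V s)" if W: "W \<in> opens X V" for W
        using fE(2)[OF V s W] gE(2)[OF V fE(1)[OF V s] W] V s opens_trans[OF V W] S.sec.res_closed[OF V s W] by simp
      show "?h V (tact S V k s) = tact Q V k (?h V s)" if k: "k \<in> Uts V" for k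
        using fE(3)[OF V s k] gE(3)[OF V fE(1)[OF V s] k] V s S.sec.act_closed[OF V k s] by simp
    qed
    fix x assume "x \<in> U"
    then obtain V t \<omega> where V: "x \<in> V" "(t, \<omega>) \<in> triv S V" using S.triv_exists by blast
    have "(?h V t, \<omega>) \<in> triv Q V" using gD(3)[OF fD(3)[OF V(2)]] S.trivD[OF V(2)] by simp
    then show "\<exists>V s \<omega>. x \<in> V \<and> (s, \<omega>) \<in> triv S V \<and> (?h V s, \<omega>) \<in> triv Q V" using V by blast
  qed
qed

lemma TMor_restrict:
  assumes S: "ttors U S" and T: "ttors U T" and h: "h \<in> TMor U S T" and V: "V \<in> opens X U"
  shows "restrict h (opens X V) \<in> TMor V (ro V S) (ro V T)"
proof -
  interpret S: ttorsor X A P B U S by (rule S)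
  note hD = Tors_MorD[OF S T h]
  note e = equivariantD[OF hD(2)]
  note O = opens_trans[OF V]
  show ?thesis
  proof (rule Tors_MorI[OF ttorsor_restrict[OF S V] ttorsor_restrict[OF T V]])
    show "restrict h (opens X V) \<in> ext_family X V (tsec (ro V S))"
      using ext_familyD(2)[OF hD(1) O] by (simp add: ext_family_def ro_simps)
    show "teq V (ro V S) (ro V T) (restrict h (opens X V))"
      unfolding equivariant_def ro_simps using e O opens_trans[of _ X V] by simp
    fix x assume "x \<in> V"
    then obtain W t \<omega> where W: "W \<in> opens X V" "x \<in> W" "(t, \<omega>) \<in> triv S W" using S.triv_exists_in[OF V] by blast
    then show "\<exists>W s \<omega>. x \<in> W \<and> (s, \<omega>) \<in> triv (ro V S) W \<and> (restrict h (opens X V) W s, \<omega>) \<in> triv (ro V T) W"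
      using hD(3)[OF W(3)] by (intro exI[of _ W] exI[of _ t] exI[of _ \<omega>]) (simp add: ro_simps)
  qed
qed

section \<open>Biequivariant maps and sums of two or three torsors\<close>

lemma Cl_comm: "a \<otimes>[H,V] b = b \<otimes>[H,V] a"
  by (simp add: H_simps add.commute)

lemma Cl_assoc:
  assumes V: "openin X V" and a: "a \<in> Cl V" and b: "b \<in> Cl V" and c: "c \<in> Cl V"
  shows "a \<otimes>[H,V] b \<otimes>[H,V] c = a \<otimes>[H,V] (b \<otimes>[H,V] c)"
proof (rule Cl_eqI[OF V])
  note ab = Cl_mult(1)[OF V a b] and bc = Cl_mult(1)[OF V b c]
  show "a \<otimes>[H,V] b \<otimes>[H,V] c \<in> Cl V" "a \<otimes>[H,V] (b \<otimes>[H,V] c) \<in> Cl V"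
    using Cl_mult(1)[OF V ab c] Cl_mult(1)[OF V a bc] .
  fix W e x assume W: "W \<in> opens X V" "e \<in> Bc W" "x \<in> W"
  show "(a \<otimes>[H,V] b \<otimes>[H,V] c) W [e] x = (a \<otimes>[H,V] (b \<otimes>[H,V] c)) W [e] x"
    unfolding Cl_mult(2)[OF V ab c W(1,2)] Cl_mult(2)[OF V a b W(1,2)] Cl_mult(2)[OF V a bc W(1,2)] Cl_mult(2)[OF V b c W(1,2)]
    using W(3) by simp
qed

text \<open>A weak form of \<open>Tors_sum\<close>, with the equation for \<open>triv Q\<close>
  replaced by what it says on representatives. It is stable under composition with morphisms,
  exchange of the factors and restriction, and by \<open>bieq_extend\<close> it still has the
  universal property.\<close>

definition bieq :: "'x set \<Rightarrow> ('x, 'x cfun, ('x, 'b) form, 'u) ttorsor \<Rightarrow> ('x, 'x cfun, ('x, 'b) form, 'u) ttorsor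
    \<Rightarrow> ('x, 'x cfun, ('x, 'b) form, 'u) ttorsor \<Rightarrow> ('x, 'u) sbimap \<Rightarrow> bool" where
  "bieq U S T Q \<beta> \<longleftrightarrow> (\<forall>V\<in>opens X U. \<forall>s\<in>tsec S V. \<forall>t\<in>tsec T V. \<beta> V s t \<in> tsec Q V \<and>
     (\<forall>W\<in>opens X V. tres Q V W (\<beta> V s t) = \<beta> W (tres S V W s) (tres T V W t)) \<and>
     (\<forall>g\<in>Uts V. \<beta> V (tact S V g s) t = tact Q V g (\<beta> V s t) \<and> \<beta> V s (tact T V g t) = tact Q V g (\<beta> V s t))) \<and>
   (\<forall>V s a t b. (s, a) \<in> triv S V \<longrightarrow> (t, b) \<in> triv T V \<longrightarrow> (\<beta> V s t, a \<otimes>[H,V] b) \<in> triv Q V)"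

lemma bieqD:
  assumes "bieq U S T Q \<beta>"
  shows "V \<in> opens X U \<Longrightarrow> s \<in> tsec S V \<Longrightarrow> t \<in> tsec T V \<Longrightarrow> \<beta> V s t \<in> tsec Q V"
    and "V \<in> opens X U \<Longrightarrow> s \<in> tsec S V \<Longrightarrow> t \<in> tsec T V \<Longrightarrow> W \<in> opens X V \<Longrightarrow>
      tres Q V W (\<beta> V s t) = \<beta> W (tres S V W s) (tres T V W t)"
    and "V \<in> opens X U \<Longrightarrow> s \<in> tsec S V \<Longrightarrow> t \<in> tsec T V \<Longrightarrow> g \<in> Uts V \<Longrightarrow> \<beta> V (tact S V g s) t = tact Q V g (\<beta> V s t)"
    and "V \<in> opens X U \<Longrightarrow> s \<in> tsec S V \<Longrightarrow> t \<in> tsec T V \<Longrightarrow> g \<in> Uts V \<Longrightarrow> \<beta> V s (tact T V g t) = tact Q V g (\<beta> V s t)"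
    and "(s, a) \<in> triv S V \<Longrightarrow> (t, b) \<in> triv T V \<Longrightarrow> (\<beta> V s t, a \<otimes>[H,V] b) \<in> triv Q V"
proof -
  note b1 = assms[unfolded bieq_def, THEN conjunct1, rule_format]
  show "(s, a) \<in> triv S V \<Longrightarrow> (t, b) \<in> triv T V \<Longrightarrow> (\<beta> V s t, a \<otimes>[H,V] b) \<in> triv Q V"
    using assms[unfolded bieq_def, THEN conjunct2] by blast
  assume V: "V \<in> opens X U" "s \<in> tsec S V" "t \<in> tsec T V"
  show "\<beta> V s t \<in> tsec Q V" "W \<in> opens X V \<Longrightarrow> tres Q V W (\<beta> V s t) = \<beta> W (tres S V W s) (tres T V W t)"
    "g \<in> Uts V \<Longrightarrow> \<beta> V (tact S V g s) t = tact Q V g (\<beta> V s t)" "g \<in> Uts V \<Longrightarrow> \<beta> V s (tact T V g t) = tact Q V g (\<beta> V s t)"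
    using b1[OF V] by blast+
qed

lemma Tors_sum_bieq:
  assumes Q: "ttors U Q" and S: "ttors U S" and T: "ttors U T"
    and sum: "Tors_sum X G H d U S T Q \<beta>"
  shows "bieq U S T Q \<beta>"
proof -
  interpret Q: ttorsor X A P B U Q by (rule Q)
  interpret S: ttorsor X A P B U S by (rule S)
  interpret T: ttorsor X A P B U T by (rule T)
  have 1: "\<forall>V\<in>opens X U. \<forall>s\<in>tsec S V. \<forall>t\<in>tsec T V. \<beta> V s t \<in> tsec Q V \<and>
        (\<forall>W\<in>opens X V. tres Q V W (\<beta> V s t) = \<beta> W (tres S V W s) (tres T V W t)) \<and>
        (\<forall>g\<in>carrier (Grp G V). \<beta> V (tact S V g s) t = tact Q V g (\<beta> V s t) \<and>
           \<beta> V s (tact T V g t) = tact Q V g (\<beta> V s t))"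
    and 2: "triv Q = ind_class X G H d Q U (\<lambda>V. {(\<beta> V s t, a \<otimes>[H,V] b) | s t a b.
        (s, a) \<in> triv S V \<and> (t, b) \<in> triv T V})" 
    using sum[unfolded Tors_sum_def, THEN conjunct1] sum[unfolded Tors_sum_def, THEN conjunct2] .
  have "(\<beta> V s t, a \<otimes>[H,V] b) \<in> triv Q V" if s: "(s, a) \<in> triv S V" and t: "(t, b) \<in> triv T V" for V s a t b
  proof (rule Q.ind_class_sub[OF 2[symmetric] S.trivD(1)[OF s]])
    show "(\<beta> V s t, a \<otimes>[H,V] b) \<in> {(\<beta> V s t, a \<otimes>[H,V] b) | s t a b. (s, a) \<in> triv S V \<and> (t, b) \<in> triv T V}"
      using s t by blast
    show "\<beta> V s t \<in> tsec Q V" using 1 S.trivD[OF s] T.trivD[OF t] by blast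
    show "a \<otimes>[H,V] b \<in> Cl V" by (rule Cl_mult(1)[OF S.oU[OF S.trivD(1)[OF s]] S.trivD(3)[OF s] T.trivD(3)[OF t]])
  qed
  then show ?thesis
    unfolding bieq_def using 1 G_simps(1)[OF S.oU] by simp
qed

lemma bieq_map:
  assumes S: "ttors U S" "ttors U S'" and T: "ttors U T" "ttors U T'"
    and b: "bieq U S' T' Q \<beta>" and f: "f \<in> TMor U S S'" and g: "g \<in> TMor U T T'"
  shows "bieq U S T Q (\<lambda>V s t. \<beta> V (f V s) (g V t))"
  unfolding bieq_def
proof (intro conjI ballI allI impI)
  note fD = Tors_MorD[OF S f] and gD = Tors_MorD[OF T g]
  note fE = equivariantD[OF fD(2)] and gE = equivariantD[OF gD(2)]
  show "(\<beta> V (f V s) (g V t), a \<otimes>[H,V] c) \<in> triv Q V" if "(s, a) \<in> triv S V" "(t, c) \<in> triv T V" for V s a t c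
    by (rule bieqD(5)[OF b fD(3)[OF that(1)] gD(3)[OF that(2)]])
  fix V s t assume V: "V \<in> opens X U" and s: "s \<in> tsec S V" and t: "t \<in> tsec T V"
  note fs = fE(1)[OF V s] and gt = gE(1)[OF V t]
  show "\<beta> V (f V s) (g V t) \<in> tsec Q V" by (rule bieqD(1)[OF b V fs gt])
  show "tres Q V W (\<beta> V (f V s) (g V t)) = \<beta> W (f W (tres S V W s)) (g W (tres T V W t))" if "W \<in> opens X V" for W
    unfolding bieqD(2)[OF b V fs gt that] fE(2)[OF V s that] gE(2)[OF V t that] ..
  show "\<beta> V (f V (tact S V k s)) (g V t) = tact Q V k (\<beta> V (f V s) (g V t))" if "k \<in> Uts V" for k
    unfolding fE(3)[OF V s that] by (rule bieqD(3)[OF b V fs gt that])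
  show "\<beta> V (f V s) (g V (tact T V k t)) = tact Q V k (\<beta> V (f V s) (g V t))" if "k \<in> Uts V" for k
    unfolding gE(3)[OF V t that] by (rule bieqD(4)[OF b V fs gt that])
qed

lemma bieq_swap:
  assumes b: "bieq U S T Q \<beta>" shows "bieq U T S Q (\<lambda>V t s. \<beta> V s t)"
  unfolding bieq_def
proof (intro conjI ballI allI impI)
  show "(\<beta> V s t, c \<otimes>[H,V] a) \<in> triv Q V" if "(t, c) \<in> triv T V" "(s, a) \<in> triv S V" for V s a t c
    unfolding Cl_comm[where a = c] by (rule bieqD(5)[OF b that(2,1)])
qed (rule bieqD[OF b], assumption+)+

lemma bieq_restrict:
  assumes b: "bieq U S T Q \<beta>" and V: "V \<in> opens X U" shows "bieq V (ro V S) (ro V T) (ro V Q) \<beta>"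
  unfolding bieq_def ro_simps using bieqD[OF b] opens_trans[OF V] by simp

text \<open>No separate universal property is needed: the values of \<open>\<beta>\<close> generate
  \<open>Q\<close>, and changing \<open>s\<close>, \<open>t\<close> by units \<open>g\<close>,
  \<open>h\<close> multiplies both \<open>\<beta>\<close> and \<open>\<gamma>\<close> by g
  h.\<close>

lemma bieq_extend:
  assumes S: "ttors U S" and T: "ttors U T" and Q: "ttors U Q" "ttors U Q'"
    and b: "bieq U S T Q \<beta>" and c: "bieq U S T Q' \<gamma>"
  shows "\<exists>h\<in>TMor U Q Q'. \<forall>V\<in>opens X U. \<forall>s\<in>tsec S V. \<forall>t\<in>tsec T V. h V (\<beta> V s t) = \<gamma> V s t"
proof -
  interpret S: ttorsor X A P B U S by (rule S)
  interpret T: ttorsor X A P B U T by (rule T)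
  interpret Q: ttorsor X A P B U Q by (rule Q(1))
  interpret Q': ttorsor X A P B U Q' by (rule Q(2))
  note bD = bieqD[OF b] and cD = bieqD[OF c]
  define D where "D = {(V, \<beta> V s t, \<gamma> V s t) | V s t. V \<in> opens X U \<and> s \<in> tsec S V \<and> t \<in> tsec T V}"
  have DI: "(V, \<beta> V s t, \<gamma> V s t) \<in> D" if "V \<in> opens X U" "s \<in> tsec S V" "t \<in> tsec T V" for V s t
    using that unfolding D_def by blast
  have "\<exists>h\<in>TMor U Q Q'. \<forall>(V, q, q')\<in>D. h V q = q'"
  proof (rule Tors_extend[OF Q])
    show "V \<in> opens X U \<and> q \<in> tsec Q V \<and> q' \<in> tsec Q' V" if "(V, q, q') \<in> D" for V q q'
      using that bD(1) cD(1) by (auto simp: D_def)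
    show "\<exists>V q q' \<omega>. x \<in> V \<and> (V, q, q') \<in> D \<and> (q, \<omega>) \<in> triv Q V \<and> (q', \<omega>) \<in> triv Q' V" if x: "x \<in> U" for x
    proof -
      obtain W s a where W: "W \<in> opens X U" "x \<in> W" "(s, a) \<in> triv S W" using S.triv_exists_in[OF opens_self[OF S.U] x] by blast
      obtain Z t e where Z: "Z \<in> opens X W" "x \<in> Z" "(t, e) \<in> triv T Z" using T.triv_exists_in[OF W(1,2)] by blast
      note s = S.triv_res[OF W(3) Z(1)]
      show ?thesis
        using DI[OF S.trivD(1,2)[OF s] T.trivD(2)[OF Z(3)]] bD(5)[OF s Z(3)] cD(5)[OF s Z(3)] Z(2) by blast
    qed
    fix V q q' W p p' Z assume "(V, q, q') \<in> D" "(W, p, p') \<in> D" and Z: "Z \<in> opens X V" "Z \<in> opens X W"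
    then obtain s t s' t' where q: "V \<in> opens X U" "s \<in> tsec S V" "t \<in> tsec T V" "q = \<beta> V s t" "q' = \<gamma> V s t"
      and p: "W \<in> opens X U" "s' \<in> tsec S W" "t' \<in> tsec T W" "p = \<beta> W s' t'" "p' = \<gamma> W s' t'" by (auto simp: D_def)
    note ZU = opens_trans[OF q(1) Z(1)]
    note sZ = S.sec.res_closed[OF q(1,2) Z(1)] and tZ = T.sec.res_closed[OF q(1,3) Z(1)]
    obtain g where g: "g \<in> Uts Z" "tres S W Z s' = tact S Z g (tres S V Z s)"
      using S.torsor_trans[OF ZU sZ S.sec.res_closed[OF p(1,2) Z(2)]] by blast
    obtain h where h: "h \<in> Uts Z" "tres T W Z t' = tact T Z h (tres T V Z t)"
      using T.torsor_trans[OF ZU tZ T.sec.res_closed[OF p(1,3) Z(2)]] by blast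
    note ht = T.sec.act_closed[OF ZU h(1) tZ]
    define k where "k = (\<lambda>x\<in>Z. g x * h x)"
    have "tres Q W Z p = tact Q Z k (tres Q V Z q)"
      unfolding p(4) q(4) bD(2)[OF p(1-3) Z(2)] bD(2)[OF q(1-3) Z(1)] g(2) h(2) bD(3)[OF ZU sZ ht g(1)] bD(4)[OF ZU sZ tZ h(1)] k_def
      by (rule Q.sec.act_mult[symmetric, OF ZU g(1) h(1) bD(1)[OF ZU sZ tZ]])
    moreover have "tres Q' W Z p' = tact Q' Z k (tres Q' V Z q')"
      unfolding p(5) q(5) cD(2)[OF p(1-3) Z(2)] cD(2)[OF q(1-3) Z(1)] g(2) h(2) cD(3)[OF ZU sZ ht g(1)] cD(4)[OF ZU sZ tZ h(1)] k_def
      by (rule Q'.sec.act_mult[symmetric, OF ZU g(1) h(1) cD(1)[OF ZU sZ tZ]])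
    moreover have "k \<in> Uts Z" unfolding k_def by (rule Uts_mult[OF S.oU[OF ZU] g(1) h(1)])
    ultimately show "\<exists>k\<in>Uts Z. tres Q W Z p = tact Q Z k (tres Q V Z q) \<and> tres Q' W Z p' = tact Q' Z k (tres Q' V Z q')" by blast
  qed
  then obtain h where h: "h \<in> TMor U Q Q'" "\<forall>(V, q, q')\<in>D. h V q = q'" by blast
  have "h V (\<beta> V s t) = \<gamma> V s t" if "V \<in> opens X U" "s \<in> tsec S V" "t \<in> tsec T V" for V s t
    using bspec[OF h(2) DI[OF that]] by simp
  then show ?thesis using h(1) by blast
qed

lemma bieq_unique:
  assumes S: "ttors U S" and T: "ttors U T" and Q: "ttors U Q" "ttors U Q'"
    and b: "bieq U S T Q \<beta>" and h: "h \<in> TMor U Q Q'" "h' \<in> TMor U Q Q'"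
    and eq: "\<And>V s t. V \<in> opens X U \<Longrightarrow> s \<in> tsec S V \<Longrightarrow> t \<in> tsec T V \<Longrightarrow> h V (\<beta> V s t) = h' V (\<beta> V s t)"
  shows "h = h'"
proof (rule Tors_Mor_unique[OF Q h])
  interpret S: ttorsor X A P B U S by (rule S)
  interpret T: ttorsor X A P B U T by (rule T)
  fix x assume x: "x \<in> U"
  obtain W s a where W: "W \<in> opens X U" "x \<in> W" "(s, a) \<in> triv S W" using S.triv_exists_in[OF opens_self[OF S.U] x] by blast
  obtain Z t e where Z: "Z \<in> opens X W" "x \<in> Z" "(t, e) \<in> triv T Z" using T.triv_exists_in[OF W(1,2)] by blast
  note s = S.trivD[OF S.triv_res[OF W(3) Z(1)]]
  show "\<exists>V q. x \<in> V \<and> V \<in> opens X U \<and> q \<in> tsec Q V \<and> h V q = h' V q"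
    using eq[OF s(1,2) T.trivD(2)[OF Z(3)]] bieqD(1)[OF b s(1,2) T.trivD(2)[OF Z(3)]] s(1) Z(2) by blast
qed

lemma bieq3_cover:
  assumes S: "ttors U S" and T: "ttors U T" and E: "ttors U E" and x: "x \<in> U"
  shows "\<exists>V s a t b u c. x \<in> V \<and> (s, a) \<in> triv S V \<and> (t, b) \<in> triv T V \<and> (u, c) \<in> triv E V"
proof -
  interpret S: ttorsor X A P B U S by (rule S)
  interpret T: ttorsor X A P B U T by (rule T)
  interpret E: ttorsor X A P B U E by (rule E)
  obtain W s a where W: "W \<in> opens X U" "x \<in> W" "(s, a) \<in> triv S W" using S.triv_exists_in[OF opens_self[OF S.U] x] by blast
  obtain Z t e where Z: "Z \<in> opens X W" "x \<in> Z" "(t, e) \<in> triv T Z" using T.triv_exists_in[OF W(1,2)] by blast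
  obtain Y u c where Y: "Y \<in> opens X Z" "x \<in> Y" "(u, c) \<in> triv E Y" using E.triv_exists_in[OF opens_trans[OF W(1) Z(1)] Z(2)] by blast
  show ?thesis using S.triv_res[OF W(3) opens_trans[OF Z(1) Y(1)]] T.triv_res[OF Z(3) Y(1)] Y by blast
qed

text \<open>Both bracketings change by the product of the three transition units, and their
  trivializations match by associativity of the addition of forms.\<close>

lemma bieq3_extend:
  assumes S: "ttors U S" and T: "ttors U T" and E: "ttors U E"
    and Q: "ttors U Q1" "ttors U Q" "ttors U Q2" "ttors U Q'"
    and b1: "bieq U S T Q1 \<beta>1" and b: "bieq U Q1 E Q \<beta>" and c1: "bieq U T E Q2 \<gamma>1" and c: "bieq U S Q2 Q' \<gamma>"
  shows "\<exists>h\<in>TMor U Q Q'. \<forall>V\<in>opens X U. \<forall>s\<in>tsec S V. \<forall>t\<in>tsec T V. \<forall>u\<in>tsec E V.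
    h V (\<beta> V (\<beta>1 V s t) u) = \<gamma> V s (\<gamma>1 V t u)"
proof -
  interpret S: ttorsor X A P B U S by (rule S)
  interpret T: ttorsor X A P B U T by (rule T)
  interpret E: ttorsor X A P B U E by (rule E)
  interpret Q1: ttorsor X A P B U Q1 by (rule Q(1))
  interpret Q: ttorsor X A P B U Q by (rule Q(2))
  interpret Q2: ttorsor X A P B U Q2 by (rule Q(3))
  interpret Q': ttorsor X A P B U Q' by (rule Q(4))
  note b1D = bieqD[OF b1] and bD = bieqD[OF b] and c1D = bieqD[OF c1] and cD = bieqD[OF c]
  define D where "D = {(V, \<beta> V (\<beta>1 V s t) u, \<gamma> V s (\<gamma>1 V t u)) | V s t u.
     V \<in> opens X U \<and> s \<in> tsec S V \<and> t \<in> tsec T V \<and> u \<in> tsec E V}"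
  have DI: "(V, \<beta> V (\<beta>1 V s t) u, \<gamma> V s (\<gamma>1 V t u)) \<in> D"
    if "V \<in> opens X U" "s \<in> tsec S V" "t \<in> tsec T V" "u \<in> tsec E V" for V s t u
    using that unfolding D_def by blast
  have "\<exists>h\<in>TMor U Q Q'. \<forall>(V, q, q')\<in>D. h V q = q'"
  proof (rule Tors_extend[OF Q(2,4)])
    show "V \<in> opens X U \<and> q \<in> tsec Q V \<and> q' \<in> tsec Q' V" if "(V, q, q') \<in> D" for V q q'
      using that bD(1) cD(1) b1D(1) c1D(1) by (auto simp: D_def)
    show "\<exists>V q q' \<omega>. x \<in> V \<and> (V, q, q') \<in> D \<and> (q, \<omega>) \<in> triv Q V \<and> (q', \<omega>) \<in> triv Q' V" if x: "x \<in> U" for x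
    proof -
      obtain V s a t e u w where V: "x \<in> V" "(s, a) \<in> triv S V" "(t, e) \<in> triv T V" "(u, w) \<in> triv E V"
        using bieq3_cover[OF S T E x] by blast
      have "(\<beta> V (\<beta>1 V s t) u, a \<otimes>[H,V] e \<otimes>[H,V] w) \<in> triv Q V" by (rule bD(5)[OF b1D(5)[OF V(2,3)] V(4)])
      moreover have "(\<gamma> V s (\<gamma>1 V t u), a \<otimes>[H,V] (e \<otimes>[H,V] w)) \<in> triv Q' V" by (rule cD(5)[OF V(2) c1D(5)[OF V(3,4)]])
      ultimately show ?thesis
        using DI[OF S.trivD(1,2)[OF V(2)] T.trivD(2)[OF V(3)] E.trivD(2)[OF V(4)]] V(1)
          Cl_assoc[OF S.oU[OF S.trivD(1)[OF V(2)]] S.trivD(3)[OF V(2)] T.trivD(3)[OF V(3)] E.trivD(3)[OF V(4)]] by metis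
    qed
    fix V q q' W p p' Z assume "(V, q, q') \<in> D" "(W, p, p') \<in> D" and Z: "Z \<in> opens X V" "Z \<in> opens X W"
    then obtain s t u s' t' u' where
          q: "V \<in> opens X U" "s \<in> tsec S V" "t \<in> tsec T V" "u \<in> tsec E V" "q = \<beta> V (\<beta>1 V s t) u" "q' = \<gamma> V s (\<gamma>1 V t u)"
      and p: "W \<in> opens X U" "s' \<in> tsec S W" "t' \<in> tsec T W" "u' \<in> tsec E W" "p = \<beta> W (\<beta>1 W s' t') u'" "p' = \<gamma> W s' (\<gamma>1 W t' u')"
      unfolding D_def by blast
    note ZU = opens_trans[OF q(1) Z(1)]
    note sZ = S.sec.res_closed[OF q(1,2) Z(1)] and tZ = T.sec.res_closed[OF q(1,3) Z(1)] and uZ = E.sec.res_closed[OF q(1,4) Z(1)]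
    obtain g where g: "g \<in> Uts Z" "tres S W Z s' = tact S Z g (tres S V Z s)"
      using S.torsor_trans[OF ZU sZ S.sec.res_closed[OF p(1,2) Z(2)]] by blast
    obtain h where h: "h \<in> Uts Z" "tres T W Z t' = tact T Z h (tres T V Z t)"
      using T.torsor_trans[OF ZU tZ T.sec.res_closed[OF p(1,3) Z(2)]] by blast
    obtain k where k: "k \<in> Uts Z" "tres E W Z u' = tact E Z k (tres E V Z u)"
      using E.torsor_trans[OF ZU uZ E.sec.res_closed[OF p(1,4) Z(2)]] by blast
    note ht = T.sec.act_closed[OF ZU h(1) tZ] and ku = E.sec.act_closed[OF ZU k(1) uZ]
    note st = b1D(1)[OF ZU sZ tZ] and tu = c1D(1)[OF ZU tZ uZ]
    note hst = Q1.sec.act_closed[OF ZU h(1) st] and ktu = Q2.sec.act_closed[OF ZU k(1) tu]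
    note stu = bD(1)[OF ZU st uZ] and stu' = cD(1)[OF ZU sZ tu]
    define j where "j = (\<lambda>x\<in>Z. g x * (\<lambda>x\<in>Z. h x * k x) x)"
    note hk = Uts_mult[OF S.oU[OF ZU] h(1) k(1)]
    have jU: "j \<in> Uts Z" unfolding j_def by (rule Uts_mult[OF S.oU[OF ZU] g(1) hk])
    have "tres Q W Z p = tact Q Z g (tact Q Z h (tact Q Z k (\<beta> Z (\<beta>1 Z (tres S V Z s) (tres T V Z t)) (tres E V Z u))))"
      unfolding p(5) bD(2)[OF p(1) b1D(1)[OF p(1-3)] p(4) Z(2)] b1D(2)[OF p(1-3) Z(2)] g(2) h(2) k(2)
        b1D(3)[OF ZU sZ ht g(1)] b1D(4)[OF ZU sZ tZ h(1)] bD(3)[OF ZU hst ku g(1)] bD(3)[OF ZU st ku h(1)] bD(4)[OF ZU st uZ k(1)] ..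
    also have "\<dots> = tact Q Z j (tres Q V Z q)"
      unfolding q(5) bD(2)[OF q(1) b1D(1)[OF q(1-3)] q(4) Z(1)] b1D(2)[OF q(1-3) Z(1)] j_def
        Q.sec.act_mult[OF ZU g(1) hk stu] Q.sec.act_mult[OF ZU h(1) k(1) stu] ..
    finally have 1: "tres Q W Z p = tact Q Z j (tres Q V Z q)" .
    have "tres Q' W Z p' = tact Q' Z g (tact Q' Z h (tact Q' Z k (\<gamma> Z (tres S V Z s) (\<gamma>1 Z (tres T V Z t) (tres E V Z u)))))"
      unfolding p(6) cD(2)[OF p(1,2) c1D(1)[OF p(1,3,4)] Z(2)] c1D(2)[OF p(1,3,4) Z(2)] g(2) h(2) k(2)
        c1D(3)[OF ZU tZ ku h(1)] c1D(4)[OF ZU tZ uZ k(1)]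
        cD(3)[OF ZU sZ Q2.sec.act_closed[OF ZU h(1) ktu] g(1)] cD(4)[OF ZU sZ ktu h(1)] cD(4)[OF ZU sZ tu k(1)] ..
    also have "\<dots> = tact Q' Z j (tres Q' V Z q')"
      unfolding q(6) cD(2)[OF q(1,2) c1D(1)[OF q(1,3,4)] Z(1)] c1D(2)[OF q(1,3,4) Z(1)] j_def
        Q'.sec.act_mult[OF ZU g(1) hk stu'] Q'.sec.act_mult[OF ZU h(1) k(1) stu'] ..
    finally show "\<exists>k\<in>Uts Z. tres Q W Z p = tact Q Z k (tres Q V Z q) \<and> tres Q' W Z p' = tact Q' Z k (tres Q' V Z q')"
      using 1 jU by blast
  qed
  then obtain h where h: "h \<in> TMor U Q Q'" "\<forall>(V, q, q')\<in>D. h V q = q'" by blast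
  have "h V (\<beta> V (\<beta>1 V s t) u) = \<gamma> V s (\<gamma>1 V t u)"
    if "V \<in> opens X U" "s \<in> tsec S V" "t \<in> tsec T V" "u \<in> tsec E V" for V s t u
    using bspec[OF h(2) DI[OF that]] by simp
  then show ?thesis using h(1) by blast
qed

lemma bieq3_unique:
  assumes S: "ttors U S" and T: "ttors U T" and E: "ttors U E"
    and Q: "ttors U Q" "ttors U Q'"
    and b1: "bieq U S T Q1 \<beta>1" and b: "bieq U Q1 E Q \<beta>" and h: "h \<in> TMor U Q Q'" "h' \<in> TMor U Q Q'"
    and eq: "\<And>V s t u. V \<in> opens X U \<Longrightarrow> s \<in> tsec S V \<Longrightarrow> t \<in> tsec T V \<Longrightarrow> u \<in> tsec E V \<Longrightarrow>
      h V (\<beta> V (\<beta>1 V s t) u) = h' V (\<beta> V (\<beta>1 V s t) u)"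
  shows "h = h'"
proof (rule Tors_Mor_unique[OF Q h])
  interpret S: ttorsor X A P B U S by (rule S)
  interpret T: ttorsor X A P B U T by (rule T)
  interpret E: ttorsor X A P B U E by (rule E)
  fix x assume x: "x \<in> U"
  obtain V s a t e u w where V: "x \<in> V" "(s, a) \<in> triv S V" "(t, e) \<in> triv T V" "(u, w) \<in> triv E V"
    using bieq3_cover[OF S T E x] by blast
  note s = S.trivD(1,2)[OF V(2)] and t = T.trivD(2)[OF V(3)] and u = E.trivD(2)[OF V(4)]
  show "\<exists>V q. x \<in> V \<and> V \<in> opens X U \<and> q \<in> tsec Q V \<and> h V q = h' V q"
    using eq[OF s t u] bieqD(1)[OF b s(1) bieqD(1)[OF b1 s t] u] s(1) V(1) by blast
qed

end

section \<open>The equivalence\<close>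

context smooth_algebroid
begin

lemma PicB_Ob_restrict:
  assumes U: "openin X U" and L: "L \<in> PicB_Ob X A P B U" and V: "V \<in> opens X U" shows "L \<in> PicB_Ob X A P B V"
proof -
  interpret L: B_line_bundle X A P B U L by (rule B_line_bundleI[OF U L])
  note M = module_sheaf_restrict[OF L.L_sheaf V]
  have "locally_free_rank X V R L 1"
    unfolding locally_free_rank_def
  proof
    fix x assume "x \<in> V"
    then obtain W q where W: "W \<in> opens X V" "x \<in> W" "L.sec.generator W q" using L.L_cover_in[OF V] by blast
    have "frame X R L W 1 (\<lambda>i. q)"
      by (rule frame_rank1I[OF L.L_sheaf L.sec.generatorD(1,2)[OF W(3)]]) (use W(3) in \<open>simp add: L.sec.generator_def\<close>)
    then show "\<exists>W\<in>opens X V. x \<in> W \<and> (\<exists>e. frame X R L W 1 e)" using W by blast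
  qed
  moreover have "B_module_structure X A P B V L (bact L)"
    unfolding B_module_structure_def by (rule ballI) (rule bspec[OF L.Bstr[unfolded B_module_structure_def] opens_trans[OF V]])
  ultimately show ?thesis using M unfolding PicB_Ob_def by blast
qed

text \<open>Three successive shrinkings make every argument a multiple of a nowhere vanishing
  section. The coefficients are then pulled out one at a time, which is why the
  \<open>unfolding\<close> steps are separate.\<close>

lemma trilinear_agree:
  assumes L: "bline U L" and M: "bline U M" and E: "bline U E"
    and N: "module_sheaf X U R N"
    and b1: "bilinear_map X U R L M N1 \<beta>1" and b: "bilinear_map X U R N1 E N0 \<beta>" and \<phi>: "sheaf_hom X U R N0 N \<phi>"
    and c1: "bilinear_map X U R M E N2 \<gamma>1" and c: "bilinear_map X U R L N2 N \<gamma>"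
    and eq: "\<And>V s t u. V \<in> opens X U \<Longrightarrow> s \<in> nonvanishing X R L V \<Longrightarrow> t \<in> nonvanishing X R M V \<Longrightarrow>
      u \<in> nonvanishing X R E V \<Longrightarrow> \<phi> V (\<beta> V (\<beta>1 V s t) u) = \<gamma> V s (\<gamma>1 V t u)"
    and V: "V \<in> opens X U" and l: "l \<in> carrier (Mod L V)" and m: "m \<in> carrier (Mod M V)" and n: "n \<in> carrier (Mod E V)"
  shows "\<phi> V (\<beta> V (\<beta>1 V l m) n) = \<gamma> V l (\<gamma>1 V m n)"
proof -
  interpret L: B_line_bundle X A P B U L by (rule L)
  interpret M: B_line_bundle X A P B U M by (rule M)
  interpret E: B_line_bundle X A P B U E by (rule E)
  note b1D = bilinear_mapD[OF b1] and bD = bilinear_mapD[OF b] and c1D = bilinear_mapD[OF c1] and cD = bilinear_mapD[OF c]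
  note pD = equivariantD[OF sheaf_hom_equivariant[OF \<phi>]]
  note B1 = b1D(1)[OF V l m] and C1 = c1D(1)[OF V m n]
  note B0 = bD(1)[OF V B1 n]
  show ?thesis
  proof (rule sheaf_sep[OF module_sheaf_sheaf[OF N] V pD(1)[OF V B0] cD(1)[OF V l C1]])
    fix x assume x: "x \<in> V"
    obtain W s k where W: "W \<in> opens X V" "x \<in> W" "s \<in> L.nv W" "k \<in> F W" "mres L V W l = k \<odot>[L,W] s"
      using L.local_multiple[OF V l x] by blast
    note WU = opens_trans[OF V W(1)]
    obtain Z t j where Z: "Z \<in> opens X W" "x \<in> Z" "t \<in> M.nv Z" "j \<in> F Z" "mres M W Z (mres M V W m) = j \<odot>[M,Z] t"
      using M.local_multiple[OF WU M.sec.res_closed[OF V m W(1)] W(2)] by blast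
    note ZU = opens_trans[OF WU Z(1)] and ZV = opens_trans[OF W(1) Z(1)]
    have m': "mres M V Z m = j \<odot>[M,Z] t" using Z(5) M.sec.res_res[OF V m W(1) Z(1)] by simp
    obtain Y u i where Y: "Y \<in> opens X Z" "x \<in> Y" "u \<in> E.nv Y" "i \<in> F Y" "mres E Z Y (mres E V Z n) = i \<odot>[E,Y] u"
      using E.local_multiple[OF ZU E.sec.res_closed[OF V n ZV] Z(2)] by blast
    note YU = opens_trans[OF ZU Y(1)] and YV = opens_trans[OF ZV Y(1)] and YW = opens_trans[OF Z(1) Y(1)]
    have lY: "mres L V Y l = restrict k Y \<odot>[L,Y] mres L W Y s" by (rule L.multiple_res[OF WU W(3,4) V l W(1,5) YW])
    have mY: "mres M V Y m = restrict j Y \<odot>[M,Y] mres M Z Y t" by (rule M.multiple_res[OF ZU Z(3,4) V m ZV m' Y(1)])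
    have nY: "mres E V Y n = i \<odot>[E,Y] u" using Y(5) E.sec.res_res[OF V n ZV Y(1)] by simp
    note s = L.nv_res[OF WU W(3) YW] and t = M.nv_res[OF ZU Z(3) Y(1)] and u = Y(3)
    note sL = L.nv_Lc[OF YU s] and tM = M.nv_Lc[OF YU t] and uE = E.nv_Lc[OF YU u]
    note k = F_restrict[OF W(4) YW] and j = F_restrict[OF Z(4) Y(1)] and i = Y(4)
    note jt = M.sec.act_closed[OF YU j tM] and iu = E.sec.act_closed[OF YU i uE]
    note st = b1D(1)[OF YU sL tM] and sjt = b1D(1)[OF YU sL jt] and tu = c1D(1)[OF YU tM uE] and tiu = c1D(1)[OF YU tM iu]
      and jtiu = c1D(1)[OF YU jt iu]
    note st_u = bD(1)[OF YU st uE] and st_iu = bD(1)[OF YU st iu] and sjt_iu = bD(1)[OF YU sjt iu]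
    have "mres N V Y (\<phi> V (\<beta> V (\<beta>1 V l m) n)) =
        restrict k Y \<odot>[N,Y] (restrict j Y \<odot>[N,Y] (i \<odot>[N,Y] \<phi> Y (\<beta> Y (\<beta>1 Y (mres L W Y s) (mres M Z Y t)) u)))"
      unfolding pD(2)[OF V B0 YV, symmetric] bD(2)[OF V B1 n YV] b1D(2)[OF V l m YV] lY mY nY
        b1D(5)[OF YU sL jt k] bD(5)[OF YU sjt iu k] pD(3)[OF YU sjt_iu k]
      unfolding b1D(6)[OF YU sL tM j] bD(5)[OF YU st iu j] pD(3)[OF YU st_iu j]
      unfolding bD(6)[OF YU st uE i] pD(3)[OF YU st_u i] ..
    moreover have "mres N V Y (\<gamma> V l (\<gamma>1 V m n)) =
        restrict k Y \<odot>[N,Y] (restrict j Y \<odot>[N,Y] (i \<odot>[N,Y] \<gamma> Y (mres L W Y s) (\<gamma>1 Y (mres M Z Y t) u)))"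
      unfolding cD(2)[OF V l C1 YV] c1D(2)[OF V m n YV] lY mY nY
        cD(5)[OF YU sL jtiu k]
      unfolding c1D(5)[OF YU tM iu j] cD(6)[OF YU sL tiu j]
      unfolding c1D(6)[OF YU tM uE i] cD(6)[OF YU sL tu i] ..
    ultimately show "\<exists>W\<in>opens X V. x \<in> W \<and> mres N V W (\<phi> V (\<beta> V (\<beta>1 V l m) n)) = mres N V W (\<gamma> V l (\<gamma>1 V m n))"
      using eq[OF YU s t u] YV Y(2) by auto
  qed
qed

section \<open>Unique comparison maps between sums and between tensor products\<close>

lemma bieq_cong:
  assumes S: "ttors U S" and T: "ttors U T" and b: "bieq U S T Q \<beta>"
    and eq: "\<And>V s t. V \<in> opens X U \<Longrightarrow> s \<in> tsec S V \<Longrightarrow> t \<in> tsec T V \<Longrightarrow> \<gamma> V s t = \<beta> V s t"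
  shows "bieq U S T Q \<gamma>"
  unfolding bieq_def
proof (intro conjI ballI allI impI)
  interpret S: ttorsor X A P B U S by (rule S)
  interpret T: ttorsor X A P B U T by (rule T)
  note bD = bieqD[OF b]
  show "(\<gamma> V s t, a \<otimes>[H,V] c) \<in> triv Q V" if "(s, a) \<in> triv S V" "(t, c) \<in> triv T V" for V s a t c
    using bD(5)[OF that] eq[OF S.trivD(1,2)[OF that(1)] T.trivD(2)[OF that(2)]] by simp
  fix V s t assume V: "V \<in> opens X U" and s: "s \<in> tsec S V" and t: "t \<in> tsec T V"
  note e = eq[OF V s t]
  show "\<gamma> V s t \<in> tsec Q V" unfolding e by (rule bD(1)[OF V s t])
  show "tres Q V W (\<gamma> V s t) = \<gamma> W (tres S V W s) (tres T V W t)" if W: "W \<in> opens X V" for W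
    unfolding e eq[OF opens_trans[OF V W] S.sec.res_closed[OF V s W] T.sec.res_closed[OF V t W]] by (rule bD(2)[OF V s t W])
  show "\<gamma> V (tact S V g s) t = tact Q V g (\<gamma> V s t)" if g: "g \<in> Uts V" for g
    unfolding e eq[OF V S.sec.act_closed[OF V g s] t] by (rule bD(3)[OF V s t g])
  show "\<gamma> V s (tact T V g t) = tact Q V g (\<gamma> V s t)" if g: "g \<in> Uts V" for g
    unfolding e eq[OF V s T.sec.act_closed[OF V g t]] by (rule bD(4)[OF V s t g])
qed

text \<open>Unique existence is the form needed to evaluate the definite descriptions in
  \<open>mk_picard\<close> and \<open>F_add\<close>.\<close>

lemma bieq_ex1:
  assumes S: "ttors U S" and T: "ttors U T" and Q: "ttors U Q" "ttors U Q'"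
    and b: "bieq U S T Q \<beta>" and c: "bieq U S T Q' \<gamma>"
  shows "\<exists>!h. h \<in> TMor U Q Q' \<and> (\<forall>V\<in>opens X U. \<forall>s\<in>tsec S V. \<forall>t\<in>tsec T V. h V (\<beta> V s t) = \<gamma> V s t)"
    (is "\<exists>!h. ?P h")
proof (rule ex_ex1I)
  show "\<exists>h. ?P h" using bieq_extend[OF assms] by (rule bexE) (intro exI conjI)
  fix h h' assume h: "?P h" "?P h'"
  show "h = h'" by (rule bieq_unique[OF S T Q b conjunct1[OF h(1)] conjunct1[OF h(2)]]) (use h in simp)
qed

lemma bieq3_ex1:
  assumes S: "ttors U S" and T: "ttors U T" and E: "ttors U E"
    and Q: "ttors U Q1" "ttors U Q" "ttors U Q2" "ttors U Q'"
    and b1: "bieq U S T Q1 \<beta>1" and b: "bieq U Q1 E Q \<beta>" and c1: "bieq U T E Q2 \<gamma>1" and c: "bieq U S Q2 Q' \<gamma>"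
  shows "\<exists>!h. h \<in> TMor U Q Q' \<and> (\<forall>V\<in>opens X U. \<forall>s\<in>tsec S V. \<forall>t\<in>tsec T V. \<forall>u\<in>tsec E V.
    h V (\<beta> V (\<beta>1 V s t) u) = \<gamma> V s (\<gamma>1 V t u))" (is "\<exists>!h. ?P h")
proof (rule ex_ex1I)
  show "\<exists>h. ?P h" using bieq3_extend[OF assms] by (rule bexE) (intro exI conjI)
  fix h h' assume h: "?P h" "?P h'"
  show "h = h'" by (rule bieq3_unique[OF S T E Q(2,4) b1 b conjunct1[OF h(1)] conjunct1[OF h(2)]]) (use h in simp)
qed

text \<open>Holds both readings of a tensor product, as a bilinear map and as a sum of torsors.
  Comparison maps are obtained from the second reading, in \<open>ten_ex1\<close>.\<close>

definition ten :: "'x set \<Rightarrow> ('x, 'u, 'b) bmod \<Rightarrow> ('x, 'u, 'b) bmod \<Rightarrow> ('x, 'u, 'b) bmod \<Rightarrow> ('x, 'u) sbimap \<Rightarrow> bool" where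
  "ten U L M T \<beta> \<longleftrightarrow> B_line_bundle X A P B U L \<and> B_line_bundle X A P B U M \<and> B_line_bundle X A P B U T \<and>
     bilinear_map X U R L M T \<beta> \<and> bieq U (FO U L) (FO U M) (FO U T) \<beta>"

lemma tenD:
  assumes "ten U L M T \<beta>"
  shows "bline U L" "bline U M" "bline U T"
    "bilinear_map X U R L M T \<beta>" "bieq U (FO U L) (FO U M) (FO U T) \<beta>"
    "ttors U (FO U L)" "ttors U (FO U M)" "ttors U (FO U T)" "module_sheaf X U R T"
proof -
  show L: "bline U L" and M: "bline U M" and T: "bline U T"
    and "bilinear_map X U R L M T \<beta>" "bieq U (FO U L) (FO U M) (FO U T) \<beta>"
    using assms unfolding ten_def by blast+
  interpret L: B_line_bundle X A P B U L by (rule L)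
  interpret M: B_line_bundle X A P B U M by (rule M)
  interpret T: B_line_bundle X A P B U T by (rule T)
  show "ttors U (FO U L)" "ttors U (FO U M)" "ttors U (FO U T)" "module_sheaf X U R T"
    by (rule L.FT.ttorsor_axioms M.FT.ttorsor_axioms T.FT.ttorsor_axioms T.L_sheaf)+
qed

lemma ten_map:
  assumes b: "ten U L' M' T \<beta>" and L: "bline U L" and M: "bline U M"
    and f: "f \<in> PicB_Mor X A P B U L L'" and g: "g \<in> PicB_Mor X A P B U M M'"
  shows "ten U L M T (\<lambda>V l m. \<beta> V (f V l) (g V m))"
proof -
  interpret L: B_line_bundle X A P B U L by (rule L)
  interpret M: B_line_bundle X A P B U M by (rule M)
  note bD = tenD[OF b]
  note Ff = F_Mor_Tors[OF L bD(1) f] and Fg = F_Mor_Tors[OF M bD(2) g]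
  have "bieq U (FO U L) (FO U M) (FO U T) (\<lambda>V l m. \<beta> V (f V l) (g V m))"
    by (rule bieq_cong[OF L.FT.ttorsor_axioms M.FT.ttorsor_axioms
          bieq_map[OF L.FT.ttorsor_axioms bD(6) M.FT.ttorsor_axioms bD(7) bD(5) Ff Fg]]) (simp add: F_Ob_simps F_Mor_apply)
  then show ?thesis unfolding ten_def using L M bD(3) bilinear_map_compose[OF bD(4) PicB_MorD(2)[OF f] PicB_MorD(2)[OF g]] by blast
qed

lemma ten_swap: "ten U L M T \<beta> \<Longrightarrow> ten U M L T (\<lambda>V m l. \<beta> V l m)"
  unfolding ten_def using bilinear_map_swap bieq_swap by blast

lemma B_line_bundle_restrict:
  assumes L: "bline U L" and V: "V \<in> opens X U" shows "bline V L"
proof -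
  interpret L: B_line_bundle X A P B U L by (rule L)
  have "L \<in> PicB_Ob X A P B U" unfolding PicB_Ob_def using L.L_sheaf L.L_free L.Bstr by blast
  from B_line_bundleI[OF opens_openin[OF V] PicB_Ob_restrict[OF L.U this V]] show ?thesis .
qed

lemma ten_restrict:
  assumes b: "ten U L M T \<beta>" and V: "V \<in> opens X U" shows "ten V L M T \<beta>"
  unfolding ten_def using B_line_bundle_restrict[OF _ V] tenD(1-3)[OF b] bilinear_map_restrict[OF tenD(4)[OF b] V]
    bieq_restrict[OF tenD(5)[OF b] V, unfolded F_Ob_restrict[OF V]] by blast

text \<open>The morphism is built on torsors and lifted by \<open>F_Mor_surj\<close>, which supplies
  bijectivity and compatibility with \<open>B\<close>. Bilinearity extends the equation from nowhere
  vanishing sections to all.\<close>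

lemma ten_ex1:
  assumes b: "ten U L M T \<beta>" and c: "ten U L M T' \<gamma>"
  shows "\<exists>!\<phi>. \<phi> \<in> PicB_Mor X A P B U T T' \<and>
    (\<forall>V\<in>opens X U. \<forall>l\<in>carrier (Mod L V). \<forall>m\<in>carrier (Mod M V). \<phi> V (\<beta> V l m) = \<gamma> V l m)" (is "\<exists>!\<phi>. ?P \<phi>")
proof (rule ex_ex1I)
  note bD = tenD[OF b] and cD = tenD[OF c]
  interpret L: B_line_bundle X A P B U L by (rule bD(1))
  interpret M: B_line_bundle X A P B U M by (rule bD(2))
  interpret T: B_line_bundle X A P B U T by (rule bD(3))
  note nv = bieqD(1)[OF bD(5), unfolded F_Ob_simps]
  obtain h where h: "h \<in> TMor U (FO U T) (FO U T')"
    "\<forall>V\<in>opens X U. \<forall>s\<in>L.nv V. \<forall>t\<in>M.nv V. h V (\<beta> V s t) = \<gamma> V s t"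
    using bieq_extend[OF bD(6-8) cD(8) bD(5) cD(5)] unfolding F_Ob_simps by blast
  obtain \<phi> where \<phi>: "\<phi> \<in> PicB_Mor X A P B U T T'" "\<forall>V\<in>opens X U. \<forall>s\<in>T.nv V. \<phi> V s = h V s"
    using F_Mor_surj[OF bD(3) cD(3) h(1)] by blast
  have "\<phi> V (\<beta> V l m) = \<gamma> V l m" if "V \<in> opens X U" "l \<in> L.Lc V" "m \<in> M.Lc V" for V l m
    by (rule bilinear_agree[OF bD(1,2) cD(9) bilinear_map_hom[OF bD(4) PicB_MorD(2)[OF \<phi>(1)]] cD(4) _ that]) (use \<phi>(2) h(2) nv in simp)
  then show "\<exists>\<phi>. ?P \<phi>" using \<phi>(1) by blast
  fix \<phi> \<psi> assume \<phi>: "?P \<phi>" "?P \<psi>"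
  show "\<phi> = \<psi>"
  proof (rule PicB_Mor_unique[OF bD(3) cD(3) conjunct1[OF \<phi>(1)] conjunct1[OF \<phi>(2)]])
    fix x assume x: "x \<in> U"
    obtain V s a t b u c where V: "x \<in> V" "(s, a) \<in> triv (FO U L) V" "(t, b) \<in> triv (FO U M) V"
      using bieq3_cover[OF bD(6,7,7) x] by blast
    note s = L.FT.trivD(1,2)[OF V(2), unfolded F_Ob_simps] and t = M.FT.trivD(2)[OF V(3), unfolded F_Ob_simps]
    have "\<phi> V (\<beta> V s t) = \<psi> V (\<beta> V s t)" using \<phi> s(1) L.nv_Lc[OF s] M.nv_Lc[OF s(1) t] by simp
    then show "\<exists>V s. x \<in> V \<and> V \<in> opens X U \<and> s \<in> T.nv V \<and> \<phi> V s = \<psi> V s" using V(1) s(1) nv[OF s t] by blast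
  qed
qed

text \<open>Same route as \<open>ten_ex1\<close>: \<open>bieq3_extend\<close> on torsors, then
  \<open>F_Mor_surj\<close>, then \<open>trilinear_agree\<close> for the remaining sections.\<close>

lemma ten3_ex1:
  assumes b1: "ten U L M T1 \<beta>1" and b: "ten U T1 E T \<beta>" and c1: "ten U M E T2 \<gamma>1" and c: "ten U L T2 T' \<gamma>"
  shows "\<exists>!\<phi>. \<phi> \<in> PicB_Mor X A P B U T T' \<and> (\<forall>V\<in>opens X U. \<forall>l\<in>carrier (Mod L V). \<forall>m\<in>carrier (Mod M V). \<forall>n\<in>carrier (Mod E V).
    \<phi> V (\<beta> V (\<beta>1 V l m) n) = \<gamma> V l (\<gamma>1 V m n))" (is "\<exists>!\<phi>. ?P \<phi>")
proof (rule ex_ex1I)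
  note b1D = tenD[OF b1] and bD = tenD[OF b] and c1D = tenD[OF c1] and cD = tenD[OF c]
  interpret L: B_line_bundle X A P B U L by (rule b1D(1))
  interpret M: B_line_bundle X A P B U M by (rule b1D(2))
  interpret E: B_line_bundle X A P B U E by (rule bD(2))
  interpret T: B_line_bundle X A P B U T by (rule bD(3))
  note nv1 = bieqD(1)[OF b1D(5), unfolded F_Ob_simps] and nv = bieqD(1)[OF bD(5), unfolded F_Ob_simps]
  obtain h where h: "h \<in> TMor U (FO U T) (FO U T')"
    "\<forall>V\<in>opens X U. \<forall>s\<in>L.nv V. \<forall>t\<in>M.nv V. \<forall>u\<in>E.nv V. h V (\<beta> V (\<beta>1 V s t) u) = \<gamma> V s (\<gamma>1 V t u)"
    using bieq3_extend[OF b1D(6,7) bD(7) b1D(8) bD(8) c1D(8) cD(8) b1D(5) bD(5) c1D(5) cD(5)] unfolding F_Ob_simps by blast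
  obtain \<phi> where \<phi>: "\<phi> \<in> PicB_Mor X A P B U T T'" "\<forall>V\<in>opens X U. \<forall>s\<in>T.nv V. \<phi> V s = h V s"
    using F_Mor_surj[OF bD(3) cD(3) h(1)] by blast
  have "\<phi> V (\<beta> V (\<beta>1 V l m) n) = \<gamma> V l (\<gamma>1 V m n)"
    if "V \<in> opens X U" "l \<in> L.Lc V" "m \<in> M.Lc V" "n \<in> E.Lc V" for V l m n
  proof (rule trilinear_agree[OF b1D(1,2) bD(2) cD(9) b1D(4) bD(4) PicB_MorD(2)[OF \<phi>(1)] c1D(4) cD(4) _ that])
    fix V s t u assume "V \<in> opens X U" "s \<in> L.nv V" "t \<in> M.nv V" "u \<in> E.nv V"
    then show "\<phi> V (\<beta> V (\<beta>1 V s t) u) = \<gamma> V s (\<gamma>1 V t u)" using \<phi>(2) h(2) nv nv1 by simp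
  qed
  then show "\<exists>\<phi>. ?P \<phi>" using \<phi>(1) by blast
  fix \<phi> \<psi> assume \<phi>: "?P \<phi>" "?P \<psi>"
  show "\<phi> = \<psi>"
  proof (rule PicB_Mor_unique[OF bD(3) cD(3) conjunct1[OF \<phi>(1)] conjunct1[OF \<phi>(2)]])
    fix x assume x: "x \<in> U"
    obtain V s a t b u c where V: "x \<in> V" "(s, a) \<in> triv (FO U L) V" "(t, b) \<in> triv (FO U M) V" "(u, c) \<in> triv (FO U E) V"
      using bieq3_cover[OF b1D(6,7) bD(7) x] by blast
    note s = L.FT.trivD(1,2)[OF V(2), unfolded F_Ob_simps] and t = M.FT.trivD(2)[OF V(3), unfolded F_Ob_simps]
      and u = E.FT.trivD(2)[OF V(4), unfolded F_Ob_simps]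
    have "\<phi> V (\<beta> V (\<beta>1 V s t) u) = \<psi> V (\<beta> V (\<beta>1 V s t) u)"
      using \<phi> s(1) L.nv_Lc[OF s] M.nv_Lc[OF s(1) t] E.nv_Lc[OF s(1) u] by simp
    then show "\<exists>V s. x \<in> V \<and> V \<in> opens X U \<and> s \<in> T.nv V \<and> \<phi> V s = \<psi> V s"
      using V(1) s(1) nv[OF s(1) nv1[OF s t] u] by blast
  qed
qed

end

section \<open>The chosen sums and the constraints of both stacks\<close>

lemma the_sumI:
  assumes "\<exists>p \<beta>. p \<in> ob U \<and> isum U a b p \<beta>"
  shows "fst (the_sum ob isum U a b) \<in> ob U"
    and "isum U a b (fst (the_sum ob isum U a b)) (snd (the_sum ob isum U a b))"
proof -
  have "\<exists>x. case x of (p, \<beta>) \<Rightarrow> p \<in> ob U \<and> isum U a b p \<beta>" using assms by auto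
  from someI_ex[OF this] show "fst (the_sum ob isum U a b) \<in> ob U"
    and "isum U a b (fst (the_sum ob isum U a b)) (snd (the_sum ob isum U a b))"
    unfolding the_sum_def by (auto split: prod.splits)
qed

text \<open>Every section of a constructed bundle is an encoded complex function, so this injection
  is the whole demand on \<open>'u\<close>.\<close>

locale large_universe = smooth_algebroid X A P B for X :: "'x topology" and A P and B :: "('x, 'b) lie_algd" +
  fixes \<iota> :: "'x cfun \<Rightarrow> 'u"
  assumes inj_\<iota>: "inj \<iota>"
begin

abbreviation "PO \<equiv> (PicB_Ob X A P B :: 'x set \<Rightarrow> ('x, 'u, 'b) bmod set)"
abbreviation "PM \<equiv> (PicB_Mor X A P B :: 'x set \<Rightarrow> ('x, 'u, 'b) bmod \<Rightarrow> ('x, 'u, 'b) bmod \<Rightarrow> ('x, 'u) smap set)"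
abbreviation "TO \<equiv> (Tors_Ob X G H d :: 'x set \<Rightarrow> ('x, 'x cfun, ('x, 'b) form, 'u) ttorsor set)"
abbreviation "PS \<equiv> (PicB X A P B :: ('x, ('x, 'u, 'b) bmod, ('x, 'u) smap) picard)"
abbreviation "TS \<equiv> (dlog_torsors X A P B :: ('x, ('x, 'x cfun, ('x, 'b) form, 'u) ttorsor, ('x, 'u) smap) picard)"
abbreviation "sc L V \<equiv> carrier (Mod (L :: ('x, 'u, 'b) bmod) V)"
abbreviation "nz L V \<equiv> nonvanishing X R (L :: ('x, 'u, 'b) bmod) V"

definition bP :: "'x set \<Rightarrow> ('x, 'u, 'b) bmod \<Rightarrow> ('x, 'u, 'b) bmod \<Rightarrow> ('x, 'u) sbimap" where
  "bP U L M = snd (the_sum PO (PicB_tensor X A P B) U L M)"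

definition bT :: "'x set \<Rightarrow> ('x, 'x cfun, ('x, 'b) form, 'u) ttorsor \<Rightarrow> ('x, 'x cfun, ('x, 'b) form, 'u) ttorsor
    \<Rightarrow> ('x, 'u) sbimap" where
  "bT U S T = snd (the_sum TO (Tors_sum X G H d) U S T)"

lemma TS_simps:
  "Ob TS = TO" "Mor TS = Tors_Mor X G H d" "Idm TS U S = (\<lambda>V\<in>opens X U. \<lambda>s\<in>tsec S V. s)"
  "Cmp TS U S g f = (\<lambda>V\<in>opens X U. \<lambda>s\<in>tsec S V. g V (f V s))"
  "ResO TS V S = ro V S" "ResM TS V f = restrict f (opens X V)"
  "SumO TS U S T = fst (the_sum TO (Tors_sum X G H d) U S T)"
  by (simp_all add: Tors_def mk_picard_def Let_def ro_def)

lemma TS_constraints: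
  "SumM TS U S S' T T' f g = (THE h. h \<in> TMor U (SumO TS U S T) (SumO TS U S' T') \<and>
    (\<forall>V\<in>opens X U. \<forall>s\<in>tsec S V. \<forall>t\<in>tsec T V. h V (bT U S T V s t) = bT U S' T' V (f V s) (g V t)))"
  "Asc TS U S T E = (THE h. h \<in> TMor U (SumO TS U (SumO TS U S T) E) (SumO TS U S (SumO TS U T E)) \<and>
    (\<forall>V\<in>opens X U. \<forall>s\<in>tsec S V. \<forall>t\<in>tsec T V. \<forall>u\<in>tsec E V.
      h V (bT U (SumO TS U S T) E V (bT U S T V s t) u) = bT U S (SumO TS U T E) V s (bT U T E V t u)))"
  "Brd TS U S T = (THE h. h \<in> TMor U (SumO TS U S T) (SumO TS U T S) \<and>
    (\<forall>V\<in>opens X U. \<forall>s\<in>tsec S V. \<forall>t\<in>tsec T V. h V (bT U S T V s t) = bT U T S V t s))"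
  "ResSum TS U V S T = (THE h. h \<in> TMor V (ro V (SumO TS U S T)) (SumO TS V (ro V S) (ro V T)) \<and>
    (\<forall>W\<in>opens X V. \<forall>s\<in>tsec S W. \<forall>t\<in>tsec T W. h W (bT U S T W s t) = bT V (ro V S) (ro V T) W s t))"
  by (simp_all add: Tors_def mk_picard_def Let_def ro_def bT_def)

lemma PS_simps:
  "Ob PS = PO" "Mor PS = PM" "Idm PS U L = (\<lambda>V\<in>opens X U. \<lambda>s\<in>sc L V. s)"
  "Cmp PS U L g f = (\<lambda>V\<in>opens X U. \<lambda>s\<in>sc L V. g V (f V s))"
  "ResO PS V L = L" "ResM PS V f = restrict f (opens X V)"
  "SumO PS U L M = fst (the_sum PO (PicB_tensor X A P B) U L M)"
  by (simp_all add: PicB_def mk_picard_def Let_def)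

lemma PS_constraints:
  "SumM PS U L L' M M' f g = (THE h. h \<in> PM U (SumO PS U L M) (SumO PS U L' M') \<and>
    (\<forall>V\<in>opens X U. \<forall>s\<in>sc L V. \<forall>t\<in>sc M V. h V (bP U L M V s t) = bP U L' M' V (f V s) (g V t)))"
  "Asc PS U L M E = (THE h. h \<in> PM U (SumO PS U (SumO PS U L M) E) (SumO PS U L (SumO PS U M E)) \<and>
    (\<forall>V\<in>opens X U. \<forall>s\<in>sc L V. \<forall>t\<in>sc M V. \<forall>u\<in>sc E V.
      h V (bP U (SumO PS U L M) E V (bP U L M V s t) u) = bP U L (SumO PS U M E) V s (bP U M E V t u)))"
  "Brd PS U L M = (THE h. h \<in> PM U (SumO PS U L M) (SumO PS U M L) \<and>
    (\<forall>V\<in>opens X U. \<forall>s\<in>sc L V. \<forall>t\<in>sc M V. h V (bP U L M V s t) = bP U M L V t s))"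
  "ResSum PS U V L M = (THE h. h \<in> PM V (SumO PS U L M) (SumO PS V L M) \<and>
    (\<forall>W\<in>opens X V. \<forall>s\<in>sc L W. \<forall>t\<in>sc M W. h W (bP U L M W s t) = bP V L M W s t))"
  by (simp_all add: PicB_def mk_picard_def Let_def bP_def)

lemma TO_ttorsor: "openin X U \<Longrightarrow> T \<in> TO U \<Longrightarrow> ttorsor X A P B U T"
  by (rule ttorsorI)

lemma TO_sum:
  assumes U: "openin X U" and S: "S \<in> TO U" and T: "T \<in> TO U"
  shows "SumO TS U S T \<in> TO U" and "bieq U S T (SumO TS U S T) (bT U S T)"
proof -
  note s = the_sumI[of TO U "Tors_sum X G H d" S T, OF Tors_sum_exists[OF TO_ttorsor[OF U S] TO_ttorsor[OF U T] inj_\<iota>]]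
  show 1: "SumO TS U S T \<in> TO U" unfolding TS_simps by (rule s(1))
  show "bieq U S T (SumO TS U S T) (bT U S T)"
    by (rule Tors_sum_bieq[OF TO_ttorsor[OF U 1] TO_ttorsor[OF U S] TO_ttorsor[OF U T]]) (unfold TS_simps bT_def, rule s(2))
qed

text \<open>\<open>tensor_pair\<close> shows that a tensor product exists, so \<open>the_sum\<close>
  chooses one; \<open>tensor_Tors_sum\<close> applies to whichever was chosen.\<close>

lemma PO_sum:
  assumes U: "openin X U" and L: "L \<in> PO U" and M: "M \<in> PO U"
  shows "SumO PS U L M \<in> PO U" and "ten U L M (SumO PS U L M) (bP U L M)"
proof -
  interpret L: B_line_bundle X A P B U L by (rule B_line_bundleI[OF U L])
  interpret M: B_line_bundle X A P B U M by (rule B_line_bundleI[OF U M])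
  interpret LM: tensor_pair X A P B U L M \<iota> by unfold_locales (rule inj_\<iota>)
  have "\<exists>T \<beta>. T \<in> PO U \<and> PicB_tensor X A P B U L M T \<beta>" using LM.LN_Ob LM.tens_tensor by blast
  note s = the_sumI[of PO U "PicB_tensor X A P B" L M, OF this]
  show T: "SumO PS U L M \<in> PO U" unfolding PS_simps by (rule s(1))
  have t: "PicB_tensor X A P B U L M (SumO PS U L M) (bP U L M)" unfolding PS_simps bP_def by (rule s(2))
  interpret T: B_line_bundle X A P B U "SumO PS U L M" by (rule B_line_bundleI[OF U T])
  show "ten U L M (SumO PS U L M) (bP U L M)"
    unfolding ten_def
  proof (intro conjI)
    show "bilinear_map X U R L M (SumO PS U L M) (bP U L M)" using t unfolding PicB_tensor_def by (elim conjE)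
    show "bieq U (FO U L) (FO U M) (FO U (SumO PS U L M)) (bP U L M)"
      by (rule Tors_sum_bieq[OF T.FT.ttorsor_axioms L.FT.ttorsor_axioms M.FT.ttorsor_axioms LM.tensor_Tors_sum[OF T t]])
  qed unfold_locales
qed

lemma TO_restrict:
  assumes U: "openin X U" and T: "T \<in> TO U" and V: "V \<in> opens X U" shows "ro V T \<in> TO V"
proof -
  interpret T: ttorsor X A P B V "ro V T" by (rule ttorsor_restrict[OF TO_ttorsor[OF U T] V])
  show ?thesis using T.torsor T.triv unfolding Tors_Ob_def by blast
qed

lemma PO_restrict: "openin X U \<Longrightarrow> L \<in> PO U \<Longrightarrow> V \<in> opens X U \<Longrightarrow> L \<in> PO V"
  by (rule PicB_Ob_restrict)

lemma FO_TO: "openin X U \<Longrightarrow> L \<in> PO U \<Longrightarrow> FO U L \<in> TO U"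
  using B_line_bundle.F_Ob_Tors[OF B_line_bundleI] by blast

lemma FM_Tors: "openin X U \<Longrightarrow> L \<in> PO U \<Longrightarrow> M \<in> PO U \<Longrightarrow> \<phi> \<in> PM U L M \<Longrightarrow> F_Mor X A P U L M \<phi> \<in> TMor U (FO U L) (FO U M)"
  by (rule F_Mor_Tors[OF B_line_bundleI B_line_bundleI])

lemma Cmp_TS: "V \<in> opens X U \<Longrightarrow> s \<in> tsec S V \<Longrightarrow> Cmp TS U S g f V s = g V (f V s)"
  by (simp add: TS_simps)

lemma Cmp_TS_Tors:
  "openin X U \<Longrightarrow> S \<in> TO U \<Longrightarrow> T \<in> TO U \<Longrightarrow> Q \<in> TO U \<Longrightarrow> f \<in> TMor U S T \<Longrightarrow> g \<in> TMor U T Q \<Longrightarrow> Cmp TS U S g f \<in> TMor U S Q"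
  unfolding TS_simps by (rule TMor_comp[OF TO_ttorsor TO_ttorsor TO_ttorsor])

lemma TMor_closed:
  assumes "openin X U" "S \<in> TO U" "T \<in> TO U" "f \<in> TMor U S T" "V \<in> opens X U" "s \<in> tsec S V"
  shows "f V s \<in> tsec T V"
  by (rule equivariantD(1)[OF Tors_MorD(2)[OF TO_ttorsor[OF assms(1,2)] TO_ttorsor[OF assms(1,3)] assms(4)] assms(5,6)])

lemma TS_iso:
  assumes U: "openin X U" and S: "S \<in> TO U" and T: "T \<in> TO U" and f: "f \<in> TMor U S T" shows "is_iso TS U S T f"
proof -
  obtain g where g: "g \<in> TMor U T S" "\<forall>V\<in>opens X U. \<forall>s\<in>tsec S V. g V (f V s) = s"
    "\<forall>V\<in>opens X U. \<forall>t\<in>tsec T V. f V (g V t) = t"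
    using Tors_inverse[OF TO_ttorsor[OF U S] TO_ttorsor[OF U T] f] by blast
  have "Cmp TS U S g f = Idm TS U S" "Cmp TS U T f g = Idm TS U T"
    unfolding TS_simps using g by (auto simp: restrict_def fun_eq_iff)
  then show ?thesis unfolding is_iso_def TS_simps(2) using f g(1) by blast
qed

text \<open>Constraints are definite descriptions. Here and in the similar lemmas below a
  unique-existence lemma, applied to the chosen universal maps, justifies the description through
  \<open>theI'\<close>.\<close>

lemma SumM_TS_spec:
  assumes U: "openin X U" and "S \<in> TO U" "S' \<in> TO U" "T \<in> TO U" "T' \<in> TO U" "f \<in> TMor U S S'" "g \<in> TMor U T T'"
  shows "SumM TS U S S' T T' f g \<in> TMor U (SumO TS U S T) (SumO TS U S' T') \<and>
    (\<forall>V\<in>opens X U. \<forall>s\<in>tsec S V. \<forall>t\<in>tsec T V.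
      SumM TS U S S' T T' f g V (bT U S T V s t) = bT U S' T' V (f V s) (g V t))"
proof -
  note t = TO_ttorsor[OF U]
  note s = TO_sum[OF U assms(2,4)] and s' = TO_sum[OF U assms(3,5)]
  show ?thesis unfolding TS_constraints by (rule theI'[OF bieq_ex1[OF t[OF assms(2)] t[OF assms(4)] t[OF s(1)] t[OF s'(1)] s(2)
      bieq_map[OF t[OF assms(2)] t[OF assms(3)] t[OF assms(4)] t[OF assms(5)] s'(2) assms(6,7)]]])
qed

lemmas SumM_TS = SumM_TS_spec[THEN conjunct1] SumM_TS_spec[THEN conjunct2, rule_format]

lemma Brd_TS_spec:
  assumes U: "openin X U" and "S \<in> TO U" "T \<in> TO U"
  shows "Brd TS U S T \<in> TMor U (SumO TS U S T) (SumO TS U T S) \<and>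
    (\<forall>V\<in>opens X U. \<forall>s\<in>tsec S V. \<forall>t\<in>tsec T V.
      Brd TS U S T V (bT U S T V s t) = bT U T S V t s)"
proof -
  note t = TO_ttorsor[OF U]
  note s = TO_sum[OF U assms(2,3)] and s' = TO_sum[OF U assms(3,2)]
  show ?thesis unfolding TS_constraints by (rule theI'[OF bieq_ex1[OF t[OF assms(2)] t[OF assms(3)] t[OF s(1)] t[OF s'(1)] s(2) bieq_swap[OF s'(2)]]])
qed

lemmas Brd_TS = Brd_TS_spec[THEN conjunct1] Brd_TS_spec[THEN conjunct2, rule_format]

lemma Asc_TS_spec:
  assumes U: "openin X U" and "S \<in> TO U" "T \<in> TO U" "E \<in> TO U"
  shows "Asc TS U S T E \<in> TMor U (SumO TS U (SumO TS U S T) E) (SumO TS U S (SumO TS U T E)) \<and>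
    (\<forall>V\<in>opens X U. \<forall>s\<in>tsec S V. \<forall>t\<in>tsec T V. \<forall>u\<in>tsec E V.
      Asc TS U S T E V (bT U (SumO TS U S T) E V (bT U S T V s t) u) = bT U S (SumO TS U T E) V s (bT U T E V t u))"
proof -
  note t = TO_ttorsor[OF U]
  note st = TO_sum[OF U assms(2,3)] and te = TO_sum[OF U assms(3,4)]
  note st_e = TO_sum[OF U st(1) assms(4)] and s_te = TO_sum[OF U assms(2) te(1)]
  show ?thesis unfolding TS_constraints by (rule theI'[OF bieq3_ex1[OF t[OF assms(2)] t[OF assms(3)] t[OF assms(4)] t[OF st(1)] t[OF st_e(1)] t[OF te(1)] t[OF s_te(1)]
      st(2) st_e(2) te(2) s_te(2)]])
qed

lemmas Asc_TS = Asc_TS_spec[THEN conjunct1] Asc_TS_spec[THEN conjunct2, rule_format]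

lemma ResSum_TS_spec:
  assumes U: "openin X U" and "S \<in> TO U" "T \<in> TO U" and V: "V \<in> opens X U"
  shows "ResSum TS U V S T \<in> TMor V (ro V (SumO TS U S T)) (SumO TS V (ro V S) (ro V T)) \<and>
    (\<forall>W\<in>opens X V. \<forall>s\<in>tsec S W. \<forall>t\<in>tsec T W.
      ResSum TS U V S T W (bT U S T W s t) = bT V (ro V S) (ro V T) W s t)"
proof -
  have oV: "openin X V" using V opens_openin by blast
  note t = TO_ttorsor[OF oV] and r = TO_restrict[OF U _ V]
  note s = TO_sum[OF U assms(2,3)] and s' = TO_sum[OF oV r[OF assms(2)] r[OF assms(3)]]
  show ?thesis unfolding TS_constraints by (rule theI'[OF bieq_ex1[OF t[OF r[OF assms(2)]] t[OF r[OF assms(3)]] t[OF r[OF s(1)]] t[OF s'(1)]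
      bieq_restrict[OF s(2) V] s'(2), unfolded ro_simps]])
qed

lemmas ResSum_TS = ResSum_TS_spec[THEN conjunct1] ResSum_TS_spec[THEN conjunct2, rule_format]

lemma SumM_PS_spec:
  assumes U: "openin X U" and "L \<in> PO U" "L' \<in> PO U" "M \<in> PO U" "M' \<in> PO U" "f \<in> PM U L L'" "g \<in> PM U M M'"
  shows "SumM PS U L L' M M' f g \<in> PM U (SumO PS U L M) (SumO PS U L' M') \<and>
    (\<forall>V\<in>opens X U. \<forall>s\<in>sc L V. \<forall>t\<in>sc M V.
      SumM PS U L L' M M' f g V (bP U L M V s t) = bP U L' M' V (f V s) (g V t))"
proof -
  note b = B_line_bundleI[OF U]
  show ?thesis unfolding PS_constraints by (rule theI'[OF ten_ex1[OF PO_sum(2)[OF U assms(2,4)]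
      ten_map[OF PO_sum(2)[OF U assms(3,5)] b[OF assms(2)] b[OF assms(4)] assms(6,7)]]])
qed

lemmas SumM_PS = SumM_PS_spec[THEN conjunct1] SumM_PS_spec[THEN conjunct2, rule_format]

lemma Brd_PS_spec:
  assumes U: "openin X U" and "L \<in> PO U" "M \<in> PO U"
  shows "Brd PS U L M \<in> PM U (SumO PS U L M) (SumO PS U M L) \<and>
    (\<forall>V\<in>opens X U. \<forall>s\<in>sc L V. \<forall>t\<in>sc M V.
      Brd PS U L M V (bP U L M V s t) = bP U M L V t s)"
  unfolding PS_constraints by (rule theI'[OF ten_ex1[OF PO_sum(2)[OF U assms(2,3)] ten_swap[OF PO_sum(2)[OF U assms(3,2)]]]])

lemmas Brd_PS = Brd_PS_spec[THEN conjunct1] Brd_PS_spec[THEN conjunct2, rule_format]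

lemma Asc_PS_spec:
  assumes U: "openin X U" and "L \<in> PO U" "M \<in> PO U" "E \<in> PO U"
  shows "Asc PS U L M E \<in> PM U (SumO PS U (SumO PS U L M) E) (SumO PS U L (SumO PS U M E)) \<and>
    (\<forall>V\<in>opens X U. \<forall>s\<in>sc L V. \<forall>t\<in>sc M V. \<forall>u\<in>sc E V.
      Asc PS U L M E V (bP U (SumO PS U L M) E V (bP U L M V s t) u) = bP U L (SumO PS U M E) V s (bP U M E V t u))"
proof -
  note lm = PO_sum[OF U assms(2,3)] and me = PO_sum[OF U assms(3,4)]
  show ?thesis unfolding PS_constraints by (rule theI'[OF ten3_ex1[OF lm(2) PO_sum(2)[OF U lm(1) assms(4)] me(2) PO_sum(2)[OF U assms(2) me(1)]]])
qed

lemmas Asc_PS = Asc_PS_spec[THEN conjunct1] Asc_PS_spec[THEN conjunct2, rule_format]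

lemma ResSum_PS_spec:
  assumes U: "openin X U" and "L \<in> PO U" "M \<in> PO U" and V: "V \<in> opens X U"
  shows "ResSum PS U V L M \<in> PM V (SumO PS U L M) (SumO PS V L M) \<and>
    (\<forall>W\<in>opens X V. \<forall>s\<in>sc L W. \<forall>t\<in>sc M W.
      ResSum PS U V L M W (bP U L M W s t) = bP V L M W s t)"
proof -
  have oV: "openin X V" using V opens_openin by blast
  note r = PO_restrict[OF U _ V]
  show ?thesis unfolding PS_constraints by (rule theI'[OF ten_ex1[OF ten_restrict[OF PO_sum(2)[OF U assms(2,3)] V] PO_sum(2)[OF oV r[OF assms(2)] r[OF assms(3)]]]])
qed

lemmas ResSum_PS = ResSum_PS_spec[THEN conjunct1] ResSum_PS_spec[THEN conjunct2, rule_format]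

abbreviation "\<mu> \<equiv> (F_add X A P B :: 'x set \<Rightarrow> ('x, 'u, 'b) bmod \<Rightarrow> ('x, 'u, 'b) bmod \<Rightarrow> ('x, 'u) smap)"

text \<open>The torsor of the tensor product, with the universal bilinear map, is itself a sum of
  the two torsors; the comparison of two sums is unique.\<close>

lemma F_add_eq:
  assumes U: "openin X U" and L: "L \<in> PO U" and M: "M \<in> PO U"
  shows "\<mu> U L M \<in> TMor U (SumO TS U (FO U L) (FO U M)) (FO U (SumO PS U L M))"
    and "V \<in> opens X U \<Longrightarrow> s \<in> nz L V \<Longrightarrow> t \<in> nz M V \<Longrightarrow> \<mu> U L M V (bT U (FO U L) (FO U M) V s t) = bP U L M V s t"
proof -
  note t = TO_ttorsor[OF U] and s = TO_sum[OF U FO_TO[OF U L] FO_TO[OF U M]] and p = PO_sum[OF U L M]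
  note ex = bieq_ex1[OF t[OF FO_TO[OF U L]] t[OF FO_TO[OF U M]] t[OF s(1)] t[OF FO_TO[OF U p(1)]] s(2) tenD(5)[OF p(2)]]
  have "\<mu> U L M = (THE h. h \<in> TMor U (SumO TS U (FO U L) (FO U M)) (FO U (SumO PS U L M)) \<and>
    (\<forall>V\<in>opens X U. \<forall>s\<in>tsec (FO U L) V. \<forall>t\<in>tsec (FO U M) V. h V (bT U (FO U L) (FO U M) V s t) = bP U L M V s t))"
    by (simp add: F_add_def Let_def case_prod_beta bT_def bP_def TS_simps PS_simps)
  note * = theI'[OF ex, folded this]
  show "\<mu> U L M \<in> TMor U (SumO TS U (FO U L) (FO U M)) (FO U (SumO PS U L M))" using * by (rule conjunct1)
  show "\<mu> U L M V (bT U (FO U L) (FO U M) V s t) = bP U L M V s t"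
    if "V \<in> opens X U" "s \<in> nz L V" "t \<in> nz M V" using conjunct2[OF *] that by (simp add: F_Ob_simps)
qed

end

section \<open>The functor is an additive equivalence\<close>

context large_universe
begin

lemma nz_sc: "s \<in> nz L V \<Longrightarrow> s \<in> sc L V"
  by (simp add: nonvanishing_def)

lemma F_stack_functor: "stack_functor X PS TS (F_Ob X A P B) (F_Mor X A P)"
  unfolding stack_functor_def PS_simps TS_simps
proof (intro allI impI ballI conjI)
  fix U L assume U: "openin X U" and L: "L \<in> PO U"
  show "FO U L \<in> TO U" by (rule FO_TO[OF U L])
  show "F_Mor X A P U L L (\<lambda>V\<in>opens X U. \<lambda>s\<in>sc L V. s) = (\<lambda>V\<in>opens X U. \<lambda>s\<in>tsec (FO U L) V. s)"
    using nz_sc by (auto simp: F_Mor_def F_Ob_simps restrict_def fun_eq_iff)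
  show "FO V L = ro V (FO U L)" if "V \<in> opens X U" for V by (rule F_Ob_restrict[OF that, symmetric])
  fix M \<phi> assume M: "M \<in> PO U" and \<phi>: "\<phi> \<in> PM U L M"
  note F\<phi> = FM_Tors[OF U L M \<phi>]
  show "F_Mor X A P U L M \<phi> \<in> TMor U (FO U L) (FO U M)" by (rule F\<phi>)
  show "F_Mor X A P V L M (restrict \<phi> (opens X V)) = restrict (F_Mor X A P U L M \<phi>) (opens X V)" if "V \<in> opens X U" for V
    using opens_trans[OF that] by (auto simp: F_Mor_def restrict_def fun_eq_iff)
  fix N \<psi> assume N: "N \<in> PO U" and \<psi>: "\<psi> \<in> PM U M N"
  have "F_Mor X A P U L M \<phi> V s \<in> nz M V" if "V \<in> opens X U" "s \<in> nz L V" for V s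
    using TMor_closed[OF U FO_TO[OF U L] FO_TO[OF U M] F\<phi> that(1)] that(2) by (simp add: F_Ob_simps)
  then show "F_Mor X A P U L N (\<lambda>V\<in>opens X U. \<lambda>s\<in>sc L V. \<psi> V (\<phi> V s)) =
      (\<lambda>V\<in>opens X U. \<lambda>s\<in>tsec (FO U L) V. F_Mor X A P U M N \<psi> V (F_Mor X A P U L M \<phi> V s))"
    using nz_sc by (auto simp: F_Mor_def F_Ob_simps restrict_def fun_eq_iff)
qed

text \<open>Nowhere vanishing sections are frames and therefore determine a morphism of line
  bundles; every torsor morphism comes from one by \<open>F_Mor_surj\<close>.\<close>

lemma F_bij:
  assumes U: "openin X U" and L: "L \<in> PO U" and M: "M \<in> PO U"
  shows "bij_betw (F_Mor X A P U L M) (PM U L M) (TMor U (FO U L) (FO U M))"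
  unfolding bij_betw_def
proof
  note LM = B_line_bundleI[OF U L] B_line_bundleI[OF U M]
  note t = TO_ttorsor[OF U FO_TO[OF U L]] TO_ttorsor[OF U FO_TO[OF U M]]
  interpret L: B_line_bundle X A P B U L by (rule LM(1))
  show "inj_on (F_Mor X A P U L M) (PM U L M)"
  proof (rule inj_onI)
    fix \<phi> \<psi> assume \<phi>: "\<phi> \<in> PM U L M" "\<psi> \<in> PM U L M" and eq: "F_Mor X A P U L M \<phi> = F_Mor X A P U L M \<psi>"
    show "\<phi> = \<psi>"
    proof (rule PicB_Mor_unique[OF LM \<phi>])
      fix x assume "x \<in> U"
      then obtain V s \<omega> where V: "x \<in> V" "(s, \<omega>) \<in> triv (FO U L) V" using L.FT.triv_exists by blast
      note s = L.FT.trivD(1,2)[OF V(2), unfolded F_Ob_simps]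
      show "\<exists>V s. x \<in> V \<and> V \<in> opens X U \<and> s \<in> nz L V \<and> \<phi> V s = \<psi> V s"
        using V(1) s F_Mor_apply[OF s, of M] eq by metis
    qed
  qed
  show "F_Mor X A P U L M ` PM U L M = TMor U (FO U L) (FO U M)"
  proof (intro Set.set_eqI iffI)
    fix \<psi> assume "\<psi> \<in> F_Mor X A P U L M ` PM U L M"
    then show "\<psi> \<in> TMor U (FO U L) (FO U M)" using FM_Tors[OF U L M] by blast
  next
    fix \<psi> assume \<psi>: "\<psi> \<in> TMor U (FO U L) (FO U M)"
    obtain \<phi> where \<phi>: "\<phi> \<in> PM U L M" "\<forall>V\<in>opens X U. \<forall>s\<in>nz L V. \<phi> V s = \<psi> V s" using F_Mor_surj[OF LM \<psi>] by blast
    have "F_Mor X A P U L M \<phi> = \<psi>"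
    proof (rule ext_family_eqI[OF Tors_MorD(1)[OF t FM_Tors[OF U L M \<phi>(1)]] Tors_MorD(1)[OF t \<psi>]])
      fix V s assume "V \<in> opens X U" "s \<in> tsec (FO U L) V"
      then show "F_Mor X A P U L M \<phi> V s = \<psi> V s" using \<phi>(2) by (simp add: F_Ob_simps F_Mor_apply)
    qed
    then show "\<psi> \<in> F_Mor X A P U L M ` PM U L M" using \<phi>(1) by blast
  qed
qed

lemma F_ess_surj:
  assumes U: "openin X U" and T: "T \<in> TO U" shows "\<exists>L\<in>PO U. \<exists>f. is_iso TS U (FO U L) T f"
proof -
  obtain L f where "L \<in> PO U" "f \<in> TMor U (FO U L) T" using ess_surj[OF TO_ttorsor[OF U T] inj_\<iota>] by blast
  then show ?thesis using TS_iso[OF U FO_TO[OF U] T] by blast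
qed

text \<open>Both composites send the sum of \<open>s\<close> and \<open>t\<close> to the tensor
  product of their images f(s) and g(t).\<close>

lemma F_add_natural:
  assumes U: "openin X U" and L: "L \<in> PO U" "L' \<in> PO U" and M: "M \<in> PO U" "M' \<in> PO U"
    and f: "f \<in> PM U L L'" and g: "g \<in> PM U M M'"
  shows "Cmp TS U (SumO TS U (FO U L) (FO U M))
      (F_Mor X A P U (SumO PS U L M) (SumO PS U L' M') (SumM PS U L L' M M' f g)) (\<mu> U L M)
    = Cmp TS U (SumO TS U (FO U L) (FO U M)) (\<mu> U L' M')
      (SumM TS U (FO U L) (FO U L') (FO U M) (FO U M') (F_Mor X A P U L L' f) (F_Mor X A P U M M' g))"
    (is "Cmp TS U ?Q ?l1 ?l2 = Cmp TS U ?Q ?r1 ?r2")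
proof -
  note o = FO_TO[OF U] and t = TO_ttorsor[OF U]
  note p = PO_sum[OF U L(1) M(1)] and p' = PO_sum[OF U L(2) M(2)]
  note q = TO_sum[OF U o[OF L(1)] o[OF M(1)]] and q' = TO_sum[OF U o[OF L(2)] o[OF M(2)]]
  note m = F_add_eq[OF U L(1) M(1)] and m' = F_add_eq[OF U L(2) M(2)]
  note Ff = FM_Tors[OF U L f] and Fg = FM_Tors[OF U M g]
  note SP = SumM_PS[OF U L M f g] and ST = SumM_TS[OF U o[OF L(1)] o[OF L(2)] o[OF M(1)] o[OF M(2)] Ff Fg]
  have l1: "?l1 \<in> TMor U (FO U (SumO PS U L M)) (FO U (SumO PS U L' M'))" by (rule FM_Tors[OF U p(1) p'(1) SP(1)])
  have l: "Cmp TS U ?Q ?l1 ?l2 \<in> TMor U ?Q (FO U (SumO PS U L' M'))"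
    by (rule Cmp_TS_Tors[OF U q(1) o[OF p(1)] o[OF p'(1)] m(1) l1])
  have r: "Cmp TS U ?Q ?r1 ?r2 \<in> TMor U ?Q (FO U (SumO PS U L' M'))"
    by (rule Cmp_TS_Tors[OF U q(1) q'(1) o[OF p'(1)] ST(1) m'(1)])
  show ?thesis
  proof (rule bieq_unique[OF t[OF o[OF L(1)]] t[OF o[OF M(1)]] t[OF q(1)] t[OF o[OF p'(1)]] q(2) l r])
    fix V s t' assume V: "V \<in> opens X U" and s: "s \<in> tsec (FO U L) V" and t: "t' \<in> tsec (FO U M) V"
    note b = bieqD(1)[OF q(2) V s t]
    have s': "s \<in> nz L V" and t'': "t' \<in> nz M V" using s t by (simp_all add: F_Ob_simps)
    have pst: "bP U L M V s t' \<in> nz (SumO PS U L M) V"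
      using bieqD(1)[OF tenD(5)[OF p(2)] V s t] by (simp add: F_Ob_simps)
    have fs: "f V s \<in> nz L' V" and gt: "g V t' \<in> nz M' V"
      using TMor_closed[OF U o[OF L(1)] o[OF L(2)] Ff V s] TMor_closed[OF U o[OF M(1)] o[OF M(2)] Fg V t] s' t'' V
      by (simp_all add: F_Ob_simps F_Mor_apply)
    have "Cmp TS U ?Q ?l1 ?l2 V (bT U (FO U L) (FO U M) V s t') = bP U L' M' V (f V s) (g V t')"
      unfolding Cmp_TS[OF V b] m(2)[OF V s' t''] F_Mor_apply[OF V pst] by (rule SP(2)[OF V nz_sc[OF s'] nz_sc[OF t'']])
    moreover have "Cmp TS U ?Q ?r1 ?r2 V (bT U (FO U L) (FO U M) V s t') = bP U L' M' V (f V s) (g V t')"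
      unfolding Cmp_TS[OF V b] ST(2)[OF V s t] F_Mor_apply[OF V s'] F_Mor_apply[OF V t''] by (rule m'(2)[OF V fs gt])
    ultimately show "Cmp TS U ?Q ?l1 ?l2 V (bT U (FO U L) (FO U M) V s t') = Cmp TS U ?Q ?r1 ?r2 V (bT U (FO U L) (FO U M) V s t')"
      by simp
  qed
qed

lemma F_add_braiding:
  assumes U: "openin X U" and L: "L \<in> PO U" and M: "M \<in> PO U"
  shows "Cmp TS U (SumO TS U (FO U L) (FO U M)) (F_Mor X A P U (SumO PS U L M) (SumO PS U M L) (Brd PS U L M)) (\<mu> U L M)
    = Cmp TS U (SumO TS U (FO U L) (FO U M)) (\<mu> U M L) (Brd TS U (FO U L) (FO U M))"
    (is "Cmp TS U ?Q ?l1 ?l2 = Cmp TS U ?Q ?r1 ?r2")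
proof -
  note o = FO_TO[OF U] and t = TO_ttorsor[OF U]
  note p = PO_sum[OF U L M] and p' = PO_sum[OF U M L]
  note q = TO_sum[OF U o[OF L] o[OF M]] and q' = TO_sum[OF U o[OF M] o[OF L]]
  note m = F_add_eq[OF U L M] and m' = F_add_eq[OF U M L]
  note BP = Brd_PS[OF U L M] and BT = Brd_TS[OF U o[OF L] o[OF M]]
  have l: "Cmp TS U ?Q ?l1 ?l2 \<in> TMor U ?Q (FO U (SumO PS U M L))"
    by (rule Cmp_TS_Tors[OF U q(1) o[OF p(1)] o[OF p'(1)] m(1) FM_Tors[OF U p(1) p'(1) BP(1)]])
  have r: "Cmp TS U ?Q ?r1 ?r2 \<in> TMor U ?Q (FO U (SumO PS U M L))"
    by (rule Cmp_TS_Tors[OF U q(1) q'(1) o[OF p'(1)] BT(1) m'(1)])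
  show ?thesis
  proof (rule bieq_unique[OF t[OF o[OF L]] t[OF o[OF M]] t[OF q(1)] t[OF o[OF p'(1)]] q(2) l r])
    fix V s t' assume V: "V \<in> opens X U" and s: "s \<in> tsec (FO U L) V" and t: "t' \<in> tsec (FO U M) V"
    note b = bieqD(1)[OF q(2) V s t]
    have s': "s \<in> nz L V" and t'': "t' \<in> nz M V" using s t by (simp_all add: F_Ob_simps)
    have pst: "bP U L M V s t' \<in> nz (SumO PS U L M) V"
      using bieqD(1)[OF tenD(5)[OF p(2)] V s t] by (simp add: F_Ob_simps)
    show "Cmp TS U ?Q ?l1 ?l2 V (bT U (FO U L) (FO U M) V s t') = Cmp TS U ?Q ?r1 ?r2 V (bT U (FO U L) (FO U M) V s t')"
      unfolding Cmp_TS[OF V b] m(2)[OF V s' t''] F_Mor_apply[OF V pst] BP(2)[OF V nz_sc[OF s'] nz_sc[OF t'']]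
        BT(2)[OF V s t] m'(2)[OF V t'' s'] ..
  qed
qed

text \<open>The test elements are iterated sums of three sections, and both ways round lead to the
  right-bracketed tensor product of \<open>s\<close>, \<open>t\<close>, \<open>u\<close>.\<close>

lemma F_add_assoc:
  assumes U: "openin X U" and L: "L \<in> PO U" and M: "M \<in> PO U" and N: "N \<in> PO U"
  defines "Q \<equiv> SumO TS U (SumO TS U (FO U L) (FO U M)) (FO U N)"
  shows "Cmp TS U Q
      (F_Mor X A P U (SumO PS U (SumO PS U L M) N) (SumO PS U L (SumO PS U M N)) (Asc PS U L M N))
      (Cmp TS U Q (\<mu> U (SumO PS U L M) N)
        (SumM TS U (SumO TS U (FO U L) (FO U M)) (FO U (SumO PS U L M)) (FO U N) (FO U N) (\<mu> U L M) (Idm TS U (FO U N))))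
    = Cmp TS U Q (\<mu> U L (SumO PS U M N))
      (Cmp TS U Q
        (SumM TS U (FO U L) (FO U L) (SumO TS U (FO U M) (FO U N)) (FO U (SumO PS U M N)) (Idm TS U (FO U L)) (\<mu> U M N))
        (Asc TS U (FO U L) (FO U M) (FO U N)))"
    (is "Cmp TS U Q ?l1 (Cmp TS U Q ?l2 ?l3) = Cmp TS U Q ?r1 (Cmp TS U Q ?r2 ?r3)")
proof -
  note o = FO_TO[OF U] and t = TO_ttorsor[OF U]
  note pLM = PO_sum[OF U L M] and pMN = PO_sum[OF U M N]
  note pl = PO_sum[OF U pLM(1) N] and pr = PO_sum[OF U L pMN(1)]
  note qLM = TO_sum[OF U o[OF L] o[OF M]] and qMN = TO_sum[OF U o[OF M] o[OF N]]
  note q = TO_sum[OF U qLM(1) o[OF N], folded Q_def] and qr = TO_sum[OF U o[OF L] qMN(1)]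
  note qFl = TO_sum[OF U o[OF pLM(1)] o[OF N]] and qFr = TO_sum[OF U o[OF L] o[OF pMN(1)]]
  note mLM = F_add_eq[OF U L M] and mMN = F_add_eq[OF U M N]
  note ml = F_add_eq[OF U pLM(1) N] and mr = F_add_eq[OF U L pMN(1)]
  have idm: "Idm TS U S \<in> TMor U S S" if "S \<in> TO U" for S unfolding TS_simps by (rule TMor_id[OF t[OF that]])
  have idm_apply: "Idm TS U S V s = s" if "V \<in> opens X U" "s \<in> tsec S V" for S V s using that by (simp add: TS_simps)
  note AP = Asc_PS[OF U L M N] and AT = Asc_TS[OF U o[OF L] o[OF M] o[OF N], folded Q_def]
  note l3 = SumM_TS[OF U qLM(1) o[OF pLM(1)] o[OF N] o[OF N] mLM(1) idm[OF o[OF N]], folded Q_def]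
  note r2 = SumM_TS[OF U o[OF L] o[OF L] qMN(1) o[OF pMN(1)] idm[OF o[OF L]] mMN(1)]
  note l2 = Cmp_TS_Tors[OF U q(1) qFl(1) o[OF pl(1)] l3(1) ml(1)]
  note r3 = Cmp_TS_Tors[OF U q(1) qr(1) qFr(1) AT(1) r2(1)]
  have l: "Cmp TS U Q ?l1 (Cmp TS U Q ?l2 ?l3) \<in> TMor U Q (FO U (SumO PS U L (SumO PS U M N)))"
    by (rule Cmp_TS_Tors[OF U q(1) o[OF pl(1)] o[OF pr(1)] l2 FM_Tors[OF U pl(1) pr(1) AP(1)]])
  have r: "Cmp TS U Q ?r1 (Cmp TS U Q ?r2 ?r3) \<in> TMor U Q (FO U (SumO PS U L (SumO PS U M N)))"
    by (rule Cmp_TS_Tors[OF U q(1) qFr(1) o[OF pr(1)] r3 mr(1)])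
  show ?thesis
  proof (rule bieq3_unique[OF t[OF o[OF L]] t[OF o[OF M]] t[OF o[OF N]] t[OF q(1)] t[OF o[OF pr(1)]] qLM(2) q(2) l r])
    fix V s t' u assume V: "V \<in> opens X U" and s: "s \<in> tsec (FO U L) V" and t: "t' \<in> tsec (FO U M) V" and u: "u \<in> tsec (FO U N) V"
    note st = bieqD(1)[OF qLM(2) V s t] and tu = bieqD(1)[OF qMN(2) V t u]
    note b = bieqD(1)[OF q(2) V st u]
    have s': "s \<in> nz L V" and t'': "t' \<in> nz M V" and u': "u \<in> nz N V" using s t u by (simp_all add: F_Ob_simps)
    have pst: "bP U L M V s t' \<in> nz (SumO PS U L M) V"
      using bieqD(1)[OF tenD(5)[OF pLM(2)] V s t] by (simp add: F_Ob_simps)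
    have ptu: "bP U M N V t' u \<in> nz (SumO PS U M N) V"
      using bieqD(1)[OF tenD(5)[OF pMN(2)] V t u] by (simp add: F_Ob_simps)
    have pstu: "bP U (SumO PS U L M) N V (bP U L M V s t') u \<in> nz (SumO PS U (SumO PS U L M) N) V"
      using bieqD(1)[OF tenD(5)[OF pl(2)] V] pst u' by (simp add: F_Ob_simps)
    let ?b = "bT U (SumO TS U (FO U L) (FO U M)) (FO U N) V (bT U (FO U L) (FO U M) V s t') u"
    have "Cmp TS U Q ?l1 (Cmp TS U Q ?l2 ?l3) V ?b = bP U L (SumO PS U M N) V s (bP U M N V t' u)"
      unfolding Cmp_TS[OF V b] l3(2)[OF V st u] mLM(2)[OF V s' t''] idm_apply[OF V u] ml(2)[OF V pst u'] F_Mor_apply[OF V pstu]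
      by (rule AP(2)[OF V nz_sc[OF s'] nz_sc[OF t''] nz_sc[OF u']])
    moreover have "Cmp TS U Q ?r1 (Cmp TS U Q ?r2 ?r3) V ?b = bP U L (SumO PS U M N) V s (bP U M N V t' u)"
      unfolding Cmp_TS[OF V b] AT(2)[OF V s t u] r2(2)[OF V s tu] mMN(2)[OF V t'' u'] idm_apply[OF V s]
      by (rule mr(2)[OF V s' ptu])
    ultimately show "Cmp TS U Q ?l1 (Cmp TS U Q ?l2 ?l3) V ?b = Cmp TS U Q ?r1 (Cmp TS U Q ?r2 ?r3) V ?b" by simp
  qed
qed

text \<open>Restriction is the identity on the objects of \<open>PicB\<close> and only truncates
  \<open>triv\<close> on torsors. So \<open>F_Ob_restrict\<close> identifies the ends literally, and
  \<open>bieq_restrict\<close> keeps the sums of sections available as test elements over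
  \<open>V\<close>.\<close>

lemma F_add_restrict:
  assumes U: "openin X U" and L: "L \<in> PO U" and M: "M \<in> PO U" and V: "V \<in> opens X U"
  defines "Q \<equiv> ro V (SumO TS U (FO U L) (FO U M))"
  shows "Cmp TS V Q (F_Mor X A P V (SumO PS U L M) (SumO PS V L M) (ResSum PS U V L M)) (restrict (\<mu> U L M) (opens X V))
    = Cmp TS V Q (\<mu> V L M) (ResSum TS U V (FO U L) (FO U M))"
    (is "Cmp TS V Q ?l1 ?l2 = Cmp TS V Q ?r1 ?r2")
proof -
  have oV: "openin X V" using V opens_openin by blast
  note LV = PO_restrict[OF U L V] and MV = PO_restrict[OF U M V]
  note o = FO_TO[OF oV] and t = TO_ttorsor[OF oV]
  note p = PO_sum[OF U L M] and p' = PO_sum[OF oV LV MV]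
  note pV = PO_restrict[OF U p(1) V]
  note q = TO_sum[OF U FO_TO[OF U L] FO_TO[OF U M]] and q' = TO_sum[OF oV o[OF LV] o[OF MV]]
  note qV = TO_restrict[OF U q(1) V, folded Q_def] and bV = bieq_restrict[OF q(2) V, unfolded F_Ob_restrict[OF V], folded Q_def]
  note m = F_add_eq[OF U L M] and m' = F_add_eq[OF oV LV MV]
  note RP = ResSum_PS[OF U L M V]
    and RT = ResSum_TS[OF U FO_TO[OF U L] FO_TO[OF U M] V, unfolded F_Ob_restrict[OF V], folded Q_def]
  have l2: "?l2 \<in> TMor V Q (FO V (SumO PS U L M))"
    using TMor_restrict[OF TO_ttorsor[OF U q(1)] TO_ttorsor[OF U FO_TO[OF U p(1)]] m(1) V]
    unfolding Q_def F_Ob_restrict[OF V] .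
  have l: "Cmp TS V Q ?l1 ?l2 \<in> TMor V Q (FO V (SumO PS V L M))"
    by (rule Cmp_TS_Tors[OF oV qV o[OF pV] o[OF p'(1)] l2 FM_Tors[OF oV pV p'(1) RP(1)]])
  have r: "Cmp TS V Q ?r1 ?r2 \<in> TMor V Q (FO V (SumO PS V L M))"
    by (rule Cmp_TS_Tors[OF oV qV q'(1) o[OF p'(1)] RT(1) m'(1)])
  show ?thesis
  proof (rule bieq_unique[OF t[OF o[OF LV]] t[OF o[OF MV]] t[OF qV] t[OF o[OF p'(1)]] bV l r])
    fix W s t' assume W: "W \<in> opens X V" and s: "s \<in> tsec (FO V L) W" and t: "t' \<in> tsec (FO V M) W"
    note WU = opens_trans[OF V W]
    note b = bieqD(1)[OF bV W s t]
    have s': "s \<in> nz L W" and t'': "t' \<in> nz M W" using s t by (simp_all add: F_Ob_simps)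
    have sU: "s \<in> tsec (FO U L) W" and tU: "t' \<in> tsec (FO U M) W" using s t by (simp_all add: F_Ob_simps)
    have pst: "bP U L M W s t' \<in> nz (SumO PS U L M) W"
      using bieqD(1)[OF tenD(5)[OF p(2)] WU sU tU] by (simp add: F_Ob_simps)
    have "restrict (\<mu> U L M) (opens X V) W = \<mu> U L M W" using W by simp
    then show "Cmp TS V Q ?l1 ?l2 W (bT U (FO U L) (FO U M) W s t') = Cmp TS V Q ?r1 ?r2 W (bT U (FO U L) (FO U M) W s t')"
      unfolding Cmp_TS[OF W b] RT(2)[OF W sU tU] m'(2)[OF W s' t'']
      using m(2)[OF WU s' t''] F_Mor_apply[OF W pst] RP(2)[OF W nz_sc[OF s'] nz_sc[OF t'']] by metis
  qed
qed

lemma F_additive: "additive_structure X PS TS (F_Ob X A P B) (F_Mor X A P) \<mu>"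
  unfolding additive_structure_def Let_def PS_simps(1,2,5,6) TS_simps(1,2,5,6)
proof (intro allI impI ballI conjI, goal_cases)
  case (1 U L M) then show ?case using PO_sum(1) by blast
next
  case (2 U L M) then show ?case using TO_sum(1) FO_TO by blast
next
  case (3 U L M) then show ?case 
    by (intro TS_iso[OF 3(1) TO_sum(1)[OF 3(1) FO_TO[OF 3(1,2)] FO_TO[OF 3(1,3)]] FO_TO[OF 3(1) PO_sum(1)[OF 3]]] F_add_eq(1)[OF 3])
next
  case (4 U L M L' M' f g) then show ?case by (intro F_add_natural)
next
  case (5 U L M) then show ?case by (rule F_add_braiding)
next
  case (6 U L M N) then show ?case by (rule F_add_assoc)
next
  case (7 U L M V) then show ?case by (rule F_add_restrict)
qed

lemma F_equivalence: "picard_stack_equivalence X PS TS (F_Ob X A P B) (F_Mor X A P) \<mu>"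
  unfolding picard_stack_equivalence_def
  using F_stack_functor F_additive F_bij F_ess_surj by (simp add: PS_simps(1,2) TS_simps(1,2))

end

theorem lemma4p1:
  fixes X :: "'x topology" and A :: "'x atlas" and P :: "'x set \<Rightarrow> 'x vfield set"
    and B :: "('x, 'b) lie_algd"
  assumes "smooth_manifold X A"
    and "integrable_distribution X A P"
    and "relative_deRham_acyclic X A P"
    and "lie_algebroid X A P B"
    and "locally_free_finite X (topspace X) (OXP X A P) B"
    and universe: "\<exists>\<iota> :: ('x \<Rightarrow> complex) \<Rightarrow> 'u. inj \<iota>"
  shows "picard_stack_equivalence X
    (PicB X A P B :: ('x, ('x, 'u, 'b) bmod, ('x, 'u) smap) picard)
    (dlog_torsors X A P B)
    (F_Ob X A P B) (F_Mor X A P) (F_add X A P B)"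
proof -
  \<comment> \<open>The injection serves to prove that objects exist; none of the data in the
    conclusion depends on it.\<close>
  obtain \<iota> :: "('x \<Rightarrow> complex) \<Rightarrow> 'u" where "inj \<iota>" using universe by blast
  then interpret large_universe X A P B \<iota> by unfold_locales (use assms in auto)
  show ?thesis by (rule F_equivalence)
qed

end
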